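(* Let $L_0$ satisfy the standing assumptions below and, for each $n\ge 0$, let $(X^{(n)}_t, L^{(n)}_t(x))_{x\in 2^{-n}\mathbb Z,\,0\le t\le t^{(n)}_{\max}}$ be the rescaled VRJP defined below. Then, as $n\to+\infty$, $t^{(n)}_{\max}\to+\infty$ in probability, and $$\big(X^{(n)}_{t\wedge t^{(n)}_{\max}},\,L^{(n)}_{t\wedge t^{(n)}_{\max}}(x)\big)_{x\in\mathbb R,\,t\ge 0}$$ converges in law to $(X_t,L_t(x))_{x\in\mathbb R,\,t\ge0}$, where $(X_t)_{t\ge0}$ is the Linearly Reinforced Motion started from $0$ with initial occupation profile $L_0$ and $(L_t)_{t\ge0}$ its occupation profiles. The topology is that of uniform convergence on compact subsets of time, resp. of space-time, where $x\mapsto L^{(n)}_t(x)$ is extended from $2^{-n}\mathbb Z$ to $\mathbb R$ by linear interpolation.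
   Context: Standing assumptions: $L_0:\mathbb R\to(0,+\infty)$ is continuous and $\int_0^{+\infty}L_0(x)^{-2}dx=\int_{-\infty}^0L_0(x)^{-2}dx=+\infty$. Rescaled VRJP: for $n\ge0$, $(X^{(n)}_t)$ is a continuous-time nearest-neighbour process on $2^{-n}\mathbb Z$ started at $0$. Set $\ell^{(n)}_t(x)=2^n\int_0^t\mathbf 1_{\{X^{(n)}_s=x\}}ds$ and $L^{(n)}_t(x)=L_0(x)+\ell^{(n)}_t(x)$ for $x\in2^{-n}\mathbb Z$. Conditionally on the past up to time $t$, the process jumps from its current position $x$ to $x+\sigma2^{-n}$, $\sigma\in\{-1,1\}$, at rate $2^{2n-1}L^{(n)}_t(x+\sigma2^{-n})$. (This is the vertex-reinforced jump process on $2^{-n}\mathbb Z$ with conductances $2^{2n-1}$ and initial local times $2^{-n}L_0(x)$.) It is defined up to an explosion time $t^{(n)}_{\max}\in(0,+\infty]$. Bass–Burdzy flow: let $(B_u)_{u\ge0}$ be a standard Brownian motion started at $0$. For each $y\in\mathbb R$ the equation $\frac{dY_u}{du}=-1$ if $Y_u>B_u$, $\frac{dY_u}{du}=+1$ if $Y_u<B_u$, $Y_0=y$, has a.s. a unique Lipschitz solution; these can be realized simultaneously as a jointly continuous flow $(\Psi^B_u(y))_{y\in\mathbb R,u\ge0}$, adapted to the filtration of $B$, such that each $y\mapsto\Psi^B_u(y)$ is an increasing $C^1$ diffeomorphism of $\mathbb R$. The reduced process is $\xi_u=(\Psi^B_u)^{-1}(B_u)$; it has jointly continuous occupation densities $(\Lambda_u(y))$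 with $\int_0^uf(\xi_v)dv=\int_{\mathbb R}f(y)\Lambda_u(y)dy$ for bounded Borel $f$, and $0\le\Lambda_u(y)<1/2$, $\partial_y\Psi^B_u(y)=1-2\Lambda_u(y)$. Linearly Reinforced Motion (LRM) started from $x_0\in\mathbb R$ with initial occupation profile $L_0$: set $S_0(x)=\int_{x_0}^xL_0(r)^{-2}dr$, $t(u)=\int_0^uL_0(S_0^{-1}(\xi_v))^3(1-2\Lambda_v(\xi_v))^{-3/2}dv$, $u(t)$ the inverse of $t(\cdot)$, $X_t=S_0^{-1}(\xi_{u(t)})$, and occupation profile $L_t(x)=L_0(x)(1-2\Lambda_{u(t)}(S_0(x)))^{-1/2}$. $B$ is called the driving Brownian motion. *)

theory Defs
  imports "HOL-Probability.Probability"
begin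

text \<open>A history is a list of pairs (sigma_i, h_i): h_i is the i-th holding time
(spent at the current site) and sigma_i in {-1,1} the direction of the following jump.
Sites are encoded by integers j, standing for j / 2^n.\<close>

definition pos_of :: "(int \<times> real) list \<Rightarrow> nat \<Rightarrow> int" where
  "pos_of hs i = (\<Sum>k<i. fst (hs ! k))"

definition hist_loc :: "nat \<Rightarrow> (int \<times> real) list \<Rightarrow> int \<Rightarrow> real" where
  "hist_loc n hs j = 2 ^ n * (\<Sum>i<length hs. if pos_of hs i = j then snd (hs ! i) else 0)"

definition hist_L :: "nat \<Rightarrow> (real \<Rightarrow> real) \<Rightarrow> (int \<times> real) list \<Rightarrow> int \<Rightarrow> real" where
  "hist_L n L0 hs j = L0 (real_of_int j / 2 ^ n) + hist_loc n hs j"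

definition jump_rate :: "nat \<Rightarrow> (real \<Rightarrow> real) \<Rightarrow> (int \<times> real) list \<Rightarrow> int \<Rightarrow> real" where
  "jump_rate n L0 hs \<sigma> = 4 ^ n / 2 * hist_L n L0 hs (pos_of hs (length hs) + \<sigma>)"

definition total_rate :: "nat \<Rightarrow> (real \<Rightarrow> real) \<Rightarrow> (int \<times> real) list \<Rightarrow> real" where
  "total_rate n L0 hs = jump_rate n L0 hs 1 + jump_rate n L0 hs (-1)"

text \<open>Probability that the next jumps go in directions sigma_i and the holding times
exceed a_i, given the history hs.\<close>
primrec vrjp_orthant :: "(int \<times> real) list \<Rightarrow> nat \<Rightarrow> (real \<Rightarrow> real) \<Rightarrow> (int \<times> real) list \<Rightarrow> ennreal" where
  "vrjp_orthant [] n L0 hs = 1"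
| "vrjp_orthant (s # ss) n L0 hs =
     (\<integral>\<^sup>+ h \<in> {snd s<..}. ennreal (jump_rate n L0 hs (fst s) * exp (- total_rate n L0 hs * h))
        * vrjp_orthant ss n L0 (hs @ [(fst s, h)]) \<partial>lborel)"

definition vrjp_law :: "nat \<Rightarrow> (real \<Rightarrow> real) \<Rightarrow> 'a measure \<Rightarrow> (nat \<Rightarrow> 'a \<Rightarrow> int)
    \<Rightarrow> (nat \<Rightarrow> 'a \<Rightarrow> real) \<Rightarrow> bool" where
  "vrjp_law n L0 M dir H \<longleftrightarrow> prob_space M
     \<and> (\<forall>i. dir i \<in> measurable M (count_space UNIV))
     \<and> (\<forall>i. H i \<in> borel_measurable M)
     \<and> (\<forall>ss. (\<forall>p\<in>set ss. fst p \<in> {-1, 1} \<and> snd p \<ge> 0) \<longrightarrow>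
          emeasure M {\<omega> \<in> space M. \<forall>i<length ss. dir i \<omega> = fst (ss ! i) \<and> H i \<omega> > snd (ss ! i)}
            = vrjp_orthant ss n L0 [])"

definition jtime :: "(nat \<Rightarrow> real) \<Rightarrow> nat \<Rightarrow> real" where
  "jtime h k = (\<Sum>i<k. h i)"

definition jpos :: "nat \<Rightarrow> (nat \<Rightarrow> int) \<Rightarrow> nat \<Rightarrow> real" where
  "jpos n d k = real_of_int (\<Sum>i<k. d i) / 2 ^ n"

definition expl_time :: "(nat \<Rightarrow> real) \<Rightarrow> ereal" where
  "expl_time h = (SUP k. ereal (jtime h k))"

definition stop_time :: "(nat \<Rightarrow> real) \<Rightarrow> real \<Rightarrow> real" where
  "stop_time h t = (if expl_time h = \<infinity> then t else min t (real_of_ereal (expl_time h)))"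

text \<open>Position X_t for t < t_max (an arbitrary value, 0, at t = t_max < infinity).\<close>
definition vrjp_path :: "nat \<Rightarrow> (nat \<Rightarrow> int) \<Rightarrow> (nat \<Rightarrow> real) \<Rightarrow> real \<Rightarrow> real" where
  "vrjp_path n d h t = (if ereal t < expl_time h then jpos n d (LEAST k. t < jtime h (Suc k)) else 0)"

definition vrjp_loc :: "nat \<Rightarrow> (nat \<Rightarrow> int) \<Rightarrow> (nat \<Rightarrow> real) \<Rightarrow> real \<Rightarrow> real \<Rightarrow> real" where
  "vrjp_loc n d h s x = 2 ^ n * suminf (\<lambda>k. if jpos n d k = x
        then max 0 (min (jtime h (Suc k)) s - jtime h k) else 0)"

definition vrjp_L :: "nat \<Rightarrow> (real \<Rightarrow> real) \<Rightarrow> (nat \<Rightarrow> int) \<Rightarrow> (nat \<Rightarrow> real) \<Rightarrow> real \<Rightarrow> real \<Rightarrow> real" where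
  "vrjp_L n L0 d h s x = L0 x + vrjp_loc n d h s x"

definition lin_interp :: "nat \<Rightarrow> (real \<Rightarrow> real) \<Rightarrow> real \<Rightarrow> real" where
  "lin_interp n f x = (let k = \<lfloor>2 ^ n * x\<rfloor>; \<theta> = 2 ^ n * x - real_of_int k in
      (1 - \<theta>) * f (real_of_int k / 2 ^ n) + \<theta> * f (real_of_int (k + 1) / 2 ^ n))"

definition vrjp_stopped :: "nat \<Rightarrow> (real \<Rightarrow> real) \<Rightarrow> (nat \<Rightarrow> int) \<Rightarrow> (nat \<Rightarrow> real)
    \<Rightarrow> (real \<Rightarrow> real) \<times> (real \<Rightarrow> real \<Rightarrow> real)" where
  "vrjp_stopped n L0 d h =
     ((\<lambda>t. vrjp_path n d h (stop_time h t)),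
      (\<lambda>t x. lin_interp n (vrjp_L n L0 d h (stop_time h t)) x))"

definition std_brownian_motion :: "'b measure \<Rightarrow> ('b \<Rightarrow> real \<Rightarrow> real) \<Rightarrow> bool" where
  "std_brownian_motion N B \<longleftrightarrow> prob_space N
     \<and> (\<forall>t. (\<lambda>\<omega>. B \<omega> t) \<in> borel_measurable N)
     \<and> (AE \<omega> in N. B \<omega> 0 = 0 \<and> continuous_on {0..} (B \<omega>))
     \<and> (\<forall>s t. 0 \<le> s \<and> s < t \<longrightarrow>
          distributed N lborel (\<lambda>\<omega>. B \<omega> t - B \<omega> s) (normal_density 0 (sqrt (t - s))))
     \<and> (\<forall>ts :: nat \<Rightarrow> real. 0 \<le> ts 0 \<and> strict_mono ts \<longrightarrow>
          prob_space.indep_vars N (\<lambda>_. borel) (\<lambda>i \<omega>. B \<omega> (ts (Suc i)) - B \<omega> (ts i)) UNIV)"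

definition bb_solution :: "(real \<Rightarrow> real) \<Rightarrow> real \<Rightarrow> (real \<Rightarrow> real) \<Rightarrow> bool" where
  "bb_solution b y Y \<longleftrightarrow> Y 0 = y \<and> (\<exists>C. C-lipschitz_on {0..} Y)
     \<and> (\<forall>u>0. (Y u > b u \<longrightarrow> (Y has_real_derivative -1) (at u))
             \<and> (Y u < b u \<longrightarrow> (Y has_real_derivative 1) (at u)))"

definition incr_C1_diffeo :: "(real \<Rightarrow> real) \<Rightarrow> bool" where
  "incr_C1_diffeo f \<longleftrightarrow> bij f \<and> (\<exists>D. continuous_on UNIV D
      \<and> (\<forall>y. (f has_real_derivative D y) (at y) \<and> D y > 0))"

definition bass_burdzy_flow :: "'b measure \<Rightarrow> ('b \<Rightarrow> real \<Rightarrow> real) \<Rightarrow> ('b \<Rightarrow> real \<Rightarrow> real \<Rightarrow> real) \<Rightarrow> bool" where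
  "bass_burdzy_flow N B \<Psi> \<longleftrightarrow>
     (AE \<omega> in N. continuous_on ({0..} \<times> UNIV) (\<lambda>(u, y). \<Psi> \<omega> u y)
                 \<and> (\<forall>u\<ge>0. incr_C1_diffeo (\<Psi> \<omega> u)))
     \<and> (\<forall>y. AE \<omega> in N. bb_solution (B \<omega>) y (\<lambda>u. \<Psi> \<omega> u y))"

definition reduced_proc :: "('b \<Rightarrow> real \<Rightarrow> real \<Rightarrow> real) \<Rightarrow> ('b \<Rightarrow> real \<Rightarrow> real) \<Rightarrow> 'b \<Rightarrow> real \<Rightarrow> real" where
  "reduced_proc \<Psi> B \<omega> u = inv (\<Psi> \<omega> u) (B \<omega> u)"

definition occupation_densities :: "'b measure \<Rightarrow> ('b \<Rightarrow> real \<Rightarrow> real) \<Rightarrow> ('b \<Rightarrow> real \<Rightarrow> real \<Rightarrow> real) \<Rightarrow> bool" where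
  "occupation_densities N \<xi> \<Lambda> \<longleftrightarrow>
     (AE \<omega> in N. continuous_on ({0..} \<times> UNIV) (\<lambda>(u, y). \<Lambda> \<omega> u y)
        \<and> (\<forall>u\<ge>0. \<forall>f :: real \<Rightarrow> real. f \<in> borel_measurable borel \<longrightarrow> bounded (range f) \<longrightarrow>
             set_lebesgue_integral lborel {0..u} (\<lambda>v. f (\<xi> \<omega> v))
               = (\<integral>y. f y * \<Lambda> \<omega> u y \<partial>lborel)))"

definition S0 :: "(real \<Rightarrow> real) \<Rightarrow> real \<Rightarrow> real" where
  "S0 L0 x = interval_lebesgue_integral lborel (ereal 0) (ereal x) (\<lambda>r. 1 / (L0 r) ^ 2)"

definition lrm_clock :: "(real \<Rightarrow> real) \<Rightarrow> (real \<Rightarrow> real) \<Rightarrow> (real \<Rightarrow> real \<Rightarrow> real) \<Rightarrow> real \<Rightarrow> real" where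
  "lrm_clock L0 \<xi> \<Lambda> u = set_lebesgue_integral lborel {0..u}
      (\<lambda>v. (L0 (inv (S0 L0) (\<xi> v))) ^ 3 * (1 - 2 * \<Lambda> v (\<xi> v)) powr (-3/2))"

definition lrm_time :: "(real \<Rightarrow> real) \<Rightarrow> (real \<Rightarrow> real) \<Rightarrow> (real \<Rightarrow> real \<Rightarrow> real) \<Rightarrow> real \<Rightarrow> real" where
  "lrm_time L0 \<xi> \<Lambda> t = the_inv_into {0..} (lrm_clock L0 \<xi> \<Lambda>) t"

definition lrm :: "(real \<Rightarrow> real) \<Rightarrow> (real \<Rightarrow> real) \<Rightarrow> (real \<Rightarrow> real \<Rightarrow> real)
    \<Rightarrow> (real \<Rightarrow> real) \<times> (real \<Rightarrow> real \<Rightarrow> real)" where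
  "lrm L0 \<xi> \<Lambda> =
     ((\<lambda>t. inv (S0 L0) (\<xi> (lrm_time L0 \<xi> \<Lambda> t))),
      (\<lambda>t x. L0 x * (1 - 2 * \<Lambda> (lrm_time L0 \<xi> \<Lambda> t) (S0 L0 x)) powr (-1/2)))"

definition lu_conv :: "(nat \<Rightarrow> (real \<Rightarrow> real) \<times> (real \<Rightarrow> real \<Rightarrow> real))
    \<Rightarrow> (real \<Rightarrow> real) \<times> (real \<Rightarrow> real \<Rightarrow> real) \<Rightarrow> bool" where
  "lu_conv fs g \<longleftrightarrow> (\<forall>T\<ge>0.
      uniform_limit {0..T} (\<lambda>k. fst (fs k)) (fst g) sequentially
    \<and> uniform_limit ({0..T} \<times> {-T..T}) (\<lambda>k p. snd (fs k) (fst p) (snd p))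
                    (\<lambda>p. snd g (fst p) (snd p)) sequentially)"

definition test_functional :: "((real \<Rightarrow> real) \<times> (real \<Rightarrow> real \<Rightarrow> real) \<Rightarrow> real) \<Rightarrow> bool" where
  "test_functional F \<longleftrightarrow> bounded (range F)
     \<and> (\<forall>fs g. lu_conv fs g \<longrightarrow> (\<lambda>k. F (fs k)) \<longlonglongrightarrow> F g)"

definition conv_in_law :: "(nat \<Rightarrow> 'a measure) \<Rightarrow> (nat \<Rightarrow> 'a \<Rightarrow> (real \<Rightarrow> real) \<times> (real \<Rightarrow> real \<Rightarrow> real))
    \<Rightarrow> 'b measure \<Rightarrow> ('b \<Rightarrow> (real \<Rightarrow> real) \<times> (real \<Rightarrow> real \<Rightarrow> real)) \<Rightarrow> bool" where
  "conv_in_law M Y N Z \<longleftrightarrow> (\<forall>F. test_functional F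
      \<longrightarrow> (\<forall>n. (\<lambda>\<omega>. F (Y n \<omega>)) \<in> borel_measurable (M n))
      \<longrightarrow> (\<lambda>\<omega>. F (Z \<omega>)) \<in> borel_measurable N
      \<longrightarrow> (\<lambda>n. \<integral>\<omega>. F (Y n \<omega>) \<partial>(M n)) \<longlonglongrightarrow> (\<integral>\<omega>. F (Z \<omega>) \<partial>N))"

end

theory Submission
  imports Defs
begin

text \<open>In the scale with edge lengths 1 / (2^n L(j) L(j+1)), which shrink as the local times L grow, the position of the
reinforced walk is a martingale, and its clock is the total shrinkage. Time changed by this clock it converges to Brownian
motion, and the image of a fixed site is driven upwards or downwards at unit speed according to the side on which the
martingale lies: this is the Bass-Burdzy equation, and the local times are read off from the derivative of the flow.
Exponential supermartingales give a modulus of continuity for the logarithm of the local times, uniformly in n; a discrete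
Tanaka formula at the origin shows that the local time there grows exponentially in the clock, which excludes explosion.
The passage to the limit is deterministic for every good trajectory close to a Brownian path, so that only convergence of
finitely many increments of the time-changed martingale is needed, against Lipschitz functions obtained as
sup-regularisations of the test functional.\<close>

text \<open>The obstacle is that a fixed site moves at speed one in the clock only if the two edges
  at the walker shrink almost equally, that is, if its two neighbours have almost equal local times.
  The modulus of continuity serves this. It holds for all times at once because an edge cannot lose
  more than its initial length: the clock spent in a window is bounded by the length of the window,
  so each exponential supermartingale has a deterministic compensator bound and dyadic chaining
  applies. The law is known only through orthant probabilities. Martingale statements are therefore
  inequalities for the kernel \<open>step\<close>, and stopping is replaced by continuation: outside
  a window of space, time and number of jumps the martingale goes on with fair coin flips of size
  \<open>e\<close> and clock steps of size e squared, so that every clock level is crossed. Walk and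
  Brownian motion are never coupled. Only a lower bound for expectations is proved, and it is
  applied to a functional and to its negative; the regularised supremum over Brownian paths near the
  walk is a Lipschitz function of finitely many increments.\<close>

definition seqM :: "(nat => int \<times> real) measure" where
 "seqM = PiM UNIV (%_. count_space UNIV \<Otimes>\<^sub>M borel)"

definition pos :: "(nat => int \<times> real) => nat => int" where
 "pos x k = (\<Sum>i<k. fst (x i))"

definition loc :: "nat => (real => real) => (nat => int \<times> real) => nat => int => real" where
 "loc n L0 x k j = L0 (real_of_int j / 2 ^ n) + 2 ^ n * (\<Sum>i<k. if pos x i = j then snd (x i) else 0)"

definition rate :: "nat => (real => real) => (nat => int \<times> real) => nat => int => real" where
 "rate n L0 x k sgm = 4 ^ n / 2 * loc n L0 x k (pos x k + sgm)"

definition trate :: "nat => (real => real) => (nat => int \<times> real) => nat => real" where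
 "trate n L0 x k = rate n L0 x k 1 + rate n L0 x k (-1)"

definition valid :: "int \<times> real => bool" where
 "valid p \<longleftrightarrow> fst p \<in> {1, -1} & snd p > 0"

text \<open>This is the conditional expectation given the first \<open>k\<close> jumps. Two
  exponential clocks compete, so direction and holding time have joint density rate times exp(-
  total rate * s). Coordinate \<open>k\<close> is overwritten and the later coordinates of
  \<open>x\<close> are left alone.\<close>

definition step :: "nat => (real => real) => nat => ((nat => int \<times> real) => ennreal) => (nat => int \<times> real) => ennreal" where
 "step n L0 k f x = (\<Sum>sgm\<in>{1, -1}. \<integral>\<^sup>+ s. indicator {0<..} s *
   (ennreal (rate n L0 x k sgm * exp (- trate n L0 x k * s)) * f (x(k := (sgm, s)))) \<partial>lborel)"

primrec steps :: "nat => (real => real) => nat => nat => ((nat => int \<times> real) => ennreal) => (nat => int \<times> real) => ennreal" where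
 "steps n L0 j 0 f = f"
| "steps n L0 j (Suc m) f = step n L0 j (steps n L0 (Suc j) m f)"

definition nonanticipating :: "nat => ((nat => int \<times> real) => 'c) => bool" where
 "nonanticipating k f \<longleftrightarrow> (\<forall>x y. (\<forall>i<k. x i = y i) --> f x = f y)"

section \<open>Measurability and algebra of the transition kernels\<close>

lemma space_seqM [simp]: "space seqM = UNIV"
 by (auto simp: seqM_def space_PiM space_pair_measure PiE_def extensional_def)

lemma measurable_seqM_nth [measurable]: "(%x. x i) \<in> seqM \<rightarrow>\<^sub>M count_space UNIV \<Otimes>\<^sub>M borel"
 unfolding seqM_def by simp

lemma measurable_seqM_upd [measurable]:
 assumes [measurable]: "f \<in> N \<rightarrow>\<^sub>M seqM" "g \<in> N \<rightarrow>\<^sub>M count_space UNIV \<Otimes>\<^sub>M borel"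
 shows "(%w. (f w)(k := g w)) \<in> N \<rightarrow>\<^sub>M seqM"
 unfolding seqM_def by (rule measurable_fun_upd[where J=UNIV]) (use assms in \<open>auto simp: seqM_def\<close>)

lemma measurable_seqM_I:
 assumes "!!i. (%w. f w i) \<in> N \<rightarrow>\<^sub>M count_space UNIV \<Otimes>\<^sub>M borel"
 shows "f \<in> N \<rightarrow>\<^sub>M seqM"
proof -
 have "(%w i. f w i) \<in> N \<rightarrow>\<^sub>M seqM"
  unfolding seqM_def by (rule measurable_PiM_single') (use assms in \<open>auto simp: space_pair_measure\<close>)
 then show ?thesis by simp
qed

lemma measurable_fst_nth [measurable]: "(%x. fst (x i)) \<in> seqM \<rightarrow>\<^sub>M count_space UNIV"
 by measurable

lemma measurable_snd_nth [measurable]: "(%x. snd (x i)) \<in> borel_measurable seqM"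
 by measurable

lemma measurable_pos [measurable]: "(%x. pos x k) \<in> seqM \<rightarrow>\<^sub>M count_space UNIV"
proof (induction k)
 case (Suc k)
 note Suc [measurable]
 have "(%x. pos x k + fst (x k)) \<in> seqM \<rightarrow>\<^sub>M count_space UNIV" by measurable
 then show ?case by (simp add: pos_def)
qed (simp add: pos_def)

lemma measurable_count_compose:
 assumes [measurable]: "g \<in> N \<rightarrow>\<^sub>M count_space (UNIV :: int set)" and "!!j. (%x. f x j) \<in> N \<rightarrow>\<^sub>M K"
 shows "(%x. f x (g x)) \<in> N \<rightarrow>\<^sub>M K"
 by (rule measurable_compose_countable[OF assms(2,1)])

lemma measurable_loc' [measurable]: "(%x. loc n L0 x k j) \<in> borel_measurable seqM"
 unfolding loc_def by measurable

lemma measurable_loc [measurable]: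
 "(%x. loc n L0 x k (pos x k)) \<in> borel_measurable seqM"
 "(%x. loc n L0 x k (pos x k + i)) \<in> borel_measurable seqM"
 by (rule measurable_count_compose; measurable)+

lemma measurable_rate [measurable]: "(%x. rate n L0 x k sgm) \<in> borel_measurable seqM"
 "(%x. trate n L0 x k) \<in> borel_measurable seqM"
 unfolding rate_def trate_def by measurable

lemma measurable_step [measurable]:
 assumes [measurable]: "f \<in> borel_measurable seqM"
 shows "step n L0 k f \<in> borel_measurable seqM"
 unfolding step_def[abs_def] by measurable

lemma measurable_steps [measurable]:
 "f \<in> borel_measurable seqM ==> steps n L0 j m f \<in> borel_measurable seqM"
 by (induction m arbitrary: j) auto

text \<open>The recursion peels off the first kernel; reducing a functional of \<open>k + 1\<close>
  jumps to one of \<open>k\<close> jumps needs the last kernel instead.\<close>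

lemma steps_Suc_end: "steps n L0 j (Suc m) f = steps n L0 j m (step n L0 (j + m) f)"
 by (induction m arbitrary: j) auto

lemma step_suminf:
 assumes [measurable]: "!!i::nat. f i \<in> borel_measurable seqM"
 shows "step n L0 k (%x. \<Sum>i. f i x) x = (\<Sum>i. step n L0 k (f i) x)"
 unfolding step_def
 by (simp add: nn_integral_suminf[symmetric] suminf_add[symmetric])

lemma steps_suminf:
 assumes [measurable]: "!!i::nat. f i \<in> borel_measurable seqM"
 shows "steps n L0 j m (%x. \<Sum>i. f i x) = (%x. \<Sum>i. steps n L0 j m (f i) x)"
proof (induction m arbitrary: j)
 case (Suc m)
 show ?case
  by (rule ext) (simp add: Suc, rule step_suminf, measurable)
qed simp

lemma step_add:
 assumes [measurable]: "f \<in> borel_measurable seqM" "g \<in> borel_measurable seqM"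
 shows "step n L0 k (%x. f x + g x) x = step n L0 k f x + step n L0 k g x"
 unfolding step_def by (simp add: distrib_left nn_integral_add algebra_simps)

lemma steps_add:
 assumes [measurable]: "f \<in> borel_measurable seqM" "g \<in> borel_measurable seqM"
 shows "steps n L0 j m (%x. f x + g x) = (%x. steps n L0 j m f x + steps n L0 j m g x)"
proof (induction m arbitrary: j)
 case (Suc m)
 show ?case by (rule ext) (simp add: Suc, rule step_add, measurable)
qed simp

lemma step_cmult:
 assumes [measurable]: "f \<in> borel_measurable seqM"
 shows "step n L0 k (%x. c * f x) x = c * step n L0 k f x"
 unfolding step_def by (simp add: nn_integral_cmult[symmetric] algebra_simps)

lemma steps_cmult:
 assumes [measurable]: "f \<in> borel_measurable seqM"
 shows "steps n L0 j m (%x. c * f x) = (%x. c * steps n L0 j m f x)"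
proof (induction m arbitrary: j)
 case (Suc m)
 show ?case by (rule ext) (simp add: Suc, rule step_cmult, measurable)
qed simp

lemma step_SUP:
 assumes [measurable]: "!!i::nat. f i \<in> borel_measurable seqM" and inc: "incseq f"
 shows "step n L0 k (%x. SUP i. f i x) x = (SUP i. step n L0 k (f i) x)"
proof -
 have i1: "incseq (%i s. indicator {0<..} s * (ennreal (rate n L0 x k sgm * exp (- trate n L0 x k * s)) * f i (x(k := (sgm, s)))))" for sgm
  using inc by (auto simp: incseq_def le_fun_def intro!: mult_left_mono)
 have i2: "incseq (%i. \<integral>\<^sup>+ s. indicator {0<..} s * (ennreal (rate n L0 x k sgm * exp (- trate n L0 x k * s)) * f i (x(k := (sgm, s)))) \<partial>lborel)" for sgm
  using i1[of sgm] by (auto simp: incseq_def le_fun_def intro!: nn_integral_mono)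
 show ?thesis
  unfolding step_def
  by (simp add: SUP_mult_left_ennreal nn_integral_monotone_convergence_SUP[OF i1, simplified] ennreal_SUP_add[OF i2 i2, simplified])
qed

lemma step_mono: "(!!x. f x <= g x) ==> step n L0 k f x <= step n L0 k g x"
 unfolding step_def by (intro sum_mono nn_integral_mono mult_left_mono) auto

lemma steps_mono: "(!!x. f x <= g x) ==> steps n L0 j m f x <= steps n L0 j m g x"
 by (induction m arbitrary: j x) (auto intro!: step_mono)

lemma steps_SUP:
 assumes [measurable]: "!!i::nat. f i \<in> borel_measurable seqM" and inc: "incseq f"
 shows "steps n L0 j m (%x. SUP i. f i x) = (%x. SUP i. steps n L0 j m (f i) x)"
proof (induction m arbitrary: j)
 case (Suc m)
 have "incseq (%i. steps n L0 (Suc j) m (f i))"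
  using inc by (auto simp: incseq_def le_fun_def intro!: steps_mono)
 then show ?case by (intro ext) (simp add: Suc, rule step_SUP, measurable)
qed simp


text \<open>Taking out what is known: overwriting coordinate \<open>k\<close> does not change a
  factor that depends on earlier coordinates only.\<close>

lemma step_mult_past:
 assumes "nonanticipating k h" and [measurable]: "f \<in> borel_measurable seqM"
 shows "step n L0 k (%y. h y * f y) x = h x * step n L0 k f x"
proof -
 have "h (x(k := p)) = h x" for p
  using assms(1) by (auto simp: nonanticipating_def)
 then have "step n L0 k (%y. h y * f y) x = step n L0 k (%y. h x * f y) x"
  unfolding step_def by simp
 then show ?thesis
  by (simp add: step_cmult)
qed

lemma nonanticipating_mono: "nonanticipating k f ==> k <= l ==> nonanticipating l f"
 unfolding nonanticipating_def by (meson less_le_trans)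

lemma steps_mult_past:
 assumes "nonanticipating j h" and [measurable]: "f \<in> borel_measurable seqM"
 shows "steps n L0 j m (%y. h y * f y) x = h x * steps n L0 j m f x"
 using assms(1)
proof (induction m arbitrary: j x)
 case (Suc m)
 have "steps n L0 (Suc j) m (%y. h y * f y) = (%x. h x * steps n L0 (Suc j) m f x)"
  using Suc nonanticipating_mono[OF Suc.prems] by auto
 then show ?case
  by (simp add: step_mult_past[OF Suc.prems])
qed simp

section \<open>Orthant probabilities as iterated kernels\<close>

lemma hist_L_eq: "hist_L n L0 (map x [0..<k]) j = loc n L0 x k j"
proof -
 have "pos_of (map x [0..<k]) i = pos x i" if "i <= k" for i
  using that by (auto simp: pos_of_def pos_def)
 then show ?thesis
  by (auto simp: hist_L_def hist_loc_def loc_def intro!: sum.cong)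
qed

lemma jump_rate_eq: "jump_rate n L0 (map x [0..<k]) sgm = rate n L0 x k sgm"
proof -
 have "pos_of (map x [0..<k]) k = pos x k"
  by (auto simp: pos_of_def pos_def)
 then show ?thesis by (simp add: jump_rate_def rate_def hist_L_eq)
qed

lemma total_rate_eq: "total_rate n L0 (map x [0..<k]) = trate n L0 x k"
 by (simp add: total_rate_def trate_def jump_rate_eq)

definition orthant :: "nat => nat => (nat => int) => (nat => real) => (nat => int \<times> real) set" where
 "orthant j k sgm a = {x. \<forall>i\<in>{j..<k}. fst (x i) = sgm i & snd (x i) > a i}"

lemma measurable_orthant [measurable]: "orthant j k sgm a \<in> sets seqM"
proof -
 have "Measurable.pred seqM (%x. \<forall>i\<in>{j..<k}. fst (x i) = sgm i & snd (x i) > a i)"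
  by measurable
 then show ?thesis
  unfolding orthant_def by (auto simp: pred_def)
qed

text \<open>The constraint on coordinate \<open>j\<close> is known after the first kernel, so it
  passes through the remaining ones. It cuts the integration over positive holding times down to
  those above \<open>a j\<close>, which is where nonnegative thresholds matter.\<close>

lemma steps_orthant:
 assumes "!!i. sgm i \<in> {1, -1}" "!!i. a i >= 0"
 shows "steps n L0 j m (indicator (orthant j (j + m) sgm a)) x
  = vrjp_orthant (map (%i. (sgm i, a i)) [j..<j + m]) n L0 (map x [0..<j])"
proof (induction m arbitrary: j x)
 case 0
 then show ?case by (simp add: orthant_def)
next
 case (Suc m)
 define h :: "(nat => int \<times> real) => ennreal" where "h = indicator {x. fst (x j) = sgm j & snd (x j) > a j}"
 have h: "nonanticipating (Suc j) h"
  by (auto simp: nonanticipating_def h_def indicator_def)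
 have [measurable]: "h \<in> borel_measurable seqM"
 proof -
  have "Measurable.pred seqM (%x. fst (x j) = sgm j & snd (x j) > a j)" by measurable
  then show ?thesis unfolding h_def by (intro borel_measurable_indicator) (auto simp: pred_def)
 qed
 have ind: "indicator (orthant j (j + Suc m) sgm a) = (%x. h x * indicator (orthant (Suc j) (Suc j + m) sgm a) x)"
 proof -
  have "{j..<j + Suc m} = insert j {Suc j..<Suc j + m}" by auto
  then show ?thesis
   by (auto simp: fun_eq_iff orthant_def h_def indicator_def)
 qed
 have "steps n L0 j (Suc m) (indicator (orthant j (j + Suc m) sgm a)) x
   = step n L0 j (%y. h y * vrjp_orthant (map (%i. (sgm i, a i)) [Suc j..<Suc j + m]) n L0 (map y [0..<Suc j])) x"
  unfolding ind steps.simps steps_mult_past[OF h borel_measurable_indicator[OF measurable_orthant]]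
  by (simp only: Suc flip: add_Suc)
 also have "... = (\<integral>\<^sup>+ s. indicator {0<..} s *
   (ennreal (rate n L0 x j (sgm j) * exp (- trate n L0 x j * s)) * (indicator {a j<..} s
    * vrjp_orthant (map (%i. (sgm i, a i)) [Suc j..<Suc j + m]) n L0 (map x [0..<j] @ [(sgm j, s)]))) \<partial>lborel)"
  using assms(1)[of j] by (auto simp: step_def h_def indicator_def)
 also have "... = vrjp_orthant (map (%i. (sgm i, a i)) (j # [Suc j..<Suc j + m])) n L0 (map x [0..<j])"
  using assms(2)[of j]
  by (auto simp: jump_rate_eq total_rate_eq indicator_def intro!: nn_integral_cong split: if_splits)
 also have "j # [Suc j..<Suc j + m] = [j..<j + Suc m]"
  by (simp add: upt_conv_Cons del: upt_Suc)
 finally show ?case .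
qed

lemma loc_pos:
 assumes "!!x. L0 x > 0" "!!i. i < k ==> snd (x i) > 0"
 shows "loc n L0 x k j >= L0 (real_of_int j / 2 ^ n)" "loc n L0 x k j > 0"
proof -
 have "(\<Sum>i<k. if pos x i = j then snd (x i) else 0) >= 0"
  using assms(2) by (intro sum_nonneg) (auto simp: less_imp_le)
 then show "loc n L0 x k j >= L0 (real_of_int j / 2 ^ n)" by (simp add: loc_def)
 then show "loc n L0 x k j > 0" using assms(1)[of "real_of_int j / 2 ^ n"] by linarith
qed

text \<open>The integrand is the derivative of - exp(- r s) Y(s). This function is nondecreasing by
  \<open>cY\<close> and at most 0 by \<open>Y\<close>, so it has a limit at most 0 and the integral
  is at most Y(0). No growth condition on \<open>Y\<close> at infinity enters.\<close>

lemma nn_integral_generator_le: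
 fixes Y Y' :: "real => real" and r :: real
 assumes r: "r > 0"
  and Y: "!!s. s >= 0 ==> (Y has_real_derivative Y' s) (at s)" "!!s. s >= 0 ==> Y s >= 0"
  and cY: "!!s. s >= 0 ==> r * Y s - Y' s >= 0"
  and mY: "Y' \<in> borel_measurable borel" "Y \<in> borel_measurable borel"
 shows "(\<integral>\<^sup>+ s. indicator {0<..} s * ennreal (exp (- r * s) * (r * Y s - Y' s)) \<partial>lborel) <= ennreal (Y 0)"
proof -
 define F where "F s = - (exp (- r * s) * Y s)" for s
 have dF: "(F has_real_derivative exp (- r * s) * (r * Y s - Y' s)) (at s)" if "s >= 0" for s
  unfolding F_def by (rule derivative_eq_intros Y that refl | simp add: algebra_simps)+
 have mono: "F s <= F t" if "0 <= s" "s <= t" for s t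
  using DERIV_nonneg_imp_nondecreasing[OF that(2), of F] dF cY that by (meson order_trans zero_le_mult_iff exp_ge_zero)
 \<comment> \<open>Freezing \<open>F\<close> to the left of 0 gives a function that is monotone on
   the whole line, so its limit at infinity is its supremum.\<close>
 define g where "g s = F (max 0 s)" for s
 have "mono g" unfolding g_def mono_def by (auto intro!: mono)
 moreover have "g s <= 0" for s using Y(2)[of "max 0 s"] by (simp add: g_def F_def)
 ultimately have g: "mono g" "!!s. g s <= 0" by auto
 have "\<exists>l. (g \<longlongrightarrow> l) at_top & l <= 0"
 proof (intro exI conjI)
  have bdd: "bdd_above (range g)" using g(2) by (intro bdd_aboveI[of _ 0]) auto
  show "(g \<longlongrightarrow> Sup (range g)) at_top"
  proof (rule order_tendstoI)
   fix a assume "a < Sup (range g)"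
   then obtain s where "a < g s" using less_cSup_iff[OF _ bdd] by auto
   then show "\<forall>\<^sub>F t in at_top. a < g t"
    using g(1) by (auto simp: eventually_at_top_linorder mono_def intro!: exI[of _ s] elim: less_le_trans)
  next
   fix a assume "Sup (range g) < a"
   then show "\<forall>\<^sub>F t in at_top. g t < a"
    using cSup_upper[OF _ bdd] by (auto intro!: always_eventually elim: le_less_trans[rotated])
  qed
  show "Sup (range g) <= 0" using g(2) by (auto intro: cSUP_least)
 qed
 then obtain l where l: "(g \<longlongrightarrow> l) at_top" "l <= 0" by auto
 have "(F \<longlongrightarrow> l) at_top"
  using l(1) by (rule Lim_transform_eventually) (auto simp: g_def eventually_at_top_linorder intro!: exI[of _ 0])
 then have "(\<integral>\<^sup>+ s. ennreal (exp (- r * s) * (r * Y s - Y' s)) * indicator {0..} s \<partial>lborel) = l - F 0"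
  using mY cY dF by (intro nn_integral_FTC_atLeast) auto
 also have "... <= ennreal (Y 0)" using l by (auto simp: F_def intro!: ennreal_leI)
 finally show ?thesis
  by (rule order_trans[rotated]) (auto intro!: nn_integral_mono simp: indicator_def)
qed


lemma nn_integral_exponential:
 assumes "r > (0::real)"
 shows "(\<integral>\<^sup>+ s. indicator {0<..} s * ennreal (r * exp (- r * s)) \<partial>lborel) = 1"
proof -
 have "(\<integral>\<^sup>+ s. ennreal (r * exp (- r * s)) * indicator {0..} s \<partial>lborel) = 0 - (- exp (- r * 0))"
 proof (rule nn_integral_FTC_atLeast)
  show "((%s. - exp (- r * s)) \<longlongrightarrow> 0) at_top"
  proof -
   have "filterlim (%s. - (r * s)) at_bot at_top"
    using assms by (intro filterlim_uminus_at_top[THEN iffD1] filterlim_tendsto_pos_mult_at_top[OF tendsto_const]) (auto simp: filterlim_ident)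
   then show ?thesis
    using tendsto_minus[OF filterlim_compose[OF exp_at_bot]] by fastforce
  qed
 qed (use assms in \<open>auto intro!: derivative_eq_intros\<close>)
 moreover have "(\<integral>\<^sup>+ s. indicator {0<..} s * ennreal (r * exp (- r * s)) \<partial>lborel)
  = (\<integral>\<^sup>+ s. ennreal (r * exp (- r * s)) * indicator {0..} s \<partial>lborel)"
  by (intro nn_integral_cong_AE AE_I[where N="{0}"]) (auto simp: indicator_def)
 ultimately show ?thesis by simp
qed

lemma rate_pos:
 assumes "!!x. L0 x > 0" "!!i. i < k ==> valid (x i)"
 shows "rate n L0 x k sgm > 0" "trate n L0 x k > 0"
proof -
 show "rate n L0 x k sgm > 0" for sgm
  using loc_pos[OF assms(1)] assms(2) by (auto simp: rate_def valid_def)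
 then show "trate n L0 x k > 0" by (simp add: trate_def add_pos_pos)
qed

lemma step_cong:
 assumes "!!p. valid p ==> f (x(k := p)) = g (x(k := p))"
 shows "step n L0 k f x = step n L0 k g x"
 unfolding step_def using assms
 by (intro sum.cong nn_integral_cong refl) (auto simp: indicator_def valid_def)

lemma step_mono_valid:
 assumes "!!p. valid p ==> f (x(k := p)) <= g (x(k := p))"
 shows "step n L0 k f x <= step n L0 k g x"
 unfolding step_def using assms
 by (intro sum_mono nn_integral_mono) (auto simp: indicator_def valid_def intro!: mult_left_mono)

text \<open>The exponential density has mass one only if the total rate is positive, hence the
  restriction to a past with positive holding times.\<close>

lemma step_const:
 assumes "!!x. L0 x > 0" "!!i. i < k ==> valid (x i)"
 shows "step n L0 k (%_. c) x = c"
proof -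
 have r: "rate n L0 x k sgm > 0" "trate n L0 x k > 0" for sgm
  using rate_pos[of L0 k x n] assms by auto
 have "step n L0 k (%_. 1) x = (\<integral>\<^sup>+ s. indicator {0<..} s * ennreal (rate n L0 x k 1 * exp (- trate n L0 x k * s))
   + indicator {0<..} s * ennreal (rate n L0 x k (-1) * exp (- trate n L0 x k * s)) \<partial>lborel)"
  by (subst nn_integral_add) (auto simp: step_def)
 also have "... = (\<integral>\<^sup>+ s. indicator {0<..} s * ennreal (trate n L0 x k * exp (- trate n L0 x k * s)) \<partial>lborel)"
  using r(1)[of 1] r(1)[of "-1"]
  by (intro nn_integral_cong) (auto simp: indicator_def trate_def algebra_simps simp flip: ennreal_plus intro!: arg_cong[where f=ennreal])
 also have "... = 1" by (rule nn_integral_exponential) (use r in auto)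
 finally show ?thesis using step_cmult[of "%_. 1" n L0 k c x] by simp
qed

lemma steps_cong:
 assumes "!!y. (\<forall>i\<in>{j..<j + m}. valid (y i)) ==> (\<forall>i<j. y i = x i) ==> f y = g y"
 shows "steps n L0 j m f x = steps n L0 j m g x"
 using assms
proof (induction m arbitrary: j x)
 case 0
 then show ?case by simp
next
 case (Suc m)
 show ?case
  unfolding steps.simps
 proof (rule step_cong, rule Suc.IH, rule Suc.prems)
  fix p y assume p: "valid p" and y: "\<forall>i\<in>{Suc j..<Suc j + m}. valid (y i)" "\<forall>i<Suc j. y i = (x(j := p)) i"
  show "\<forall>i<j. y i = x i" using y by simp
  show "\<forall>i\<in>{j..<j + Suc m}. valid (y i)"
  proof
   fix i assume "i \<in> {j..<j + Suc m}"
   then show "valid (y i)" using y p by (cases "i = j") auto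
  qed
 qed
qed

lemma steps_const:
 assumes "!!x. L0 x > 0" "!!i. i < j ==> valid (x i)"
 shows "steps n L0 j m (%_. c) x = c"
 using assms(2)
proof (induction m arbitrary: j x)
 case (Suc m)
 have "steps n L0 j (Suc m) (%_. c) x = step n L0 j (%_. c) x"
  unfolding steps.simps
  by (rule step_cong, rule Suc.IH) (use Suc.prems in \<open>auto simp: less_Suc_eq\<close>)
 then show ?case using step_const[OF assms(1) Suc.prems] by simp
qed simp

text \<open>Read \<open>Y s\<close> as the value of the process after waiting for time
  \<open>s\<close> without a jump, and \<open>y sgm s\<close> as a bound for its value after a jump
  in direction \<open>sgm\<close> at that time. Hypothesis \<open>gen\<close> says that the jump
  part of the generator plus the drift is nonpositive; integration against the exponential density
  then loses at most \<open>Y 0\<close>.\<close>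

lemma step_le_generator:
 fixes y :: "int => real => real" and Y Y' :: "real => real"
 assumes "!!x. L0 x > 0" "!!i. i < k ==> valid (x i)"
  and f: "!!sgm s. sgm \<in> {1, -1} ==> s > 0 ==> f (x(k := (sgm, s))) <= ennreal (y sgm s)"
  and y: "!!sgm s. sgm \<in> {1, -1} ==> s >= 0 ==> y sgm s >= 0"
  and my: "!!sgm. sgm \<in> {1, -1} ==> y sgm \<in> borel_measurable borel"
  and Y: "!!s. s >= 0 ==> (Y has_real_derivative Y' s) (at s)" "!!s. s >= 0 ==> Y s >= 0"
  and mY: "Y' \<in> borel_measurable borel" "Y \<in> borel_measurable borel"
  and gen: "!!s. s >= 0 ==> rate n L0 x k 1 * (y 1 s - Y s) + rate n L0 x k (-1) * (y (-1) s - Y s) + Y' s <= 0"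
 shows "step n L0 k f x <= ennreal (Y 0)"
proof -
 have r: "rate n L0 x k sgm > 0" "trate n L0 x k > 0" for sgm
  using rate_pos[of L0 k x n] assms(1,2) by auto
 have [measurable]: "y 1 \<in> borel_measurable borel" "y (-1) \<in> borel_measurable borel" using my by auto
 let ?r = "trate n L0 x k"
 have le: "rate n L0 x k 1 * y 1 s + rate n L0 x k (-1) * y (-1) s <= ?r * Y s - Y' s" if "s >= 0" for s
  using gen[OF that] by (simp add: trate_def algebra_simps)
 have nn: "0 <= rate n L0 x k 1 * y 1 s + rate n L0 x k (-1) * y (-1) s" if "s >= 0" for s
  using y[OF _ that] r by (simp add: less_imp_le)
 have "step n L0 k f x <= (\<Sum>sgm\<in>{1, -1}. \<integral>\<^sup>+ s. indicator {0<..} s *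
   (ennreal (rate n L0 x k sgm * exp (- ?r * s)) * ennreal (y sgm s)) \<partial>lborel)"
  unfolding step_def using f by (intro sum_mono nn_integral_mono) (auto simp: indicator_def intro!: mult_left_mono)
 also have "... = (\<integral>\<^sup>+ s. indicator {0<..} s * (ennreal (rate n L0 x k 1 * exp (- ?r * s)) * ennreal (y 1 s))
  + indicator {0<..} s * (ennreal (rate n L0 x k (-1) * exp (- ?r * s)) * ennreal (y (-1) s)) \<partial>lborel)"
  by (subst nn_integral_add) auto
 also have "... <= (\<integral>\<^sup>+ s. indicator {0<..} s * ennreal (exp (- ?r * s) * (?r * Y s - Y' s)) \<partial>lborel)"
 proof (intro nn_integral_mono)
  fix s :: real
  show "indicator {0<..} s * (ennreal (rate n L0 x k 1 * exp (- ?r * s)) * ennreal (y 1 s))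
  + indicator {0<..} s * (ennreal (rate n L0 x k (-1) * exp (- ?r * s)) * ennreal (y (-1) s))
  <= indicator {0<..} s * ennreal (exp (- ?r * s) * (?r * Y s - Y' s))"
  proof (cases "s > 0")
   case True
   have "ennreal (rate n L0 x k 1 * exp (- ?r * s)) * ennreal (y 1 s) + ennreal (rate n L0 x k (-1) * exp (- ?r * s)) * ennreal (y (-1) s)
    = ennreal (exp (- ?r * s) * (rate n L0 x k 1 * y 1 s + rate n L0 x k (-1) * y (-1) s))"
    using True y[of 1 s] y[of "-1" s] r(1)[of 1] r(1)[of "-1"]
    by (simp add: ennreal_mult[symmetric] ennreal_plus[symmetric] less_imp_le algebra_simps del: ennreal_plus)
   also have "... <= ennreal (exp (- ?r * s) * (?r * Y s - Y' s))"
    using le[of s] True by (intro ennreal_leI mult_left_mono) auto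
   finally show ?thesis using True by simp
  qed simp
 qed
 also have "... <= ennreal (Y 0)"
  by (rule nn_integral_generator_le) (use r Y mY order_trans[OF nn le] in auto)
 finally show ?thesis .
qed

lemma nonanticipating_pos: "l <= k ==> nonanticipating k (%x. pos x l)"
 by (auto simp: nonanticipating_def pos_def intro!: sum.cong)

lemma nonanticipating_loc: "l <= k ==> nonanticipating k (%x. loc n L0 x l j)"
proof -
 assume l: "l <= k"
 have "pos x i = pos y i" if "\<forall>i<k. x i = y i" "i < l" for x y i
  using nonanticipating_pos[of i k] that l by (auto simp: nonanticipating_def)
 then show ?thesis using l by (auto simp: nonanticipating_def loc_def intro!: sum.cong)
qed

lemma nonanticipatingD: "nonanticipating k f ==> (!!i. i < k ==> x i = y i) ==> f x = f y"
 unfolding nonanticipating_def by blast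

lemma nonanticipatingI: "(!!x y. (!!i. i < k ==> x i = y i) ==> f x = f y) ==> nonanticipating k f"
 unfolding nonanticipating_def by blast

lemma nonanticipating_rate: "nonanticipating k (%x. rate n L0 x k sgm)" "nonanticipating k (%x. trate n L0 x k)"
proof -
 show *: "nonanticipating k (%x. rate n L0 x k sgm)" for sgm
 proof (rule nonanticipatingI)
  fix x y :: "nat => int \<times> real" assume xy: "!!i. i < k ==> x i = y i"
  have "pos x k = pos y k" by (rule nonanticipatingD[OF nonanticipating_pos[OF order_refl] xy])
  moreover have "loc n L0 x k j = loc n L0 y k j" for j
   by (rule nonanticipatingD[OF nonanticipating_loc[OF order_refl] xy])
  ultimately show "rate n L0 x k sgm = rate n L0 y k sgm" by (simp add: rate_def)
 qed
 show "nonanticipating k (%x. trate n L0 x k)"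
  unfolding trate_def by (rule nonanticipatingI) (intro arg_cong2[where f="(+)"] nonanticipatingD[OF *])
qed

lemma nonanticipating_step:
 assumes "nonanticipating (Suc k) f"
 shows "nonanticipating k (step n L0 k f)"
proof (rule nonanticipatingI)
 fix x y :: "nat => int \<times> real" assume xy: "!!i. i < k ==> x i = y i"
 have "f (x(k := p)) = f (y(k := p))" for p
  by (rule nonanticipatingD[OF assms]) (use xy in \<open>auto simp: less_Suc_eq\<close>)
 moreover have "rate n L0 x k sgm = rate n L0 y k sgm" "trate n L0 x k = trate n L0 y k" for sgm
  by (rule nonanticipatingD[OF nonanticipating_rate(1) xy] nonanticipatingD[OF nonanticipating_rate(2) xy], assumption)+
 ultimately show "step n L0 k f x = step n L0 k f y" unfolding step_def by simp
qed

section \<open>The random jump sequence, its law and nonnegative supermartingales\<close>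

locale vrjp =
 fixes n :: nat and L0 :: "real => real" and M :: "'a measure"
  and dir :: "nat => 'a => int" and H :: "nat => 'a => real"
 assumes L0_pos: "!!x. L0 x > 0" and law: "vrjp_law n L0 M dir H"
begin

sublocale prob_space M using law by (simp add: vrjp_law_def)

definition X :: "'a => nat => int \<times> real" where "X om i = (dir i om, H i om)"

lemma measurable_X [measurable]: "X \<in> M \<rightarrow>\<^sub>M seqM"
proof (rule measurable_seqM_I)
 fix i
 have [measurable]: "dir i \<in> M \<rightarrow>\<^sub>M count_space UNIV" "H i \<in> borel_measurable M"
  using law by (auto simp: vrjp_law_def)
 show "(%w. X w i) \<in> M \<rightarrow>\<^sub>M count_space UNIV \<Otimes>\<^sub>M borel" unfolding X_def by measurable
qed

lemma emeasure_orthant: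
 assumes "!!i. sgm i \<in> {1, -1}" "!!i. a i >= 0"
 shows "emeasure M {om \<in> space M. X om \<in> orthant 0 k sgm a} = steps n L0 0 k (indicator (orthant 0 k sgm a)) x"
proof -
 let ?ss = "map (%i. (sgm i, a i)) [0..<k]"
 have "{om \<in> space M. X om \<in> orthant 0 k sgm a}
  = {om \<in> space M. \<forall>i<length ?ss. dir i om = fst (?ss ! i) & H i om > snd (?ss ! i)}"
  by (auto simp: orthant_def X_def)
 moreover have "\<forall>p\<in>set ?ss. fst p \<in> {-1, 1} & snd p >= 0" using assms by auto
 then have "emeasure M {om \<in> space M. \<forall>i<length ?ss. dir i om = fst (?ss ! i) & H i om > snd (?ss ! i)} = vrjp_orthant ?ss n L0 []"
  using law unfolding vrjp_law_def by blast
 ultimately have "emeasure M {om \<in> space M. X om \<in> orthant 0 k sgm a} = vrjp_orthant ?ss n L0 []"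
  by simp
 also have "... = steps n L0 0 k (indicator (orthant 0 k sgm a)) x"
  using steps_orthant[of sgm a n L0 0 k x] assms by simp
 finally show ?thesis .
qed

text \<open>The law speaks only about directions 1 and -1 and about thresholds at least 0. That
  nothing else occurs follows from mass one of the kernels: given an admissible word of directions,
  the two admissible continuations with positive holding time exhaust the probability. There are
  only countably many words.\<close>

lemma AE_valid: "AE om in M. \<forall>i. valid (X om i)"
proof -
 define O' where "O' k sgm = orthant 0 k sgm (%_. 0)" for k sgm
 have [measurable]: "O' k sgm \<in> sets seqM" for k sgm by (simp add: O'_def)
 have O'_Suc: "y \<in> O' (Suc k) (\<tau>(k := sgm)) \<longleftrightarrow> y \<in> O' k \<tau> & fst (y k) = sgm & snd (y k) > 0" for y k \<tau> sgm
 proof -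
  have "{0..<Suc k} = insert k {0..<k}" by auto
  then show ?thesis unfolding O'_def orthant_def by auto
 qed
 \<comment> \<open>Words are padded by 1, because \<open>orthant\<close> takes a total function of
   directions.\<close>
 define \<tau> :: "int list => nat => int" where "\<tau> l i = (if i < length l then l ! i else 1)" for l i
 have "AE om in M. X om \<in> O' (length l) (\<tau> l) --> valid (X om (length l))" if l: "set l \<subseteq> {1, -1}" for l
 proof -
  let ?k = "length l"
  have \<tau>: "\<tau> l i \<in> {1, -1}" for i using l nth_mem[of i l] by (auto simp: \<tau>_def simp del: nth_mem)
  let ?A = "%sgm. {om \<in> space M. X om \<in> O' (Suc ?k) ((\<tau> l)(?k := sgm))}"
  let ?B = "{om \<in> space M. X om \<in> O' ?k (\<tau> l)}"
  have ex: "emeasure M (?A sgm) = steps n L0 0 (Suc ?k) (indicator (O' (Suc ?k) ((\<tau> l)(?k := sgm)))) (%_. (1, 1))" if "sgm \<in> {1, -1}" for sgm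
   unfolding O'_def using that \<tau> by (intro emeasure_orthant) auto
  \<comment> \<open>On valid trajectories the two continuations add up to the indicator of the
    shorter word, and the last kernel then acts on a function of the past, where it has mass
    one.\<close>
  have "emeasure M (?A 1) + emeasure M (?A (-1))
   = steps n L0 0 (Suc ?k) (%x. indicator (O' (Suc ?k) ((\<tau> l)(?k := 1))) x + indicator (O' (Suc ?k) ((\<tau> l)(?k := -1))) x) (%_. (1, 1))"
   unfolding ex[of 1, simplified] ex[of "-1", simplified]
   by (subst steps_add) simp_all
  also have "... = steps n L0 0 (Suc ?k) (indicator (O' ?k (\<tau> l))) (%_. (1, 1))"
   by (rule steps_cong) (auto simp: O'_Suc indicator_def valid_def)
  also have "... = steps n L0 0 ?k (indicator (O' ?k (\<tau> l))) (%_. (1, 1))"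
  proof -
   have "steps n L0 0 ?k (step n L0 ?k (indicator (O' ?k (\<tau> l)))) (%_. (1, 1)) = steps n L0 0 ?k (indicator (O' ?k (\<tau> l))) (%_. (1, 1))"
   proof (rule steps_cong)
    fix y :: "nat => int \<times> real" assume y: "\<forall>i\<in>{0..<0 + ?k}. valid (y i)"
    have "nonanticipating ?k (indicator (O' ?k (\<tau> l)) :: _ => ennreal)"
     by (auto simp: nonanticipating_def O'_def orthant_def indicator_def)
    from step_mult_past[OF this, of "%_. 1" n L0 y]
    show "step n L0 ?k (indicator (O' ?k (\<tau> l))) y = indicator (O' ?k (\<tau> l)) y"
     using step_const[of L0 ?k y n 1] L0_pos y by simp
   qed
   then show ?thesis by (subst steps_Suc_end) simp
  qed
  also have "... = emeasure M ?B"
   unfolding O'_def using \<tau> by (intro emeasure_orthant[symmetric]) auto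
  finally have eq: "emeasure M (?A 1) + emeasure M (?A (-1)) = emeasure M ?B" .
  have "emeasure M (?A 1 \<union> ?A (-1)) = emeasure M ?B"
   unfolding eq[symmetric] by (rule plus_emeasure[symmetric]) (auto simp: O'_Suc)
  moreover have "?A 1 \<union> ?A (-1) \<subseteq> ?B" by (auto simp: O'_Suc)
  ultimately have "emeasure M (?B - (?A 1 \<union> ?A (-1))) = 0"
   by (subst emeasure_Diff) auto
  then have "AE om in M. om \<notin> ?B - (?A 1 \<union> ?A (-1))"
   by (intro AE_not_in) (auto simp: null_sets_def)
  moreover have "AE om in M. om \<in> space M" by (rule AE_space)
  ultimately show ?thesis
   by eventually_elim (auto simp: O'_Suc valid_def)
 qed
 then have "AE om in M. \<forall>l. set l \<subseteq> {1, -1} --> X om \<in> O' (length l) (\<tau> l) --> valid (X om (length l))"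
  by (subst AE_all_countable) auto
 then show ?thesis
 proof eventually_elim
  case (elim om)
  show "\<forall>i. valid (X om i)"
  proof
   fix k show "valid (X om k)"
   proof (induction k rule: less_induct)
    case (less k)
    let ?l = "map (%i. fst (X om i)) [0..<k]"
    have "set ?l \<subseteq> {1, -1}" "X om \<in> O' (length ?l) (\<tau> ?l)"
     using less unfolding valid_def O'_def orthant_def \<tau>_def by fastforce+
    then show ?case using elim by fastforce
   qed
  qed
 qed
qed

text \<open>Later coordinates are frozen at a valid value, so that every measurable set of sequences
  induces an event that depends on the first \<open>k\<close> jumps only.\<close>

definition trunc :: "nat => (nat => int \<times> real) => nat => int \<times> real" where
 "trunc k x i = (if i < k then x i else (1, 1))"

lemma measurable_trunc [measurable]: "trunc k \<in> seqM \<rightarrow>\<^sub>M seqM"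
 by (rule measurable_seqM_I) (auto simp: trunc_def)

text \<open>Only orthants that constrain at least \<open>k\<close> coordinates are taken: then
  truncation at \<open>k\<close> never leaves a free coordinate among the first \<open>k\<close>.
  The empty set is added because two orthants with contradictory directions are disjoint, and the
  generator has to be stable under intersection.\<close>

lemma sets_seqM_orthants:
 "sets seqM = sigma_sets UNIV (insert {} {orthant 0 N sgm a | N sgm a. k <= N})"
proof -
 let ?E = "{{sgm} \<times> {a<..} | (sgm::int) (a::real). True}"
 have 1: "sets (count_space (UNIV::int set) \<Otimes>\<^sub>M (borel::real measure)) = sets (sigma UNIV ?E)"
 proof -
  have "sets (count_space UNIV \<Otimes>\<^sub>M borel) = sets (sigma (space (count_space (UNIV::int set)) \<times> space (borel::real measure))
   { a \<times> b | a b. a \<in> (range (%sgm. {sgm})) & b \<in> range greaterThan })"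
  proof (rule sets_pair_eq)
   show "sets (count_space (UNIV::int set)) = sigma_sets (space (count_space UNIV)) (range (%sgm. {sgm}))"
    using sigma_sets_singletons[of "UNIV :: int set"] by (auto simp: image_def)
   show "sets (borel::real measure) = sigma_sets (space borel) (range greaterThan)"
    by (subst borel_Ioi) simp
   show "countable (range (%sgm::int. {sgm}))" "range (%sgm::int. {sgm}) \<subseteq> range (%sgm. {sgm})"
    "\<Union>(range (%sgm::int. {sgm})) = space (count_space UNIV)" by auto
   show "countable (range (%i::nat. {- real i<..}))" by simp
   show "\<Union>(range (%i::nat. {- real i<..})) = space borel"
   proof -
    have "b \<in> \<Union>(range (%i::nat. {- real i<..}))" for b
    proof -
     obtain i where "- b < real i" using reals_Archimedean2 by blast
     then have "b \<in> {- real i<..}" by auto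
     then show ?thesis by blast
    qed
    then show ?thesis by auto
   qed
  qed auto
  also have "{ a \<times> b | a b. a \<in> (range (%sgm::int. {sgm})) & b \<in> range greaterThan } = ?E" by auto
  finally show ?thesis by simp
 qed
 let ?J = "{{..<N} | N::nat. k <= N}"
 let ?P = "{{f\<in>(\<Pi>\<^sub>E i\<in>UNIV. UNIV). \<forall>i\<in>j. f i \<in> A i} | A j. j \<in> ?J & A \<in> Pi j (%_. ?E)}"
 have "sets seqM = sets (\<Pi>\<^sub>M i\<in>UNIV. sigma UNIV ?E)"
  unfolding seqM_def by (rule sets_PiM_cong) (simp_all add: 1)
 also have "... = sets (sigma (\<Pi>\<^sub>E i\<in>(UNIV::nat set). UNIV) ?P)"
 proof (rule sets_PiM_sigma)
  show "\<exists>S\<subseteq>?E. countable S & UNIV = \<Union>S"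
  proof (intro exI conjI)
   let ?S = "range (%(sgm::int, i::nat). {sgm} \<times> {- real i<..})"
   show "?S \<subseteq> ?E" by auto
   show "UNIV = \<Union>?S"
   proof -
    have "(sgm, b) \<in> \<Union>?S" for sgm b
    proof -
     obtain i where "- b < real i" using reals_Archimedean2 by blast
     then have "(sgm, b) \<in> (%(sgm::int, i::nat). {sgm} \<times> {- real i<..}) (sgm, i)" by auto
     then show ?thesis by blast
    qed
    then show ?thesis by auto
   qed
  qed simp
  show "\<Union>?J = UNIV"
  proof -
   have "i \<in> {..<max k (Suc i)}" for i by auto
   then show ?thesis by (auto, metis lessThan_iff max.cobounded1)
  qed
 qed auto
 also have "... = sigma_sets UNIV ?P" by (subst sets_measure_of) (auto simp: PiE_def extensional_def)
 also have "?P = {orthant 0 N sgm a | N sgm a. k <= N}"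
 proof (intro set_eqI iffI)
  fix Z assume "Z \<in> ?P"
  then obtain A N where "Z = {f\<in>(\<Pi>\<^sub>E i\<in>UNIV. UNIV). \<forall>i\<in>{..<N}. f i \<in> A i}" "k <= N" "A \<in> Pi {..<N} (%_. ?E)"
   by blast
  then have Z: "Z = {f. \<forall>i<N. f i \<in> A i}" "k <= N" "!!i. i < N ==> A i \<in> ?E"
   by (auto simp: PiE_def extensional_def)
  then obtain sgm a where "!!i. i < N ==> A i = {sgm i} \<times> {a i<..}"
   by simp metis
  then have "Z = orthant 0 N sgm a" using Z by (auto simp: orthant_def mem_Times_iff)
  then show "Z \<in> {orthant 0 N sgm a | N sgm a. k <= N}" using Z by auto
 next
  fix Z assume "Z \<in> {orthant 0 N sgm a | N sgm a. k <= N}"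
  then obtain N sgm a where Z: "Z = orthant 0 N sgm a" "k <= N" by auto
  then have "Z = {f\<in>(\<Pi>\<^sub>E i\<in>UNIV. UNIV). \<forall>i\<in>{..<N}. f i \<in> {sgm i} \<times> {a i<..}}"
   by (auto simp: orthant_def mem_Times_iff PiE_def extensional_def)
  then show "Z \<in> ?P" using Z by (auto intro!: exI[of _ "%i. {sgm i} \<times> {a i<..}"] exI[of _ "{..<N}"])
 qed
 finally have eq: "sets seqM = sigma_sets UNIV {orthant 0 N sgm a | N sgm a. k <= N}" .
 show ?thesis
  unfolding eq by (rule sigma_sets_eqI) (auto intro: sigma_sets.Empty sigma_sets.Basic)
qed

lemma steps_const0: "steps n L0 0 k (%_. c) x = c"
 by (rule steps_const) (auto simp: L0_pos)

text \<open>Dynkin's argument from the orthants. A generator may have inadmissible directions or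
  negative thresholds, which the law does not cover; almost sure validity reduces these cases to the
  null event or to thresholds at least 0.\<close>

lemma emeasure_trunc:
 assumes "A \<in> sets seqM"
 shows "emeasure M {om \<in> space M. trunc k (X om) \<in> A} = steps n L0 0 k (%x. indicator A (trunc k x)) (%_. (1, 1))"
proof -
 let ?G = "insert {} {orthant 0 N sgm a | N sgm a. k <= N}"
 have G: "?G \<subseteq> Pow UNIV" by simp
 have "Int_stable ?G"
 proof (rule Int_stableI)
  fix A B assume AB: "A \<in> ?G" "B \<in> ?G"
  show "A \<inter> B \<in> ?G"
  proof (cases "A \<inter> B = {}")
   case False
   then obtain z where z: "z \<in> A" "z \<in> B" by auto
   obtain N sgm a where A: "A = orthant 0 N sgm a" "k <= N" using AB(1) z by auto
   obtain N' sgm' a' where B: "B = orthant 0 N' sgm' a'" "k <= N'" using AB(2) z by auto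
   have eq: "sgm i = sgm' i" if "i < N" "i < N'" for i
    using z that by (auto simp: A B orthant_def Ball_def)
   have "A \<inter> B = orthant 0 (max N N') (%i. if i < N then sgm i else sgm' i)
    (%i. if i < N then if i < N' then max (a i) (a' i) else a i else a' i)"
    unfolding A B using eq by (auto simp: orthant_def)
   then show ?thesis using A(2) by (auto intro!: exI[of _ "max N N'"])
  qed simp
 qed
 from this G assms[unfolded sets_seqM_orthants[of k]]
 show ?thesis
 proof (induction rule: sigma_sets_induct_disjoint)
  case (basic A)
  show ?case
  proof (cases "A = {}")
   case True
   then show ?thesis using steps_const0[of k 0] by simp
  next
   case False
   then obtain N sgm a where A: "A = orthant 0 N sgm a" "k <= N" using basic by auto
   define C where "C \<longleftrightarrow> (\<forall>i\<in>{k..<N}. 1 = sgm i & 1 > a i)"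
   have T: "trunc k x \<in> A \<longleftrightarrow> C & x \<in> orthant 0 k sgm a" for x
    using A(2) by (auto simp: A(1) orthant_def trunc_def C_def split: if_splits)
   show ?thesis
   proof (cases "C & (\<forall>i<k. sgm i \<in> {1, -1})")
    case False
    have "AE om in M. \<not> trunc k (X om) \<in> A"
     using AE_valid
     by eventually_elim (use False in \<open>auto simp: T orthant_def valid_def Ball_def, metis\<close>)
    then have "emeasure M {om \<in> space M. trunc k (X om) \<in> A} = 0"
     by (rule emeasure_eq_0_AE)
    moreover have "steps n L0 0 k (%x. indicator A (trunc k x)) (%_. (1, 1)) = steps n L0 0 k (%x. 0) (%_. (1, 1))"
     by (rule steps_cong) (use False in \<open>auto simp: T indicator_def orthant_def valid_def Ball_def, metis\<close>)
    ultimately show ?thesis using steps_const0[of k 0] by simp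
   next
    case True
    have [measurable]: "A \<in> sets seqM" by (simp add: A)
    define sgm' where "sgm' i = (if i < k then sgm i else 1)" for i
    \<comment> \<open>A negative threshold says the same as threshold 0 for a positive holding
      time.\<close>
    define a' where "a' i = max 0 (a i)" for i
    have "emeasure M {om \<in> space M. trunc k (X om) \<in> A} = emeasure M {om \<in> space M. X om \<in> orthant 0 k sgm' a'}"
     by (rule emeasure_eq_AE, use AE_valid in eventually_elim)
      (use True in \<open>auto simp: T orthant_def valid_def sgm'_def a'_def\<close>)
    also have "... = steps n L0 0 k (indicator (orthant 0 k sgm' a')) (%_. (1, 1))"
     by (rule emeasure_orthant) (use True in \<open>auto simp: sgm'_def a'_def\<close>)
    also have "... = steps n L0 0 k (%x. indicator A (trunc k x)) (%_. (1, 1))"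
     by (rule steps_cong) (use True in \<open>auto simp: T orthant_def valid_def sgm'_def a'_def indicator_def\<close>)
    finally show ?thesis .
   qed
  qed
 next
  case empty
  then show ?case using steps_const0[of k 0] by simp
 next
  case (compl A)
  then have [measurable]: "A \<in> sets seqM" unfolding sets_seqM_orthants[of k] by blast
  let ?s = "%A. steps n L0 0 k (%x. indicator A (trunc k x)) (%_. (1, 1))"
  have "?s (UNIV - A) + ?s A = steps n L0 0 k (%x. indicator (UNIV - A) (trunc k x) + indicator A (trunc k x)) (%_. (1, 1))"
   by (subst steps_add) auto
  also have "... = steps n L0 0 k (%x. 1) (%_. (1, 1))" by (rule steps_cong) (auto simp: indicator_def)
  also have "... = 1" using steps_const0[of k 1] by simp
  finally have 1: "?s (UNIV - A) + ?s A = 1" .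
  have "emeasure M {om \<in> space M. trunc k (X om) \<in> UNIV - A} + emeasure M {om \<in> space M. trunc k (X om) \<in> A} = emeasure M (space M)"
   by (subst plus_emeasure) (auto intro!: arg_cong[where f="emeasure M"])
  then have "emeasure M {om \<in> space M. trunc k (X om) \<in> UNIV - A} + ?s A = ?s (UNIV - A) + ?s A"
   unfolding compl(2) 1 by (simp add: emeasure_space_1)
  moreover have "?s A ~= \<top>" unfolding compl(2)[symmetric] by simp
  ultimately show ?case
   using ennreal_add_left_cancel[of "?s A" "emeasure M {om \<in> space M. trunc k (X om) \<in> UNIV - A}" "?s (UNIV - A)"]
   by (simp add: add.commute)
 next
  case (union A)
  then have [measurable]: "A i \<in> sets seqM" for i unfolding sets_seqM_orthants[of k] by blast
  have "emeasure M {om \<in> space M. trunc k (X om) \<in> (\<Union>i. A i)} = emeasure M (\<Union>i. {om \<in> space M. trunc k (X om) \<in> A i})"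
   by (intro arg_cong[where f="emeasure M"]) auto
  also have "... = (\<Sum>i. emeasure M {om \<in> space M. trunc k (X om) \<in> A i})"
   using union(1) by (intro suminf_emeasure[symmetric]) (auto simp: disjoint_family_on_def)
  also have "... = steps n L0 0 k (%x. \<Sum>i. indicator (A i) (trunc k x)) (%_. (1, 1))"
   unfolding union(3) by (subst steps_suminf) simp_all
  also have "... = steps n L0 0 k (%x. indicator (\<Union>i. A i) (trunc k x)) (%_. (1, 1))"
   by (simp only: suminf_indicator[OF union(1)])
  finally show ?case .
 qed
qed

text \<open>Monotone class argument on top of \<open>emeasure_trunc\<close>. Apart from
  \<open>AE_valid\<close>, later probabilities use the law only through this identity.\<close>

lemma nn_integral_steps:
 assumes "f \<in> borel_measurable seqM" "nonanticipating k f"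
 shows "(\<integral>\<^sup>+ om. f (X om) \<partial>M) = steps n L0 0 k f (%_. (1, 1))"
proof -
 have "(\<integral>\<^sup>+ om. f (trunc k (X om)) \<partial>M) = steps n L0 0 k (%x. f (trunc k x)) (%_. (1, 1))"
  using assms(1)
 proof (induction rule: borel_measurable_induct)
  case (cong f g)
  then have "f = g" by auto
  then show ?case using cong by simp
 next
  case (set A)
  have "(\<integral>\<^sup>+ om. indicator A (trunc k (X om)) \<partial>M) = (\<integral>\<^sup>+ om. indicator {om \<in> space M. trunc k (X om) \<in> A} om \<partial>M)"
   by (intro nn_integral_cong) (auto simp: indicator_def)
  also have "... = emeasure M {om \<in> space M. trunc k (X om) \<in> A}"
   using measurable_sets[OF measurable_compose[OF measurable_X measurable_trunc[of k]] set]
   by (intro nn_integral_indicator) (simp add: vimage_def Int_def conj_commute)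
  finally show ?case using emeasure_trunc[OF set] by simp
 next
  case (mult u c)
  then show ?case by (simp add: nn_integral_cmult steps_cmult)
 next
  case (add u v)
  then show ?case by (simp add: nn_integral_add steps_add)
 next
  case (seq U)
  note seq(1)[measurable]
  have "(\<integral>\<^sup>+ om. (SUP i. U i) (trunc k (X om)) \<partial>M) = (SUP i. \<integral>\<^sup>+ om. U i (trunc k (X om)) \<partial>M)"
   unfolding SUP_apply using seq(3) by (intro nn_integral_monotone_convergence_SUP) (auto simp: incseq_def le_fun_def)
  also have "... = steps n L0 0 k (%x. SUP i. U i (trunc k x)) (%_. (1, 1))"
   using seq(3) by (subst steps_SUP) (auto simp: incseq_def le_fun_def seq)
  finally show ?case by (simp add: SUP_apply image_comp)
 qed
 moreover have "f (trunc k x) = f x" for x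
  using assms(2) by (auto simp: nonanticipating_def trunc_def)
 ultimately show ?thesis by simp
qed

lemma nn_integral_step:
 assumes [measurable]: "f \<in> borel_measurable seqM" and f: "nonanticipating (Suc k) f"
 shows "(\<integral>\<^sup>+ om. f (X om) \<partial>M) = (\<integral>\<^sup>+ om. step n L0 k f (X om) \<partial>M)"
 using nn_integral_steps[OF assms] nn_integral_steps[of "step n L0 k f" k] nonanticipating_step[OF f]
 by (simp only: steps_Suc_end add_0 measurable_step assms)

text \<open>Nonnegativity and the one-step inequality are required only after valid pasts, since
  only there the kernel is a probability kernel.\<close>

definition supermart :: "(nat => (nat => int \<times> real) => real) => bool" where
 "supermart g \<longleftrightarrow> (\<forall>k. g k \<in> borel_measurable seqM & nonanticipating k (g k) &
  (\<forall>x. (\<forall>i<k. valid (x i)) --> g k x >= 0 & step n L0 k (%y. ennreal (g (Suc k) y)) x <= ennreal (g k x)))"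

lemma supermartD:
 assumes "supermart g"
 shows "g k \<in> borel_measurable seqM" "nonanticipating k (g k)"
  "(!!i. i < k ==> valid (x i)) ==> g k x >= 0"
  "(!!i. i < k ==> valid (x i)) ==> step n L0 k (%y. ennreal (g (Suc k) y)) x <= ennreal (g k x)"
proof -
 have *: "g k \<in> borel_measurable seqM & nonanticipating k (g k) &
  (\<forall>x. (\<forall>i<k. valid (x i)) --> g k x >= 0 & step n L0 k (%y. ennreal (g (Suc k) y)) x <= ennreal (g k x))"
  using assms unfolding supermart_def by (rule spec)
 show "g k \<in> borel_measurable seqM" using * by (rule conjunct1)
 show "nonanticipating k (g k)" using * by (elim conjE)
 assume "!!i. i < k ==> valid (x i)"
 then have v: "\<forall>i<k. valid (x i)" by simp
 have **: "g k x >= 0 & step n L0 k (%y. ennreal (g (Suc k) y)) x <= ennreal (g k x)"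
  using *[THEN conjunct2, THEN conjunct2, THEN spec, THEN mp, OF v] .
 show "g k x >= 0" "step n L0 k (%y. ennreal (g (Suc k) y)) x <= ennreal (g k x)"
  using ** by (rule conjunct1, rule conjunct2)
qed

lemma supermart_nn_integral_le:
 assumes g: "supermart g"
 shows "(\<integral>\<^sup>+ om. ennreal (g k (X om)) \<partial>M) <= ennreal (g 0 (%_. (1, 1)))"
proof (induction k)
 case 0
 have "g 0 x = g 0 (%_. (1, 1))" for x
  using supermartD(2)[OF g, of 0] unfolding nonanticipating_def by blast
 then have "(\<integral>\<^sup>+ om. ennreal (g 0 (X om)) \<partial>M) = (\<integral>\<^sup>+ om. ennreal (g 0 (%_. (1, 1))) \<partial>M)"
  by (intro nn_integral_cong arg_cong[where f=ennreal])
 also have "... = ennreal (g 0 (%_. (1, 1)))" by (simp add: emeasure_space_1)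
 finally show ?case by simp
next
 case (Suc k)
 have [measurable]: "g k \<in> borel_measurable seqM" for k by (rule supermartD(1)[OF g])
 have "(\<integral>\<^sup>+ om. ennreal (g (Suc k) (X om)) \<partial>M) = (\<integral>\<^sup>+ om. step n L0 k (%y. ennreal (g (Suc k) y)) (X om) \<partial>M)"
 proof (rule nn_integral_step)
  show "nonanticipating (Suc k) (%x. ennreal (g (Suc k) x))"
   by (rule nonanticipatingI) (rule arg_cong[where f=ennreal], rule nonanticipatingD[OF supermartD(2)[OF g]])
 qed measurable
 also have "... <= (\<integral>\<^sup>+ om. ennreal (g k (X om)) \<partial>M)"
  by (rule nn_integral_mono_AE, use AE_valid in eventually_elim) (rule supermartD(4)[OF g], blast)
 finally show ?case using Suc by simp
qed

text \<open>The process is reset to \<open>c\<close> from the step after it first reaches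
  \<open>c\<close>. The reset only lowers an overshoot, so the result \<open>h\<close> is again a
  supermartingale; Markov's inequality at index \<open>k\<close> and monotone limits in
  \<open>k\<close> give the maximal inequality without a stopping time.\<close>

lemma supermart_ville:
 assumes g: "supermart g" and c: "c > 0"
 shows "prob {om \<in> space M. \<exists>k. g k (X om) >= c} <= g 0 (%_. (1, 1)) / c"
proof -
 have [measurable]: "g k \<in> borel_measurable seqM" for k by (rule supermartD(1)[OF g])
 have na: "nonanticipating k (g k)" for k by (rule supermartD(2)[OF g])
 define h where "h k x = (if \<exists>i<k. g i x >= c then c else g k x)" for k x
 have hmeas: "h k \<in> borel_measurable seqM" for k unfolding h_def[abs_def] by measurable
 have hna: "nonanticipating k (h k)" for k
  unfolding nonanticipating_def
 proof safe
  fix x y :: "nat => int \<times> real" assume xy: "\<forall>i<k. x i = y i"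
  have "g i x = g i y" if "i <= k" for i
   using na[of i] xy that by (auto simp: nonanticipating_def)
  then show "h k x = h k y" by (auto simp: h_def)
 qed
 have h: "supermart h"
  unfolding supermart_def
 proof (intro allI conjI impI)
  fix k and x :: "nat => int \<times> real" assume v: "\<forall>i<k. valid (x i)"
  show "h k x >= 0" using supermartD(3)[OF g, of k x] v c by (auto simp: h_def)
  have gi: "g i (x(k := p)) = g i x" if "i <= k" for i p
   using na[of i] that by (auto simp: nonanticipating_def)
  show "step n L0 k (%y. ennreal (h (Suc k) y)) x <= ennreal (h k x)"
  proof (cases "\<exists>i<Suc k. g i x >= c")
   case True
   have "step n L0 k (%y. ennreal (h (Suc k) y)) x = step n L0 k (%y. ennreal c) x"
    by (rule step_cong) (use True gi in \<open>auto simp: h_def less_Suc_eq_le\<close>)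
   also have "... = ennreal c" by (rule step_const[OF L0_pos]) (use v in auto)
   also have "... <= ennreal (h k x)" using True by (auto simp: h_def less_Suc_eq intro!: ennreal_leI)
   finally show ?thesis .
  next
   case False
   have "step n L0 k (%y. ennreal (h (Suc k) y)) x = step n L0 k (%y. ennreal (g (Suc k) y)) x"
    by (rule step_cong) (use False gi in \<open>auto simp: h_def less_Suc_eq_le\<close>)
   also have "... <= ennreal (g k x)" using supermartD(4)[OF g, of k x] v by blast
   also have "... = ennreal (h k x)" using False by (auto simp: h_def)
   finally show ?thesis .
  qed
 qed (use hmeas hna in auto)
 define A where "A k = {om \<in> space M. \<exists>i<k. g i (X om) >= c}" for k :: nat
 have [measurable]: "A k \<in> sets M" for k unfolding A_def by measurable
 have g0: "g 0 (%_. (1, 1)) >= 0" using supermartD(3)[OF g, of 0] by simp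
 have "prob (A k) <= g 0 (%_. (1, 1)) / c" for k
 proof -
  have "ennreal c * emeasure M (A k) = (\<integral>\<^sup>+ om. ennreal c * indicator (A k) om \<partial>M)"
   by (simp add: nn_integral_cmult_indicator)
  also have "... <= (\<integral>\<^sup>+ om. ennreal (h k (X om)) \<partial>M)"
   by (rule nn_integral_mono) (auto simp: indicator_def A_def h_def)
  also have "... <= ennreal (g 0 (%_. (1, 1)))"
   using supermart_nn_integral_le[OF h, of k] by (simp add: h_def)
  finally have "c * prob (A k) <= g 0 (%_. (1, 1))"
   using c g0 by (simp add: emeasure_eq_measure ennreal_mult[symmetric])
  then show ?thesis using c by (simp add: field_simps)
 qed
 moreover have "(%k. prob (A k)) \<longlonglongrightarrow> prob (\<Union>k. A k)"
  by (rule finite_Lim_measure_incseq) (auto simp: incseq_def A_def intro: less_le_trans)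
 ultimately have "prob (\<Union>k. A k) <= g 0 (%_. (1, 1)) / c"
  by (intro LIMSEQ_le_const2[of "%k. prob (A k)"]) auto
 moreover have "(\<Union>k. A k) = {om \<in> space M. \<exists>k. g k (X om) >= c}" by (auto simp: A_def)
 ultimately show ?thesis by simp
qed

end

section \<open>Scale, clock and martingale of one trajectory\<close>

definition jmp :: "nat => (real => real) => (nat => int \<times> real) => nat => real" where
 "jmp n L0 x k = of_int (fst (x k)) / (2 ^ n * ((loc n L0 x k (pos x k) + 2 ^ n * snd (x k)) * loc n L0 x k (pos x k + fst (x k))))"

text \<open>Loss of length, during the holding time \<open>k\<close>, of the edge that leaves the
  current site in direction \<open>sgm\<close>.\<close>

definition shrink :: "nat => (real => real) => (nat => int \<times> real) => nat => int => real" where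
 "shrink n L0 x k sgm = 1 / (2 ^ n * loc n L0 x k (pos x k + sgm)) *
  (1 / loc n L0 x k (pos x k) - 1 / (loc n L0 x k (pos x k) + 2 ^ n * snd (x k)))"

text \<open>The average of the two losses has a second meaning: as a function of the holding time
  its derivative is the sum over both directions of rate times squared jump, so it is also the
  bracket of the martingale.\<close>

definition dclk :: "nat => (real => real) => (nat => int \<times> real) => nat => real" where
 "dclk n L0 x k = (shrink n L0 x k 1 + shrink n L0 x k (-1)) / 2"

definition mart :: "nat => (real => real) => (nat => int \<times> real) => nat => real" where
 "mart n L0 x k = (\<Sum>i<k. jmp n L0 x i)"

definition edge0 :: "nat => (real => real) => int => real" where
 "edge0 n L0 i = 1 / (2 ^ n * (L0 (real_of_int i / 2 ^ n) * L0 (real_of_int (i + 1) / 2 ^ n)))"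

definition scl0 :: "nat => (real => real) => int => real" where
 "scl0 n L0 j = (if j >= 0 then \<Sum>i\<in>{0..<j}. edge0 n L0 i else - (\<Sum>i\<in>{j..<0}. edge0 n L0 i))"

text \<open>While the walker waits, the image of its own site stays put. All sites to the right are
  pulled left by the loss of the right edge, all sites to the left are pulled right by the loss of
  the left edge.\<close>

definition dscl :: "nat => (real => real) => (nat => int \<times> real) => int => nat => real" where
 "dscl n L0 x j i = (if pos x i < j then - shrink n L0 x i 1 else if pos x i > j then shrink n L0 x i (-1) else 0)"

definition scl :: "nat => (real => real) => (nat => int \<times> real) => nat => int => real" where
 "scl n L0 x k j = scl0 n L0 j + (\<Sum>i<k. dscl n L0 x j i)"

lemma pos_Suc: "pos x (Suc k) = pos x k + fst (x k)"
 by (simp add: pos_def)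

lemma loc_Suc: "loc n L0 x (Suc k) j = loc n L0 x k j + (if pos x k = j then 2 ^ n * snd (x k) else 0)"
 by (simp add: loc_def algebra_simps)

lemma loc_0: "loc n L0 x 0 j = L0 (real_of_int j / 2 ^ n)"
 by (simp add: loc_def)

lemma scl_Suc: "scl n L0 x (Suc k) j = scl n L0 x k j + dscl n L0 x j k"
 by (simp add: scl_def)

lemma mart_Suc: "mart n L0 x (Suc k) = mart n L0 x k + jmp n L0 x k"
 by (simp add: mart_def)

lemma scl0_Suc: "scl0 n L0 (j + 1) = scl0 n L0 j + edge0 n L0 j"
proof (cases "j >= 0")
 case True
 then have "{0..<j + 1} = insert j {0..<j}" by auto
 with True show ?thesis by (simp add: scl0_def)
next
 case False
 then have "{j..<0} = insert j {j + 1..<0}" by auto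
 then have *: "(\<Sum>i\<in>{j..<0}. edge0 n L0 i) = edge0 n L0 j + (\<Sum>i\<in>{j + 1..<0}. edge0 n L0 i)" by simp
 show ?thesis
 proof (cases "j = -1")
  case True
  then show ?thesis using * by (simp add: scl0_def)
 next
  case F: False
  with False have "\<not> j + 1 >= 0" by simp
  then show ?thesis using * False by (simp add: scl0_def)
 qed
qed

locale traj =
 fixes n :: nat and L0 :: "real => real" and x :: "nat => int \<times> real"
 assumes L0p: "!!y. L0 y > 0" and val: "!!i. valid (x i)"
begin

abbreviation "L \<equiv> loc n L0 x"
abbreviation "S \<equiv> scl n L0 x"
abbreviation "Mt \<equiv> mart n L0 x"
abbreviation "sh \<equiv> shrink n L0 x"

lemma h_pos: "snd (x i) > 0" using val[of i] by (simp add: valid_def)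

lemma dir_cases: "fst (x i) = 1 \<or> fst (x i) = -1" using val[of i] by (simp add: valid_def)

lemma L_pos: "L k j > 0" and L_ge: "L k j >= L0 (real_of_int j / 2 ^ n)"
 using loc_pos[where ?L0.0=L0 and k=k and x=x and j=j and n=n] L0p h_pos by auto

lemma sh_eq: "sh k sgm = 1 / (2 ^ n * L k (pos x k + sgm)) * (1 / L k (pos x k) - 1 / L (Suc k) (pos x k))"
 by (simp add: shrink_def loc_Suc)

lemma sh_pos: "sh k sgm > 0"
proof -
 have "1 / L k (pos x k) - 1 / L (Suc k) (pos x k) > 0"
  using L_pos[of k "pos x k"] h_pos[of k] by (simp add: loc_Suc frac_less2)
 then show ?thesis unfolding sh_eq using L_pos[of k "pos x k + sgm"] by simp
qed

text \<open>During a holding time only the two edges at the current site change length, and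
  \<open>dscl\<close> differs between the ends of such an edge by exactly this change and agrees at
  the ends of all others.\<close>

lemma S_diff: "S k (j + 1) - S k j = 1 / (2 ^ n * (L k j * L k (j + 1)))"
proof (induction k)
 case 0
 then show ?case by (simp add: scl_def scl0_Suc edge0_def loc_0)
next
 case (Suc k)
 have p: "L k j > 0" "L k (j + 1) > 0" "L (Suc k) j > 0" "L (Suc k) (j+1) > 0" by (rule L_pos)+
 consider "pos x k < j" | "pos x k = j" | "pos x k = j + 1" | "pos x k > j + 1" by linarith
 then show ?case
 proof cases
  case 2
  then have "sh k 1 = 1 / (2 ^ n * (L k j * L k (j + 1))) - 1 / (2 ^ n * (L (Suc k) j * L k (j + 1)))"
   using p by (simp add: sh_eq field_simps)
  with 2 Suc show ?thesis by (simp add: scl_Suc dscl_def loc_Suc)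
 next
  case 3
  then have "sh k (-1) = 1 / (2 ^ n * (L k j * L k (j + 1))) - 1 / (2 ^ n * (L k j * L (Suc k) (j + 1)))"
   using p by (simp add: sh_eq field_simps)
  with 3 Suc show ?thesis by (simp add: scl_Suc dscl_def loc_Suc)
 qed (use Suc in \<open>auto simp: scl_Suc dscl_def loc_Suc\<close>)
qed

lemma S_step: "S k j < S k (j + 1)"
proof -
 have "S k (j + 1) - S k j > 0" unfolding S_diff using L_pos[of k j] L_pos[of k "j + 1"] by simp
 then show ?thesis by simp
qed

lemma S_less: "i < j ==> S k i < S k j"
proof (induction j rule: int_gr_induct)
 case base
 show ?case by (rule S_step)
next
 case (step j)
 then show ?case using S_step[of k j] by simp
qed

lemma S_le: "i <= j ==> S k i <= S k j"
 using S_less[of i j k] by (cases "i = j") auto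

text \<open>Waiting fixes the image of the occupied site, and the jump adds the length of the
  crossed edge at the end of the holding time, which is what \<open>jmp\<close> computes. So the
  walker seen in the moving scale is the martingale.\<close>

lemma S_pos: "S k (pos x k) = Mt k"
proof (induction k)
 case 0
 then show ?case by (simp add: scl_def mart_def pos_def scl0_def)
next
 case (Suc k)
 have eq: "S (Suc k) (pos x k) = Mt k" using Suc by (simp add: scl_Suc dscl_def)
 have "L (Suc k) (pos x k) = L k (pos x k) + 2 ^ n * snd (x k)" by (simp add: loc_Suc)
 moreover have "L (Suc k) (pos x k + 1) = L k (pos x k + 1)" "L (Suc k) (pos x k - 1) = L k (pos x k - 1)" by (auto simp: loc_Suc)
 ultimately show ?case
  using dir_cases[of k] S_diff[of "Suc k" "pos x k"] S_diff[of "Suc k" "pos x k - 1"] eq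
  by (auto simp: pos_Suc mart_Suc jmp_def mult.commute)
qed

lemma gap_Suc: "S (Suc k) j2 - S (Suc k) j1 = S k j2 - S k j1 - (if j1 <= pos x k & pos x k < j2 then sh k 1 else 0)
  - (if j1 < pos x k & pos x k <= j2 then sh k (-1) else 0)" if "j1 < j2"
 using that by (auto simp: scl_Suc dscl_def)

text \<open>Only losses of left edges are kept, since these occur in the Tanaka formula below; the
  omitted losses of right edges have the favourable sign.\<close>

lemma gap_sum:
 assumes "j1 < j2"
 shows "(\<Sum>i<k. if j1 < pos x i & pos x i <= j2 then sh i (-1) else 0) <= scl0 n L0 j2 - scl0 n L0 j1 - (S k j2 - S k j1)"
proof (induction k)
 case (Suc k)
 then show ?case using gap_Suc[OF assms, of k] sh_pos[of k 1] by auto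
qed (simp add: scl_def)

lemma gap_mono: "j1 < j2 ==> S k j2 - S k j1 <= scl0 n L0 j2 - scl0 n L0 j1"
proof -
 have "0 <= (\<Sum>i<k. if j1 < pos x i & pos x i <= j2 then sh i (-1) else 0)"
  using sh_pos by (intro sum_nonneg) (auto simp: less_imp_le)
 then show "j1 < j2 ==> ?thesis" using gap_sum[of j1 j2 k] by linarith
qed

text \<open>While the walker is in the window, both edges at its site belong to the window enlarged
  by one site, and their losses come out of its initial length, which never becomes negative. The
  bound does not depend on \<open>k\<close>; this makes all later estimates uniform in time.\<close>

lemma clk_sum:
 assumes "j1 <= j2"
 shows "(\<Sum>i<k. if j1 <= pos x i & pos x i <= j2 then dclk n L0 x i else 0) <= (scl0 n L0 (j2 + 1) - scl0 n L0 (j1 - 1)) / 2"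
proof -
 have "2 * (\<Sum>i<k. if j1 <= pos x i & pos x i <= j2 then dclk n L0 x i else 0) <= scl0 n L0 (j2 + 1) - scl0 n L0 (j1 - 1) - (S k (j2 + 1) - S k (j1 - 1))"
 proof (induction k)
  case (Suc k)
  have "2 * (if j1 <= pos x k & pos x k <= j2 then dclk n L0 x k else 0)
   <= (if j1 - 1 <= pos x k & pos x k < j2 + 1 then sh k 1 else 0) + (if j1 - 1 < pos x k & pos x k <= j2 + 1 then sh k (-1) else 0)"
   using sh_pos[of k 1] sh_pos[of k "-1"] by (auto simp: dclk_def)
  then show ?case using gap_Suc[of "j1 - 1" "j2 + 1" k] assms Suc by (simp add: algebra_simps)
 qed (simp add: scl_def)
 then show ?thesis using S_less[of "j1 - 1" "j2 + 1" k] assms by simp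
qed

end

section \<open>Discrete Tanaka formula for the log local times\<close>

definition dfluct :: "nat => (real => real) => int => int => (nat => int \<times> real) => nat => real" where
 "dfluct n L0 j1 j2 x i =
  (if (j1 < pos x i & pos x i < j2) \<or> (pos x i = j1 & fst (x i) = 1) \<or> (pos x i = j2 & fst (x i) = -1) then jmp n L0 x i else 0)
  + (of_bool (pos x i = j2) - of_bool (pos x i = j1)) / 2 *
   ln ((loc n L0 x i (pos x i) + 2 ^ n * snd (x i)) / loc n L0 x i (pos x i))"

definition fluct :: "nat => (real => real) => int => int => (nat => int \<times> real) => nat => real" where
 "fluct n L0 j1 j2 x k = (\<Sum>i<k. dfluct n L0 j1 j2 x i)"

definition occ :: "nat => (real => real) => int => int => (nat => int \<times> real) => nat => real" where
 "occ n L0 j1 j2 x k = (\<Sum>i<k. if j1 <= pos x i & pos x i <= j2 then dclk n L0 x i else 0)"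

context traj begin

text \<open>Image of the walker clamped to the window from \<open>j1\<close> to \<open>j2\<close>
  and measured from the left end of the window.\<close>

definition phi :: "int => int => nat => real" where
 "phi j1 j2 k = (if pos x k <= j1 then 0 else if pos x k >= j2 then S k j2 - S k j1 else Mt k - S k j1)"

lemma phi_inner: "j1 <= pos x k ==> pos x k <= j2 ==> phi j1 j2 k = Mt k - S k j1"
 using S_pos[of k] by (auto simp: phi_def)

lemma phi_bounds: "j1 < j2 ==> 0 <= phi j1 j2 k & phi j1 j2 k <= S k j2 - S k j1"
 using S_le[of j1 "pos x k" k] S_le[of "pos x k" j2 k] S_less[of j1 j2 k] S_pos[of k] by (auto simp: phi_def)

text \<open>Discrete Tanaka formula. Jumps strictly inside the window count in both directions,
  jumps from an end point only inwards. The inward jumps at an end point have a drift, namely half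
  of the growth of the log local time there, with opposite signs at \<open>j1\<close> and
  \<open>j2\<close>; \<open>dfluct\<close> is the jump part with this drift removed. The last term
  comes from the motion of the left end of the window.\<close>

lemma phi_Suc:
 assumes "j1 < j2"
 shows "phi j1 j2 (Suc k) - phi j1 j2 k = dfluct n L0 j1 j2 x k
  + (of_bool (pos x k = j1) - of_bool (pos x k = j2)) / 2 * ln (L (Suc k) (pos x k) / L k (pos x k))
  - (if j1 < pos x k & pos x k <= j2 then sh k (-1) else 0)"
proof -
 have ln: "ln (L (Suc k) (pos x k) / L k (pos x k)) = ln ((L k (pos x k) + 2 ^ n * snd (x k)) / L k (pos x k))"
  by (simp add: loc_Suc)
 consider "pos x k < j1" | "pos x k = j1" | "j1 < pos x k" "pos x k < j2" | "pos x k = j2" | "pos x k > j2" by linarith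
 then show ?thesis
 proof cases
  case 1
  then show ?thesis using assms dir_cases[of k] by (auto simp: phi_def dfluct_def pos_Suc)
 next
  case 2
  show ?thesis
  proof (cases "fst (x k) = 1")
   case True
   then have "phi j1 j2 (Suc k) = Mt (Suc k) - S (Suc k) j1" "phi j1 j2 k = 0"
    using 2 assms by (auto intro!: phi_inner simp: pos_Suc) (simp add: phi_def)
   then show ?thesis using 2 assms True S_pos[of k] ln by (simp add: dfluct_def mart_Suc scl_Suc dscl_def)
  next
   case False
   then show ?thesis using 2 assms dir_cases[of k] ln by (auto simp: phi_def dfluct_def pos_Suc)
  qed
 next
  case 3
  then have "phi j1 j2 (Suc k) = Mt (Suc k) - S (Suc k) j1" "phi j1 j2 k = Mt k - S k j1"
   using dir_cases[of k] by (auto intro!: phi_inner simp: pos_Suc)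
  then show ?thesis using 3 by (simp add: dfluct_def mart_Suc scl_Suc dscl_def)
 next
  case 4
  have k: "phi j1 j2 k = Mt k - S k j1" using 4 assms by (intro phi_inner) auto
  show ?thesis
  proof (cases "fst (x k) = 1")
   case True
   then have "phi j1 j2 (Suc k) = S (Suc k) j2 - S (Suc k) j1" using 4 assms by (simp add: phi_def pos_Suc)
   then show ?thesis using 4 assms True k S_pos[of k] ln by (simp add: dfluct_def scl_Suc dscl_def)
  next
   case False
   then have s: "fst (x k) = -1" using dir_cases[of k] by auto
   then have "phi j1 j2 (Suc k) = Mt (Suc k) - S (Suc k) j1" using 4 assms by (intro phi_inner) (auto simp: pos_Suc)
   then show ?thesis using 4 assms s k ln by (simp add: dfluct_def mart_Suc scl_Suc dscl_def)
  qed
 next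
  case 5
  then have "phi j1 j2 (Suc k) = S (Suc k) j2 - S (Suc k) j1" "phi j1 j2 k = S k j2 - S k j1"
   using dir_cases[of k] assms S_pos[of "Suc k"] by (auto simp: phi_def pos_Suc)
  then show ?thesis using 5 assms by (simp add: dfluct_def scl_Suc dscl_def)
 qed
qed

definition rho :: "nat => int => real" where "rho k j = ln (L k j) - ln (L 0 j)"

text \<open>Summing the Tanaka formula and solving for the boundary terms expresses the difference
  of two log local times by a compensated jump sum and by lengths in the scale.\<close>

lemma rho_fluct:
 assumes "j1 < j2"
 shows "(rho k j2 - rho k j1) / 2 = fluct n L0 j1 j2 x k - (phi j1 j2 k - phi j1 j2 0)
  - (\<Sum>i<k. if j1 < pos x i & pos x i <= j2 then sh i (-1) else 0)"
proof (induction k)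
 case 0
 then show ?case by (simp add: rho_def fluct_def)
next
 case (Suc k)
 have "ln (L (Suc k) (pos x k) / L k (pos x k)) = ln (L (Suc k) (pos x k)) - ln (L k (pos x k))"
  using L_pos[of "Suc k" "pos x k"] L_pos[of k "pos x k"] by (simp add: ln_div)
 moreover have "rho (Suc k) j = rho k j + of_bool (pos x k = j) * (ln (L (Suc k) (pos x k)) - ln (L k (pos x k)))" for j
  by (auto simp: rho_def loc_Suc)
 ultimately have "(rho (Suc k) j2 - rho (Suc k) j1) / 2 = (rho k j2 - rho k j1) / 2
  + (of_bool (pos x k = j2) - of_bool (pos x k = j1)) / 2 * ln (L (Suc k) (pos x k) / L k (pos x k))"
  by (simp add: left_diff_distrib diff_divide_distrib add_divide_distrib)
 moreover have "(of_bool (pos x k = j1) - of_bool (pos x k = j2)) / 2 * ln (L (Suc k) (pos x k) / L k (pos x k))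
  = - ((of_bool (pos x k = j2) - of_bool (pos x k = j1)) / 2 * ln (L (Suc k) (pos x k) / L k (pos x k)))"
  by (simp add: left_diff_distrib diff_divide_distrib)
 ultimately show ?case using Suc phi_Suc[OF assms, of k]
  unfolding fluct_def sum.lessThan_Suc by linarith
qed

text \<open>The change of \<open>phi\<close> and the sum of losses are each at most the initial
  length of the window; the factor 1/2 in \<open>rho_fluct\<close> turns 1 and 2 into 2 and
  4.\<close>

lemma rho_diff_le:
 assumes "j1 < j2"
 shows "\<bar>rho k j2 - rho k j1\<bar> <= 2 * \<bar>fluct n L0 j1 j2 x k\<bar> + 4 * (scl0 n L0 j2 - scl0 n L0 j1)"
proof -
 have "0 <= (\<Sum>i<k. if j1 < pos x i & pos x i <= j2 then sh i (-1) else 0)"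
  using sh_pos by (intro sum_nonneg) (auto simp: less_imp_le)
 then show ?thesis
  using rho_fluct[OF assms, of k] gap_sum[OF assms, of k] phi_bounds[OF assms, of k] phi_bounds[OF assms, of 0]
   gap_mono[OF assms, of k] gap_mono[OF assms, of 0] S_less[OF assms, of k]
  by (simp add: abs_le_iff) linarith
qed

end


section \<open>Exponential supermartingales for the compensated jump sums\<close>

lemma exp_le_quadratic:
 fixes z :: real
 assumes "z <= 1"
 shows "exp z <= 1 + z + z\<^sup>2"
proof (cases "z >= 0")
 case True
 then show ?thesis using exp_bound[of z] assms by simp
next
 case False
 define t where "t = - z"
 have t: "t > 0" using False by (simp add: t_def)
 have "1 <= (1 - t + t\<^sup>2) * (1 + t + t\<^sup>2 / 2)"
 proof -
  have "(1 - t + t\<^sup>2) * (1 + t + t\<^sup>2 / 2) = 1 + t\<^sup>2 / 2 + t ^ 3 / 2 + t ^ 4 / 2"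
   by (simp add: field_simps power2_eq_square power3_eq_cube power4_eq_xxxx)
  then show ?thesis using t by simp
 qed
 also have "... <= (1 - t + t\<^sup>2) * exp t"
 proof (rule mult_left_mono)
  show "1 + t + t\<^sup>2 / 2 <= exp t" using exp_lower_Taylor_quadratic[of t] t by simp
  have "1 - t + t\<^sup>2 = (1 - t / 2)\<^sup>2 + 3 / 4 * t\<^sup>2" by (simp add: power2_eq_square algebra_simps)
  then show "0 <= 1 - t + t\<^sup>2" by simp
 qed
 finally have "exp (- t) <= 1 - t + t\<^sup>2" by (simp add: exp_minus field_simps)
 then show ?thesis by (simp add: t_def)
qed

lemma loc_upd [simp]:
 "i <= k ==> pos (x(k := p)) i = pos x i"
 "i <= k ==> loc n L0 (x(k := p)) i j = loc n L0 x i j"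
 using nonanticipatingD[OF nonanticipating_pos[of i k], of "x(k := p)" x]
  nonanticipatingD[OF nonanticipating_loc[of i k n L0 j], of "x(k := p)" x] by auto

lemma shrink_dclk_upd:
 "i < k ==> jmp n L0 (x(k := p)) i = jmp n L0 x i"
 "i < k ==> dclk n L0 (x(k := p)) i = dclk n L0 x i"
 "i < k ==> dfluct n L0 j1 j2 (x(k := p)) i = dfluct n L0 j1 j2 x i"
 by (auto simp: jmp_def dclk_def shrink_def dfluct_def)


text \<open>Here \<open>a\<close> selects the directions whose jumps are counted. Rate times jump is
  plus or minus one half of the logarithmic derivative of the local time at the current site, so the
  drift of the counted jumps is removed by the logarithm with factor (a(-1) - a(1))/2. The bound on
  \<open>tht\<close> keeps the exponent at most 1, as the quadratic bound for exp demands, and the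
  quadratic term is paid by the clock.\<close>

lemma step_exp_le:
 fixes a :: "int => real"
 assumes L0p: "!!y. L0 y > 0" and val: "!!i. i < k ==> valid (x i)"
  and a: "a 1 \<in> {0, 1}" "a (-1) \<in> {0, 1}" and C: "C >= 0"
  and th: "!!sgm. sgm \<in> {1, -1} ==> \<bar>tht\<bar> <= 2 ^ n * (loc n L0 x k (pos x k) * loc n L0 x k (pos x k + sgm))"
  and f: "!!sgm s. sgm \<in> {1, -1} ==> s > 0 ==> f (x(k := (sgm, s))) <= ennreal (C * exp (tht * (a sgm * jmp n L0 (x(k := (sgm, s))) k
   + (a (-1) - a 1) / 2 * ln ((loc n L0 x k (pos x k) + 2 ^ n * s) / loc n L0 x k (pos x k))) - tht\<^sup>2 * dclk n L0 (x(k := (sgm, s))) k))"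
 shows "step n L0 k f x <= ennreal C"
proof -
 define l where "l = loc n L0 x k (pos x k)"
 define m where "m sgm = loc n L0 x k (pos x k + sgm)" for sgm
 define N :: real where "N = 2 ^ n"
 have N: "N > 0" by (simp add: N_def)
 have lm: "l > 0" "m sgm > 0" for sgm
  using loc_pos(2)[where ?L0.0=L0 and k=k and x=x and n=n] L0p val by (auto simp: l_def m_def valid_def)
 define J where "J sgm s = of_int sgm / (N * ((l + N * s) * m sgm))" for sgm :: int and s :: real
 define D where "D s = (1 / m 1 + 1 / m (-1)) / (2 * N) * (1 / l - 1 / (l + N * s))" for s
 define v where "v s = (1 / m 1 + 1 / m (-1)) / 2 / (l + N * s)\<^sup>2" for s
 define b where "b = (a (-1) - a 1) / 2"
 \<comment> \<open>Value after waiting for time \<open>s\<close>: the compensators have run, but no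
   jump has happened.\<close>
 define Y where "Y s = C * exp (tht * b * (ln (l + N * s) - ln l) - tht\<^sup>2 * D s)" for s
 define Y' where "Y' s = Y s * (tht * b * (N / (l + N * s)) - tht\<^sup>2 * v s)" for s
 have ls: "l + N * s > 0" if "s >= 0" for s using lm N that by (simp add: add_pos_nonneg)
 have jJ: "jmp n L0 (x(k := (sgm, s))) k = J sgm s" for sgm s
  by (simp add: jmp_def J_def l_def m_def N_def)
 have dD: "dclk n L0 (x(k := (sgm, s))) k = D s" for sgm s
 proof -
  define q where "q = 1 / l - 1 / (l + N * s)"
  have "dclk n L0 (x(k := (sgm, s))) k = (1 / (N * m 1) * q + 1 / (N * m (-1)) * q) / 2"
   by (simp add: dclk_def shrink_def l_def m_def N_def q_def)
  then show ?thesis using N lm(2)[of 1] lm(2)[of "-1"] by (simp add: D_def field_simps flip: q_def)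
 qed
 have r: "rate n L0 x k sgm = N\<^sup>2 / 2 * m sgm" for sgm
  by (simp add: rate_def m_def N_def power2_eq_square flip: power_mult_distrib)
 have "step n L0 k f x <= ennreal (Y 0)"
 proof (rule step_le_generator[where y="%sgm s. Y s * exp (tht * (a sgm * J sgm s))" and Y'=Y'])
  fix sgm :: int and s :: real assume "sgm \<in> {1, -1}" "s > 0"
  then have "f (x(k := (sgm, s))) <= ennreal (C * exp (tht * (a sgm * J sgm s + b * ln ((l + N * s) / l)) - tht\<^sup>2 * D s))"
   using f[of sgm s] by (simp add: jJ dD b_def l_def N_def)
  also have "ln ((l + N * s) / l) = ln (l + N * s) - ln l" using ls[of s] lm \<open>s > 0\<close> by (simp add: ln_div)
  also have "C * exp (tht * (a sgm * J sgm s + b * (ln (l + N * s) - ln l)) - tht\<^sup>2 * D s) = Y s * exp (tht * (a sgm * J sgm s))"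
   unfolding Y_def mult.assoc by (simp add: algebra_simps flip: exp_add)
  finally show "f (x(k := (sgm, s))) <= ennreal (Y s * exp (tht * (a sgm * J sgm s)))" .
 next
  fix s :: real assume s: "s >= 0"
  define w where "w = l + N * s"
  have w: "w > 0" using ls[OF s] by (simp add: w_def)
  have "(D has_real_derivative (1 / m 1 + 1 / m (-1)) / (2 * N) * (N / w\<^sup>2)) (at s)"
   unfolding D_def by (rule derivative_eq_intros refl | use w in \<open>force simp: w_def\<close>)+
    (use w in \<open>simp add: w_def power2_eq_square\<close>)
  moreover have "(1 / m 1 + 1 / m (-1)) / (2 * N) * (N / w\<^sup>2) = v s"
   using N by (simp add: v_def w_def)
  ultimately have dD': "(D has_real_derivative v s) (at s)" by simp
  have "((%s. ln (l + N * s) - ln l) has_real_derivative N / w) (at s)"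
   by (rule derivative_eq_intros refl | use w in \<open>force simp: w_def\<close>)+
  then have "((%s. tht * b * (ln (l + N * s) - ln l) - tht\<^sup>2 * D s) has_real_derivative tht * b * (N / w) - tht\<^sup>2 * v s) (at s)"
   by (intro DERIV_diff DERIV_cmult dD')
  then show "(Y has_real_derivative Y' s) (at s)"
   unfolding Y_def Y'_def w_def mult.assoc by (intro DERIV_cmult DERIV_fun_exp)
  have J1: "tht * (a sgm * J sgm s) <= 1" if "sgm \<in> {1, -1}" for sgm
  proof -
   have "\<bar>tht\<bar> <= N * (l * m sgm)" using th[OF that] by (simp add: N_def l_def m_def)
   also have "... <= N * ((l + N * s) * m sgm)" using N lm(2)[of sgm] s by (intro mult_left_mono mult_right_mono) auto
   finally have "\<bar>tht\<bar> / (N * ((l + N * s) * m sgm)) <= 1" using N lm(2)[of sgm] ls[OF s] by (simp add: divide_le_eq)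
   moreover have "\<bar>tht * (a sgm * J sgm s)\<bar> <= \<bar>tht\<bar> / (N * ((l + N * s) * m sgm))"
    using a that N lm(2)[of sgm] ls[OF s] by (auto simp: J_def abs_mult)
   ultimately show ?thesis by linarith
  qed
  have Y0: "Y s >= 0" using C by (simp add: Y_def)
  have e: "exp (tht * (a sgm * J sgm s)) - 1 <= tht * (a sgm * J sgm s) + tht\<^sup>2 * (a sgm * (J sgm s)\<^sup>2)" if "sgm \<in> {1, -1}" for sgm
  proof -
   have "(tht * (a sgm * J sgm s))\<^sup>2 = tht\<^sup>2 * (a sgm * (J sgm s)\<^sup>2)"
    using a that by (auto simp: power_mult_distrib)
   then show ?thesis using exp_le_quadratic[OF J1[OF that]] by simp
  qed
  \<comment> \<open>The local time of the neighbour cancels: it multiplies the rate and divides the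
    jump. This is why the scale makes the position a martingale.\<close>
  have rJ: "rate n L0 x k sgm * J sgm s = of_int sgm * (N / (l + N * s)) / 2" for sgm
   unfolding r J_def w_def[symmetric] using N lm(2)[of sgm] w by (simp add: field_simps power2_eq_square)
  have rJ2: "rate n L0 x k sgm * (J sgm s)\<^sup>2 = 1 / m sgm / 2 / (l + N * s)\<^sup>2" if "sgm \<in> {1, -1}" for sgm
  proof -
   have "(real_of_int sgm)\<^sup>2 = 1" using that by auto
   then show ?thesis
    unfolding r J_def w_def[symmetric] using N lm(2)[of sgm] w
    by (simp add: power_divide power_mult_distrib) (simp add: field_simps power2_eq_square)
  qed
  have rp: "rate n L0 x k sgm >= 0" for sgm using lm(2)[of sgm] by (simp add: r)
  let ?e = "%sgm. exp (tht * (a sgm * J sgm s)) - 1"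
  have "rate n L0 x k 1 * ?e 1 + rate n L0 x k (-1) * ?e (-1)
   <= rate n L0 x k 1 * (tht * (a 1 * J 1 s) + tht\<^sup>2 * (a 1 * (J 1 s)\<^sup>2))
   + rate n L0 x k (-1) * (tht * (a (-1) * J (-1) s) + tht\<^sup>2 * (a (-1) * (J (-1) s)\<^sup>2))"
   using e[of 1] e[of "-1"] rp by (intro add_mono mult_left_mono) auto
  also have "... = tht * (a 1 * (rate n L0 x k 1 * J 1 s) + a (-1) * (rate n L0 x k (-1) * J (-1) s))
   + tht\<^sup>2 * (a 1 * (rate n L0 x k 1 * (J 1 s)\<^sup>2) + a (-1) * (rate n L0 x k (-1) * (J (-1) s)\<^sup>2))"
   by (simp add: algebra_simps)
  also have "... = - (tht * b * (N / (l + N * s)))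
   + tht\<^sup>2 * (a 1 * (1 / m 1 / 2 / (l + N * s)\<^sup>2) + a (-1) * (1 / m (-1) / 2 / (l + N * s)\<^sup>2))"
   by (subst rJ2, simp, subst rJ2, simp, subst (1 2) rJ) (use w in \<open>simp add: b_def field_simps flip: w_def\<close>)
  \<comment> \<open>The clock pays for squared jumps in both directions, so a direction that is not
    counted only gives room.\<close>
  also have "... <= - (tht * b * (N / (l + N * s))) + tht\<^sup>2 * v s"
  proof -
   have "a sgm * (1 / m sgm / 2 / (l + N * s)\<^sup>2) <= 1 / m sgm / 2 / (l + N * s)\<^sup>2" if "sgm \<in> {1, -1}" for sgm
    using a that lm(2)[of sgm] by auto
   from this[of 1] this[of "-1"]
   have "a 1 * (1 / m 1 / 2 / (l + N * s)\<^sup>2) + a (-1) * (1 / m (-1) / 2 / (l + N * s)\<^sup>2) <= v s"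
    unfolding v_def by (simp add: add_divide_distrib)
   then show ?thesis by (simp add: mult_left_mono)
  qed
  finally have *: "rate n L0 x k 1 * ?e 1 + rate n L0 x k (-1) * ?e (-1) + (tht * b * (N / (l + N * s)) - tht\<^sup>2 * v s) <= 0"
   by simp
  have "rate n L0 x k 1 * (Y s * exp (tht * (a 1 * J 1 s)) - Y s) + rate n L0 x k (-1) * (Y s * exp (tht * (a (-1) * J (-1) s)) - Y s) + Y' s
   = Y s * (rate n L0 x k 1 * ?e 1 + rate n L0 x k (-1) * ?e (-1) + (tht * b * (N / (l + N * s)) - tht\<^sup>2 * v s))"
   by (simp add: Y'_def algebra_simps)
  also have "... <= 0" using * Y0 by (rule mult_nonneg_nonpos[rotated])
  finally show "rate n L0 x k 1 * (Y s * exp (tht * (a 1 * J 1 s)) - Y s) + rate n L0 x k (-1) * (Y s * exp (tht * (a (-1) * J (-1) s)) - Y s) + Y' s <= 0" .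
 qed (use L0p val C in \<open>auto simp: Y_def Y'_def[abs_def] D_def v_def J_def\<close>)
 then show ?thesis by (simp add: Y_def D_def)
qed


lemma naD: "nonanticipating k f ==> \<forall>i<k. x i = y i ==> f x = f y"
 unfolding nonanticipating_def by blast

lemma naI: "(!!x y. \<forall>i<k. x i = y i ==> f x = f y) ==> nonanticipating k f"
 unfolding nonanticipating_def by blast

lemma measurable_loc_dir [measurable]: "(%x. loc n L0 x k (pos x k + fst (x k))) \<in> borel_measurable seqM"
 by (rule measurable_count_compose[where f="%x j. loc n L0 x k j"]) measurable

lemma measurable_jmp [measurable]:
 "(%x. jmp n L0 x k) \<in> borel_measurable seqM"
 "(%x. dclk n L0 x k) \<in> borel_measurable seqM"
 "(%x. dfluct n L0 j1 j2 x k) \<in> borel_measurable seqM"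
 "(%x. mart n L0 x k) \<in> borel_measurable seqM"
 "(%x. fluct n L0 j1 j2 x k) \<in> borel_measurable seqM"
 "(%x. occ n L0 j1 j2 x k) \<in> borel_measurable seqM"
proof -
 show 1 [measurable]: "(%x. jmp n L0 x k) \<in> borel_measurable seqM" for k unfolding jmp_def by measurable
 show 2 [measurable]: "(%x. dclk n L0 x k) \<in> borel_measurable seqM" for k unfolding dclk_def shrink_def by measurable
 show 3 [measurable]: "(%x. dfluct n L0 j1 j2 x k) \<in> borel_measurable seqM" for k
  unfolding dfluct_def of_bool_def by measurable
 show "(%x. mart n L0 x k) \<in> borel_measurable seqM" unfolding mart_def by measurable
 show "(%x. fluct n L0 j1 j2 x k) \<in> borel_measurable seqM" unfolding fluct_def by measurable
 show "(%x. occ n L0 j1 j2 x k) \<in> borel_measurable seqM" unfolding occ_def by measurable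
qed

lemma nonanticipating_sum:
 assumes "!!i. i < k ==> nonanticipating (Suc i) (%x. f x i)"
 shows "nonanticipating k (%x. \<Sum>i<k. f x i)"
proof (rule naI)
 fix x y :: "nat => int \<times> real" assume xy: "\<forall>i<k. x i = y i"
 have "f x i = f y i" if "i < k" for i
  by (rule naD[OF assms[OF that]]) (use xy that in auto)
 then show "(\<Sum>i<k. f x i) = (\<Sum>i<k. f y i)" by simp
qed

lemma nonanticipating_jmp:
 "nonanticipating (Suc k) (%x. jmp n L0 x k)"
 "nonanticipating (Suc k) (%x. dclk n L0 x k)"
 "nonanticipating (Suc k) (%x. dfluct n L0 j1 j2 x k)"
proof -
 have p: "pos x k = pos y k" and l: "loc n L0 x k j = loc n L0 y k j" and xk: "x k = y k"
  if "\<forall>i<Suc k. x i = y i" for x y j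
  using naD[OF nonanticipating_pos[of k "Suc k"], of x y]
   naD[OF nonanticipating_loc[of k "Suc k" n L0 j], of x y] that by simp_all
 show j: "nonanticipating (Suc k) (%x. jmp n L0 x k)"
 proof (rule naI)
  fix x y :: "nat => int \<times> real" assume xy: "\<forall>i<Suc k. x i = y i"
  show "jmp n L0 x k = jmp n L0 y k" unfolding jmp_def p[OF xy] l[OF xy] xk[OF xy] ..
 qed
 show "nonanticipating (Suc k) (%x. dclk n L0 x k)"
 proof (rule naI)
  fix x y :: "nat => int \<times> real" assume xy: "\<forall>i<Suc k. x i = y i"
  show "dclk n L0 x k = dclk n L0 y k" unfolding dclk_def shrink_def p[OF xy] l[OF xy] xk[OF xy] ..
 qed
 show "nonanticipating (Suc k) (%x. dfluct n L0 j1 j2 x k)"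
 proof (rule naI)
  fix x y :: "nat => int \<times> real" assume xy: "\<forall>i<Suc k. x i = y i"
  show "dfluct n L0 j1 j2 x k = dfluct n L0 j1 j2 y k"
   unfolding dfluct_def naD[OF j xy] p[OF xy] l[OF xy] xk[OF xy] ..
 qed
qed

context vrjp begin

text \<open>Outside the window the increment vanishes; inside, \<open>step_exp_le\<close> applies
  with both directions selected, at an end point with the inward one. Jump sizes involve the
  neighbouring sites, hence the lower bound for \<open>L0\<close> on the window enlarged by one site
  on each side.\<close>

lemma supermart_fluct:
 assumes j: "j1 < j2" and c: "c > 0" "!!j. j1 - 1 <= j ==> j <= j2 + 1 ==> L0 (real_of_int j / 2 ^ n) >= c"
  and th: "\<bar>tht\<bar> <= 2 ^ n * c\<^sup>2"
 shows "supermart (%k x. exp (tht * fluct n L0 j1 j2 x k - tht\<^sup>2 * occ n L0 j1 j2 x k))"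
 unfolding supermart_def
proof (intro allI conjI impI)
 fix k
 let ?g = "%k x. exp (tht * fluct n L0 j1 j2 x k - tht\<^sup>2 * occ n L0 j1 j2 x k)"
 show "?g k \<in> borel_measurable seqM" by measurable
 have o: "nonanticipating (Suc i) (%x. if j1 <= pos x i & pos x i <= j2 then dclk n L0 x i else 0)" for i
 proof (rule naI)
  fix x y :: "nat => int \<times> real" assume xy: "\<forall>l<Suc i. x l = y l"
  show "(if j1 <= pos x i & pos x i <= j2 then dclk n L0 x i else 0) = (if j1 <= pos y i & pos y i <= j2 then dclk n L0 y i else 0)"
   unfolding naD[OF nonanticipating_jmp(2) xy] naD[OF nonanticipating_pos[OF le_SucI[OF order_refl]] xy] ..
 qed
 show "nonanticipating k (?g k)"
 proof (rule naI)
  fix x y :: "nat => int \<times> real" assume xy: "\<forall>l<k. x l = y l"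
  show "?g k x = ?g k y"
   unfolding fluct_def occ_def naD[OF nonanticipating_sum[OF o] xy]
    naD[OF nonanticipating_sum[OF nonanticipating_jmp(3)] xy] ..
 qed
 fix x :: "nat => int \<times> real" assume v: "\<forall>i<k. valid (x i)"
 show "0 <= ?g k x" by simp
 have F: "fluct n L0 j1 j2 (x(k := p)) (Suc k) = fluct n L0 j1 j2 x k + dfluct n L0 j1 j2 (x(k := p)) k" for p
  by (simp add: fluct_def shrink_dclk_upd)
 have O: "occ n L0 j1 j2 (x(k := p)) (Suc k) = occ n L0 j1 j2 x k + (if j1 <= pos x k & pos x k <= j2 then dclk n L0 (x(k := p)) k else 0)" for p
  by (simp add: occ_def shrink_dclk_upd cong: if_cong sum.cong) (intro sum.cong, auto simp: shrink_dclk_upd)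
 show "step n L0 k (%y. ennreal (?g (Suc k) y)) x <= ennreal (?g k x)"
 proof (cases "j1 <= pos x k & pos x k <= j2")
  case False
  have "step n L0 k (%y. ennreal (?g (Suc k) y)) x = step n L0 k (%y. ennreal (?g k x)) x"
   by (rule step_cong) (use False j in \<open>simp add: F O, auto simp: dfluct_def\<close>)
  also have "... = ennreal (?g k x)" by (rule step_const) (use v L0_pos in auto)
  finally show ?thesis by simp
 next
  case True
  define a :: "int => real" where "a sgm = of_bool ((j1 < pos x k & pos x k < j2) \<or> (pos x k = j1 & sgm = 1) \<or> (pos x k = j2 & sgm = -1))" for sgm
  show ?thesis
  proof (rule step_exp_le[where a=a and tht=tht])
   fix sgm :: int assume s: "sgm \<in> {1, -1}"
   have lc: "loc n L0 x k j >= c" if "j1 - 1 <= j" "j <= j2 + 1" for j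
    using c(2)[OF that] loc_pos(1)[where ?L0.0=L0 and k=k and x=x and n=n and j=j] L0_pos v by (auto simp: valid_def)
   have "c * c <= loc n L0 x k (pos x k) * loc n L0 x k (pos x k + sgm)"
    using s True c(1) lc[of "pos x k"] lc[of "pos x k + sgm"] by (intro mult_mono) auto
   then have "2 ^ n * c\<^sup>2 <= 2 ^ n * (loc n L0 x k (pos x k) * loc n L0 x k (pos x k + sgm))"
    by (simp add: power2_eq_square)
   then show "\<bar>tht\<bar> <= 2 ^ n * (loc n L0 x k (pos x k) * loc n L0 x k (pos x k + sgm))" using th by linarith
   fix s :: real assume "s > 0"
   have "dfluct n L0 j1 j2 (x(k := (sgm, s))) k = a sgm * jmp n L0 (x(k := (sgm, s))) k
    + (a (-1) - a 1) / 2 * ln ((loc n L0 x k (pos x k) + 2 ^ n * s) / loc n L0 x k (pos x k))"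
    using True j s by (auto simp: dfluct_def a_def)
   then show "ennreal (?g (Suc k) (x(k := (sgm, s)))) <= ennreal (?g k x * exp (tht * (a sgm * jmp n L0 (x(k := (sgm, s))) k
    + (a (-1) - a 1) / 2 * ln ((loc n L0 x k (pos x k) + 2 ^ n * s) / loc n L0 x k (pos x k))) - tht\<^sup>2 * dclk n L0 (x(k := (sgm, s))) k))"
    using True unfolding F O by (simp add: algebra_simps flip: exp_add)
  qed (use L0_pos v in \<open>auto simp: a_def\<close>)
 qed
qed

text \<open>The maximal inequality is used once for each sign. The random compensator
  \<open>occ\<close> is replaced by the deterministic bound \<open>clk_sum\<close>, so the estimate
  covers all times simultaneously.\<close>

lemma prob_fluct_ge:
 assumes j: "j1 < j2" and c: "c > 0" "!!j. j1 - 1 <= j ==> j <= j2 + 1 ==> L0 (real_of_int j / 2 ^ n) >= c"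
  and th: "0 <= tht" "tht <= 2 ^ n * c\<^sup>2"
 shows "prob {om \<in> space M. \<exists>k. \<bar>fluct n L0 j1 j2 (X om) k\<bar> > w}
  <= 2 * exp (- tht * w + tht\<^sup>2 * ((scl0 n L0 (j2 + 1) - scl0 n L0 (j1 - 1)) / 2))"
proof -
 let ?D = "(scl0 n L0 (j2 + 1) - scl0 n L0 (j1 - 1)) / 2"
 have one: "prob {om \<in> space M. \<exists>k. s * fluct n L0 j1 j2 (X om) k > w} <= exp (- tht * w + tht\<^sup>2 * ?D)" if s: "s = 1 \<or> s = -1" for s :: real
 proof -
  let ?g = "%k x. exp ((s * tht) * fluct n L0 j1 j2 x k - (s * tht)\<^sup>2 * occ n L0 j1 j2 x k)"
  have sm: "supermart ?g"
   using s th by (intro supermart_fluct[OF j c]) auto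
  note supermartD(1)[OF sm, measurable]
  have "prob {om \<in> space M. \<exists>k. s * fluct n L0 j1 j2 (X om) k > w} <= prob {om \<in> space M. \<exists>k. ?g k (X om) >= exp (tht * w - tht\<^sup>2 * ?D)}"
  proof (rule finite_measure_mono_AE)
   show "AE om in M. om \<in> {om \<in> space M. \<exists>k. s * fluct n L0 j1 j2 (X om) k > w} --> om \<in> {om \<in> space M. \<exists>k. ?g k (X om) >= exp (tht * w - tht\<^sup>2 * ?D)}"
    using AE_valid
   proof eventually_elim
    case (elim om)
    interpret T: traj n L0 "X om" by standard (use L0_pos elim in auto)
    have "exp (tht * w - tht\<^sup>2 * ?D) <= ?g k (X om)" if "s * fluct n L0 j1 j2 (X om) k > w" for k
    proof -
     have "tht * w <= tht * (s * fluct n L0 j1 j2 (X om) k)" using that th by (intro mult_left_mono) auto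
     moreover have "tht\<^sup>2 * occ n L0 j1 j2 (X om) k <= tht\<^sup>2 * ?D"
      using T.clk_sum[of j1 j2 k] j by (intro mult_left_mono) (auto simp: occ_def)
     moreover have "(s * tht)\<^sup>2 = tht\<^sup>2" using s by auto
     ultimately show ?thesis unfolding exp_le_cancel_iff by (simp only: mult.assoc mult.left_commute[of s tht])
    qed
    then show ?case by auto
   qed
  qed measurable
  also have "... <= ?g 0 (%_. (1, 1)) / exp (tht * w - tht\<^sup>2 * ?D)" by (rule supermart_ville[OF sm]) simp
  also have "... = exp (- tht * w + tht\<^sup>2 * ?D)" by (simp add: fluct_def occ_def exp_minus[symmetric] inverse_eq_divide[symmetric])
  finally show ?thesis .
 qed
 have abs: "\<bar>a\<bar> > w \<longleftrightarrow> 1 * a > w \<or> -1 * a > w" for a :: real by linarith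
 have "{om \<in> space M. \<exists>k. \<bar>fluct n L0 j1 j2 (X om) k\<bar> > w} =
  {om \<in> space M. \<exists>k. 1 * fluct n L0 j1 j2 (X om) k > w} \<union> {om \<in> space M. \<exists>k. -1 * fluct n L0 j1 j2 (X om) k > w}"
  unfolding abs by blast
 then have "prob {om \<in> space M. \<exists>k. \<bar>fluct n L0 j1 j2 (X om) k\<bar> > w} <=
  prob {om \<in> space M. \<exists>k. 1 * fluct n L0 j1 j2 (X om) k > w} + prob {om \<in> space M. \<exists>k. -1 * fluct n L0 j1 j2 (X om) k > w}"
  by (simp only:) (rule measure_Un_le; measurable)
 then show ?thesis using one[of 1] one[of "-1"] by simp
qed

end

section \<open>Dyadic modulus of continuity of the log local times\<close>

lemma scl0_diff_le:
 assumes c: "c > 0" "!!j. a <= j ==> j <= b ==> L0 (real_of_int j / 2 ^ n) >= c" and "a <= b"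
 shows "scl0 n L0 b - scl0 n L0 a <= real_of_int (b - a) / 2 ^ n / c\<^sup>2"
 using \<open>a <= b\<close> c(2)
proof (induction b rule: int_ge_induct)
 case base
 then show ?case by simp
next
 case (step b)
 have cb: "c <= L0 (real_of_int b / 2 ^ n)" "c <= L0 (real_of_int (b + 1) / 2 ^ n)"
  using step.prems[of b] step.prems[of "b + 1"] step.hyps by auto
 then have "c * c <= L0 (real_of_int b / 2 ^ n) * L0 (real_of_int (b + 1) / 2 ^ n)"
  using c(1) by (intro mult_mono) auto
 then have "edge0 n L0 b <= 1 / (2 ^ n * c\<^sup>2)"
  unfolding edge0_def using c(1) cb by (intro divide_left_mono) (auto simp: power2_eq_square intro!: mult_pos_pos)
 moreover have "real_of_int (b + 1 - a) / 2 ^ n / c\<^sup>2 = real_of_int (b - a) / 2 ^ n / c\<^sup>2 + 1 / (2 ^ n * c\<^sup>2)"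
  by (simp add: add_divide_distrib diff_divide_distrib)
 moreover have "scl0 n L0 b - scl0 n L0 a <= real_of_int (b - a) / 2 ^ n / c\<^sup>2" using step by simp
 ultimately show ?case unfolding scl0_Suc by linarith
qed

text \<open>For a dyadic interval of length 1/2^l the clock spent there is of order 1/2^l, so 1 /
  sqrt 2 ^ l is the natural size of the fluctuation. The factor \<open>l + 1\<close> pays for the
  number of intervals of level \<open>l\<close> in the window of radius \<open>r\<close>.\<close>

definition modulus_ok :: "nat => (real => real) => real => nat => (nat => int \<times> real) => bool" where
 "modulus_ok n L0 A r x \<longleftrightarrow> (\<forall>l\<le>n. \<forall>q\<in>{- int r * 2 ^ l..<int r * 2 ^ l}.
  \<not> (\<exists>k. \<bar>fluct n L0 (q * 2 ^ (n - l)) ((q + 1) * 2 ^ (n - l)) x k\<bar> > A * real (l + 1) / sqrt 2 ^ l))"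

lemma measurable_modulus_ok [measurable]: "Measurable.pred seqM (modulus_ok n L0 A r)"
 unfolding modulus_ok_def[abs_def] by measurable

lemma L0_lower_bound:
 assumes "continuous_on UNIV L0" "!!y. (L0::real => real) y > 0"
 shows "\<exists>c>0. \<forall>y. \<bar>y\<bar> <= R --> L0 y >= c"
proof (cases "R >= 0")
 case True
 then have "\<exists>z\<in>{-R..R}. \<forall>y\<in>{-R..R}. L0 z <= L0 y"
  by (intro continuous_attains_inf) (auto intro: continuous_on_subset[OF assms(1)])
 then obtain z where "!!y. y \<in> {-R..R} ==> L0 z <= L0 y" by blast
 then show ?thesis using assms(2)[of z] by (intro exI[of _ "L0 z"]) (auto simp: abs_le_iff)
qed (auto intro: exI[of _ 1])

text \<open>Union bound over all dyadic intervals. The exponential tail at level \<open>l\<close> is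
  a power \<open>l + 1\<close> of the small number \<open>y\<close>, which beats the 2 r 2^l
  intervals of that level; \<open>A\<close> does not depend on \<open>n\<close> or on the
  probability space.\<close>

lemma prob_modulus_ok:
 assumes L0: "continuous_on UNIV L0" "!!y. (L0::real => real) y > 0" and p: "p > 0"
 shows "\<exists>A>0. \<forall>n M dir H. vrjp n L0 (M::'a measure) dir H -->
  measure M {om \<in> space M. \<not> modulus_ok n L0 A r (vrjp.X dir H om)} <= p"
proof -
 obtain c where c: "c > 0" "!!y. \<bar>y\<bar> <= real r + 1 ==> L0 y >= c"
  using L0_lower_bound[OF L0, of "real r + 1"] by auto
 \<comment> \<open>The bound by c squared makes the parameter \<open>tht\<close> admissible, the
   bound by \<open>c\<close> keeps the quadratic term bounded.\<close>
 define \<beta> where "\<beta> = min c (c\<^sup>2)"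
 have \<beta>: "\<beta> > 0" "\<beta> <= c" "\<beta> <= c\<^sup>2" using c by (auto simp: \<beta>_def)
 \<comment> \<open>The value 1/4 makes the sum over levels geometric with ratio at most 1/2; the
   other entry brings the total, 8 r exp(2) y, below \<open>p\<close>.\<close>
 define y where "y = min (1/4) (p / (8 * real r * exp 2 + 1))"
 have pos: "8 * real r * exp 2 + 1 > 0" by (simp add: add_nonneg_pos)
 have y: "y > 0" "y <= 1/4" "8 * real r * exp 2 * y <= p"
 proof -
  show "y > 0" "y <= 1/4" using p pos by (simp_all only: y_def min.cobounded1) (simp add: min_def)
  have "8 * real r * exp 2 * y <= (8 * real r * exp 2 + 1) * (p / (8 * real r * exp 2 + 1))"
   using p pos by (intro mult_mono) (auto simp: y_def)
  then show "8 * real r * exp 2 * y <= p" using pos by simp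
 qed
 define A where "A = - ln y / \<beta>"
 have A: "A > 0" "exp (- \<beta> * A) = y" using y \<beta> by (auto simp: A_def divide_neg_pos)
 show ?thesis
 proof (intro exI[of _ A] conjI allI impI A)
  fix n and M :: "'a measure" and dir H assume "vrjp n L0 M dir H"
  then interpret vrjp n L0 M dir H .
  define Z where "Z l q = {om \<in> space M. \<exists>k. \<bar>fluct n L0 (q * 2 ^ (n - l)) ((q + 1) * 2 ^ (n - l)) (X om) k\<bar> > A * real (l + 1) / sqrt 2 ^ l}" for l and q :: int
  have [measurable]: "Z l q \<in> sets M" for l q unfolding Z_def by measurable
  define Q where "Q l = {- int r * 2 ^ l..<int r * 2 ^ l}" for l :: nat
  have Zp: "prob (Z l q) <= 2 * exp 2 * y ^ (l + 1)" if l: "l <= n" and q: "q \<in> Q l" for l q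
  proof -
   define j1 where "j1 = q * 2 ^ (n - l)" define j2 where "j2 = (q + 1) * 2 ^ (n - l)"
   have pw: "(2::int) ^ n = 2 ^ l * 2 ^ (n - l)" using l by (simp flip: power_add)
   have j12: "- int r * 2 ^ n <= j1" "j2 <= int r * 2 ^ n" "j1 < j2"
   proof -
    have "(- int r * 2 ^ l) * 2 ^ (n - l) <= q * 2 ^ (n - l)" using q by (intro mult_right_mono) (auto simp: Q_def)
    then show "- int r * 2 ^ n <= j1" by (simp add: j1_def pw algebra_simps)
    have "(q + 1) * 2 ^ (n - l) <= (int r * 2 ^ l) * 2 ^ (n - l)" using q by (intro mult_right_mono) (auto simp: Q_def)
    then show "j2 <= int r * 2 ^ n" by (simp add: j2_def pw algebra_simps)
    show "j1 < j2" by (simp add: j1_def j2_def)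
   qed
   have cj: "L0 (real_of_int j / 2 ^ n) >= c" if "j1 - 1 <= j" "j <= j2 + 1" for j
   proof (rule c(2))
    have "- int r * 2 ^ n - 1 <= j" "j <= int r * 2 ^ n + 1" using that j12 by auto
    then have "- real r * 2 ^ n - 1 <= real_of_int j" "real_of_int j <= real r * 2 ^ n + 1"
     by (auto simp flip: of_int_le_iff[where ?'a=real])
    moreover have "(1::real) <= 2 ^ n" by simp
    ultimately have "\<bar>real_of_int j\<bar> <= (real r + 1) * 2 ^ n" unfolding distrib_right mult_1 by linarith
    then show "\<bar>real_of_int j / 2 ^ n\<bar> <= real r + 1" by (simp add: abs_divide divide_le_eq)
   qed
   \<comment> \<open>With this choice \<open>tht\<close> times the threshold is linear in
     \<open>l + 1\<close>, while \<open>tht\<close> squared times the clock stays below 2.\<close>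
   define tht where "tht = \<beta> * sqrt 2 ^ l"
   have s2: "(sqrt 2 ^ l)\<^sup>2 = (2::real) ^ l" by (simp add: power2_eq_square flip: power_mult_distrib)
   have th: "0 <= tht" "tht <= 2 ^ n * c\<^sup>2"
   proof -
    have "sqrt 2 ^ l <= (2::real) ^ l" by (intro power_mono) (auto intro: real_le_lsqrt)
    also have "... <= 2 ^ n" using l by simp
    finally show "tht <= 2 ^ n * c\<^sup>2" unfolding tht_def using \<beta> by (subst mult.commute) (intro mult_mono, auto)
    show "0 <= tht" using \<beta> by (simp add: tht_def)
   qed
   have D: "scl0 n L0 (j2 + 1) - scl0 n L0 (j1 - 1) <= 3 / (2 ^ l * c\<^sup>2)"
   proof -
    have "scl0 n L0 (j2 + 1) - scl0 n L0 (j1 - 1) <= real_of_int (j2 + 1 - (j1 - 1)) / 2 ^ n / c\<^sup>2"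
     by (rule scl0_diff_le) (use c(1) cj j12 in auto)
    \<comment> \<open>The extra 2 comes from the enlarged window. Even for l = n it is absorbed by
      the factor 3.\<close>
    also have "real_of_int (j2 + 1 - (j1 - 1)) = 2 ^ (n - l) + 2" by (simp add: j1_def j2_def algebra_simps)
    also have "(2 ^ (n - l) + 2) / 2 ^ n <= (3::real) / 2 ^ l"
    proof -
     have "(2::real) ^ n = 2 ^ l * 2 ^ (n - l)" using l by (simp flip: power_add)
     moreover have "(2::real) ^ (n - l) + 2 <= 3 * 2 ^ (n - l)" using one_le_power[of "2::real" "n - l"] by linarith
     ultimately show ?thesis by (simp add: divide_le_eq field_simps)
    qed
    finally show ?thesis using c(1) by (simp add: divide_right_mono field_simps)
   qed
   have "prob (Z l q) <= 2 * exp (- tht * (A * real (l + 1) / sqrt 2 ^ l) + tht\<^sup>2 * ((scl0 n L0 (j2 + 1) - scl0 n L0 (j1 - 1)) / 2))"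
    unfolding Z_def j1_def[symmetric] j2_def[symmetric] by (rule prob_fluct_ge[OF j12(3) c(1) cj th])
   also have "... <= 2 * exp (- \<beta> * A * real (l + 1) + 2)"
   proof -
    have "tht * (A * real (l + 1) / sqrt 2 ^ l) = \<beta> * A * real (l + 1)" by (simp add: tht_def)
    moreover have "tht\<^sup>2 * ((scl0 n L0 (j2 + 1) - scl0 n L0 (j1 - 1)) / 2) <= tht\<^sup>2 * (3 / (2 ^ l * c\<^sup>2) / 2)"
     using D by (intro mult_left_mono divide_right_mono) auto
    moreover have "tht\<^sup>2 * (3 / (2 ^ l * c\<^sup>2) / 2) = 3 / 2 * (\<beta>\<^sup>2 / c\<^sup>2)"
     by (simp add: tht_def power_mult_distrib s2)
    moreover have "\<beta>\<^sup>2 / c\<^sup>2 <= 1" using \<beta> c(1) by (simp add: divide_le_eq power_mono)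
    ultimately have "- tht * (A * real (l + 1) / sqrt 2 ^ l) + tht\<^sup>2 * ((scl0 n L0 (j2 + 1) - scl0 n L0 (j1 - 1)) / 2) <= - \<beta> * A * real (l + 1) + 2"
     unfolding minus_mult_left[symmetric] by linarith
    then show ?thesis unfolding mult_le_cancel_left_pos[OF zero_less_numeral] exp_le_cancel_iff .
   qed
   also have "... = 2 * exp 2 * y ^ (l + 1)"
   proof -
    have "y ^ (l + 1) = exp (real (l + 1) * (- \<beta> * A))" unfolding A(2)[symmetric] by (rule exp_of_nat_mult[symmetric])
    then show ?thesis by (simp add: exp_add[symmetric] algebra_simps)
   qed
   finally show ?thesis .
  qed
  have "{om \<in> space M. \<not> modulus_ok n L0 A r (X om)} = (\<Union>l\<in>{..n}. \<Union>q\<in>Q l. Z l q)"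
   by (auto simp: modulus_ok_def Z_def Q_def)
  also have "prob ... <= (\<Sum>l\<in>{..n}. prob (\<Union>q\<in>Q l. Z l q))"
   by (rule measure_UNION_le) (auto simp: Q_def)
  also have "... <= (\<Sum>l\<in>{..n}. \<Sum>q\<in>Q l. prob (Z l q))"
   by (intro sum_mono measure_UNION_le) (auto simp: Q_def)
  also have "... <= (\<Sum>l\<in>{..n}. \<Sum>q\<in>Q l. 2 * exp 2 * y ^ (l + 1))"
   using Zp by (intro sum_mono) auto
  also have "... = (\<Sum>l\<in>{..n}. 4 * real r * exp 2 * y * (2 * y) ^ l)"
   by (intro sum.cong refl) (simp add: Q_def power_mult_distrib)
  also have "... <= (\<Sum>l\<in>{..n}. 4 * real r * exp 2 * y * (1 / 2) ^ l)"
   using y by (intro sum_mono mult_left_mono power_mono) auto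
  also have "... = 4 * real r * exp 2 * y * (\<Sum>l\<in>{..n}. (1 / 2) ^ l)" by (simp add: sum_distrib_left)
  also have "... <= 4 * real r * exp 2 * y * 2"
  proof (intro mult_left_mono)
   show "(\<Sum>l\<in>{..n}. (1 / 2) ^ l) <= (2::real)"
    using sum_gp0[of "1/2::real" n] by simp
  qed (use y in auto)
  also have "... <= p" using y(3) by simp
  finally show "measure M {om \<in> space M. \<not> modulus_ok n L0 A r (X om)} <= p" .
 qed
qed


text \<open>The bound of \<open>rho_diff_le\<close> on a dyadic interval of length 1/2^l on which
  the fluctuation is under control and \<open>L0\<close> is at least \<open>c\<close>.\<close>

definition level_bound :: "real => real => nat => real" where
 "level_bound A c l = 2 * (A * real (l + 1) / sqrt 2 ^ l) + 4 * (1 / 2 ^ l / c\<^sup>2)"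

text \<open>Twice the tail from level \<open>m\<close> on: one chain for each of the two sites, and
  the coarse step between them at level \<open>m\<close>.\<close>

definition modulus :: "real => real => nat => real" where
 "modulus A c m = 2 * (\<Sum>l. level_bound A c (l + m))"

text \<open>The part with \<open>l + 1\<close> over a power of sqrt 2 is a termwise differentiated
  geometric series.\<close>

lemma summable_level_bound: "summable (level_bound A c)"
proof -
 have s2: "norm (1 / sqrt 2) < 1" by simp
 have "summable (%l. real (Suc l) * (1 / sqrt 2) ^ l)"
  using termdiff_converges[of "1 / sqrt 2" 1 "%_. 1"] summable_geometric[where ?'a=real]
  by (simp add: diffs_def)
 then have "summable (%l. (2 * A) * (real (Suc l) * (1 / sqrt 2) ^ l) + (4 / c\<^sup>2) * (1 / 2) ^ l)"
  by (intro summable_add summable_mult summable_geometric) auto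
 moreover have "(%l. (2 * A) * (real (Suc l) * (1 / sqrt 2) ^ l) + (4 / c\<^sup>2) * (1 / 2) ^ l) = level_bound A c"
  by (auto simp: level_bound_def fun_eq_iff power_divide mult.assoc mult.commute)
 ultimately show ?thesis by simp
qed

lemma modulus_tendsto: "modulus A c \<longlonglongrightarrow> 0"
 unfolding modulus_def using tendsto_mult_right_zero[OF suminf_exist_split2[OF summable_level_bound]] .

lemma level_bound_nonneg: "A >= 0 ==> level_bound A c l >= 0"
 by (simp add: level_bound_def)

context traj begin

lemma rho_level:
 assumes ok: "modulus_ok n L0 A r x" and c: "c > 0" "!!y. \<bar>y\<bar> <= real r ==> L0 y >= c"
  and l: "l <= n" and q: "- int r * 2 ^ l <= q" "q < int r * 2 ^ l"
 shows "\<bar>rho k ((q + 1) * 2 ^ (n - l)) - rho k (q * 2 ^ (n - l))\<bar> <= level_bound A c l"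
proof -
 define j1 where "j1 = q * 2 ^ (n - l)" define j2 where "j2 = (q + 1) * 2 ^ (n - l)"
 have pw: "(2::int) ^ n = 2 ^ l * 2 ^ (n - l)" using l by (simp flip: power_add)
 have j12: "- int r * 2 ^ n <= j1" "j2 <= int r * 2 ^ n" "j1 < j2"
 proof -
  have "(- int r * 2 ^ l) * 2 ^ (n - l) <= q * 2 ^ (n - l)" using q by (intro mult_right_mono) auto
  then show "- int r * 2 ^ n <= j1" by (simp add: j1_def pw algebra_simps)
  have "(q + 1) * 2 ^ (n - l) <= (int r * 2 ^ l) * 2 ^ (n - l)" using q by (intro mult_right_mono) auto
  then show "j2 <= int r * 2 ^ n" by (simp add: j2_def pw algebra_simps)
  show "j1 < j2" by (simp add: j1_def j2_def)
 qed
 have "scl0 n L0 j2 - scl0 n L0 j1 <= real_of_int (j2 - j1) / 2 ^ n / c\<^sup>2"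
 proof (rule scl0_diff_le)
  fix j assume "j1 <= j" "j <= j2"
  then have "- int r * 2 ^ n <= j" "j <= int r * 2 ^ n" using j12 by auto
  then have "- real r * 2 ^ n <= real_of_int j" "real_of_int j <= real r * 2 ^ n"
   by (auto simp flip: of_int_le_iff[where ?'a=real])
  then show "c <= L0 (real_of_int j / 2 ^ n)" by (intro c(2)) (simp add: abs_divide divide_le_eq abs_le_iff)
 qed (use c j12 in auto)
 also have "real_of_int (j2 - j1) / 2 ^ n = 1 / 2 ^ l"
 proof -
  have "(2::real) ^ n = 2 ^ l * 2 ^ (n - l)" using l by (simp flip: power_add)
  then show ?thesis by (simp add: j1_def j2_def algebra_simps)
 qed
 finally have "scl0 n L0 j2 - scl0 n L0 j1 <= 1 / 2 ^ l / c\<^sup>2" .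
 moreover have "\<bar>fluct n L0 j1 j2 x k\<bar> <= A * real (l + 1) / sqrt 2 ^ l"
  using ok l q unfolding modulus_ok_def j1_def j2_def by (auto simp: not_less)
 ultimately show ?thesis
  unfolding level_bound_def j1_def[symmetric] j2_def[symmetric]
  by (intro order_trans[OF rho_diff_le[OF j12(3), of k]] add_mono mult_left_mono) auto
qed

text \<open>Chaining: rounding down to multiples of the next power of two either changes nothing or
  crosses one dyadic interval, so each level is paid at most once.\<close>

lemma rho_floor:
 assumes ok: "modulus_ok n L0 A r x" and c: "c > 0" "!!y. \<bar>y\<bar> <= real r ==> L0 y >= c" and A: "A >= 0"
  and i: "- int r * 2 ^ n <= i" "i <= int r * 2 ^ n" and d: "d <= n"
 shows "\<bar>rho k i - rho k ((i div 2 ^ d) * 2 ^ d)\<bar> <= (\<Sum>l\<in>{n - d<..n}. level_bound A c l)"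
 using d
proof (induction d)
 case 0
 then show ?case by simp
next
 case (Suc d)
 define q where "q = i div 2 ^ d"
 let ?l = "n - d"
 have pw: "(2::int) ^ n = 2 ^ ?l * 2 ^ d" using Suc.prems by (simp flip: power_add)
 have q: "- int r * 2 ^ ?l <= q" "q <= int r * 2 ^ ?l"
 proof -
  have "(- int r * 2 ^ ?l) * 2 ^ d <= i" using i pw by (simp add: algebra_simps)
  then have "((- int r * 2 ^ ?l) * 2 ^ d) div 2 ^ d <= q" unfolding q_def by (intro zdiv_mono1) auto
  then show "- int r * 2 ^ ?l <= q" by (subst (asm) nonzero_mult_div_cancel_right) auto
  have "i <= (int r * 2 ^ ?l) * 2 ^ d" using i pw by (simp add: algebra_simps)
  then have "q <= ((int r * 2 ^ ?l) * 2 ^ d) div 2 ^ d" unfolding q_def by (intro zdiv_mono1) auto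
  then show "q <= int r * 2 ^ ?l" by simp
 qed
 have i2: "i div 2 ^ Suc d = q div 2" unfolding q_def power_Suc2 by (simp add: zdiv_zmult2_eq)
 have set: "{n - Suc d<..n} = insert ?l {?l<..n}" using Suc.prems by auto
 have "\<bar>rho k (q * 2 ^ d) - rho k ((q div 2) * 2 ^ Suc d)\<bar> <= level_bound A c ?l"
 proof (cases "even q")
  case True
  then have e: "(q div 2) * 2 ^ Suc d = q * 2 ^ d" by auto
  show ?thesis unfolding e using level_bound_nonneg[OF A] by simp
 next
  case False
  define t where "t = q div 2"
  have "q = 2 * t + 1" unfolding t_def using odd_two_times_div_two_succ[OF False] by simp
  then have e: "(q div 2) * 2 ^ Suc d = (q - 1) * 2 ^ d" unfolding t_def[symmetric] by simp
  \<comment> \<open>The left end of the range is even here, so an odd \<open>q\<close> still has its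
    left neighbour in the range.\<close>
  have "q ~= - int r * 2 ^ ?l"
  proof
   assume "q = - int r * 2 ^ ?l"
   moreover have "even ((2::int) ^ ?l)" using Suc.prems by simp
   ultimately show False using False by simp
  qed
  then have "\<bar>rho k ((q - 1 + 1) * 2 ^ (n - ?l)) - rho k ((q - 1) * 2 ^ (n - ?l))\<bar> <= level_bound A c ?l"
   using q by (intro rho_level[OF ok c]) auto
  then show ?thesis unfolding e using Suc.prems by simp
 qed
 moreover have "\<bar>rho k i - rho k (q * 2 ^ d)\<bar> <= (\<Sum>l\<in>{?l<..n}. level_bound A c l)"
  using Suc unfolding q_def by simp
 ultimately show ?case unfolding set i2 by (subst sum.insert) auto
qed

text \<open>Two sites at distance at most 2^(n - m) round down to equal or adjacent multiples of
  that power; two chains and at most one interval of level \<open>m\<close> connect them.\<close>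

lemma rho_modulus:
 assumes ok: "modulus_ok n L0 A r x" and c: "c > 0" "!!y. \<bar>y\<bar> <= real r ==> L0 y >= c" and A: "A >= 0"
  and ij: "- int r * 2 ^ n <= i" "i <= j" "j <= int r * 2 ^ n" "j - i <= 2 ^ (n - m)" and m: "m <= n"
 shows "\<bar>rho k j - rho k i\<bar> <= modulus A c m"
proof -
 let ?D = "(2::int) ^ (n - m)"
 have pw: "(2::int) ^ n = 2 ^ m * ?D" using m by (simp flip: power_add)
 have le: "i div ?D <= j div ?D" "j div ?D <= i div ?D + 1"
 proof -
  show "i div ?D <= j div ?D" using ij by (intro zdiv_mono1) auto
  have "j div ?D <= (i + ?D) div ?D" using ij by (intro zdiv_mono1) auto
  then show "j div ?D <= i div ?D + 1" by simp
 qed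
 have "\<bar>rho k (j div ?D * ?D) - rho k (i div ?D * ?D)\<bar> <= level_bound A c m"
 proof (cases "j div ?D = i div ?D")
  case True
  then show ?thesis using level_bound_nonneg[OF A] by simp
 next
  case False
  then have e: "j div ?D = i div ?D + 1" using le by auto
  have "(- int r * 2 ^ m) * ?D <= i" using ij pw by (simp add: algebra_simps)
  then have "((- int r * 2 ^ m) * ?D) div ?D <= i div ?D" by (intro zdiv_mono1) auto
  then have "- int r * 2 ^ m <= i div ?D" by (subst (asm) nonzero_mult_div_cancel_right) auto
  moreover have "j <= (int r * 2 ^ m) * ?D" using ij pw by (simp add: algebra_simps)
  then have "j div ?D <= ((int r * 2 ^ m) * ?D) div ?D" by (intro zdiv_mono1) auto
  ultimately show ?thesis unfolding e using rho_level[OF ok c m, of "i div ?D" k] e by simp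
 qed
 moreover have "\<bar>rho k i - rho k (i div ?D * ?D)\<bar> <= (\<Sum>l\<in>{n - (n - m)<..n}. level_bound A c l)"
  by (rule rho_floor[OF ok c A]) (use ij in auto)
 moreover have "\<bar>rho k j - rho k (j div ?D * ?D)\<bar> <= (\<Sum>l\<in>{n - (n - m)<..n}. level_bound A c l)"
  by (rule rho_floor[OF ok c A]) (use ij in auto)
 moreover have "level_bound A c m + 2 * (\<Sum>l\<in>{n - (n - m)<..n}. level_bound A c l) <= modulus A c m"
 proof -
  have "(\<Sum>l\<in>{m..n}. level_bound A c l) = (\<Sum>l\<in>{..n - m}. level_bound A c (l + m))"
   by (rule sum.reindex_bij_witness[of _ "%l. l + m" "%l. l - m"]) (use m in auto)
  also have "... <= (\<Sum>l. level_bound A c (l + m))"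
   by (rule sum_le_suminf) (use summable_level_bound level_bound_nonneg[OF A] in \<open>auto simp: summable_iff_shift\<close>)
  finally have "2 * (\<Sum>l\<in>{m..n}. level_bound A c l) <= modulus A c m" by (simp add: modulus_def)
  moreover have "{m..n} = insert m {m<..n}" using m by auto
  ultimately show ?thesis using m level_bound_nonneg[OF A, of c m] by simp
 qed
 ultimately show ?thesis by linarith
qed

end

section \<open>Continuation of martingale and clock beyond the window\<close>

definition alive :: "nat => nat => nat => (nat => int \<times> real) => nat => bool" where
 "alive n s km x k \<longleftrightarrow> (\<forall>i\<le>k. \<bar>pos x i\<bar> <= int s * 2 ^ n) & (\<Sum>i<k. snd (x i)) <= real s & k < km"

text \<open>Total rate times holding time is a standard exponential variable, independent of the
  past, and exceeds ln 2 with probability 1/2. It serves as a fair coin, so the continuation needs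
  no extra randomness.\<close>

definition dW :: "nat => (real => real) => nat => nat => real => (nat => int \<times> real) => nat => real" where
 "dW n L0 s km e x k = (if alive n s km x k then jmp n L0 x k
  else if trate n L0 x k * snd (x k) > ln 2 then e else - e)"

text \<open>The square of \<open>e\<close> is the variance of a coin step, so the clock remains the
  bracket after the walk has left the window.\<close>

definition du :: "nat => (real => real) => nat => nat => real => (nat => int \<times> real) => nat => real" where
 "du n L0 s km e x k = (if alive n s km x k then dclk n L0 x k else e\<^sup>2)"

definition Wk :: "nat => (real => real) => nat => nat => real => (nat => int \<times> real) => nat => real" where
 "Wk n L0 s km e x k = (\<Sum>i<k. dW n L0 s km e x i)"

definition uk :: "nat => (real => real) => nat => nat => real => (nat => int \<times> real) => nat => real" where
 "uk n L0 s km e x k = (\<Sum>i<k. du n L0 s km e x i)"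

lemma measurable_alive [measurable]: "Measurable.pred seqM (%x. alive n s km x k)"
proof -
 have [measurable]: "Measurable.pred seqM (%x. \<bar>pos x i\<bar> <= C)" for i C
  using measurable_compose[OF measurable_pos, of "%j. \<bar>j\<bar> <= C" "count_space UNIV" i] by simp
 show ?thesis unfolding alive_def by measurable
qed

lemma measurable_dW [measurable]:
 "(%x. dW n L0 s km e x k) \<in> borel_measurable seqM"
 "(%x. du n L0 s km e x k) \<in> borel_measurable seqM"
 "(%x. Wk n L0 s km e x k) \<in> borel_measurable seqM"
 "(%x. uk n L0 s km e x k) \<in> borel_measurable seqM"
 unfolding dW_def du_def Wk_def uk_def by measurable

lemma nonanticipating_alive: "nonanticipating k (%x. alive n s km x k)"
proof (rule naI)
 fix x y :: "nat => int \<times> real" assume xy: "\<forall>i<k. x i = y i"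
 have "pos x i = pos y i" if "i <= k" for i using naD[OF nonanticipating_pos[OF that] xy] .
 then show "alive n s km x k = alive n s km y k" using xy by (simp add: alive_def)
qed

lemma nonanticipating_dW:
 "nonanticipating (Suc k) (%x. dW n L0 s km e x k)"
 "nonanticipating (Suc k) (%x. du n L0 s km e x k)"
proof -
 have a: "alive n s km x k = alive n s km y k" and t: "trate n L0 x k = trate n L0 y k"
  if "\<forall>i<Suc k. x i = y i" for x y
  using naD[OF nonanticipating_alive, of k x y] naD[OF nonanticipating_rate(2), of k x y] that by auto
 show "nonanticipating (Suc k) (%x. dW n L0 s km e x k)"
 proof (rule naI)
  fix x y :: "nat => int \<times> real" assume xy: "\<forall>i<Suc k. x i = y i"
  then have "x k = y k" by simp
  then show "dW n L0 s km e x k = dW n L0 s km e y k" unfolding dW_def a[OF xy] t[OF xy] naD[OF nonanticipating_jmp(1) xy] by simp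
 qed
 show "nonanticipating (Suc k) (%x. du n L0 s km e x k)"
 proof (rule naI)
  fix x y :: "nat => int \<times> real" assume xy: "\<forall>i<Suc k. x i = y i"
  show "du n L0 s km e x k = du n L0 s km e y k" unfolding du_def a[OF xy] naD[OF nonanticipating_jmp(2) xy] ..
 qed
qed

lemma nonanticipating_uk:
 "l <= k ==> nonanticipating k (%x. uk n L0 s km e x l)" "l <= k ==> nonanticipating k (%x. Wk n L0 s km e x l)"
 unfolding uk_def Wk_def
 by (rule nonanticipating_mono[OF nonanticipating_sum[OF nonanticipating_dW(2)]], assumption)
  (rule nonanticipating_mono[OF nonanticipating_sum[OF nonanticipating_dW(1)]], assumption)

lemma upd_eq: "nonanticipating k f ==> f (x(k := p)) = f x"
 by (rule naD) auto

lemma nn_integral_exp_tail: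
 assumes "r > (0::real)"
 shows "(\<integral>\<^sup>+ s. indicator {a<..} s * ennreal (r * exp (- r * s)) \<partial>lborel) = ennreal (exp (- r * a))"
proof -
 have "(\<integral>\<^sup>+ s. ennreal (r * exp (- r * s)) * indicator {a..} s \<partial>lborel) = 0 - (- exp (- r * a))"
 proof (rule nn_integral_FTC_atLeast)
  show "((%s. - exp (- r * s)) \<longlongrightarrow> 0) at_top"
  proof -
   have "filterlim (%s. - (r * s)) at_bot at_top"
    using assms by (intro filterlim_uminus_at_top[THEN iffD1] filterlim_tendsto_pos_mult_at_top[OF tendsto_const]) (auto simp: filterlim_ident)
   then show ?thesis
    using tendsto_minus[OF filterlim_compose[OF exp_at_bot]] by fastforce
  qed
 qed (use assms in \<open>auto intro!: derivative_eq_intros\<close>)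
 moreover have "(\<integral>\<^sup>+ s. indicator {a<..} s * ennreal (r * exp (- r * s)) \<partial>lborel)
  = (\<integral>\<^sup>+ s. ennreal (r * exp (- r * s)) * indicator {a..} s \<partial>lborel)"
  by (intro nn_integral_cong_AE AE_I[where N="{a}"]) (auto simp: indicator_def)
 ultimately show ?thesis by simp
qed

lemma step_eq_exponential:
 assumes L0p: "!!y. L0 y > 0" and val: "!!i. i < k ==> valid (x i)"
  and f: "!!sgm s. sgm \<in> {1, -1} ==> s > 0 ==> f (x(k := (sgm, s))) = h s" and [measurable]: "h \<in> borel_measurable borel"
 shows "step n L0 k f x = (\<integral>\<^sup>+ s. indicator {0<..} s * (ennreal (trate n L0 x k * exp (- trate n L0 x k * s)) * h s) \<partial>lborel)"
proof -
 have r: "rate n L0 x k sgm > 0" for sgm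
  using rate_pos[of L0 k x n] L0p val by auto
 have "step n L0 k f x = (\<Sum>sgm\<in>{1, -1}. \<integral>\<^sup>+ s. indicator {0<..} s * (ennreal (rate n L0 x k sgm * exp (- trate n L0 x k * s)) * h s) \<partial>lborel)"
  unfolding step_def using f by (intro sum.cong nn_integral_cong) (auto simp: indicator_def)
 also have "... = (\<integral>\<^sup>+ s. indicator {0<..} s * (ennreal (rate n L0 x k 1 * exp (- trate n L0 x k * s)) * h s)
   + indicator {0<..} s * (ennreal (rate n L0 x k (-1) * exp (- trate n L0 x k * s)) * h s) \<partial>lborel)"
  by (subst nn_integral_add) auto
 also have "... = (\<integral>\<^sup>+ s. indicator {0<..} s * (ennreal (trate n L0 x k * exp (- trate n L0 x k * s)) * h s) \<partial>lborel)"
 proof (intro nn_integral_cong)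
  fix s :: real
  have "ennreal (trate n L0 x k * exp (- trate n L0 x k * s)) = ennreal (rate n L0 x k 1 * exp (- trate n L0 x k * s)) + ennreal (rate n L0 x k (-1) * exp (- trate n L0 x k * s))"
   using r[of 1] r[of "-1"] by (subst ennreal_plus[symmetric]) (auto simp: trate_def algebra_simps)
  then show "indicator {0<..} s * (ennreal (rate n L0 x k 1 * exp (- trate n L0 x k * s)) * h s)
   + indicator {0<..} s * (ennreal (rate n L0 x k (-1) * exp (- trate n L0 x k * s)) * h s) = indicator {0<..} s * (ennreal (trate n L0 x k * exp (- trate n L0 x k * s)) * h s)"
   by (simp add: distrib_left distrib_right)
 qed
 finally show ?thesis .
qed

text \<open>The number ln 2 divided by the total rate is the median of the holding time.\<close>

lemma step_coin:
 assumes L0p: "!!y. L0 y > 0" and val: "!!i. i < k ==> valid (x i)" and AB: "A >= 0" "B >= 0"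
  and f: "!!sgm s. sgm \<in> {1, -1} ==> s > 0 ==> f (x(k := (sgm, s))) = ennreal (if trate n L0 x k * s > ln 2 then A else B)"
 shows "step n L0 k f x = ennreal ((A + B) / 2)"
proof -
 define r where "r = trate n L0 x k"
 have r: "r > 0" using rate_pos[of L0 k x n] L0p val by (auto simp: r_def)
 define a where "a = ln 2 / r"
 have a: "a > 0" "exp (- r * a) = 1 / 2" using r by (auto simp: a_def exp_minus)
 have m: "r * s > ln 2 \<longleftrightarrow> s > a" for s using r by (simp add: a_def divide_less_eq mult.commute)
 let ?e = "%s. ennreal (r * exp (- r * s))"
 let ?I = "%A. (\<integral>\<^sup>+ s. indicator A s * ?e s \<partial>lborel)"
 have i1: "?I {a<..} = ennreal (1 / 2)" unfolding a(2)[symmetric] by (rule nn_integral_exp_tail[OF r])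
 have "?I {0<..a} + ?I {a<..} = (\<integral>\<^sup>+ s. indicator {0<..a} s * ?e s + indicator {a<..} s * ?e s \<partial>lborel)"
  by (subst nn_integral_add) auto
 also have "... = ?I {0<..}" by (intro nn_integral_cong) (use a in \<open>auto simp: indicator_def\<close>)
 also have "... = 1" using nn_integral_exp_tail[OF r, of 0] by simp
 finally have "?I {0<..a} + ennreal (1 / 2) = ennreal (1 / 2) + ennreal (1 / 2)"
  unfolding i1 by (subst ennreal_plus[symmetric]) auto
 then have i2: "?I {0<..a} = ennreal (1 / 2)"
  using ennreal_add_left_cancel[of "ennreal (1/2)" "?I {0<..a}" "ennreal (1/2)"] by (simp add: add.commute)
 have "step n L0 k f x = (\<integral>\<^sup>+ s. indicator {0<..} s * (?e s * ennreal (if trate n L0 x k * s > ln 2 then A else B)) \<partial>lborel)"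
  unfolding r_def by (rule step_eq_exponential) (use L0p val f in auto)
 also have "... = (\<integral>\<^sup>+ s. ennreal A * (indicator {a<..} s * ?e s) + ennreal B * (indicator {0<..a} s * ?e s) \<partial>lborel)"
  unfolding r_def[symmetric] m by (intro nn_integral_cong) (use a in \<open>auto simp: indicator_def mult.commute\<close>)
 also have "... = ennreal A * ?I {a<..} + ennreal B * ?I {0<..a}"
  by (subst nn_integral_add) (auto simp: nn_integral_cmult)
 also have "... = ennreal (A * (1 / 2)) + ennreal (B * (1 / 2))"
  unfolding i1 i2 ennreal_mult[OF AB(1) zero_le_divide_1_iff[THEN iffD2, OF zero_le_numeral]]
   ennreal_mult[OF AB(2) zero_le_divide_1_iff[THEN iffD2, OF zero_le_numeral]] ..
 also have "... = ennreal ((A + B) / 2)"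
  using AB by (subst ennreal_plus[symmetric]) (auto simp: add_divide_distrib)
 finally show ?thesis .
qed

text \<open>Taylor expansion of exp(i z) to second order, multiplied by the unit number exp(i b);
  the real part is taken. Only an upper bound is used, because the lower bound for a cosine follows
  from a phase shift by pi.\<close>

lemma cos_add_taylor: "cos (b + z) <= cos b - z * sin b - z\<^sup>2 / 2 * cos b + \<bar>z\<bar> ^ 3" for b z :: real
proof -
 let ?p = "\<Sum>k\<le>2. (\<i> * complex_of_real z) ^ k / fact k"
 have "cmod (iexp z - ?p) <= \<bar>z\<bar> ^ Suc 2 / fact (Suc 2)" by (rule iexp_approx1)
 also have "... <= \<bar>z\<bar> ^ 3"
 proof -
  have "a / 6 <= a" if "a >= 0" for a :: real using that by simp
  from this[of "\<bar>z\<bar> ^ 3"] show ?thesis by (simp add: fact_numeral eval_nat_numeral)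
 qed
 finally have 1: "cmod (iexp z - ?p) <= \<bar>z\<bar> ^ 3" .
 have p: "?p = Complex (1 - z\<^sup>2 / 2) z"
  by (simp add: numeral_2_eq_2 complex_eq_iff power2_eq_square)
 have "Re (iexp b * (iexp z - ?p)) <= cmod (iexp b * (iexp z - ?p))" by (rule complex_Re_le_cmod)
 also have "... <= \<bar>z\<bar> ^ 3" using 1 by (simp add: norm_mult)
 also have "Re (iexp b * (iexp z - ?p)) = cos (b + z) - (cos b - z * sin b - z\<^sup>2 / 2 * cos b)"
  unfolding p by (simp add: exp_Euler cos_of_real sin_of_real cos_add algebra_simps Re_exp Im_exp)
 finally show ?thesis by simp
qed

text \<open>As long as the trajectory is alive, all local times at and next to the walker are at
  least \<open>c\<close>, so \<open>e\<close> bounds every jump and every clock step; the coin steps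
  are of the same size.\<close>

locale wenv = vrjp n L0 M dir H for n L0 and M :: "'a measure" and dir H +
 fixes s km :: nat and c e :: real
 assumes c_pos: "c > 0" and c_le: "!!y. \<bar>y\<bar> <= real s + 1 ==> L0 y >= c" and e_def: "e = 1 / (2 ^ n * c\<^sup>2)" and e_le: "e <= 1"
begin

abbreviation "al \<equiv> alive n s km"
abbreviation "w \<equiv> dW n L0 s km e"
abbreviation "u \<equiv> du n L0 s km e"
abbreviation "Wp \<equiv> Wk n L0 s km e"
abbreviation "up \<equiv> uk n L0 s km e"

lemma e_pos: "e > 0" using c_pos by (simp add: e_def)

lemma alive_loc:
 assumes "!!i. i < k ==> valid (x i)" "al x k" "sgm \<in> {1, -1, 0}"
 shows "loc n L0 x k (pos x k + sgm) >= c"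
proof -
 have "\<bar>pos x k\<bar> <= int s * 2 ^ n" using assms(2) by (auto simp: alive_def)
 then have "\<bar>pos x k + sgm\<bar> <= int s * 2 ^ n + 1" using assms(3) by auto
 then have "real_of_int \<bar>pos x k + sgm\<bar> <= real_of_int (int s * 2 ^ n + 1)" by (simp only: of_int_le_iff)
 then have "\<bar>real_of_int (pos x k + sgm)\<bar> <= real s * 2 ^ n + 1" by simp
 also have "... <= (real s + 1) * 2 ^ n" by (simp add: distrib_right)
 finally have "L0 (real_of_int (pos x k + sgm) / 2 ^ n) >= c" by (intro c_le) (simp add: abs_divide divide_le_eq)
 then show ?thesis
  using loc_pos(1)[where ?L0.0=L0 and k=k and x=x and n=n and j="pos x k + sgm"] L0_pos assms(1) by (force simp: valid_def)
qed

lemma alive_prod: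
 assumes "!!i. i < k ==> valid (x i)" "al x k" "sgm \<in> {1, -1}"
 shows "1 / e <= 2 ^ n * (loc n L0 x k (pos x k) * loc n L0 x k (pos x k + sgm))"
proof -
 have "c * c <= loc n L0 x k (pos x k) * loc n L0 x k (pos x k + sgm)"
  using alive_loc[OF assms(1,2), of 0] alive_loc[OF assms(1,2), of sgm] assms(3) c_pos by (intro mult_mono) auto
 then show ?thesis using c_pos by (simp add: e_def power2_eq_square)
qed

lemma du_bounds:
 assumes "!!i. i <= k ==> valid (x i)"
 shows "0 < u x k" "u x k <= e"
proof -
 have "0 < u x k & u x k <= e"
 proof (cases "al x k")
  case True
  define l where "l = loc n L0 x k (pos x k)"
  define q where "q = 1 / l - 1 / (l + 2 ^ n * snd (x k))"
  have v: "!!i. i < k ==> valid (x i)" using assms by auto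
  have l: "l > 0" using alive_loc[OF v True, of 0] c_pos by (simp add: l_def)
  have h: "snd (x k) > 0" using assms[of k] by (simp add: valid_def)
  have q: "q > 0" "q <= 1 / l" using l h by (auto simp: q_def frac_less2)
  have sh: "0 < shrink n L0 x k sgm & shrink n L0 x k sgm <= e" if "sgm \<in> {1, -1}" for sgm
  proof -
   define m where "m = loc n L0 x k (pos x k + sgm)"
   have m: "m > 0" using alive_loc[OF v True, of sgm] that c_pos by (auto simp: m_def)
   have "shrink n L0 x k sgm = 1 / (2 ^ n * m) * q" by (simp add: shrink_def m_def q_def l_def)
   moreover have "1 / (2 ^ n * m) * q <= 1 / (2 ^ n * m) * (1 / l)" using m q by (intro mult_left_mono) auto
   moreover have "1 / (2 ^ n * m) * (1 / l) = 1 / (2 ^ n * (l * m))" by simp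
   moreover have "1 / (2 ^ n * (l * m)) <= e"
    using alive_prod[OF v True that] e_pos l m by (simp add: l_def m_def field_simps)
   ultimately have "shrink n L0 x k sgm <= e" by linarith
   moreover have "shrink n L0 x k sgm > 0" unfolding \<open>shrink n L0 x k sgm = 1 / (2 ^ n * m) * q\<close> using m q by simp
   ultimately show ?thesis by simp
  qed
  show ?thesis using sh[of 1] sh[of "-1"] True by (simp add: du_def dclk_def)
 next
  case False
  have "e * e <= e * 1" using e_pos e_le by (intro mult_left_mono) auto
  then show ?thesis using False e_pos by (simp add: du_def power2_eq_square)
 qed
 then show "0 < u x k" "u x k <= e" by auto
qed

definition blk :: "real => real => (nat => int \<times> real) => nat => real" where
 "blk a b x i = of_bool (a <= up x i & up x i < b)"

lemma measurable_blk [measurable]: "(%x. blk a b x i) \<in> borel_measurable seqM"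
 unfolding blk_def of_bool_def by measurable

lemma nonanticipating_blk: "nonanticipating i (%x. blk a b x i)"
proof (rule naI)
 fix x y :: "nat => int \<times> real" assume xy: "\<forall>l<i. x l = y l"
 show "blk a b x i = blk a b y i" unfolding blk_def naD[OF nonanticipating_uk(1)[OF order_refl] xy] ..
qed

lemma na_weighted:
 assumes "!!i. nonanticipating i (%x. T x i)" "!!i. nonanticipating (Suc i) (%x. f x i)"
 shows "nonanticipating k (%x. \<Sum>i<k. T x i * f x i :: real)"
proof (rule nonanticipating_sum, rule naI)
 fix i and x y :: "nat => int \<times> real" assume xy: "\<forall>l<Suc i. x l = y l"
 then have xy': "\<forall>l<i. x l = y l" by simp
 show "T x i * f x i = T y i * f y i" unfolding naD[OF assms(1) xy'] naD[OF assms(2) xy] ..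
qed

lemma weighted_upd:
 assumes "!!i. nonanticipating i (%x. T x i)" "!!i. nonanticipating (Suc i) (%x. f x i)"
 shows "(\<Sum>i<Suc k. T (x(k := p)) i * f (x(k := p)) i) = (\<Sum>i<k. T x i * f x i :: real) + T x k * f (x(k := p)) k"
proof -
 have "(\<Sum>i<k. T (x(k := p)) i * f (x(k := p)) i) = (\<Sum>i<k. T x i * f x i)"
  by (rule upd_eq[OF na_weighted[OF assms], where x=x and p=p])
 moreover have "T (x(k := p)) k = T x k" by (rule upd_eq[OF assms(1), where x=x and p=p])
 ultimately show ?thesis by simp
qed

text \<open>A coin step satisfies the same exponential inequality as a genuine jump, with clock
  increment e squared.\<close>

lemma cosh_bound:
 assumes l: "\<bar>l\<bar> * e <= 1"
 shows "(exp (l * e - l\<^sup>2 * e\<^sup>2) + exp (- (l * e) - l\<^sup>2 * e\<^sup>2)) / 2 <= 1"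
proof -
 define z where "z = l * e"
 have z: "\<bar>z\<bar> <= 1" using l e_pos by (simp add: z_def abs_mult)
 have "exp z + exp (- z) <= 2 * (1 + z\<^sup>2)"
  using exp_le_quadratic[of z] exp_le_quadratic[of "-z"] z by (simp add: abs_le_iff)
 also have "... <= 2 * exp (z\<^sup>2)" using exp_ge_add_one_self[of "z\<^sup>2"] by (intro mult_left_mono) auto
 finally have "(exp z + exp (- z)) * exp (- z\<^sup>2) <= 2 * exp (z\<^sup>2) * exp (- z\<^sup>2)" by (intro mult_right_mono) auto
 also have "... = 2" by (simp add: exp_minus)
 finally have "exp (z - z\<^sup>2) + exp (- z - z\<^sup>2) <= 2" by (simp add: distrib_right flip: exp_add)
 moreover have "z\<^sup>2 = l\<^sup>2 * e\<^sup>2" by (simp add: z_def power_mult_distrib)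
 ultimately show ?thesis by (simp add: z_def)
qed

text \<open>While the trajectory is alive both directions count, so the logarithmic compensator of
  \<open>step_exp_le\<close> has factor 0; afterwards the coin step takes over.\<close>

lemma supermart_blk:
 assumes l: "\<bar>l\<bar> * e <= 1"
 shows "supermart (%k x. exp (l * (\<Sum>i<k. blk a b x i * w x i) - l\<^sup>2 * (\<Sum>i<k. blk a b x i * u x i)))"
 unfolding supermart_def
proof (intro allI conjI impI)
 fix k
 let ?g = "%k x. exp (l * (\<Sum>i<k. blk a b x i * w x i) - l\<^sup>2 * (\<Sum>i<k. blk a b x i * u x i))"
 show "?g k \<in> borel_measurable seqM" by measurable
 show "nonanticipating k (?g k)"
 proof (rule naI)
  fix x y :: "nat => int \<times> real" assume xy: "\<forall>l<k. x l = y l"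
  show "?g k x = ?g k y"
   unfolding naD[OF na_weighted[OF nonanticipating_blk nonanticipating_dW(1)] xy]
    naD[OF na_weighted[OF nonanticipating_blk nonanticipating_dW(2)] xy] ..
 qed
 fix x :: "nat => int \<times> real" assume v: "\<forall>i<k. valid (x i)"
 show "0 <= ?g k x" by simp
 note U = weighted_upd[OF nonanticipating_blk nonanticipating_dW(1)] weighted_upd[OF nonanticipating_blk nonanticipating_dW(2)]
 have gS: "?g (Suc k) (x(k := p)) = ?g k x * exp (l * (blk a b x k * w (x(k := p)) k) - l\<^sup>2 * (blk a b x k * u (x(k := p)) k))" for p
  unfolding U by (simp add: algebra_simps flip: exp_add)
 have al: "al (x(k := p)) k = al x k" "trate n L0 (x(k := p)) k = trate n L0 x k" for p
  using upd_eq[OF nonanticipating_alive] upd_eq[OF nonanticipating_rate(2)] by auto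
 show "step n L0 k (%y. ennreal (?g (Suc k) y)) x <= ennreal (?g k x)"
 proof (cases "blk a b x k = 0")
  case True
  have "step n L0 k (%y. ennreal (?g (Suc k) y)) x = step n L0 k (%y. ennreal (?g k x)) x"
   by (rule step_cong) (simp only: gS True, simp)
  also have "... = ennreal (?g k x)" by (rule step_const) (use v L0_pos in auto)
  finally show ?thesis by simp
 next
  case False
  then have B: "blk a b x k = 1" by (auto simp: blk_def)
  show ?thesis
  proof (cases "al x k")
   case True
   show ?thesis
   proof (rule step_exp_le[where a="%_. 1" and tht=l])
    fix sgm :: int assume s: "sgm \<in> {1, -1}"
    have "\<bar>l\<bar> <= 1 / e" using l e_pos by (simp add: field_simps)
    also have "... <= 2 ^ n * (loc n L0 x k (pos x k) * loc n L0 x k (pos x k + sgm))"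
     using v s True by (intro alive_prod) auto
    finally show "\<bar>l\<bar> <= 2 ^ n * (loc n L0 x k (pos x k) * loc n L0 x k (pos x k + sgm))" .
    fix h :: real
    show "ennreal (?g (Suc k) (x(k := (sgm, h)))) <= ennreal (?g k x * exp (l * (1 * jmp n L0 (x(k := (sgm, h))) k
     + (1 - 1) / 2 * ln ((loc n L0 x k (pos x k) + 2 ^ n * h) / loc n L0 x k (pos x k))) - l\<^sup>2 * dclk n L0 (x(k := (sgm, h))) k))"
     unfolding gS B by (simp add: dW_def du_def al True)
   qed (use L0_pos v in auto)
  next
   case False
   let ?A = "?g k x * exp (l * e - l\<^sup>2 * e\<^sup>2)" and ?B = "?g k x * exp (- (l * e) - l\<^sup>2 * e\<^sup>2)"
   have "step n L0 k (%y. ennreal (?g (Suc k) y)) x = ennreal ((?A + ?B) / 2)"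
   proof (rule step_coin)
    fix sgm :: int and h :: real
    show "ennreal (?g (Suc k) (x(k := (sgm, h)))) = ennreal (if trate n L0 x k * h > ln 2 then ?A else ?B)"
     unfolding gS B by (simp add: dW_def du_def al False)
   qed (use L0_pos v in auto)
   also have "... <= ennreal (?g k x)"
    unfolding distrib_left[symmetric] times_divide_eq_right[symmetric]
    by (intro ennreal_leI mult_left_le) (use cosh_bound[OF l] in auto)
   finally show ?thesis .
  qed
 qed
qed


text \<open>The last clock step may pass \<open>b\<close> by at most \<open>e\<close>. The current
  clock value appears in the bound to make it inductive.\<close>

lemma blk_sum_le:
 assumes "!!i. i < k ==> valid (x i)" "a <= b"
 shows "(\<Sum>i<k. blk a b x i * u x i) <= max 0 (min (up x k) (b + e) - a)"
 using assms(1)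
proof (induction k)
 case (Suc k)
 have u: "0 < u x k" "u x k <= e" using du_bounds[of k x] Suc.prems by auto
 have S: "up x (Suc k) = up x k + u x k" by (simp add: uk_def)
 have IH: "(\<Sum>i<k. blk a b x i * u x i) <= max 0 (min (up x k) (b + e) - a)" using Suc by auto
 show ?case
 proof (cases "a <= up x k & up x k < b")
  case True
  then have "blk a b x k = 1" by (simp add: blk_def)
  then show ?thesis using IH True u e_pos unfolding S sum.lessThan_Suc by (auto simp: max_def min_def split: if_splits)
 next
  case False
  then have "blk a b x k = 0" by (auto simp: blk_def)
  then show ?thesis using IH u unfolding S sum.lessThan_Suc by (auto simp: max_def min_def split: if_splits)
 qed
qed (use e_pos assms(2) in auto)

lemma prob_blk:
 assumes l: "0 <= l" "l * e <= 1" and ab: "a <= b"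
 shows "prob {om \<in> space M. \<exists>k. \<bar>\<Sum>i<k. blk a b (X om) i * w (X om) i\<bar> > z} <= 2 * exp (- l * z + l\<^sup>2 * (b - a + e))"
proof -
 let ?F = "%x k. \<Sum>i<k. blk a b x i * w x i"
 let ?D = "b - a + e"
 have one: "prob {om \<in> space M. \<exists>k. sg * ?F (X om) k > z} <= exp (- l * z + l\<^sup>2 * ?D)" if s: "sg = 1 \<or> sg = -1" for sg :: real
 proof -
  let ?g = "%k x. exp ((sg * l) * ?F x k - (sg * l)\<^sup>2 * (\<Sum>i<k. blk a b x i * u x i))"
  have sm: "supermart ?g" using s l by (intro supermart_blk) auto
  note supermartD(1)[OF sm, measurable]
  have "prob {om \<in> space M. \<exists>k. sg * ?F (X om) k > z} <= prob {om \<in> space M. \<exists>k. ?g k (X om) >= exp (l * z - l\<^sup>2 * ?D)}"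
  proof (rule finite_measure_mono_AE)
   show "AE om in M. om \<in> {om \<in> space M. \<exists>k. sg * ?F (X om) k > z} --> om \<in> {om \<in> space M. \<exists>k. ?g k (X om) >= exp (l * z - l\<^sup>2 * ?D)}"
    using AE_valid
   proof eventually_elim
    case (elim om)
    have "exp (l * z - l\<^sup>2 * ?D) <= ?g k (X om)" if "sg * ?F (X om) k > z" for k
    proof -
     have "l * z <= l * (sg * ?F (X om) k)" using that l by (intro mult_left_mono) auto
     moreover have "(\<Sum>i<k. blk a b (X om) i * u (X om) i) <= ?D"
      by (rule order_trans[OF blk_sum_le]) (use elim ab e_pos in auto)
     then have "l\<^sup>2 * (\<Sum>i<k. blk a b (X om) i * u (X om) i) <= l\<^sup>2 * ?D" by (intro mult_left_mono) auto
     moreover have "(sg * l)\<^sup>2 = l\<^sup>2" using s by auto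
     ultimately show ?thesis unfolding exp_le_cancel_iff by (simp only: mult.assoc mult.left_commute[of sg l])
    qed
    then show ?case by auto
   qed
  qed measurable
  also have "... <= ?g 0 (%_. (1, 1)) / exp (l * z - l\<^sup>2 * ?D)" by (rule supermart_ville[OF sm]) simp
  also have "... = exp (- l * z + l\<^sup>2 * ?D)" by (simp add: exp_minus[symmetric] inverse_eq_divide[symmetric])
  finally show ?thesis .
 qed
 have abs: "\<bar>a\<bar> > z \<longleftrightarrow> 1 * a > z \<or> -1 * a > z" for a :: real by linarith
 have "{om \<in> space M. \<exists>k. \<bar>?F (X om) k\<bar> > z} =
  {om \<in> space M. \<exists>k. 1 * ?F (X om) k > z} \<union> {om \<in> space M. \<exists>k. -1 * ?F (X om) k > z}"
  unfolding abs by blast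
 then have "prob {om \<in> space M. \<exists>k. \<bar>?F (X om) k\<bar> > z} <=
  prob {om \<in> space M. \<exists>k. 1 * ?F (X om) k > z} + prob {om \<in> space M. \<exists>k. -1 * ?F (X om) k > z}"
  by (simp only:) (rule measure_Un_le; measurable)
 then show ?thesis using one[of 1] one[of "-1"] by linarith
qed

text \<open>One jump in terms of its holding time \<open>h\<close>: rate times jump cancels between
  the two directions, which is the martingale property, and rate times squared jump adds up to the
  derivative \<open>v\<close> of the clock \<open>D\<close>, which identifies the bracket.\<close>

lemma jump_calculus:
 assumes val: "!!i. i < k ==> valid (x i)"
 obtains J :: "int => real => real" and D v :: "real => real" where
  "!!sgm h. jmp n L0 (x(k := (sgm, h))) k = J sgm h" "!!sgm h. dclk n L0 (x(k := (sgm, h))) k = D h"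
  "!!h. h >= 0 ==> (D has_real_derivative v h) (at h)" "D 0 = 0" "!!h. h >= 0 ==> v h >= 0"
  "!!h. h >= 0 ==> rate n L0 x k 1 * J 1 h + rate n L0 x k (-1) * J (-1) h = 0"
  "!!h. h >= 0 ==> rate n L0 x k 1 * (J 1 h)\<^sup>2 + rate n L0 x k (-1) * (J (-1) h)\<^sup>2 = v h"
  "!!h sgm. h >= 0 ==> sgm \<in> {1, -1} ==> \<bar>J sgm h\<bar> <= 1 / (2 ^ n * (loc n L0 x k (pos x k) * loc n L0 x k (pos x k + sgm)))"
  "!!sgm. J sgm \<in> borel_measurable borel" "D \<in> borel_measurable borel" "v \<in> borel_measurable borel"
proof -
 define l where "l = loc n L0 x k (pos x k)"
 define m where "m sgm = loc n L0 x k (pos x k + sgm)" for sgm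
 define N :: real where "N = 2 ^ n"
 have N: "N > 0" by (simp add: N_def)
 have lm: "l > 0" "m sgm > 0" for sgm
  using loc_pos(2)[where ?L0.0=L0 and k=k and x=x and n=n] L0_pos val by (auto simp: l_def m_def valid_def)
 define J where "J sgm t = of_int sgm / (N * ((l + N * t) * m sgm))" for sgm :: int and t :: real
 define D where "D t = (1 / m 1 + 1 / m (-1)) / (2 * N) * (1 / l - 1 / (l + N * t))" for t
 define v where "v t = (1 / m 1 + 1 / m (-1)) / 2 / (l + N * t)\<^sup>2" for t
 have ls: "l + N * t > 0" if "t >= 0" for t using lm N that by (simp add: add_pos_nonneg)
 have r: "rate n L0 x k sgm = N\<^sup>2 / 2 * m sgm" for sgm
  by (simp add: rate_def m_def N_def power2_eq_square flip: power_mult_distrib)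
 show thesis
 proof (rule that[of J D v])
  show "jmp n L0 (x(k := (sgm, h))) k = J sgm h" for sgm h
   by (simp add: jmp_def J_def l_def m_def N_def)
  show "dclk n L0 (x(k := (sgm, t))) k = D t" for sgm t
  proof -
   define q where "q = 1 / l - 1 / (l + N * t)"
   have "dclk n L0 (x(k := (sgm, t))) k = (1 / (N * m 1) * q + 1 / (N * m (-1)) * q) / 2"
    by (simp add: dclk_def shrink_def l_def m_def N_def q_def)
   then show ?thesis using N lm(2)[of 1] lm(2)[of "-1"] by (simp add: D_def field_simps flip: q_def)
  qed
  show "D 0 = 0" by (simp add: D_def)
  show "J sgm \<in> borel_measurable borel" "D \<in> borel_measurable borel" "v \<in> borel_measurable borel" for sgm
   unfolding J_def[abs_def] D_def[abs_def] v_def[abs_def] by measurable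
  fix t :: real assume t: "t >= 0"
  define ww where "ww = l + N * t"
  have ww: "ww > 0" using ls[OF t] by (simp add: ww_def)
  have "(D has_real_derivative (1 / m 1 + 1 / m (-1)) / (2 * N) * (N / ww\<^sup>2)) (at t)"
   unfolding D_def by (rule derivative_eq_intros refl | use ww in \<open>force simp: ww_def\<close>)+
    (use ww in \<open>simp add: ww_def power2_eq_square\<close>)
  moreover have "(1 / m 1 + 1 / m (-1)) / (2 * N) * (N / ww\<^sup>2) = v t"
   using N by (simp add: v_def ww_def)
  ultimately show "(D has_real_derivative v t) (at t)" by simp
  show "v t >= 0" using lm(2)[of 1] lm(2)[of "-1"] by (simp add: v_def)
  have rJ: "rate n L0 x k sgm * J sgm t = of_int sgm * (N / ww) / 2" for sgm
   unfolding r J_def ww_def[symmetric] using N lm(2)[of sgm] ww by (simp add: field_simps power2_eq_square)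
  show "rate n L0 x k 1 * J 1 t + rate n L0 x k (-1) * J (-1) t = 0" unfolding rJ by simp
  have rJ2: "rate n L0 x k sgm * (J sgm t)\<^sup>2 = 1 / m sgm / 2 / ww\<^sup>2" if "sgm \<in> {1, -1}" for sgm
  proof -
   have "(real_of_int sgm)\<^sup>2 = 1" using that by auto
   then show ?thesis
    unfolding r J_def ww_def[symmetric] using N lm(2)[of sgm] ww
    by (simp add: power_divide power_mult_distrib) (simp add: field_simps power2_eq_square)
  qed
  show "rate n L0 x k 1 * (J 1 t)\<^sup>2 + rate n L0 x k (-1) * (J (-1) t)\<^sup>2 = v t"
   using rJ2[of 1] rJ2[of "-1"] by (simp add: v_def ww_def add_divide_distrib)
  fix sgm :: int assume sg: "sgm \<in> {1, -1}"
  have "\<bar>J sgm t\<bar> = 1 / (N * (ww * m sgm))" using sg N ww lm(2)[of sgm] by (auto simp: J_def abs_mult ww_def)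
  also have "... <= 1 / (N * (l * m sgm))"
   using N lm(1) lm(2)[of sgm] ww t by (intro divide_left_mono mult_left_mono mult_right_mono mult_pos_pos) (auto simp: ww_def less_imp_le)
  finally show "\<bar>J sgm t\<bar> <= 1 / (2 ^ n * (loc n L0 x k (pos x k) * loc n L0 x k (pos x k + sgm)))"
   by (simp add: N_def l_def m_def)
 qed
qed


text \<open>With q = z^2/2 the average of the two cosines is cos b (1 - q) up to |z|^3. The product
  exp(q) (1 - q) lies between 1 - q^2 and 1, and q^2 <= |z|^3, exp(q) <= 2; this gives the constant
  3.\<close>

lemma cos_coin_bound:
 fixes z b :: real
 assumes z: "\<bar>z\<bar> <= 1"
 shows "exp (z\<^sup>2 / 2) * ((cos (b + z) + cos (b - z)) / 2) <= cos b + 3 * \<bar>z\<bar> ^ 3"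
proof -
 define q where "q = z\<^sup>2 / 2"
 have z2: "z\<^sup>2 <= 1" using z by (simp add: abs_square_le_1)
 have q: "0 <= q" "q <= 1 / 2" using z2 by (auto simp: q_def)
 have e2: "exp q <= 2"
 proof -
  have "exp q <= 1 + q + q\<^sup>2" using q by (intro exp_le_quadratic) auto
  also have "q\<^sup>2 <= q * (1/2)" unfolding power2_eq_square using q by (intro mult_left_mono) auto
  finally show ?thesis using q by simp
 qed
 have "(cos (b + z) + cos (b - z)) / 2 <= cos b * (1 - q) + \<bar>z\<bar> ^ 3"
  using cos_add_taylor[of b z] cos_add_taylor[of b "-z"] by (simp add: q_def right_diff_distrib mult.commute)
 then have "exp q * ((cos (b + z) + cos (b - z)) / 2) <= exp q * (cos b * (1 - q) + \<bar>z\<bar> ^ 3)"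
  by (intro mult_left_mono) auto
 also have "... = cos b * (exp q * (1 - q)) + exp q * \<bar>z\<bar> ^ 3" by (simp add: algebra_simps)
 also have "cos b * (exp q * (1 - q)) <= cos b + q\<^sup>2"
 proof -
  have "exp q * (1 - q) <= exp q * exp (- q)" using exp_ge_add_one_self[of "-q"] by (intro mult_left_mono) auto
  then have 1: "exp q * (1 - q) <= 1" by (simp add: exp_minus)
  have "(1 + q) * (1 - q) <= exp q * (1 - q)" using exp_ge_add_one_self[of q] q by (intro mult_right_mono) auto
  then have 2: "1 - q\<^sup>2 <= exp q * (1 - q)" by (simp add: power2_eq_square algebra_simps)
  have "\<bar>cos b\<bar> * \<bar>exp q * (1 - q) - 1\<bar> <= 1 * q\<^sup>2" using 1 2 by (intro mult_mono) auto
  then have "cos b * (exp q * (1 - q) - 1) <= q\<^sup>2" using abs_le_D1[of "cos b * (exp q * (1 - q) - 1)" "q\<^sup>2"] by (simp add: abs_mult)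
  then show ?thesis by (simp add: right_diff_distrib)
 qed
 also have "q\<^sup>2 <= \<bar>z\<bar> ^ 3"
 proof -
  have "q\<^sup>2 = \<bar>z\<bar> ^ 3 * (\<bar>z\<bar> / 4)" by (simp add: q_def power2_eq_square power3_eq_cube)
  also have "... <= \<bar>z\<bar> ^ 3 * 1" using z by (intro mult_left_mono) auto
  finally show ?thesis by simp
 qed
 also have "exp q * \<bar>z\<bar> ^ 3 <= 2 * \<bar>z\<bar> ^ 3" using e2 by (intro mult_right_mono) auto
 finally show ?thesis by (simp add: q_def)
qed

text \<open>For a martingale with bracket \<open>u\<close>, exp(V) cos(R) is a martingale up to
  third order errors. These are at most B^3 \<open>e\<close> per unit of clock, so the term with
  \<open>C'\<close> pays for them; the factor 3 is that of \<open>cos_coin_bound\<close>. The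
  constant \<open>C\<close> keeps everything nonnegative, as \<open>supermart\<close> requires: the
  weights vanish once the clock has passed \<open>U\<close>, so exp(V) is at most exp E and the
  clock in the block at most U + 1.\<close>

lemma supermart_cos:
 fixes T :: "(nat => int \<times> real) => nat => real"
 assumes T[measurable]: "!!i. (%x. T x i) \<in> borel_measurable seqM" and Tn: "!!i. nonanticipating i (%x. T x i)"
  and TB: "!!x i. \<bar>T x i\<bar> <= B * blk 0 U x i" and U: "U >= 0" and B: "B >= 0" "B * e <= 1"
  and E: "E = B\<^sup>2 * (U + 1) / 2" and C': "C' = 3 * exp E * B ^ 3 * e" and C: "C = exp E + C' * (U + 1)"
 shows "supermart (%k x. C + exp ((\<Sum>i<k. (T x i)\<^sup>2 * u x i) / 2) * cos ((\<Sum>i<k. T x i * w x i) + alp) - C' * (\<Sum>i<k. blk 0 U x i * u x i))"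
  and "!!x k. (!!i. i < k ==> valid (x i)) ==> (\<Sum>i<k. (T x i)\<^sup>2 * u x i) / 2 <= E"
  and "!!x k. (!!i. i < k ==> valid (x i)) ==> (\<Sum>i<k. blk 0 U x i * u x i) <= U + 1"
proof -
 have C'0: "C' >= 0" using B e_pos by (simp add: C')
 have T2n: "nonanticipating i (%x. (T x i)\<^sup>2)" for i
 proof (rule naI)
  fix x y :: "nat => int \<times> real" assume xy: "\<forall>l<i. x l = y l"
  show "(T x i)\<^sup>2 = (T y i)\<^sup>2" unfolding naD[OF Tn xy] ..
 qed
 show Ub: "(\<Sum>i<k. blk 0 U x i * u x i) <= U + 1" if "!!i. i < k ==> valid (x i)" for x k
  by (rule order_trans[OF blk_sum_le]) (use that U e_pos e_le in auto)
 show Vb: "(\<Sum>i<k. (T x i)\<^sup>2 * u x i) / 2 <= E" if v: "!!i. i < k ==> valid (x i)" for x k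
 proof -
  have "(\<Sum>i<k. (T x i)\<^sup>2 * u x i) <= (\<Sum>i<k. B\<^sup>2 * (blk 0 U x i * u x i))"
  proof (rule sum_mono)
   fix i assume "i \<in> {..<k}"
   then have u: "u x i >= 0" using du_bounds[of i x] v by (auto simp: less_imp_le)
   have "(T x i)\<^sup>2 <= (B * blk 0 U x i)\<^sup>2" using TB[of x i] by (simp add: abs_le_square_iff[symmetric])
   also have "... = B\<^sup>2 * blk 0 U x i" by (simp add: blk_def power_mult_distrib)
   finally show "(T x i)\<^sup>2 * u x i <= B\<^sup>2 * (blk 0 U x i * u x i)" using u by (simp add: mult_right_mono flip: mult.assoc)
  qed
  also have "... = B\<^sup>2 * (\<Sum>i<k. blk 0 U x i * u x i)" by (simp add: sum_distrib_left)
  also have "... <= B\<^sup>2 * (U + 1)" using Ub[OF v] by (intro mult_left_mono) auto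
  finally show ?thesis by (simp add: E)
 qed
 let ?V = "%k x. (\<Sum>i<k. (T x i)\<^sup>2 * u x i) / 2" and ?R = "%k x. (\<Sum>i<k. T x i * w x i) + alp" and ?O = "%k x. \<Sum>i<k. blk 0 U x i * u x i"
 let ?g = "%k x. C + exp (?V k x) * cos (?R k x) - C' * ?O k x"
 have low: "C + exp a * cos b - C' * o' >= 0" if "a <= E" "o' <= U + 1" for a b o'
 proof -
  have "exp a * cos b >= - exp E"
  proof -
   have "\<bar>exp a * cos b\<bar> <= exp E * 1" unfolding abs_mult using that by (intro mult_mono) auto
   then show ?thesis by (simp add: abs_le_iff)
  qed
  moreover have "C' * o' <= C' * (U + 1)" using that C'0 by (intro mult_left_mono) auto
  ultimately show ?thesis unfolding C by linarith
 qed
 show "supermart ?g"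
  unfolding supermart_def
 proof (intro allI conjI impI)
  fix k
  show "?g k \<in> borel_measurable seqM" by measurable
  show "nonanticipating k (?g k)"
  proof (rule naI)
   fix x y :: "nat => int \<times> real" assume xy: "\<forall>l<k. x l = y l"
   show "?g k x = ?g k y"
    unfolding naD[OF na_weighted[OF Tn nonanticipating_dW(1)] xy] naD[OF na_weighted[OF T2n nonanticipating_dW(2)] xy]
     naD[OF na_weighted[OF nonanticipating_blk nonanticipating_dW(2)] xy] ..
  qed
  fix x :: "nat => int \<times> real" assume v': "\<forall>i<k. valid (x i)"
  then have v: "!!i. i < k ==> valid (x i)" by simp
  show "0 <= ?g k x" using low[OF Vb[OF v] Ub[OF v]] .
  define t where "t = T x k"
  define V where "V = ?V k x" define R where "R = ?R k x" define O' where "O' = ?O k x"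
  have gS: "?g (Suc k) (x(k := p)) = C + exp (V + t\<^sup>2 * u (x(k := p)) k / 2) * cos (R + t * w (x(k := p)) k) - C' * (O' + blk 0 U x k * u (x(k := p)) k)" for p
   unfolding weighted_upd[OF Tn nonanticipating_dW(1)] weighted_upd[OF T2n nonanticipating_dW(2)] weighted_upd[OF nonanticipating_blk nonanticipating_dW(2)]
   by (simp add: V_def R_def O'_def t_def add_divide_distrib algebra_simps)
  have gk: "?g k x = C + exp V * cos R - C' * O'" by (simp add: V_def R_def O'_def)
  have upv: "valid ((x(k := p)) i)" if "valid p" "i <= k" for p i using that v by (auto simp: le_less)
  have ub: "0 < u (x(k := p)) k" "u (x(k := p)) k <= e" if "valid p" for p using du_bounds[of k "x(k := p)"] upv[OF that] by auto
  have Vb': "V + t\<^sup>2 * u (x(k := p)) k / 2 <= E" if "valid p" for p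
   using Vb[of "Suc k" "x(k := p)"] upv[OF that] unfolding weighted_upd[OF T2n nonanticipating_dW(2)] by (simp add: V_def t_def add_divide_distrib less_Suc_eq_le)
  have Ob': "O' + blk 0 U x k * u (x(k := p)) k <= U + 1" if "valid p" for p
   using Ub[of "Suc k" "x(k := p)"] upv[OF that] unfolding weighted_upd[OF nonanticipating_blk nonanticipating_dW(2)] by (simp add: O'_def less_Suc_eq_le)
  have VE: "V <= E" using Vb[OF v] by (simp add: V_def)
  have OU: "O' <= U + 1" using Ub[OF v] by (simp add: O'_def)
  have al: "al (x(k := p)) k = al x k" "trate n L0 (x(k := p)) k = trate n L0 x k" for p
   using upd_eq[OF nonanticipating_alive] upd_eq[OF nonanticipating_rate(2)] by auto
  show "step n L0 k (%y. ennreal (?g (Suc k) y)) x <= ennreal (?g k x)"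
  proof (cases "t = 0")
   case True
   have "step n L0 k (%y. ennreal (?g (Suc k) y)) x <= step n L0 k (%y. ennreal (?g k x)) x"
   proof (rule step_mono_valid, rule ennreal_leI)
    fix p assume p: "valid p"
    have "0 <= C' * (blk 0 U x k * u (x(k := p)) k)" using C'0 ub[OF p] by (simp add: blk_def)
    then show "?g (Suc k) (x(k := p)) <= ?g k x" unfolding gS gk using True by (simp add: distrib_left)
   qed
   also have "... = ennreal (?g k x)" by (rule step_const) (use v L0_pos in auto)
   finally show ?thesis .
  next
   case False
   then have "blk 0 U x k ~= 0" using TB[of x k] by (auto simp: t_def)
   then have b1: "blk 0 U x k = 1" by (simp add: blk_def)
   have tB: "\<bar>t\<bar> <= B" using TB[of x k] b1 by (simp add: t_def)
   have t3: "\<bar>t\<bar> ^ 3 <= B ^ 3" using tB by (intro power_mono) auto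
   show ?thesis
   proof (cases "al x k")
    case False
    let ?A = "C + exp (V + t\<^sup>2 * e\<^sup>2 / 2) * cos (R + t * e) - C' * (O' + e\<^sup>2)"
    let ?B = "C + exp (V + t\<^sup>2 * e\<^sup>2 / 2) * cos (R - t * e) - C' * (O' + e\<^sup>2)"
    \<comment> \<open>After the window the clock step does not depend on the jump, so any valid pair
      yields the bounds \<open>nn\<close>.\<close>
    have pv: "valid (1, 1)" by (simp add: valid_def)
    have nn: "V + t\<^sup>2 * e\<^sup>2 / 2 <= E" "O' + e\<^sup>2 <= U + 1"
     using Vb'[OF pv] Ob'[OF pv] b1 by (auto simp: du_def al False)
    have "step n L0 k (%y. ennreal (?g (Suc k) y)) x = ennreal ((?A + ?B) / 2)"
    proof (rule step_coin)
     show "0 <= ?A" "0 <= ?B" by (rule low[OF nn])+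
     fix sgm :: int and h :: real
     show "ennreal (?g (Suc k) (x(k := (sgm, h)))) = ennreal (if trate n L0 x k * h > ln 2 then ?A else ?B)"
      unfolding gS b1 by (simp add: dW_def du_def al False)
    qed (use L0_pos v in auto)
    also have "... <= ennreal (?g k x)"
    proof (rule ennreal_leI)
     define z where "z = t * e"
     have z: "\<bar>z\<bar> <= 1" using order_trans[OF mult_right_mono[OF tB] B(2)] e_pos by (simp add: z_def abs_mult)
     have "exp V * (exp (z\<^sup>2 / 2) * ((cos (R + z) + cos (R - z)) / 2)) <= exp V * (cos R + 3 * \<bar>z\<bar> ^ 3)"
      by (intro mult_left_mono cos_coin_bound[OF z]) auto
     also have "... = exp V * cos R + exp V * (3 * \<bar>z\<bar> ^ 3)" by (simp add: distrib_left)
     also have "exp V * (3 * \<bar>z\<bar> ^ 3) <= exp E * (3 * (B ^ 3 * e ^ 3))"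
     proof (intro mult_mono)
      show "\<bar>z\<bar> ^ 3 <= B ^ 3 * e ^ 3" using mult_right_mono[OF t3, of "e ^ 3"] e_pos by (simp add: z_def abs_mult power_mult_distrib)
     qed (use VE B e_pos in auto)
     also have "... = C' * e\<^sup>2" by (simp add: C' power2_eq_square power3_eq_cube)
     finally have "exp V * (exp (z\<^sup>2 / 2) * ((cos (R + z) + cos (R - z)) / 2)) <= exp V * cos R + C' * e\<^sup>2" by simp
     moreover have "exp V * (exp (z\<^sup>2 / 2) * ((cos (R + z) + cos (R - z)) / 2)) = (exp (V + t\<^sup>2 * e\<^sup>2 / 2) * cos (R + t * e) + exp (V + t\<^sup>2 * e\<^sup>2 / 2) * cos (R - t * e)) / 2"
      by (simp add: exp_add z_def power_mult_distrib algebra_simps add_divide_distrib)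
     ultimately show "(?A + ?B) / 2 <= ?g k x" unfolding gk by (simp add: distrib_left)
    qed
    finally show ?thesis .
   next
    case True
    obtain J D v' where J: "!!sgm h. jmp n L0 (x(k := (sgm, h))) k = J sgm h" "!!sgm h. dclk n L0 (x(k := (sgm, h))) k = D h"
      and D: "!!h. h >= 0 ==> (D has_real_derivative v' h) (at h)" "D 0 = 0" and v'0: "!!h. h >= 0 ==> v' h >= 0"
      and J0: "!!h. h >= 0 ==> rate n L0 x k 1 * J 1 h + rate n L0 x k (-1) * J (-1) h = 0"
      and J2: "!!h. h >= 0 ==> rate n L0 x k 1 * (J 1 h)\<^sup>2 + rate n L0 x k (-1) * (J (-1) h)\<^sup>2 = v' h"
      and Jb: "!!h sgm. h >= 0 ==> sgm \<in> {1, -1} ==> \<bar>J sgm h\<bar> <= 1 / (2 ^ n * (loc n L0 x k (pos x k) * loc n L0 x k (pos x k + sgm)))"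
      and [measurable]: "!!sgm. J sgm \<in> borel_measurable borel" "D \<in> borel_measurable borel" "v' \<in> borel_measurable borel"
     by (rule jump_calculus[where k=k and x=x, OF v]) (assumption, rule that)
    have Je: "\<bar>J sgm h\<bar> <= e" if "h >= 0" "sgm \<in> {1, -1}" for h sgm
    proof -
     have "1 / (2 ^ n * (loc n L0 x k (pos x k) * loc n L0 x k (pos x k + sgm))) <= 1 / (1 / e)"
     proof (rule divide_left_mono)
      have "0 < 1 / e" using e_pos by simp
      then show "0 < 2 ^ n * (loc n L0 x k (pos x k) * loc n L0 x k (pos x k + sgm)) * (1 / e)"
       using alive_prod[OF v True that(2)] by (intro mult_pos_pos[OF less_le_trans]) auto
     qed (use alive_prod[OF v True that(2)] in auto)
     then show ?thesis using Jb[OF that] by simp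
    qed
    have uD: "u (x(k := (sgm, h))) k = D h" "w (x(k := (sgm, h))) k = J sgm h" for sgm h
     by (auto simp: du_def dW_def al True J)
    have bd: "V + t\<^sup>2 * D h / 2 <= E" "O' + D h <= U + 1" if "h >= 0" for h
    proof -
     have "V + t\<^sup>2 * D h / 2 <= E & O' + D h <= U + 1"
     proof (cases "h = 0")
      case True
      then show ?thesis using VE OU by (simp add: D(2))
     next
      case False
      then have "valid (1, h)" using that by (simp add: valid_def)
      from Vb'[OF this] Ob'[OF this] show ?thesis by (simp add: uD b1)
     qed
     then show "V + t\<^sup>2 * D h / 2 <= E" "O' + D h <= U + 1" by auto
    qed
    let ?Y = "%h. C + exp (V + t\<^sup>2 * D h / 2) * cos R - C' * (O' + D h)"
    let ?Y' = "%h. exp (V + t\<^sup>2 * D h / 2) * (t\<^sup>2 * v' h / 2) * cos R - C' * v' h"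
    let ?y = "%sgm h. C + exp (V + t\<^sup>2 * D h / 2) * cos (R + t * J sgm h) - C' * (O' + D h)"
    have "step n L0 k (%y. ennreal (?g (Suc k) y)) x <= ennreal (?Y 0)"
    proof (rule step_le_generator[where y="?y" and Y'="?Y'"])
     fix h :: real assume h: "h >= 0"
     show "(?Y has_real_derivative ?Y' h) (at h)"
      by (rule derivative_eq_intros D(1)[OF h] refl | simp)+
     show "?Y h >= 0" by (rule low[OF bd[OF h]])
     let ?X = "exp (V + t\<^sup>2 * D h / 2)"
     let ?r = "rate n L0 x k"
     have rp: "?r sgm >= 0" for sgm using rate_pos[of L0 k x n] L0_pos v by (auto simp: less_imp_le)
     have tay: "?r sgm * (cos (R + t * J sgm h) - cos R) <= ?r sgm * (- (t * J sgm h) * sin R - (t * J sgm h)\<^sup>2 / 2 * cos R + B ^ 3 * (e * (J sgm h)\<^sup>2))" if "sgm \<in> {1, -1}" for sgm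
     proof (rule mult_left_mono[OF _ rp])
      \<comment> \<open>Splitting the cube into size times square: the size is at most
        \<open>e\<close>, and the squares, weighted by the rates, add up to the clock
        derivative.\<close>
      have "\<bar>t * J sgm h\<bar> ^ 3 = \<bar>t\<bar> ^ 3 * (\<bar>J sgm h\<bar> * (J sgm h)\<^sup>2)"
      proof -
       have "(J sgm h)\<^sup>2 = \<bar>J sgm h\<bar>\<^sup>2" by simp
       then show ?thesis by (simp only: abs_mult power_mult_distrib) (simp add: power3_eq_cube power2_eq_square)
      qed
      also have "... <= B ^ 3 * (e * (J sgm h)\<^sup>2)" using t3 Je[OF h that] B by (intro mult_mono) auto
      finally show "cos (R + t * J sgm h) - cos R <= - (t * J sgm h) * sin R - (t * J sgm h)\<^sup>2 / 2 * cos R + B ^ 3 * (e * (J sgm h)\<^sup>2)"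
       using cos_add_taylor[of R "t * J sgm h"] by simp
     qed
     have "?r 1 * (cos (R + t * J 1 h) - cos R) + ?r (-1) * (cos (R + t * J (-1) h) - cos R)
      <= - t * sin R * (?r 1 * J 1 h + ?r (-1) * J (-1) h) - t\<^sup>2 / 2 * cos R * (?r 1 * (J 1 h)\<^sup>2 + ?r (-1) * (J (-1) h)\<^sup>2)
       + B ^ 3 * e * (?r 1 * (J 1 h)\<^sup>2 + ?r (-1) * (J (-1) h)\<^sup>2)"
      using tay[of 1] tay[of "-1"] by (simp add: algebra_simps power_mult_distrib add_divide_distrib)
     also have "... = - t\<^sup>2 / 2 * cos R * v' h + B ^ 3 * e * v' h" unfolding J0[OF h] J2[OF h] by simp
     finally have "?X * (?r 1 * (cos (R + t * J 1 h) - cos R) + ?r (-1) * (cos (R + t * J (-1) h) - cos R)) <= ?X * (- t\<^sup>2 / 2 * cos R * v' h + B ^ 3 * e * v' h)"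
      by (intro mult_left_mono) auto
     moreover have "?X * (B ^ 3 * e * v' h) <= C' * v' h"
     proof -
      have "?X * (B ^ 3 * e * v' h) <= exp E * (B ^ 3 * e * v' h)" using bd(1)[OF h] B e_pos v'0[OF h] by (intro mult_right_mono) auto
      also have "... <= C' * v' h" using B e_pos v'0[OF h] by (simp add: C' mult_right_mono mult.assoc)
      finally show ?thesis .
     qed
     ultimately show "?r 1 * (?y 1 h - ?Y h) + ?r (-1) * (?y (-1) h - ?Y h) + ?Y' h <= 0"
      by (simp add: algebra_simps)
    next
     fix sgm :: int and h :: real assume "sgm \<in> {1, -1}" "h > 0"
     show "ennreal (?g (Suc k) (x(k := (sgm, h)))) <= ennreal (?y sgm h)" unfolding gS b1 uD by simp
    next
     fix sgm :: int and h :: real assume "h >= 0"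
     then show "0 <= ?y sgm h" by (intro low bd)
    qed (use L0_pos v in \<open>auto\<close>)
    then show ?thesis unfolding gk by (simp add: D(2))
   qed
  qed
 qed
qed

end

lemma abs_exp_diff_le:
 fixes a b E :: real
 assumes "a <= E" "b <= E"
 shows "\<bar>exp a - exp b\<bar> <= exp E * \<bar>a - b\<bar>"
proof -
 have "exp a - exp b <= exp E * (a - b)" if "b <= a" "a <= E" for a b :: real
 proof -
  have "exp a - exp b = exp a * (1 - exp (b - a))" by (simp add: right_diff_distrib flip: exp_add)
  also have "... <= exp a * (a - b)" using exp_ge_add_one_self[of "b - a"] by (intro mult_left_mono) (linarith, simp)
  also have "... <= exp E * (a - b)" using that by (intro mult_right_mono) auto
  finally show ?thesis .
 qed
 from this[of a b] this[of b a] show ?thesis using assms by (cases "a <= b") auto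
qed

section \<open>Time change and increments over a clock grid\<close>

context wenv begin

definition cross :: "(nat => int \<times> real) => real => nat" where
 "cross x g = (LEAST k. g <= up x k)"

definition Wg :: "(nat => int \<times> real) => real => real" where
 "Wg x g = Wp x (cross x g)"

lemma measurable_cross [measurable]: "(%x. cross x g) \<in> seqM \<rightarrow>\<^sub>M count_space UNIV"
 unfolding cross_def by measurable

lemma measurable_Wg [measurable]: "(%x. Wg x g) \<in> borel_measurable seqM"
 unfolding Wg_def by (rule measurable_compose_countable[where f="%k x. Wp x k"]) measurable

context
 fixes x :: "nat => int \<times> real"
 assumes v: "\<forall>i. valid (x i)"
begin

lemma up_Suc: "up x (Suc k) = up x k + u x k" by (simp add: uk_def)

lemma up_less: "up x k < up x (Suc k)" using du_bounds[of k x] v by (simp add: up_Suc)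

lemma up_mono: "k <= l ==> up x k <= up x l"
 by (rule lift_Suc_mono_le[of "up x"]) (auto intro: less_imp_le up_less)

lemma up_0: "up x 0 = 0" by (simp add: uk_def)

text \<open>From index \<open>km\<close> on the trajectory is no longer alive, so the clock grows by
  a fixed amount per step. Every level is therefore crossed by a deterministic index, even if the
  walk explodes or escapes.\<close>

lemma up_ge: "up x (km + j) >= real j * e\<^sup>2"
proof (induction j)
 case 0
 then show ?case using up_mono[of 0 km] by (simp add: up_0)
next
 case (Suc j)
 have "\<not> al x (km + j)" by (simp add: alive_def)
 then have "u x (km + j) = e\<^sup>2" by (simp add: du_def)
 then show ?case using Suc by (simp add: up_Suc algebra_simps)
qed

lemma cross_exists: "g <= up x (km + nat \<lceil>g / e\<^sup>2\<rceil>)"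
proof -
 have "g / e\<^sup>2 <= real (nat \<lceil>g / e\<^sup>2\<rceil>)" by linarith
 then have "g <= real (nat \<lceil>g / e\<^sup>2\<rceil>) * e\<^sup>2" using e_pos by (simp add: divide_le_eq)
 then show ?thesis using up_ge[of "nat \<lceil>g / e\<^sup>2\<rceil>"] by linarith
qed

lemma up_cross: "g <= up x (cross x g)"
 unfolding cross_def by (rule LeastI[of "%k. g <= up x k", OF cross_exists])

lemma cross_le_iff: "cross x g <= k \<longleftrightarrow> g <= up x k"
proof
 assume "cross x g <= k"
 then show "g <= up x k" using up_cross[of g] up_mono by (blast intro: order_trans)
next
 assume "g <= up x k"
 then show "cross x g <= k" unfolding cross_def by (rule Least_le)
qed

lemma cross_mono: "g <= g' ==> cross x g <= cross x g'"
 unfolding cross_le_iff using up_cross[of g'] by simp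

lemma cross_bound: "cross x g <= km + nat \<lceil>g / e\<^sup>2\<rceil>"
 unfolding cross_le_iff by (rule cross_exists)

lemma up_cross_le: "g >= 0 ==> up x (cross x g) <= g + e"
proof (cases "cross x g")
 case 0
 then show "g >= 0 ==> ?thesis" using e_pos by (simp add: up_0)
next
 case (Suc k)
 then have "\<not> cross x g <= k" by simp
 then have "up x k < g" unfolding cross_le_iff by simp
 then show ?thesis using du_bounds(2)[of k x] v by (simp add: Suc up_Suc)
qed

lemma blk_cross: "blk a b x i = of_bool (cross x a <= i & i < cross x b)"
 unfolding blk_def by (auto simp: cross_le_iff not_le[symmetric])

lemma blk_sum:
 assumes "a <= b"
 shows "(\<Sum>i<k. blk a b x i * f i) = (\<Sum>i<min k (cross x b). f i) - (\<Sum>i<min k (cross x a). f i)"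
proof (induction k)
 case (Suc k)
 have *: "cross x a <= cross x b" by (rule cross_mono[OF assms])
 consider "k < cross x a" | "cross x a <= k" "k < cross x b" | "cross x b <= k" by linarith
 then show ?case
 proof cases
  case 1
  then show ?thesis using Suc * by (simp add: blk_cross min_def)
 next
  case 2
  then show ?thesis using Suc * by (simp add: blk_cross min_def)
 next
  case 3
  then show ?thesis using Suc * by (simp add: blk_cross min_def)
 qed
qed simp

end

definition osc_ok :: "real => nat => real => (nat => int \<times> real) => bool" where
 "osc_ok hh m z x \<longleftrightarrow> (\<forall>j<m. \<not> (\<exists>k. \<bar>\<Sum>i<k. blk (real j * hh) (real (Suc j) * hh) x i * w x i\<bar> > z))"

lemma measurable_osc_ok [measurable]: "Measurable.pred seqM (osc_ok hh m z)"
 unfolding osc_ok_def[abs_def] by measurable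

lemma osc_okD:
 assumes "osc_ok hh m z x" "\<forall>i. valid (x i)" "j < m" "hh >= 0" "cross x (real j * hh) <= k" "k <= cross x (real (Suc j) * hh)"
 shows "\<bar>Wp x k - Wg x (real j * hh)\<bar> <= z"
proof -
 have "real j * hh <= real (Suc j) * hh" using assms(4) by (intro mult_right_mono) auto
 then have "(\<Sum>i<k. blk (real j * hh) (real (Suc j) * hh) x i * w x i) = Wp x k - Wg x (real j * hh)"
  using assms(5,6) by (subst blk_sum[OF assms(2)]) (auto simp: Wg_def Wk_def min_absorb1 min_absorb2)
 then show ?thesis using assms(1,3) unfolding osc_ok_def by (metis not_less)
qed

lemma prob_osc_ok:
 assumes l: "0 <= l" "l * e <= 1" and hh: "hh >= 0"
 shows "prob {om \<in> space M. \<not> osc_ok hh m z (X om)} <= 2 * real m * exp (- l * z + l\<^sup>2 * (hh + e))"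
proof -
 let ?Z = "%j. {om \<in> space M. \<exists>k. \<bar>\<Sum>i<k. blk (real j * hh) (real (Suc j) * hh) (X om) i * w (X om) i\<bar> > z}"
 have "{om \<in> space M. \<not> osc_ok hh m z (X om)} = (\<Union>j\<in>{..<m}. ?Z j)" by (auto simp: osc_ok_def)
 then have "prob {om \<in> space M. \<not> osc_ok hh m z (X om)} = prob (\<Union>j\<in>{..<m}. ?Z j)" by simp
 also have "... <= (\<Sum>j\<in>{..<m}. prob (?Z j))" by (rule measure_UNION_le) (auto, measurable)
 also have "... <= (\<Sum>j\<in>{..<m}. 2 * exp (- l * z + l\<^sup>2 * (hh + e)))"
 proof (rule sum_mono)
  fix j
  have "prob (?Z j) <= 2 * exp (- l * z + l\<^sup>2 * (real (Suc j) * hh - real j * hh + e))"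
   by (rule prob_blk) (use l hh in \<open>auto intro!: mult_right_mono\<close>)
  then show "prob (?Z j) <= 2 * exp (- l * z + l\<^sup>2 * (hh + e))" by (simp add: algebra_simps)
 qed
 finally show ?thesis by simp
qed

text \<open>Increments of the time-changed martingale have nearly the joint characteristic function
  of independent Gaussian variables of variance \<open>hh\<close>. The weights of
  \<open>supermart_cos\<close> are constant on clock blocks, and the supermartingale is evaluated at
  a deterministic index. Only an upper bound for arbitrary phase \<open>alp\<close> is claimed;
  phase alp + pi supplies the lower bound.\<close>

lemma char_bound:
 fixes tht :: "nat => real" and alp hh :: real and m :: nat
 assumes hh: "hh >= 0"
 defines "B \<equiv> \<Sum>j<m. \<bar>tht j\<bar>" and "U \<equiv> real m * hh"
 defines "E \<equiv> B\<^sup>2 * (U + 1) / 2" and "V0 \<equiv> (\<Sum>j<m. (tht j)\<^sup>2) * hh / 2"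
 assumes Be: "B * e <= 1"
 shows "(\<integral>om. cos ((\<Sum>j<m. tht j * (Wg (X om) (real (Suc j) * hh) - Wg (X om) (real j * hh))) + alp) \<partial>M)
  <= exp (- V0) * cos alp + (3 * exp E * B ^ 3 * (U + 1) + exp E * (\<Sum>j<m. (tht j)\<^sup>2)) * e"
proof -
 define T where "T x i = (\<Sum>j<m. tht j * blk (real j * hh) (real (Suc j) * hh) x i)" for x i
 have B0: "B >= 0" by (simp add: B_def sum_nonneg)
 have U0: "U >= 0" using hh by (simp add: U_def)
 have Tm [measurable]: "(%x. T x i) \<in> borel_measurable seqM" for i unfolding T_def by measurable
 have Tn: "nonanticipating i (%x. T x i)" for i
 proof (rule naI)
  fix x y :: "nat => int \<times> real" assume xy: "\<forall>l<i. x l = y l"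
  show "T x i = T y i" unfolding T_def naD[OF nonanticipating_blk xy] ..
 qed
 have TB: "\<bar>T x i\<bar> <= B * blk 0 U x i" for x i
 proof -
  have "\<bar>T x i\<bar> <= (\<Sum>j<m. \<bar>tht j * blk (real j * hh) (real (Suc j) * hh) x i\<bar>)" unfolding T_def by (rule sum_abs)
  also have "... <= (\<Sum>j<m. \<bar>tht j\<bar> * blk 0 U x i)"
  proof (rule sum_mono)
   fix j assume j: "j \<in> {..<m}"
   have "0 <= real j * hh" "real (Suc j) * hh <= real m * hh" using hh j by (auto intro!: mult_right_mono)
   then have "blk (real j * hh) (real (Suc j) * hh) x i <= blk 0 U x i" "0 <= blk (real j * hh) (real (Suc j) * hh) x i"
    by (auto simp: blk_def U_def)
   then show "\<bar>tht j * blk (real j * hh) (real (Suc j) * hh) x i\<bar> <= \<bar>tht j\<bar> * blk 0 U x i"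
    unfolding abs_mult by (intro mult_left_mono) auto
  qed
  finally show ?thesis by (simp add: B_def sum_distrib_right)
 qed
 \<comment> \<open>Distinct blocks are disjoint, so the mixed products vanish.\<close>
 have T2: "(T x i)\<^sup>2 = (\<Sum>j<m. (tht j)\<^sup>2 * blk (real j * hh) (real (Suc j) * hh) x i)" for x i
 proof -
  let ?b = "%j. blk (real j * hh) (real (Suc j) * hh) x i"
  have bb: "?b j * ?b j' = (if j' = j then ?b j else 0)" for j j'
  proof (cases "j = j'")
   case False
   have "real (Suc j) * hh <= real j' * hh \<or> real (Suc j') * hh <= real j * hh"
    using False hh by (cases "j < j'") (auto intro!: mult_right_mono)
   then show ?thesis using False by (auto simp: blk_def)
  qed (simp add: blk_def)
  have "(T x i)\<^sup>2 = (\<Sum>j<m. \<Sum>j'<m. (tht j * tht j') * (?b j * ?b j'))"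
   unfolding T_def power2_eq_square sum_product by (intro sum.cong refl) (simp add: algebra_simps)
  also have "... = (\<Sum>j<m. \<Sum>j'<m. if j' = j then (tht j)\<^sup>2 * ?b j else 0)"
   unfolding bb by (intro sum.cong refl) (simp add: power2_eq_square)
  also have "... = (\<Sum>j<m. (tht j)\<^sup>2 * ?b j)" by (simp add: sum.delta)
  finally show ?thesis .
 qed
 define C' where "C' = 3 * exp E * B ^ 3 * e"
 define C where "C = exp E + C' * (U + 1)"
 have C'0: "C' >= 0" using B0 e_pos by (simp add: C'_def)
 have E_eq: "E = B\<^sup>2 * (U + 1) / 2" by (simp add: E_def)
 note sc1 = supermart_cos(1)[where T=T and B=B and U=U and E=E and C'=C' and C=C and alp=alp, OF Tm Tn TB U0 B0 Be E_eq C'_def C_def]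
 have sc2: "(\<Sum>i<k. (T x i)\<^sup>2 * u x i) / 2 <= E" if "\<forall>i. valid (x i)" for x k
  by (rule supermart_cos(2)[where T=T and B=B and U=U and E=E and C'=C' and C=C, OF Tm Tn TB U0 B0 Be E_eq C'_def C_def])
   (rule spec[OF that])
 have sc3: "(\<Sum>i<k. blk 0 U x i * u x i) <= U + 1" if "\<forall>i. valid (x i)" for x k
  by (rule supermart_cos(3)[where T=T and B=B and U=U and E=E and C'=C' and C=C, OF Tm Tn TB U0 B0 Be E_eq C'_def C_def])
   (rule spec[OF that])
 \<comment> \<open>A deterministic index by which every valid trajectory has crossed clock level
   \<open>U\<close>; all blocks are complete there.\<close>
 define K where "K = km + nat \<lceil>U / e\<^sup>2\<rceil>"
 let ?V = "%x. (\<Sum>i<K. (T x i)\<^sup>2 * u x i) / 2" and ?R = "%x. (\<Sum>i<K. T x i * w x i) + alp" and ?O = "%x. \<Sum>i<K. blk 0 U x i * u x i"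
 let ?R' = "%x. (\<Sum>j<m. tht j * (Wg x (real (Suc j) * hh) - Wg x (real j * hh))) + alp"
 have sw: "(\<Sum>i<K. \<Sum>j<m. c j * blk (real j * hh) (real (Suc j) * hh) x i * f i) = (\<Sum>j<m. c j * ((\<Sum>i<cross x (real (Suc j) * hh). f i) - (\<Sum>i<cross x (real j * hh). f i)))"
  if v: "\<forall>i. valid (x i)" for x and f c :: "nat => real"
 proof -
  have "(\<Sum>i<K. \<Sum>j<m. c j * blk (real j * hh) (real (Suc j) * hh) x i * f i) = (\<Sum>j<m. c j * (\<Sum>i<K. blk (real j * hh) (real (Suc j) * hh) x i * f i))"
   by (subst sum.swap) (simp add: sum_distrib_left mult.assoc)
  also have "... = (\<Sum>j<m. c j * ((\<Sum>i<cross x (real (Suc j) * hh). f i) - (\<Sum>i<cross x (real j * hh). f i)))"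
  proof (intro sum.cong refl arg_cong2[where f="(*)"])
   fix j assume j: "j \<in> {..<m}"
   have le: "real j * hh <= real (Suc j) * hh" "real (Suc j) * hh <= U" using hh j by (auto simp: U_def intro!: mult_right_mono)
   have "cross x (real (Suc j) * hh) <= K" "cross x (real j * hh) <= K"
    using cross_mono[OF v le(2)] cross_mono[OF v le(1)] cross_bound[OF v, of U] unfolding K_def by linarith+
   then show "(\<Sum>i<K. blk (real j * hh) (real (Suc j) * hh) x i * f i) = (\<Sum>i<cross x (real (Suc j) * hh). f i) - (\<Sum>i<cross x (real j * hh). f i)"
    by (subst blk_sum[OF v le(1)]) (simp add: min_absorb2)
  qed
  finally show ?thesis .
 qed
 have RR: "?R x = ?R' x" if "\<forall>i. valid (x i)" for x
  unfolding T_def sum_distrib_right Wg_def Wk_def sw[OF that] ..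
 \<comment> \<open>A block has clock length \<open>hh\<close> up to the overshoots at its two ends,
   each of which lies between 0 and \<open>e\<close>.\<close>
 have VV: "\<bar>?V x - V0\<bar> <= (\<Sum>j<m. (tht j)\<^sup>2) * e" if v: "\<forall>i. valid (x i)" for x
 proof -
  have "?V x = (\<Sum>j<m. (tht j)\<^sup>2 * (up x (cross x (real (Suc j) * hh)) - up x (cross x (real j * hh)))) / 2"
   by (simp only: T2 sum_distrib_right uk_def sw[OF that])
  then have eq0: "?V x - V0 = (\<Sum>j<m. (tht j)\<^sup>2 * (up x (cross x (real (Suc j) * hh)) - up x (cross x (real j * hh)) - hh)) / 2"
  proof -
   assume eq: "?V x = (\<Sum>j<m. (tht j)\<^sup>2 * (up x (cross x (real (Suc j) * hh)) - up x (cross x (real j * hh)))) / 2"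
   have "V0 = (\<Sum>j<m. (tht j)\<^sup>2 * hh) / 2" by (simp add: V0_def sum_distrib_right)
   moreover have "(\<Sum>j<m. (tht j)\<^sup>2 * (up x (cross x (real (Suc j) * hh)) - up x (cross x (real j * hh)) - hh))
    = (\<Sum>j<m. (tht j)\<^sup>2 * (up x (cross x (real (Suc j) * hh)) - up x (cross x (real j * hh)))) - (\<Sum>j<m. (tht j)\<^sup>2 * hh)"
    by (subst sum_subtractf[symmetric]) (simp only: right_diff_distrib)
   ultimately show ?thesis unfolding eq diff_divide_distrib[symmetric] by simp
  qed
  have "\<bar>?V x - V0\<bar> <= (\<Sum>j<m. (tht j)\<^sup>2 * e) / 2"
  proof -
   have "\<bar>\<Sum>j<m. (tht j)\<^sup>2 * (up x (cross x (real (Suc j) * hh)) - up x (cross x (real j * hh)) - hh)\<bar> <= (\<Sum>j<m. (tht j)\<^sup>2 * e)"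
   proof (rule order_trans[OF sum_abs sum_mono])
    fix j
    have n: "0 <= real j * hh" "0 <= real (Suc j) * hh" using hh by auto
    have "\<bar>up x (cross x (real (Suc j) * hh)) - up x (cross x (real j * hh)) - hh\<bar> <= e"
     using up_cross[OF v, of "real (Suc j) * hh"] up_cross[OF v, of "real j * hh"] up_cross_le[OF v n(1)] up_cross_le[OF v n(2)]
     unfolding of_nat_Suc distrib_right by (simp add: abs_le_iff)
    then show "\<bar>(tht j)\<^sup>2 * (up x (cross x (real (Suc j) * hh)) - up x (cross x (real j * hh)) - hh)\<bar> <= (tht j)\<^sup>2 * e"
     unfolding abs_mult by (simp add: mult_left_mono)
   qed
   then show ?thesis unfolding eq0 by simp
  qed
  also have "... <= (\<Sum>j<m. (tht j)\<^sup>2) * e"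
  proof -
   have "0 <= (\<Sum>j<m. (tht j)\<^sup>2) * e" using e_pos by (intro mult_nonneg_nonneg sum_nonneg) auto
   moreover have "(\<Sum>j<m. (tht j)\<^sup>2 * e) = (\<Sum>j<m. (tht j)\<^sup>2) * e" by (simp add: sum_distrib_right)
   ultimately show ?thesis by linarith
  qed
  finally show ?thesis .
 qed
 have V0E: "V0 <= E"
 proof -
  have "(\<Sum>j<m. (tht j)\<^sup>2) <= B\<^sup>2"
  proof -
   have "(\<Sum>j<m. (tht j)\<^sup>2) = (\<Sum>j<m. \<bar>tht j\<bar> * \<bar>tht j\<bar>)" by (simp add: power2_eq_square)
   also have "... <= (\<Sum>j<m. \<bar>tht j\<bar> * B)" unfolding B_def by (intro sum_mono mult_left_mono member_le_sum) auto
   finally show ?thesis by (simp add: B_def sum_distrib_right power2_eq_square)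
  qed
  moreover have "hh <= U + 1 \<or> m = 0"
  proof (cases m)
   case (Suc k)
   have "1 * hh <= real m * hh" using hh Suc by (intro mult_right_mono) auto
   then show ?thesis by (simp add: U_def)
  qed simp
  moreover have "V0 <= E" if "m = 0" using that U0 by (simp add: V0_def E_def)
  moreover have "V0 <= E" if "(\<Sum>j<m. (tht j)\<^sup>2) <= B\<^sup>2" "hh <= U + 1"
   unfolding V0_def E_def using that hh U0 by (intro divide_right_mono mult_mono) auto
  ultimately show ?thesis by blast
 qed
 let ?g = "%x. C + exp (?V x) * cos (?R x) - C' * ?O x"
 have sm: "(\<integral>\<^sup>+ om. ennreal (?g (X om)) \<partial>M) <= ennreal (C + cos alp)"
  using supermart_nn_integral_le[OF sc1, of K] by simp
 have C1: "C >= 1"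
 proof -
  have "1 <= exp E" unfolding E_def using U0 by simp
  moreover have "0 <= C' * (U + 1)" using C'0 U0 by simp
  ultimately show ?thesis unfolding C_def by linarith
 qed
 have pt: "AE om in M. 0 <= ?g (X om) & exp V0 * cos (?R' (X om)) + C <= ?g (X om) + (C' * (U + 1) + exp E * ((\<Sum>j<m. (tht j)\<^sup>2) * e))"
  using AE_valid
 proof eventually_elim
  case (elim om)
  then have v: "\<forall>i. valid (X om i)" by simp
  have V: "?V (X om) <= E" and O: "?O (X om) <= U + 1" using sc2[OF v] sc3[OF v] by auto
  \<comment> \<open>The random exponent is exchanged for the constant \<open>V0\<close>, at the
    price exp E times their difference.\<close>
  have "exp V0 * cos (?R' (X om)) - exp (?V (X om)) * cos (?R' (X om)) <= \<bar>exp V0 - exp (?V (X om))\<bar> * 1"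
   unfolding left_diff_distrib[symmetric]
   by (rule order_trans[OF abs_ge_self]) (unfold abs_mult, intro mult_left_mono, auto)
  also have "... <= exp E * \<bar>V0 - ?V (X om)\<bar>" using abs_exp_diff_le[OF V0E V] by simp
  also have "... <= exp E * ((\<Sum>j<m. (tht j)\<^sup>2) * e)" using VV[OF v] by (intro mult_left_mono) (auto simp: abs_minus_commute)
  finally have 1: "exp V0 * cos (?R' (X om)) <= exp (?V (X om)) * cos (?R (X om)) + exp E * ((\<Sum>j<m. (tht j)\<^sup>2) * e)"
   unfolding RR[OF v] by simp
  have 2: "C' * ?O (X om) <= C' * (U + 1)" using O C'0 by (intro mult_left_mono) auto
  have "0 <= ?g (X om)" using supermartD(3)[OF sc1, of K "X om"] v by simp
  then show ?case using 1 2 by linarith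
 qed
 define d where "d = C' * (U + 1) + exp E * ((\<Sum>j<m. (tht j)\<^sup>2) * e)"
 have int_g: "integrable M (%om. ?g (X om))"
 proof (rule integrableI_nonneg)
  show "AE om in M. 0 <= ?g (X om)" using pt by eventually_elim auto
  show "(\<integral>\<^sup>+ om. ennreal (?g (X om)) \<partial>M) < \<infinity>" using sm by (rule le_less_trans) simp
 qed measurable
 have "(\<integral>om. ?g (X om) \<partial>M) <= C + cos alp"
 proof -
  have "ennreal (\<integral>om. ?g (X om) \<partial>M) = (\<integral>\<^sup>+ om. ennreal (?g (X om)) \<partial>M)"
   by (rule nn_integral_eq_integral[symmetric, OF int_g]) (use pt in eventually_elim, auto)
  then have "ennreal (\<integral>om. ?g (X om) \<partial>M) <= ennreal (C + cos alp)" using sm by simp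
  moreover have "C + cos alp >= 0" using C1 cos_ge_minus_one[of alp] by linarith
  ultimately show ?thesis by simp
 qed
 moreover have int_c: "integrable M (%om. cos (?R' (X om)))"
  by (rule integrable_const_bound[of _ 1]) auto
 have "(\<integral>om. exp V0 * cos (?R' (X om)) + C \<partial>M) <= (\<integral>om. ?g (X om) + d \<partial>M)"
  by (rule integral_mono_AE) (use int_c int_g pt in \<open>auto simp: d_def\<close>)
 then have "exp V0 * (\<integral>om. cos (?R' (X om)) \<partial>M) + C <= (\<integral>om. ?g (X om) \<partial>M) + d"
  using int_c int_g by (simp add: prob_space)
 ultimately have *: "exp V0 * (\<integral>om. cos (?R' (X om)) \<partial>M) <= cos alp + d" by linarith
 have d0: "d >= 0" unfolding d_def using C'0 U0 e_pos by (intro add_nonneg_nonneg mult_nonneg_nonneg sum_nonneg) auto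
 have V00: "V0 >= 0" unfolding V0_def using hh by (simp add: sum_nonneg)
 have "(\<integral>om. cos (?R' (X om)) \<partial>M) = exp (- V0) * (exp V0 * (\<integral>om. cos (?R' (X om)) \<partial>M))" by (simp flip: mult.assoc exp_add)
 also have "... <= exp (- V0) * (cos alp + d)" using * by (intro mult_left_mono) auto
 also have "... <= exp (- V0) * cos alp + d" using mult_right_mono[of "exp (- V0)" 1 d] d0 V00 by (simp add: distrib_left)
 also have "d = (3 * exp E * B ^ 3 * (U + 1) + exp E * (\<Sum>j<m. (tht j)\<^sup>2)) * e"
  by (simp add: d_def C'_def algebra_simps)
 finally show ?thesis .
qed

end

section \<open>From characteristic functions to Lipschitz functions of finitely many
  increments\<close>

inductive trig_poly :: "nat => ((nat => real) => real) => bool" for m where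
 trig_cos: "trig_poly m (%w. cos ((\<Sum>i<m. tht i * w i) + alp))"
| trig_add: "trig_poly m f ==> trig_poly m g ==> trig_poly m (%w. f w + g w)"
| trig_scale: "trig_poly m f ==> trig_poly m (%w. c * f w)"

lemma trig_const: "trig_poly m (%w. c)"
 using trig_scale[OF trig_cos[of m "%_. 0" 0], of c] by simp

text \<open>Products of cosines are sums of cosines, so these functions form an algebra, as the
  Stone-Weierstrass theorem requires.\<close>

lemma trig_mult:
 assumes f: "trig_poly m f" and g: "trig_poly m g"
 shows "trig_poly m (%w. f w * g w)"
 using f
proof induction
 case (trig_cos tht alp)
 show ?case
  using g
 proof induction
  case (trig_cos tht' alp')
  let ?a = "%w. (\<Sum>i<m. tht i * w i) + alp" and ?b = "%w. (\<Sum>i<m. tht' i * w i) + alp'"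
  have "cos (?a w) * cos (?b w) = 1/2 * cos ((\<Sum>i<m. (tht i - tht' i) * w i) + (alp - alp')) + 1/2 * cos ((\<Sum>i<m. (tht i + tht' i) * w i) + (alp + alp'))" for w
  proof -
   have "(\<Sum>i<m. (tht i - tht' i) * w i) + (alp - alp') = ?a w - ?b w" "(\<Sum>i<m. (tht i + tht' i) * w i) + (alp + alp') = ?a w + ?b w"
    by (simp_all add: left_diff_distrib distrib_right sum_subtractf sum.distrib)
   then show ?thesis by (simp only: cos_times_cos) (simp add: add_divide_distrib)
  qed
  moreover have "trig_poly m (%w. 1/2 * cos ((\<Sum>i<m. (tht i - tht' i) * w i) + (alp - alp')) + 1/2 * cos ((\<Sum>i<m. (tht i + tht' i) * w i) + (alp + alp')))"
   by (intro trig_poly.trig_add trig_poly.trig_scale trig_poly.trig_cos)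
  ultimately show ?case by simp
 next
  case (trig_add f g)
  then show ?case using trig_poly.trig_add[OF trig_add.IH] by (simp add: distrib_left)
 next
  case (trig_scale f c)
  then show ?case using trig_poly.trig_scale[OF trig_scale.IH, of c] by (simp add: algebra_simps)
 qed
next
 case (trig_add f g)
 then show ?case using trig_poly.trig_add[OF trig_add.IH] by (simp add: distrib_right)
next
 case (trig_scale f c)
 then show ?case using trig_poly.trig_scale[OF trig_scale.IH, of c] by (simp add: algebra_simps)
qed

lemma trig_poly_bounded: "trig_poly m f ==> \<exists>C. \<forall>w. \<bar>f w\<bar> <= C"
proof (induction rule: trig_poly.induct)
 case (trig_cos tht alp)
 then show ?case by (auto intro!: exI[of _ 1])
next
 case (trig_add f g)
 then obtain C C' where "\<forall>w. \<bar>f w\<bar> <= C" "\<forall>w. \<bar>g w\<bar> <= C'" by auto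
 then have "\<bar>f w + g w\<bar> <= C + C'" for w using abs_triangle_ineq[of "f w" "g w"] by (meson add_mono order_trans)
 then show ?case by blast
next
 case (trig_scale f c)
 then obtain C where "\<forall>w. \<bar>f w\<bar> <= C" by auto
 then have "\<bar>c * f w\<bar> <= \<bar>c\<bar> * C" for w by (simp add: abs_mult mult_left_mono)
 then show ?case by blast
qed

lemma trig_poly_measurable:
 assumes "trig_poly m f" "!!i. (%om. V om i) \<in> borel_measurable P"
 shows "(%om. f (V om)) \<in> borel_measurable P"
 using assms(1)
proof induction
 case (trig_cos tht alp)
 note assms(2)[measurable]
 show ?case by measurable
qed (auto intro!: borel_measurable_add borel_measurable_times)

lemma trig_poly_tendsto:
 fixes P :: "nat => 'a measure" and Q :: "'b measure"
 assumes P: "!!n. prob_space (P n)" and Q: "prob_space Q"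
  and V: "!!n i. (%om. V n om i) \<in> borel_measurable (P n)" and Z: "!!i. (%om. Z om i) \<in> borel_measurable Q"
  and char: "!!tht alp. (%n. \<integral>om. cos ((\<Sum>i<m. tht i * V n om i) + alp) \<partial>P n) \<longlonglongrightarrow> (\<integral>om. cos ((\<Sum>i<m. tht i * Z om i) + alp) \<partial>Q)"
  and T: "trig_poly m T"
 shows "(%n. \<integral>om. T (V n om) \<partial>P n) \<longlonglongrightarrow> (\<integral>om. T (Z om) \<partial>Q)"
 using T
proof induction
 case (trig_cos tht alp)
 then show ?case by (rule char)
next
 case (trig_add f g)
 have i: "integrable (P n) (%om. h (V n om))" "integrable Q (%om. h (Z om))" if h: "trig_poly m h" for n h
 proof -
  interpret p: prob_space "P n" by (rule P)
  interpret q: prob_space Q by (rule Q)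
  obtain C where C: "\<forall>w. \<bar>h w\<bar> <= C" using trig_poly_bounded[OF h] by auto
  show "integrable (P n) (%om. h (V n om))" by (rule p.integrable_const_bound[of _ C]) (use C trig_poly_measurable[OF h V] in auto)
  show "integrable Q (%om. h (Z om))" by (rule q.integrable_const_bound[of _ C]) (use C trig_poly_measurable[OF h Z] in auto)
 qed
 show ?case using trig_add i by (simp add: tendsto_add)
next
 case (trig_scale f c)
 then show ?case by (simp add: tendsto_mult)
qed

text \<open>The substitution s = sin(c w) sends the coordinates to a compact cube, where
  Stone-Weierstrass applies to \<open>Gm\<close> composed with arcsin. The approximation inverts the
  substitution only on [-R, R]; elsewhere the value of \<open>T\<close> is still close to the value
  of \<open>Gm\<close> at some other point \<open>z\<close>, so \<open>T\<close> inherits the bound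
  of \<open>Gm\<close> globally.\<close>

lemma trig_approx:
 fixes Gm :: "(nat => real) => real"
 assumes Gm: "continuous_on UNIV Gm" and R: "R > 0" and e: "e > 0"
 shows "\<exists>T. trig_poly m T & (\<forall>w. \<exists>z. \<bar>Gm z - T w\<bar> < e & ((\<forall>i<m. \<bar>w i\<bar> <= R) --> (\<forall>i<m. z i = w i)))"
proof -
 \<comment> \<open>This makes the sine injective on exactly the range [-R, R].\<close>
 define c where "c = pi / (2 * R)"
 \<comment> \<open>Coordinates from \<open>m\<close> on are pinned to 0; otherwise the available
   functions would not separate points.\<close>
 define S where "S = (\<Pi>\<^sub>E i\<in>(UNIV::nat set). if i < m then {-1..1} else {0::real})"
 have "compactin (product_topology (%i. euclidean) UNIV) S"
  unfolding S_def compactin_PiE by auto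
 then have "compact S" unfolding euclidean_product_topology by simp
 define sn where "sn w i = (if i < m then sin (c * w i) else 0)" for w :: "nat => real" and i
 have snS: "sn w \<in> S" for w by (auto simp: sn_def S_def)
 define as where "as s i = (if i < m then arcsin (s i) / c else 0)" for s :: "nat => real" and i
 have c0: "c > 0" using R by (simp add: c_def)
 have cont_as: "continuous_on S as"
 proof (rule continuous_on_coordinatewise_then_product)
  fix i
  show "continuous_on S (%s. as s i)"
  proof (cases "i < m")
   case True
   have "continuous_on S (%s. arcsin (s i))"
   proof (rule continuous_on_arcsin)
    show "continuous_on S (%s. s i)" by (rule continuous_on_subset[OF continuous_on_product_coordinates]) simp
    show "\<forall>s\<in>S. -1 <= s i & s i <= 1"
    proof
     fix s assume "s \<in> S"
     then have "s i \<in> (if i < m then {-1..1} else {0})" unfolding S_def by blast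
     then show "-1 <= s i & s i <= 1" using True by simp
    qed
   qed
   then show ?thesis using True c0 by (simp add: as_def continuous_on_divide)
  qed (simp add: as_def)
 qed
 have cont: "continuous_on S (%s. Gm (as s))"
  by (rule continuous_on_compose2[OF Gm cont_as]) auto
 let ?P = "%f. continuous_on S f & trig_poly m (%w. f (sn w))"
 have "\<exists>g. ?P g & (\<forall>s\<in>S. \<bar>Gm (as s) - g s\<bar> < e)"
 proof (rule Stone_Weierstrass_HOL[where P="?P", OF \<open>compact S\<close> _ _ _ _ _ cont e])
  show "?P (%x. a)" for a by (simp add: trig_const)
  show "?P f ==> continuous_on S f" for f by simp
  show "?P f & ?P g ==> ?P (%x. f x + g x)" for f g by (auto intro!: continuous_on_add trig_add)
  show "?P f & ?P g ==> ?P (%x. f x * g x)" for f g by (auto intro!: continuous_on_mult trig_mult)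
  fix x y assume "x \<in> S & y \<in> S & x ~= y"
  then obtain i where i: "x i ~= y i" "i < m" by (force simp: S_def PiE_iff fun_eq_iff split: if_splits)
  have "trig_poly m (%w. sn w i)"
  proof -
   have "(\<Sum>l<m. (if l = i then c else 0) * w l) = c * w i" for w :: "nat => real"
    using i(2) by (simp add: if_distrib[of "%a. a * _"] sum.delta cong: if_cong)
   then have "sn w i = cos ((\<Sum>l<m. (if l = i then c else 0) * w l) + (- (pi / 2)))" for w
    using i(2) by (simp add: sn_def cos_diff)
   then show ?thesis using trig_cos[of m "%l. if l = i then c else 0" "- (pi / 2)"] by simp
  qed
  then show "\<exists>f. ?P f & f x ~= f y"
   using i by (intro exI[of _ "%s. s i"]) (auto intro: continuous_on_subset[OF continuous_on_product_coordinates])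
 qed
 then obtain g where g: "?P g" "!!s. s \<in> S ==> \<bar>Gm (as s) - g s\<bar> < e" by blast
 show ?thesis
 proof (intro exI[of _ "%w. g (sn w)"] conjI allI)
  show "trig_poly m (%w. g (sn w))" using g(1) by simp
  fix w :: "nat => real"
  have "as (sn w) i = w i" if "i < m" "\<bar>w i\<bar> <= R" for i
  proof -
   have "\<bar>c * w i\<bar> <= pi / 2" using that(2) R by (simp add: c_def abs_mult field_simps)
   then have "arcsin (sin (c * w i)) = c * w i" by (intro arcsin_sin) (auto simp: abs_le_iff)
   then show ?thesis using that(1) c0 by (simp add: as_def sn_def)
  qed
  then show "\<exists>z. \<bar>Gm z - g (sn w)\<bar> < e & ((\<forall>i<m. \<bar>w i\<bar> <= R) --> (\<forall>i<m. z i = w i))"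
   using g(2)[OF snS] by (intro exI[of _ "as (sn w)"]) auto
 qed
qed

lemma integral_approx:
 fixes p :: "'c measure" and Y :: "'c => nat => real"
 assumes p: "prob_space p" and Y[measurable]: "!!i. (%om. Y om i) \<in> borel_measurable p" and G[measurable]: "(%om. Gm (Y om)) \<in> borel_measurable p"
  and T[measurable]: "(%om. T (Y om)) \<in> borel_measurable p"
  and le: "measure p {om \<in> space p. \<not> (\<forall>i<m. \<bar>Y om i\<bar> <= R)} <= e"
  and pt: "!!w. \<bar>Gm w - T w\<bar> <= e + (2 * C + 1) * of_bool (\<not> (\<forall>i<m. \<bar>w i\<bar> <= R))"
  and bd: "!!w. \<bar>Gm w\<bar> <= C" and D: "!!w. \<bar>T w\<bar> <= D"
 shows "\<bar>(\<integral>om. Gm (Y om) \<partial>p) - (\<integral>om. T (Y om) \<partial>p)\<bar> <= e + (2 * C + 1) * e"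
proof -
 interpret prob_space p by (rule p)
 have C0: "C >= 0" using bd[of undefined] by linarith
 have i1: "integrable p (%om. Gm (Y om))" by (rule integrable_const_bound[of _ C]) (use bd in auto)
 have i2: "integrable p (%om. T (Y om))" by (rule integrable_const_bound[of _ D]) (use D in auto)
 define A where "A = {om \<in> space p. \<not> (\<forall>i<m. \<bar>Y om i\<bar> <= R)}"
 have [measurable]: "A \<in> sets p" unfolding A_def by measurable
 have i3: "integrable p (indicat_real A)" by (rule integrable_const_bound[of _ 1]) (auto simp: indicator_def)
 have "\<bar>(\<integral>om. Gm (Y om) \<partial>p) - (\<integral>om. T (Y om) \<partial>p)\<bar> = \<bar>\<integral>om. Gm (Y om) - T (Y om) \<partial>p\<bar>" using i1 i2 by simp
 also have "... <= (\<integral>om. \<bar>Gm (Y om) - T (Y om)\<bar> \<partial>p)" by (rule integral_abs_bound)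
 also have "... <= (\<integral>om. e + (2 * C + 1) * indicat_real A om \<partial>p)"
 proof (rule integral_mono)
  fix om assume "om \<in> space p"
  then show "\<bar>Gm (Y om) - T (Y om)\<bar> <= e + (2 * C + 1) * indicat_real A om" using pt[of "Y om"] by (auto simp: A_def indicator_def split: if_splits)
 qed (use i1 i2 i3 in auto)
 also have "... = e + (2 * C + 1) * measure p A" using i3 by (simp add: prob_space)
 also have "... <= e + (2 * C + 1) * e" using le C0 by (intro add_left_mono mult_left_mono) (auto simp: A_def)
 finally show ?thesis .
qed

text \<open>Convergence of cosines extends by linearity to trigonometric polynomials; tightness
  makes the region outside the cube negligible, where both \<open>Gm\<close> and its approximation
  are bounded.\<close>

lemma fdd_convergence:
 fixes P :: "nat => 'a measure" and Q :: "'b measure" and Gm :: "(nat => real) => real"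
 assumes P: "!!n. prob_space (P n)" and Q: "prob_space Q"
  and V[measurable]: "!!n i. (%om. V n om i) \<in> borel_measurable (P n)" and Z[measurable]: "!!i. (%om. Z om i) \<in> borel_measurable Q"
  and char: "!!tht alp. (%n. \<integral>om. cos ((\<Sum>i<m. tht i * V n om i) + alp) \<partial>P n) \<longlonglongrightarrow> (\<integral>om. cos ((\<Sum>i<m. tht i * Z om i) + alp) \<partial>Q)"
  and tight: "!!e. e > 0 ==> \<exists>R>0. (\<forall>\<^sub>F n in sequentially. measure (P n) {om \<in> space (P n). \<not> (\<forall>i<m. \<bar>V n om i\<bar> <= R)} <= e)
    & measure Q {om \<in> space Q. \<not> (\<forall>i<m. \<bar>Z om i\<bar> <= R)} <= e"
  and lip: "!!w w'. \<bar>Gm w - Gm w'\<bar> <= c * (\<Sum>i<m. \<bar>w i - w' i\<bar>)" and bd: "!!w. \<bar>Gm w\<bar> <= C"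
 shows "(%n. \<integral>om. Gm (V n om) \<partial>P n) \<longlonglongrightarrow> (\<integral>om. Gm (Z om) \<partial>Q)"
  and "(%om. Gm (V n om)) \<in> borel_measurable (P n)" and "(%om. Gm (Z om)) \<in> borel_measurable Q"
proof -
 have cont: "continuous_on UNIV Gm"
  unfolding continuous_on_def
 proof
  fix w0 :: "nat => real"
  have "((%w. c * (\<Sum>i<m. \<bar>w i - w0 i\<bar>)) \<longlongrightarrow> c * (\<Sum>i<m. \<bar>w0 i - w0 i\<bar>)) (at w0)"
  proof -
   have "continuous_on UNIV (%w. c * (\<Sum>i<m. \<bar>w i - w0 i\<bar>))"
    by (intro continuous_intros continuous_on_product_coordinates)
   then show ?thesis unfolding continuous_on_def by (elim ballE[of _ _ w0]) (simp_all del: sum_abs)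
  qed
  then have "((%w. c * (\<Sum>i<m. \<bar>w i - w0 i\<bar>)) \<longlongrightarrow> 0) (at w0)" by simp
  then have "((%w. Gm w - Gm w0) \<longlongrightarrow> 0) (at w0)"
   by (rule Lim_null_comparison[rotated]) (use lip in \<open>auto intro!: always_eventually\<close>)
  then show "(Gm \<longlongrightarrow> Gm w0) (at w0 within UNIV)" by (simp add: LIM_zero_iff)
 qed
 have mV: "V n \<in> borel_measurable (P n)" for n by (rule measurable_coordinatewise_then_product) (rule V)
 have mZ: "Z \<in> borel_measurable Q" by (rule measurable_coordinatewise_then_product) (rule Z)
 show m1[measurable]: "(%om. Gm (V n om)) \<in> borel_measurable (P n)" for n
  by (rule measurable_compose[OF mV borel_measurable_continuous_onI[OF cont]])
 show m2[measurable]: "(%om. Gm (Z om)) \<in> borel_measurable Q"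
  by (rule measurable_compose[OF mZ borel_measurable_continuous_onI[OF cont]])
 have C0: "C >= 0" using bd[of undefined] by linarith
 show "(%n. \<integral>om. Gm (V n om) \<partial>P n) \<longlonglongrightarrow> (\<integral>om. Gm (Z om) \<partial>Q)"
 proof (rule LIMSEQ_I)
  fix r :: real assume r: "r > 0"
  define e where "e = r / (4 * (1 + (2 * C + 1)))"
  have e0: "e > 0" using r C0 by (simp add: e_def)
  obtain R where R: "R > 0" "\<forall>\<^sub>F n in sequentially. measure (P n) {om \<in> space (P n). \<not> (\<forall>i<m. \<bar>V n om i\<bar> <= R)} <= e"
    "measure Q {om \<in> space Q. \<not> (\<forall>i<m. \<bar>Z om i\<bar> <= R)} <= e"
   using tight[OF e0] by auto
  obtain T where T: "trig_poly m T" "!!w. \<exists>z. \<bar>Gm z - T w\<bar> < min e 1 & ((\<forall>i<m. \<bar>w i\<bar> <= R) --> (\<forall>i<m. z i = w i))"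
   using trig_approx[OF cont R(1), of "min e 1" m] e0 by auto
  obtain D where bT: "!!w. \<bar>T w\<bar> <= D" using trig_poly_bounded[OF T(1)] by auto
  have pt: "\<bar>Gm w - T w\<bar> <= e + (2 * C + 1) * of_bool (\<not> (\<forall>i<m. \<bar>w i\<bar> <= R))" for w
  proof -
   obtain z where z: "\<bar>Gm z - T w\<bar> < min e 1" "(\<forall>i<m. \<bar>w i\<bar> <= R) --> (\<forall>i<m. z i = w i)" using T(2)[of w] by auto
   show ?thesis
   proof (cases "\<forall>i<m. \<bar>w i\<bar> <= R")
    case True
    \<comment> \<open>By \<open>lip\<close> the function \<open>Gm\<close> sees only the first
      \<open>m\<close> coordinates, so it agrees at \<open>w\<close> and \<open>z\<close> although
      these may differ later.\<close>
    then have "(\<Sum>i<m. \<bar>w i - z i\<bar>) = 0" using z(2) by simp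
    then have "Gm w = Gm z" using lip[of w z] by simp
    then show ?thesis using z True by simp
   next
    case False
    then show ?thesis using z bd[of z] bd[of w] e0 by (simp add: abs_le_iff) linarith
   qed
  qed
  have conv: "(%n. \<integral>om. T (V n om) \<partial>P n) \<longlonglongrightarrow> (\<integral>om. T (Z om) \<partial>Q)" by (rule trig_poly_tendsto[OF P Q V Z char T(1)])
  have "\<forall>\<^sub>F n in sequentially. \<bar>(\<integral>om. T (V n om) \<partial>P n) - (\<integral>om. T (Z om) \<partial>Q)\<bar> < r / 4"
   using tendstoD[OF conv, of "r / 4"] r by (simp add: dist_real_def)
  with R(2) have "\<forall>\<^sub>F n in sequentially. norm ((\<integral>om. Gm (V n om) \<partial>P n) - (\<integral>om. Gm (Z om) \<partial>Q)) < r"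
  proof eventually_elim
   case (elim n)
   have "e + (2 * C + 1) * e = e * (1 + (2 * C + 1))" by (simp add: algebra_simps)
   moreover have "(r / (4 * k)) * k = r / 4" if "k ~= 0" for k using that by simp
   from this[of "1 + (2 * C + 1)"] have "e * (1 + (2 * C + 1)) = r / 4" unfolding e_def using C0 by linarith
   ultimately have e1: "e + (2 * C + 1) * e = r / 4" by simp
   show ?case
    using integral_approx[OF P V m1 trig_poly_measurable[OF T(1) V] elim(1) pt bd bT] integral_approx[OF Q Z m2 trig_poly_measurable[OF T(1) Z] R(3) pt bd bT] elim(2) r unfolding e1 real_norm_def by linarith
  qed
  then show "\<exists>no. \<forall>n\<ge>no. norm ((\<integral>om. Gm (V n om) \<partial>P n) - (\<integral>om. Gm (Z om) \<partial>Q)) < r" by (simp add: eventually_sequentially)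
 qed
qed

lemma normal_char:
 assumes "prob_space N" and d: "distributed N lborel Y (normal_density 0 (sqrt h))" and h: "h > 0"
 shows "(\<integral>om. iexp (t * Y om) \<partial>N) = complex_of_real (exp (- (t\<^sup>2 * h) / 2))"
proof -
 interpret prob_space N by fact
 have s: "sqrt h > 0" using h by simp
 have Y[measurable]: "Y \<in> borel_measurable N" using d by (auto simp: distributed_def)
 have d': "distributed N lborel (%om. (Y om - 0) / sqrt h) std_normal_density"
  using d normal_standard_normal_convert[OF s, of Y 0] by simp
 then have "distr N lborel (%om. (Y om - 0) / sqrt h) = std_normal_distribution" by (simp add: distributed_distr_eq_density)
 then have eq: "distr N borel (%om. (Y om - 0) / sqrt h) = std_normal_distribution" by (metis distr_cong sets_lborel)
 have "(\<integral>om. iexp (t * Y om) \<partial>N) = (\<integral>om. iexp ((t * sqrt h) * ((Y om - 0) / sqrt h)) \<partial>N)" using s by (simp add: mult.assoc)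
 also have "... = (\<integral>z. iexp ((t * sqrt h) * z) \<partial>distr N borel (%om. (Y om - 0) / sqrt h))"
  by (subst integral_distr) auto
 also have "... = char std_normal_distribution (t * sqrt h)" unfolding eq char_def ..
 also have "... = complex_of_real (exp (- (t\<^sup>2 * h) / 2))" using h by (simp add: char_std_normal_distribution power_mult_distrib)
 finally show ?thesis .
qed

lemma brownian_cos:
 assumes B: "std_brownian_motion N B" and hh: "hh > 0"
 shows "(\<integral>om. cos ((\<Sum>j<m. tht j * (B om (real (Suc j) * hh) - B om (real j * hh))) + alp) \<partial>N)
  = exp (- ((\<Sum>j<m. (tht j)\<^sup>2) * hh / 2)) * cos alp"
proof -
 interpret prob_space N using B by (simp add: std_brownian_motion_def)
 let ?D = "%j om. B om (real (Suc j) * hh) - B om (real j * hh)"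
 have Bm[measurable]: "(%om. B om t) \<in> borel_measurable N" for t using B by (simp add: std_brownian_motion_def)
 have "strict_mono (%i. real i * hh)" using hh by (auto simp: strict_mono_def)
 then have "indep_vars (%_. borel) (%i om. ?D i om) UNIV"
  using B by (auto simp: std_brownian_motion_def dest!: spec[of _ "%i. real i * hh"])
 then have ind: "indep_vars (%_. borel) (%i om. ?D i om) {..<m}" by (rule indep_vars_subset) auto
 have ind2: "indep_vars (%_. borel) (%i om. iexp (tht i * ?D i om)) {..<m}"
  by (rule indep_vars_compose2[OF ind, of "%i z. iexp (tht i * z)"]) auto
 have int: "integrable N (%om. iexp (tht j * ?D j om))" for j
  by (rule integrable_const_bound[of _ 1]) auto
 have "distributed N lborel (?D j) (normal_density 0 (sqrt hh))" for j
 proof -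
  have "real (Suc j) * hh - real j * hh = hh" by (simp add: algebra_simps)
  moreover have "0 <= real j * hh & real j * hh < real (Suc j) * hh" using hh by auto
  ultimately show ?thesis using B unfolding std_brownian_motion_def by metis
 qed
 then have ch: "(\<integral>om. iexp (tht j * ?D j om) \<partial>N) = complex_of_real (exp (- ((tht j)\<^sup>2 * hh) / 2))" for j
  using normal_char[OF prob_space_axioms _ hh, of "?D j" "tht j"] by blast
 have "(\<integral>om. (\<Prod>j<m. iexp (tht j * ?D j om)) \<partial>N) = (\<Prod>j<m. \<integral>om. iexp (tht j * ?D j om) \<partial>N)"
  by (rule indep_vars_lebesgue_integral) (use ind2 int in auto)
 also have "... = complex_of_real (exp (\<Sum>j<m. - ((tht j)\<^sup>2 * hh) / 2))" unfolding ch by (simp add: exp_sum)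
 also have "(\<Sum>j<m. - ((tht j)\<^sup>2 * hh) / 2) = - ((\<Sum>j<m. (tht j)\<^sup>2) * hh / 2)"
  by (simp add: sum_distrib_right sum_divide_distrib sum_negf)
 finally have P: "(\<integral>om. (\<Prod>j<m. iexp (tht j * ?D j om)) \<partial>N) = complex_of_real (exp (- ((\<Sum>j<m. (tht j)\<^sup>2) * hh / 2)))" .
 have pr: "(\<Prod>j<m. iexp (tht j * ?D j om)) = iexp (\<Sum>j<m. tht j * ?D j om)" for om
  by (simp add: exp_sum[symmetric] sum_distrib_left)
 have ic: "integrable N (%om. iexp (\<Sum>j<m. tht j * ?D j om) * iexp alp)"
  by (rule integrable_const_bound[of _ 1]) (auto simp: norm_mult)
 have "(\<integral>om. cos ((\<Sum>j<m. tht j * ?D j om) + alp) \<partial>N) = (\<integral>om. Re (iexp (\<Sum>j<m. tht j * ?D j om) * iexp alp) \<partial>N)"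
  by (intro Bochner_Integration.integral_cong refl) (simp add: Re_exp Im_exp cos_add)
 also have "... = Re (\<integral>om. iexp (\<Sum>j<m. tht j * ?D j om) * iexp alp \<partial>N)" by (rule integral_Re[OF ic])
 also have "... = Re (complex_of_real (exp (- ((\<Sum>j<m. (tht j)\<^sup>2) * hh / 2))) * iexp alp)"
  using P unfolding pr by simp
 finally show ?thesis by (simp add: Re_exp)
qed

section \<open>The Bass-Burdzy flow of a single path and its stability\<close>

lemma integrable_indicator_Icc: "integrable lborel (indicat_real {s..t::real})"
 by (rule integrable_real_indicator) (auto simp: emeasure_lborel_Icc_eq)

text \<open>The difference quotients are bounded by the Lipschitz constant and converge to
  \<open>k\<close> off a null set, so dominated convergence applies. Their integrals are difference
  quotients of an antiderivative of \<open>f\<close>, which converge to the values of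
  \<open>f\<close>.\<close>

lemma lipschitz_FTC:
 fixes f k :: "real => real"
 assumes lip: "C-lipschitz_on {0..} f" and N: "N \<in> null_sets lborel"
  and d: "!!v. v > 0 ==> v \<notin> N ==> (f has_real_derivative k v) (at v)"
  and k[measurable]: "k \<in> borel_measurable borel" and st: "0 <= s" "s <= t"
 shows "(LINT v:{s..t}|lborel. k v) = f t - f s"
proof -
 define g where "g v = f (max 0 v)" for v
 have C0: "C >= 0" using lip by (rule lipschitz_on_nonneg)
 have glip: "\<bar>g v - g w\<bar> <= C * \<bar>v - w\<bar>" for v w
 proof -
  have "\<bar>g v - g w\<bar> <= C * \<bar>max 0 v - max 0 w\<bar>" using lipschitz_onD[OF lip, of "max 0 v" "max 0 w"] by (simp add: g_def dist_real_def)
  also have "... <= C * \<bar>v - w\<bar>" using C0 by (intro mult_left_mono) auto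
  finally show ?thesis .
 qed
 have gc: "isCont g v" for v
 proof -
  have "C-lipschitz_on UNIV g" using glip C0 by (intro lipschitz_onI) (auto simp: dist_real_def)
  then have "continuous_on UNIV g" by (rule lipschitz_on_continuous_on)
  then show ?thesis by (simp add: continuous_on_eq_continuous_at)
 qed
 obtain F where F: "!!v. (F has_real_derivative g v) (at v)"
  using einterval_antiderivative[of "-\<infinity>" \<infinity> g] gc by (auto simp: has_real_derivative_iff_has_vector_derivative)
 define h where "h n = 1 / real (Suc n)" for n
 have h0: "h n > 0" for n by (simp add: h_def)
 have hl: "h \<longlonglongrightarrow> 0" unfolding h_def by (rule LIMSEQ_Suc[OF lim_1_over_n])
 have dq: "(%n. (\<phi> (v + h n) - \<phi> v) / h n) \<longlonglongrightarrow> D" if "(\<phi> has_real_derivative D) (at v)" for \<phi> D v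
 proof -
  have "((%e. (\<phi> (v + e) - \<phi> v) / e) \<longlongrightarrow> D) (at 0)" using that by (simp add: DERIV_def)
  moreover have "filterlim h (at 0) sequentially" using hl h0 by (auto simp: filterlim_at intro!: always_eventually less_imp_neq[symmetric])
  ultimately show ?thesis by (rule filterlim_compose)
 qed
 define q where "q n v = (g (v + h n) - g v) / h n" for n v
 have gcont: "continuous_on A g" for A using gc by (simp add: continuous_at_imp_continuous_on)
 have qc: "continuous_on A (q n)" for A n
  unfolding q_def using h0[of n] by (intro continuous_intros continuous_on_compose2[OF gcont[of UNIV]]) auto
 have [measurable]: "q n \<in> borel_measurable borel" for n by (rule borel_measurable_continuous_onI[OF qc])
 have qb: "\<bar>q n v\<bar> <= C" for n v
  using glip[of "v + h n" v] h0[of n] by (simp add: q_def divide_le_eq)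
 have I: "(LINT v:{s..t}|lborel. q n v) = (F (t + h n) - F t) / h n - (F (s + h n) - F s) / h n" for n
 proof -
  have "((%v. (F (v + h n) - F v) / h n) has_real_derivative q n v) (at v)" for v
  proof -
   have "((%v. F (v + h n)) has_real_derivative g (v + h n)) (at v)"
    using F[of "v + h n"] by (simp add: DERIV_shift)
   then show ?thesis unfolding q_def by (intro DERIV_cdivide DERIV_diff F)
  qed
  then have "(q n has_integral (F (t + h n) - F t) / h n - (F (s + h n) - F s) / h n) {s..t}"
   using st(2) by (intro fundamental_theorem_of_calculus) (auto simp: has_real_derivative_iff_has_vector_derivative[symmetric] intro: has_field_derivative_at_within)
  then have "integral {s..t} (q n) = (F (t + h n) - F t) / h n - (F (s + h n) - F s) / h n" by (rule integral_unique)
  moreover have "set_integrable lborel {s..t} (q n)" unfolding set_integrable_def by (rule borel_integrable_compact) (auto intro: qc)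
  ultimately show ?thesis by (simp add: set_borel_integral_eq_integral(2))
 qed
 have "(%n. LINT v:{s..t}|lborel. q n v) \<longlonglongrightarrow> (LINT v:{s..t}|lborel. k v)"
  unfolding set_lebesgue_integral_def
 proof (rule integral_dominated_convergence[where w="%v. C * indicator {s..t} v"])
  show "integrable lborel (%v. C * indicator {s..t} v)" by (intro integrable_mult_right integrable_indicator_Icc)
  have "AE v in lborel. v \<notin> N & v ~= 0"
   using AE_not_in[OF N] AE_lborel_singleton[of 0] by eventually_elim auto
  then show "AE v in lborel. (%n. indicat_real {s..t} v *\<^sub>R q n v) \<longlonglongrightarrow> indicat_real {s..t} v *\<^sub>R k v"
  proof eventually_elim
   case (elim v)
   show ?case
   proof (cases "v \<in> {s..t}")
    case True
    then have v: "v > 0" using st elim by auto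
    have "(%n. (f (v + h n) - f v) / h n) \<longlonglongrightarrow> k v" by (rule dq[OF d]) (use v elim in auto)
    moreover have "(f (v + h n) - f v) / h n = q n v" for n using v h0[of n] by (simp add: q_def g_def max_def)
    ultimately show ?thesis using True by simp
   qed simp
  qed
  show "AE v in lborel. norm (indicat_real {s..t} v *\<^sub>R q n v) <= C * indicator {s..t} v" for n
   using qb by (auto simp: indicator_def)
 qed auto
 moreover have "(%n. LINT v:{s..t}|lborel. q n v) \<longlonglongrightarrow> g t - g s"
  unfolding I by (intro tendsto_diff dq F)
 ultimately show ?thesis using st LIMSEQ_unique by (fastforce simp: g_def max_def)
qed

text \<open>Almost sure properties of one sample. The differential equation holds simultaneously
  only for countably many starting points, hence the rational ones; the others are reached by
  continuity and monotonicity of the flow.\<close>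

locale bbflow =
 fixes b :: "real => real" and \<Psi> \<Lambda> :: "real => real => real" and \<xi> :: "real => real"
 assumes b_cont: "continuous_on {0..} b" and b0: "b 0 = 0"
  and Psi_cont: "continuous_on ({0..} \<times> UNIV) (%(u, y). \<Psi> u y)"
  and diffeo: "!!u. u >= 0 ==> incr_C1_diffeo (\<Psi> u)"
  and sol: "!!q. q \<in> \<rat> ==> bb_solution b q (%u. \<Psi> u q)"
  and Lam_cont: "continuous_on ({0..} \<times> UNIV) (%(u, y). \<Lambda> u y)"
  and xi_def: "!!v. \<xi> v = inv (\<Psi> v) (b v)"
  and occup: "!!u f. u >= 0 ==> f \<in> borel_measurable borel ==> bounded (range f) ==>
    set_lebesgue_integral lborel {0..u} (%v. f (\<xi> v)) = (\<integral>y. f y * \<Lambda> u y \<partial>lborel)"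
begin

lemma Psi_cont_y: "u >= 0 ==> continuous_on A (%y. \<Psi> u y)"
 by (rule continuous_on_compose2[OF Psi_cont, of A "%y. (u, y)", simplified]) (auto intro!: continuous_intros)

lemma Psi_cont_u: "continuous_on {0..} (%u. \<Psi> u y)"
 by (rule continuous_on_compose2[OF Psi_cont, of "{0..}" "%u. (u, y)", simplified]) (auto intro!: continuous_intros)

lemma Lam_cont_y: "u >= 0 ==> continuous_on A (%y. \<Lambda> u y)"
 by (rule continuous_on_compose2[OF Lam_cont, of A "%y. (u, y)", simplified]) (auto intro!: continuous_intros)

lemma Psi_less: "u >= 0 ==> y1 < y2 ==> \<Psi> u y1 < \<Psi> u y2"
 using diffeo[of u] unfolding incr_C1_diffeo_def by (metis DERIV_pos_imp_increasing)

lemma Psi_less_iff: "u >= 0 ==> \<Psi> u y1 < \<Psi> u y2 \<longleftrightarrow> y1 < y2"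
 using Psi_less[of u y1 y2] Psi_less[of u y2 y1] by (cases y1 y2 rule: linorder_cases) auto

lemma Psi_xi: "v >= 0 ==> \<Psi> v (\<xi> v) = b v"
 unfolding xi_def using diffeo[of v] by (simp add: incr_C1_diffeo_def bij_is_surj surj_f_inv_f)

lemma less_xi_iff: "v >= 0 ==> y < \<xi> v \<longleftrightarrow> \<Psi> v y < b v"
 using Psi_less_iff[of v y "\<xi> v"] Psi_xi[of v] by simp

lemma xi_less_iff: "v >= 0 ==> \<xi> v < y \<longleftrightarrow> b v < \<Psi> v y"
 using Psi_less_iff[of v "\<xi> v" y] Psi_xi[of v] by simp

lemma xi_eq_iff: "v >= 0 ==> \<xi> v = y \<longleftrightarrow> \<Psi> v y = b v"
 using less_xi_iff[of v y] xi_less_iff[of v y] by linarith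

definition hit :: "real => real set" where "hit y = {v. v >= 0 & \<Psi> v y = b v}"

text \<open>The occupation formula for the indicator of a single point: \<open>\<xi>\<close> spends
  no time at \<open>y\<close>, and being there means that the flow line of \<open>y\<close> meets
  the path.\<close>

lemma hit_null: "hit y \<in> null_sets lborel"
proof -
 have "{v \<in> {0..real n}. \<Psi> v y = b v} \<in> null_sets lborel" for n
 proof -
  let ?A = "{v \<in> {0..real n}. \<Psi> v y = b v}"
  have "closed ?A"
  proof -
   have "continuous_on {0..real n} (%v. \<Psi> v y - b v)"
    by (intro continuous_intros continuous_on_subset[OF Psi_cont_u] continuous_on_subset[OF b_cont]) auto
   then have "closed ({0..real n} \<inter> (%v. \<Psi> v y - b v) -` {0})" by (intro continuous_closed_preimage) auto
   moreover have "{0..real n} \<inter> (%v. \<Psi> v y - b v) -` {0} = ?A" by auto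
   ultimately show ?thesis by simp
  qed
  then have A[measurable]: "?A \<in> sets lborel" by simp
  have fin: "emeasure lborel ?A < \<infinity>"
   by (rule le_less_trans[OF emeasure_mono[of _ "{0..real n}"]]) auto
  have "set_lebesgue_integral lborel {0..real n} (%v. indicat_real {y} (\<xi> v)) = (\<integral>z. indicat_real {y} z * \<Lambda> (real n) z \<partial>lborel)"
   by (rule occup) (auto simp: indicator_def bounded_iff intro!: exI[of _ 1])
  also have "... = 0" by (rule integral_eq_zero_AE) (use AE_lborel_singleton[of y] in eventually_elim, auto)
  also have "set_lebesgue_integral lborel {0..real n} (%v. indicat_real {y} (\<xi> v)) = (\<integral>v. indicat_real ?A v \<partial>lborel)"
   unfolding set_lebesgue_integral_def by (intro Bochner_Integration.integral_cong refl) (auto simp: indicator_def xi_eq_iff)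
  finally have "measure lborel ?A = 0" using fin by simp
  then have "emeasure lborel ?A = 0" using fin by (simp add: emeasure_eq_ennreal_measure)
  then show ?thesis using A by (simp only: null_sets_def) simp
 qed
 then have "(\<Union>n. {v \<in> {0..real n}. \<Psi> v y = b v}) \<in> null_sets lborel" by (rule null_sets_UN)
 moreover have "(\<Union>n. {v \<in> {0..real n}. \<Psi> v y = b v}) = hit y"
  unfolding hit_def using real_arch_simple by auto
 ultimately show ?thesis by simp
qed

lemma measurable_side [measurable]:
 "Measurable.pred borel (%v. \<Psi> (max 0 v) y < b (max 0 v))" "Measurable.pred borel (%v. b (max 0 v) < \<Psi> (max 0 v) y)"
proof -
 have "continuous_on UNIV (%v. \<Psi> (max 0 v) y)" "continuous_on UNIV (%v. b (max 0 v))"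
  by (rule continuous_on_compose2[OF Psi_cont_u] continuous_on_compose2[OF b_cont], intro continuous_intros, auto)+
 then have [measurable]: "(%v. \<Psi> (max 0 v) y) \<in> borel_measurable borel" "(%v. b (max 0 v)) \<in> borel_measurable borel"
  by (auto intro: borel_measurable_continuous_onI)
 show "Measurable.pred borel (%v. \<Psi> (max 0 v) y < b (max 0 v))" "Measurable.pred borel (%v. b (max 0 v) < \<Psi> (max 0 v) y)" by measurable
qed

lemma set_integral_const_interval: "s <= t ==> (LINT v:{s..t}|lborel. (c::real)) = c * (t - s)"
 by (simp add: set_integral_const)

lemma rat_slopes:
 assumes q: "q \<in> \<rat>" and st: "0 <= s" "s <= t"
 shows "\<bar>\<Psi> t q - \<Psi> s q\<bar> <= t - s"
  and "(!!v. s <= v ==> v <= t ==> \<Psi> v q < b v) ==> \<Psi> t q - \<Psi> s q = t - s"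
  and "(!!v. s <= v ==> v <= t ==> b v < \<Psi> v q) ==> \<Psi> t q - \<Psi> s q = - (t - s)"
proof -
 obtain C where C: "C-lipschitz_on {0..} (%u. \<Psi> u q)" using sol[OF q] by (auto simp: bb_solution_def)
 define k :: "real => real" where "k v = (if \<Psi> (max 0 v) q < b (max 0 v) then 1 else -1)" for v
 have [measurable]: "k \<in> borel_measurable borel" unfolding k_def by measurable
 have "((%u. \<Psi> u q) has_real_derivative k v) (at v)" if "v > 0" "v \<notin> hit q" for v
  using sol[OF q] that by (cases "\<Psi> v q < b v") (auto simp: bb_solution_def hit_def k_def)
 then have I: "(LINT v:{s..t}|lborel. k v) = \<Psi> t q - \<Psi> s q"
  by (intro lipschitz_FTC[OF C hit_null]) (use st in auto)
 have sk: "set_integrable lborel {s..t} k" unfolding set_integrable_def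
  by (rule Bochner_Integration.integrable_bound[OF integrable_indicator_Icc[of s t]]) (auto simp: k_def indicator_def)
 have sc: "set_integrable lborel {s..t} (%_. c::real)" for c by (simp add: set_integrable_def integrable_indicator_Icc)
 have "(LINT v:{s..t}|lborel. k v) <= (LINT v:{s..t}|lborel. 1)" "(LINT v:{s..t}|lborel. -1) <= (LINT v:{s..t}|lborel. k v)"
  by (rule set_integral_mono[OF sk sc] set_integral_mono[OF sc sk], simp add: k_def)+
 then show "\<bar>\<Psi> t q - \<Psi> s q\<bar> <= t - s" unfolding I set_integral_const_interval[OF st(2)] by (auto simp: abs_le_iff)
 {
  assume a: "!!v. s <= v ==> v <= t ==> \<Psi> v q < b v"
  have "(LINT v:{s..t}|lborel. k v) = (LINT v:{s..t}|lborel. 1)"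
   by (rule set_lebesgue_integral_cong) (use a st in \<open>auto simp: k_def max_def\<close>)
  then show "\<Psi> t q - \<Psi> s q = t - s" unfolding I set_integral_const_interval[OF st(2)] by simp
 next
  assume a: "!!v. s <= v ==> v <= t ==> b v < \<Psi> v q"
  have "(LINT v:{s..t}|lborel. k v) = (LINT v:{s..t}|lborel. -1)"
   by (rule set_lebesgue_integral_cong) (use a st in \<open>auto simp: k_def max_def dest: less_imp_le leD\<close>)
  then show "\<Psi> t q - \<Psi> s q = - (t - s)" unfolding I set_integral_const_interval[OF st(2)] by simp
 }
qed

lemma rat_approx:
 fixes y :: real
 shows "\<exists>q. (\<forall>n. q n \<in> \<rat> & q n < y) & q \<longlonglongrightarrow> y" "\<exists>q. (\<forall>n. q n \<in> \<rat> & y < q n) & q \<longlonglongrightarrow> y"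
proof -
 have "\<exists>q\<in>\<rat>. y - 1 / real (Suc n) < q & q < y" for n by (rule Rats_dense_in_real) simp
 then obtain q where q: "!!n. q n \<in> \<rat>" "!!n. y - 1 / real (Suc n) < q n" "!!n. q n < y" by metis
 have l: "(%n. y - 1 / real (Suc n)) \<longlonglongrightarrow> y - 0" "(%n. y + 1 / real (Suc n)) \<longlonglongrightarrow> y + 0"
  by (intro tendsto_intros LIMSEQ_Suc[OF lim_1_over_n])+
 have "q \<longlonglongrightarrow> y" using l(1) by (intro tendsto_sandwich[of "%n. y - 1 / real (Suc n)" q sequentially "%_. y"]) (use q in \<open>auto intro!: always_eventually less_imp_le\<close>)
 then show "\<exists>q. (\<forall>n. q n \<in> \<rat> & q n < y) & q \<longlonglongrightarrow> y" using q by auto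
 have "\<exists>q\<in>\<rat>. y < q & q < y + 1 / real (Suc n)" for n by (rule Rats_dense_in_real) simp
 then obtain q where q: "!!n. q n \<in> \<rat>" "!!n. y < q n" "!!n. q n < y + 1 / real (Suc n)" by metis
 have "q \<longlonglongrightarrow> y" using l(2) by (intro tendsto_sandwich[of "%n. y" q sequentially "%n. y + 1 / real (Suc n)"]) (use q in \<open>auto intro!: always_eventually less_imp_le\<close>)
 then show "\<exists>q. (\<forall>n. q n \<in> \<rat> & y < q n) & q \<longlonglongrightarrow> y" using q by auto
qed

lemma Psi_tendsto: "u >= 0 ==> q \<longlonglongrightarrow> y ==> (%n. \<Psi> u (q n)) \<longlonglongrightarrow> \<Psi> u y"
 using continuous_on_tendsto_compose[OF Psi_cont_y[of u UNIV]] by auto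

lemma slope_le: "0 <= s ==> s <= t ==> \<bar>\<Psi> t y - \<Psi> s y\<bar> <= t - s"
proof -
 assume st: "0 <= s" "s <= t"
 obtain q where q: "\<forall>n. q n \<in> \<rat> & q n < y" "q \<longlonglongrightarrow> y" using rat_approx(1) by blast
 have "(%n. \<bar>\<Psi> t (q n) - \<Psi> s (q n)\<bar>) \<longlonglongrightarrow> \<bar>\<Psi> t y - \<Psi> s y\<bar>" using st q(2) by (intro tendsto_intros Psi_tendsto) auto
 then show ?thesis by (rule LIMSEQ_le_const2) (use q(1) rat_slopes(1) st in blast)
qed

text \<open>Approximating \<open>y\<close> by rationals from below keeps them on the same side of
  the path, by monotonicity of the flow; from above this would fail. The downward case approximates
  from above.\<close>

lemma slope_up:
 assumes st: "0 <= s" "s <= t" and below: "!!v. s <= v ==> v <= t ==> \<Psi> v y < b v"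
 shows "\<Psi> t y = \<Psi> s y + (t - s)"
proof -
 obtain q where q: "\<forall>n. q n \<in> \<rat> & q n < y" "q \<longlonglongrightarrow> y" using rat_approx(1) by blast
 have "(%n. \<Psi> t (q n) - \<Psi> s (q n)) \<longlonglongrightarrow> \<Psi> t y - \<Psi> s y" using st q(2) by (intro tendsto_intros Psi_tendsto) auto
 moreover have "\<Psi> t (q n) - \<Psi> s (q n) = t - s" for n
 proof (rule rat_slopes(2))
  fix v assume "s <= v" "v <= t"
  then show "\<Psi> v (q n) < b v" using less_trans[OF Psi_less[of v "q n" y] below[of v]] q(1) st by simp
 qed (use q(1) st in auto)
 ultimately show ?thesis using LIMSEQ_unique[OF _ tendsto_const] by fastforce
qed

lemma slope_down:
 assumes st: "0 <= s" "s <= t" and above: "!!v. s <= v ==> v <= t ==> b v < \<Psi> v y"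
 shows "\<Psi> t y = \<Psi> s y - (t - s)"
proof -
 obtain q where q: "\<forall>n. q n \<in> \<rat> & y < q n" "q \<longlonglongrightarrow> y" using rat_approx(2) by blast
 have "(%n. \<Psi> t (q n) - \<Psi> s (q n)) \<longlonglongrightarrow> \<Psi> t y - \<Psi> s y" using st q(2) by (intro tendsto_intros Psi_tendsto) auto
 moreover have "\<Psi> t (q n) - \<Psi> s (q n) = - (t - s)" for n
 proof (rule rat_slopes(3))
  fix v assume "s <= v" "v <= t"
  then show "b v < \<Psi> v (q n)" using less_trans[OF above[of v] Psi_less[of v y "q n"]] q(1) st by simp
 qed (use q(1) st in auto)
 ultimately show ?thesis using LIMSEQ_unique[OF _ tendsto_const] by fastforce
qed

lemma Psi_0: "\<Psi> 0 y = y"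
proof -
 obtain q where q: "\<forall>n. q n \<in> \<rat> & q n < y" "q \<longlonglongrightarrow> y" using rat_approx(1) by blast
 have "(%n. \<Psi> 0 (q n)) \<longlonglongrightarrow> \<Psi> 0 y" using q(2) by (intro Psi_tendsto) auto
 moreover have "\<Psi> 0 (q n) = q n" for n using sol[of "q n"] q(1) by (simp add: bb_solution_def)
 ultimately show ?thesis using q(2) LIMSEQ_unique by auto
qed


lemma deriv_u:
 assumes u: "u > 0" and ne: "\<Psi> u y ~= b u"
 shows "((%u. \<Psi> u y) has_real_derivative (if \<Psi> u y < b u then 1 else -1)) (at u)"
proof -
 have "continuous_on {0<..} (%v. b v - \<Psi> v y)"
  by (intro continuous_intros continuous_on_subset[OF Psi_cont_u] continuous_on_subset[OF b_cont]) auto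
 then have "isCont (%v. b v - \<Psi> v y) u" using u by (simp add: continuous_on_eq_continuous_at)
 then have c: "((%v. b v - \<Psi> v y) \<longlongrightarrow> b u - \<Psi> u y) (nhds u)"
  unfolding isCont_def using tendsto_at_iff_tendsto_nhds[of "%v. b v - \<Psi> v y" u] by simp
 have der: "((%v. \<Psi> v y) has_real_derivative D) (at u)"
  if d: "d > 0" "!!v. dist v u < d ==> P v" and eq: "!!s t. 0 <= s ==> s <= t ==> (!!v. s <= v ==> v <= t ==> P v) ==> \<Psi> t y = \<Psi> s y + D * (t - s)" for d D P
 proof -
  define d' where "d' = min d u"
  have d': "d' > 0" using d u by (simp add: d'_def)
  have e: "\<Psi> v y = \<Psi> u y + D * (v - u)" if "dist v u < d'" for v
  proof (cases "u <= v")
   case True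
   show ?thesis
   proof (rule eq)
    fix w assume "u <= w" "w <= v"
    then show "P w" using that by (intro d(2)) (simp add: d'_def dist_real_def)
   qed (use u True in auto)
  next
   case False
   have "\<Psi> u y = \<Psi> v y + D * (u - v)"
   proof (rule eq)
    fix w assume "v <= w" "w <= u"
    then show "P w" using that by (intro d(2)) (simp add: d'_def dist_real_def)
   qed (use that False in \<open>auto simp: d'_def dist_real_def\<close>)
   then show ?thesis by (simp add: algebra_simps)
  qed
  have "((%v. \<Psi> u y + D * (v - u)) has_real_derivative D) (at u)" by (auto intro!: derivative_eq_intros)
  then show ?thesis by (rule has_field_derivative_transform_within[OF _ d']) (use e in auto)
 qed
 show ?thesis
 proof (cases "\<Psi> u y < b u")
  case True
  then have "0 < b u - \<Psi> u y" by simp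
  from order_tendstoD(1)[OF c this] obtain d where d: "d > 0" "!!v. dist v u < d ==> 0 < b v - \<Psi> v y"
   unfolding eventually_nhds_metric by blast
  have "((%v. \<Psi> v y) has_real_derivative 1) (at u)"
  proof (rule der[where P="%v. 0 < b v - \<Psi> v y", OF d])
   fix s t :: real assume "0 <= s" "s <= t" "!!v. s <= v ==> v <= t ==> 0 < b v - \<Psi> v y"
   then show "\<Psi> t y = \<Psi> s y + 1 * (t - s)" using slope_up[of s t y] by simp
  qed
  then show ?thesis using True by simp
 next
  case False
  then have "b u - \<Psi> u y < 0" using ne by simp
  from order_tendstoD(2)[OF c this] obtain d where d: "d > 0" "!!v. dist v u < d ==> b v - \<Psi> v y < 0"
   unfolding eventually_nhds_metric by blast
  have "((%v. \<Psi> v y) has_real_derivative -1) (at u)"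
  proof (rule der[where P="%v. b v - \<Psi> v y < 0", OF d])
   fix s t :: real assume "0 <= s" "s <= t" "!!v. s <= v ==> v <= t ==> b v - \<Psi> v y < 0"
   then show "\<Psi> t y = \<Psi> s y + -1 * (t - s)" using slope_down[of s t y] by simp
  qed
  then show ?thesis using False by simp
 qed
qed

text \<open>Two flow lines move in parallel unless the path is between them; then they approach each
  other at speed two. The times when the path meets one of them form a null set.\<close>

lemma gap_change:
 assumes y: "y1 < y2" and st: "0 <= s" "s <= t"
 shows "\<Psi> t y2 - \<Psi> t y1 = \<Psi> s y2 - \<Psi> s y1 - 2 * (LINT v:{s..t}|lborel. indicat_real {y1<..<y2} (\<xi> v))"
proof -
 define k :: "real => real" where "k v = (if \<Psi> (max 0 v) y1 < b (max 0 v) & b (max 0 v) < \<Psi> (max 0 v) y2 then -2 else 0)" for v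
 have [measurable]: "k \<in> borel_measurable borel" unfolding k_def by measurable
 have "2-lipschitz_on {0..} (%u. \<Psi> u y2 - \<Psi> u y1)"
 proof (rule lipschitz_onI)
  fix u v :: real assume uv: "u \<in> {0..}" "v \<in> {0..}"
  have "\<bar>\<Psi> u y - \<Psi> v y\<bar> <= \<bar>u - v\<bar>" for y
   using slope_le[of u v y] slope_le[of v u y] uv by (cases "u <= v") (auto simp: abs_minus_commute)
  moreover have "\<bar>a - c - (a' - c')\<bar> <= 2 * r" if "\<bar>a - a'\<bar> <= r" "\<bar>c - c'\<bar> <= r" for a a' c c' r :: real using that by linarith
  ultimately show "dist (\<Psi> u y2 - \<Psi> u y1) (\<Psi> v y2 - \<Psi> v y1) <= 2 * dist u v" unfolding dist_real_def by blast
 qed simp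
 then have "(LINT v:{s..t}|lborel. k v) = (\<Psi> t y2 - \<Psi> t y1) - (\<Psi> s y2 - \<Psi> s y1)"
 proof (rule lipschitz_FTC[where N="hit y1 \<union> hit y2"])
  show "hit y1 \<union> hit y2 \<in> null_sets lborel" by (intro null_sets.Un hit_null)
  fix v assume v: "v > 0" "v \<notin> hit y1 \<union> hit y2"
  then have ne: "\<Psi> v y1 ~= b v" "\<Psi> v y2 ~= b v" by (auto simp: hit_def)
  have "((%u. \<Psi> u y2 - \<Psi> u y1) has_real_derivative (if \<Psi> v y2 < b v then 1 else -1) - (if \<Psi> v y1 < b v then 1 else -1)) (at v)"
   by (intro DERIV_diff deriv_u v ne)
  moreover have "(if \<Psi> v y2 < b v then 1 else -1) - (if \<Psi> v y1 < b v then 1 else -1) = k v"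
   using v(1) ne Psi_less[of v y1 y2] y by (auto simp: k_def)
  ultimately show "((%u. \<Psi> u y2 - \<Psi> u y1) has_real_derivative k v) (at v)" by simp
 qed (use st in auto)
 moreover have "(LINT v:{s..t}|lborel. k v) = (LINT v:{s..t}|lborel. -2 * indicat_real {y1<..<y2} (\<xi> v))"
 proof (rule set_lebesgue_integral_cong)
  have "k v = -2 * indicat_real {y1<..<y2} (\<xi> v)" if "v \<in> {s..t}" for v
   using that st less_xi_iff[of v y1] xi_less_iff[of v y2] by (auto simp: k_def indicator_def max_def)
  then show "\<forall>v. v \<in> {s..t} --> k v = -2 * indicat_real {y1<..<y2} (\<xi> v)" by blast
 qed simp
 moreover have "(LINT v:{s..t}|lborel. -2 * indicat_real {y1<..<y2} (\<xi> v)) = -2 * (LINT v:{s..t}|lborel. indicat_real {y1<..<y2} (\<xi> v))"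
  by (rule set_integral_mult_right)
 ultimately show ?thesis by linarith
qed

text \<open>The time the path spends between two flow lines is the integral of the occupation
  density between their labels. Together with \<open>gap_change\<close> this yields the space
  derivative of the flow.\<close>

lemma gap_Lam:
 assumes y: "y1 < y2" and u: "u >= 0"
 shows "((%y. 1 - 2 * \<Lambda> u y) has_integral \<Psi> u y2 - \<Psi> u y1) {y1..y2}"
proof -
 have ii: "set_integrable lborel {y1..y2} (%y. \<Lambda> u y)"
  unfolding set_integrable_def by (rule borel_integrable_compact) (auto intro: Lam_cont_y[OF u])
 have "(LINT v:{0..u}|lborel. indicat_real {y1<..<y2} (\<xi> v)) = (\<integral>y. indicat_real {y1<..<y2} y * \<Lambda> u y \<partial>lborel)"
  by (rule occup[OF u]) (auto simp: indicator_def bounded_iff intro!: exI[of _ 1])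
 also have "... = (LINT y:{y1..y2}|lborel. \<Lambda> u y)"
  unfolding set_lebesgue_integral_def
 proof (rule integral_cong_AE)
  show "AE y in lborel. indicat_real {y1<..<y2} y * \<Lambda> u y = indicat_real {y1..y2} y *\<^sub>R \<Lambda> u y"
   using AE_lborel_singleton[of y1] AE_lborel_singleton[of y2] by eventually_elim (auto simp: indicator_def)
  have [measurable]: "\<Lambda> u \<in> borel_measurable borel" by (rule borel_measurable_continuous_onI) (rule Lam_cont_y[OF u])
  show "(%y. indicat_real {y1<..<y2} y * \<Lambda> u y) \<in> borel_measurable lborel" "(%y. indicat_real {y1..y2} y *\<^sub>R \<Lambda> u y) \<in> borel_measurable lborel" by measurable
 qed
 also have "... = integral {y1..y2} (\<Lambda> u)" by (rule set_borel_integral_eq_integral(2)[OF ii])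
 finally have *: "(LINT v:{0..u}|lborel. indicat_real {y1<..<y2} (\<xi> v)) = integral {y1..y2} (\<Lambda> u)" .
 have "(\<Lambda> u has_integral integral {y1..y2} (\<Lambda> u)) {y1..y2}"
  by (intro integrable_integral integrable_continuous_interval Lam_cont_y[OF u])
 then have "((%y. 1 - 2 * \<Lambda> u y) has_integral (y2 - y1) - 2 * integral {y1..y2} (\<Lambda> u)) {y1..y2}"
  using y has_integral_const_real[of "1::real" y1 y2] by (intro has_integral_diff has_integral_mult_right) auto
 moreover have "\<Psi> u y2 - \<Psi> u y1 = (y2 - y1) - 2 * integral {y1..y2} (\<Lambda> u)"
  using gap_change[OF y order_refl u] unfolding * by (simp add: Psi_0)
 ultimately show ?thesis by simp
qed

lemma Psi_deriv: "u >= 0 ==> (\<Psi> u has_real_derivative 1 - 2 * \<Lambda> u y) (at y)"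
proof -
 assume u: "u >= 0"
 let ?g = "%y. 1 - 2 * \<Lambda> u y"
 have c: "continuous_on {y - 1..y + 1} ?g" by (intro continuous_intros Lam_cont_y[OF u])
 have "((%z. integral {y - 1..z} ?g) has_real_derivative ?g y) (at y within {y - 1..y + 1})"
  by (rule integral_has_real_derivative[OF c]) auto
 note d = this
 have eq: "integral {y - 1..z} ?g = \<Psi> u z - \<Psi> u (y - 1)" if z: "z \<in> {y - 1..y + 1}" for z
 proof (cases "z = y - 1")
  case False
  then have "y - 1 < z" using z by simp
  from gap_Lam[OF this u] show ?thesis by (rule integral_unique)
 qed simp
 have "((%z. \<Psi> u z - \<Psi> u (y - 1)) has_real_derivative ?g y) (at y within {y - 1..y + 1})"
  by (rule has_field_derivative_transform_within[OF d zero_less_one _ eq]) simp_all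
 then have "((%z. \<Psi> u z - \<Psi> u (y - 1)) has_real_derivative ?g y) (at y)"
  by (subst (asm) at_within_interior) (auto simp: interior_atLeastAtMost_real)
 then have "((%z. (\<Psi> u z - \<Psi> u (y - 1)) + \<Psi> u (y - 1)) has_real_derivative ?g y + 0) (at y)" by (intro DERIV_add DERIV_const)
 then show ?thesis by simp
qed

lemma Lam_less: "u >= 0 ==> 1 - 2 * \<Lambda> u y > 0"
proof -
 assume u: "u >= 0"
 obtain D where "(\<Psi> u has_real_derivative D) (at y)" "D > 0" using diffeo[OF u] unfolding incr_C1_diffeo_def by auto
 then show ?thesis using DERIV_unique[OF Psi_deriv[OF u, of y]] by auto
qed

text \<open>Deterministic stability of the equation: \<open>s\<close> is a discrete image,
  \<open>m\<close> the discrete martingale, and steps have relative speed error \<open>kap\<close>.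
  If \<open>s\<close> is above \<open>m\<close>, it descends at almost full speed, which the flow
  line cannot beat. If it is below \<open>m\<close> but exceeds the flow line by more than tht +
  \<eta>, then the flow line is below the path during the whole step and rises at full speed.
  Otherwise the excess after the step is at most tht + 3 \<eta>. So the excess never grows except
  through \<open>kap\<close>.\<close>

lemma compare_up:
 fixes s m u :: "nat => real"
 assumes u0: "u 0 = 0" and du: "!!k. k < K ==> u k <= u (Suc k) & u (Suc k) <= u k + \<eta>" and kap: "0 <= kap" "0 <= \<eta>" "0 <= tht"
  and close: "!!k v. k < K ==> u k <= v ==> v <= u (Suc k) ==> \<bar>m k - b v\<bar> <= tht"
  and up: "!!k. k < K ==> s (Suc k) - s k <= (1 + kap) * (u (Suc k) - u k)"
  and down: "!!k. k < K ==> s k > m k ==> s (Suc k) - s k <= - (1 - kap) * (u (Suc k) - u k)"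
  and k: "k <= K"
 shows "s k - \<Psi> (u k) y <= max (s 0 - y) (tht + 3 * \<eta>) + kap * u k & u k >= 0"
 using k
proof (induction k)
 case 0
 then show ?case by (simp add: u0 Psi_0)
next
 case (Suc k)
 let ?A = "max (s 0 - y) (tht + 3 * \<eta>)" and ?d = "u (Suc k) - u k"
 have k: "k < K" using Suc by simp
 have IH: "s k - \<Psi> (u k) y <= ?A + kap * u k" "u k >= 0" using Suc by auto
 have d: "0 <= ?d" "?d <= \<eta>" using du[OF k] by auto
 have sl: "\<bar>\<Psi> (u (Suc k)) y - \<Psi> (u k) y\<bar> <= ?d" using slope_le[of "u k" "u (Suc k)" y] IH(2) d by simp
 have "s (Suc k) - \<Psi> (u (Suc k)) y <= ?A + kap * u (Suc k)"
 proof (cases "s k > m k")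
  case True
  then show ?thesis using down[OF k True] sl IH by (simp add: algebra_simps)
 next
  case False
  show ?thesis
  proof (cases "s k - \<Psi> (u k) y > tht + \<eta>")
   case True
   have "\<Psi> (u (Suc k)) y = \<Psi> (u k) y + ?d"
   proof (rule slope_up)
    fix v assume v: "u k <= v" "v <= u (Suc k)"
    have "\<bar>\<Psi> v y - \<Psi> (u k) y\<bar> <= v - u k" using slope_le[of "u k" v y] v IH(2) by simp
    then show "\<Psi> v y < b v" using True False close[OF k v] v d by linarith
   qed (use IH(2) d in auto)
   then show ?thesis using up[OF k] IH by (simp add: algebra_simps)
  next
   case F: False
   have "0 <= kap * u k" using kap IH by simp
   moreover have "s (Suc k) <= s k + ?d + (kap * u (Suc k) - kap * u k)" using up[OF k] by (simp add: algebra_simps)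
   ultimately have "s (Suc k) - \<Psi> (u (Suc k)) y <= tht + 3 * \<eta> + kap * u (Suc k)" using F sl d by linarith
   then show ?thesis by linarith
  qed
 qed
 then show ?case using IH d by simp
qed

text \<open>Mirror image of \<open>compare_up\<close>, with the same three cases.\<close>

lemma compare_down:
 fixes s m u :: "nat => real"
 assumes u0: "u 0 = 0" and du: "!!k. k < K ==> u k <= u (Suc k) & u (Suc k) <= u k + \<eta>" and kap: "0 <= kap" "0 <= \<eta>" "0 <= tht"
  and close: "!!k v. k < K ==> u k <= v ==> v <= u (Suc k) ==> \<bar>m k - b v\<bar> <= tht"
  and up: "!!k. k < K ==> s (Suc k) - s k >= - (1 + kap) * (u (Suc k) - u k)"
  and down: "!!k. k < K ==> s k < m k ==> s (Suc k) - s k >= (1 - kap) * (u (Suc k) - u k)"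
  and k: "k <= K"
 shows "\<Psi> (u k) y - s k <= max (y - s 0) (tht + 3 * \<eta>) + kap * u k & u k >= 0"
 using k
proof (induction k)
 case 0
 then show ?case by (simp add: u0 Psi_0)
next
 case (Suc k)
 let ?A = "max (y - s 0) (tht + 3 * \<eta>)" and ?d = "u (Suc k) - u k"
 have k: "k < K" using Suc by simp
 have IH: "\<Psi> (u k) y - s k <= ?A + kap * u k" "u k >= 0" using Suc by auto
 have d: "0 <= ?d" "?d <= \<eta>" using du[OF k] by auto
 have sl: "\<bar>\<Psi> (u (Suc k)) y - \<Psi> (u k) y\<bar> <= ?d" using slope_le[of "u k" "u (Suc k)" y] IH(2) d by simp
 have "\<Psi> (u (Suc k)) y - s (Suc k) <= ?A + kap * u (Suc k)"
 proof (cases "s k < m k")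
  case True
  then show ?thesis using down[OF k True] sl IH by (simp add: algebra_simps)
 next
  case False
  show ?thesis
  proof (cases "\<Psi> (u k) y - s k > tht + \<eta>")
   case True
   have "\<Psi> (u (Suc k)) y = \<Psi> (u k) y - ?d"
   proof (rule slope_down)
    fix v assume v: "u k <= v" "v <= u (Suc k)"
    have "\<bar>\<Psi> v y - \<Psi> (u k) y\<bar> <= v - u k" using slope_le[of "u k" v y] v IH(2) by simp
    then show "b v < \<Psi> v y" using True False close[OF k v] v d by linarith
   qed (use IH(2) d in auto)
   then show ?thesis using up[OF k] IH by (simp add: algebra_simps)
  next
   case F: False
   have "0 <= kap * u k" using kap IH by simp
   moreover have "s k <= s (Suc k) + ?d + (kap * u (Suc k) - kap * u k)" using up[OF k] by (simp add: algebra_simps)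
   ultimately have "\<Psi> (u (Suc k)) y - s (Suc k) <= tht + 3 * \<eta> + kap * u (Suc k)" using F sl d by linarith
   then show ?thesis by linarith
  qed
 qed
 then show ?case using IH d by simp
qed

end

section \<open>Growth of the local time at the origin, number of jumps, good trajectories\<close>

definition clk :: "nat => (real => real) => (nat => int \<times> real) => nat => real" where
 "clk n L0 x k = (\<Sum>i<k. dclk n L0 x i)"

lemma measurable_clk [measurable]: "(%x. clk n L0 x k) \<in> borel_measurable seqM"
 unfolding clk_def by measurable

lemma dyadic_uniform_continuity:
 fixes f :: "real => real"
 assumes "continuous_on {-R..R} f" "eps > 0"
 shows "\<exists>m0. \<forall>m\<ge>m0. \<forall>y z. \<bar>y\<bar> <= R --> \<bar>z\<bar> <= R --> \<bar>y - z\<bar> <= 1 / 2 ^ m --> \<bar>f y - f z\<bar> <= eps"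
proof -
 have "uniformly_continuous_on {-R..R} f" using assms by (intro compact_uniformly_continuous) auto
 then obtain d where d: "d > 0" "!!y z. y \<in> {-R..R} ==> z \<in> {-R..R} ==> dist z y < d ==> dist (f z) (f y) < eps"
  using assms(2) unfolding uniformly_continuous_on_def by blast
 obtain m0 where m0: "(1 / 2) ^ m0 < d" using real_arch_pow_inv[OF d(1), of "1/2"] by auto
 show ?thesis
 proof (intro exI[of _ m0] allI impI)
  fix m y z assume m: "m0 <= m" and yz: "\<bar>y\<bar> <= R" "\<bar>z\<bar> <= R" "\<bar>y - z\<bar> <= 1 / 2 ^ m"
  have "1 / 2 ^ m <= (1 / 2 :: real) ^ m0" using power_decreasing[OF m, of "1/2::real"] by (simp add: power_one_over)
  then have "dist y z < d" using yz m0 by (simp add: dist_real_def)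
  then show "\<bar>f y - f z\<bar> <= eps" using d(2)[of z y] yz(1,2) by (simp add: dist_real_def abs_le_iff[of y] abs_le_iff[of z])
 qed
qed

text \<open>The log local time is ln L0 plus \<open>rho\<close>: the first is uniformly continuous
  on the window, the second has the dyadic modulus. The resolution \<open>m\<close> depends neither
  on \<open>n\<close> nor on time nor on the trajectory.\<close>

lemma ln_loc_osc:
 assumes L0: "continuous_on UNIV L0" "!!y. (L0::real => real) y > 0" and A: "A >= 0" and e: "eps > 0"
 shows "\<exists>m. \<forall>n\<ge>m. \<forall>x. (\<forall>i. valid (x i)) --> modulus_ok n L0 A r x -->
  (\<forall>k i j. \<bar>i\<bar> <= int r * 2 ^ n --> \<bar>j\<bar> <= int r * 2 ^ n --> \<bar>i - j\<bar> <= 2 ^ (n - m)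
    --> \<bar>ln (loc n L0 x k j) - ln (loc n L0 x k i)\<bar> <= eps)"
proof -
 obtain c where c: "c > 0" "!!y. \<bar>y\<bar> <= real r ==> L0 y >= c" using L0_lower_bound[OF L0, of "real r"] by auto
 have "continuous_on {-real r..real r} (%y. ln (L0 y))"
  using L0(2) by (intro continuous_on_ln continuous_on_subset[OF L0(1)]) (auto simp: less_imp_neq[symmetric])
 then obtain m0 where m0: "!!m y z. m >= m0 ==> \<bar>y\<bar> <= real r ==> \<bar>z\<bar> <= real r ==> \<bar>y - z\<bar> <= 1 / 2 ^ m ==> \<bar>ln (L0 y) - ln (L0 z)\<bar> <= eps / 2"
  using dyadic_uniform_continuity[of "real r" "%y. ln (L0 y)" "eps / 2"] e by auto
 have "\<forall>\<^sub>F m in sequentially. modulus A c m < eps / 2"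
  using e by (intro order_tendstoD(2)[OF modulus_tendsto]) auto
 then obtain m1 where m1: "!!m. m >= m1 ==> modulus A c m < eps / 2" unfolding eventually_sequentially by auto
 define m where "m = max m0 m1"
 show ?thesis
 proof (intro exI[of _ m] allI impI)
  fix n x k and i j :: int
  assume n: "m <= n" and v: "\<forall>i. valid (x i)" and ok: "modulus_ok n L0 A r x"
   and i: "\<bar>i\<bar> <= int r * 2 ^ n" "\<bar>j\<bar> <= int r * 2 ^ n" "\<bar>i - j\<bar> <= 2 ^ (n - m)"
  interpret traj n L0 x by standard (use L0 v in auto)
  have site: "\<bar>real_of_int l / 2 ^ n\<bar> <= real r" if "\<bar>l\<bar> <= int r * 2 ^ n" for l
  proof -
   have "real_of_int \<bar>l\<bar> <= real_of_int (int r * 2 ^ n)" using that by (simp only: of_int_le_iff)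
   then show ?thesis by (simp add: abs_divide divide_le_eq)
  qed
  have "real_of_int \<bar>i - j\<bar> <= real_of_int (2 ^ (n - m))" using i(3) by (simp only: of_int_le_iff)
  then have "\<bar>real_of_int i / 2 ^ n - real_of_int j / 2 ^ n\<bar> <= 2 ^ (n - m) / 2 ^ n"
   by (simp add: diff_divide_distrib[symmetric] abs_divide divide_right_mono)
  also have "2 ^ (n - m) / 2 ^ n = 1 / (2::real) ^ m" using n by (simp add: power_diff)
  finally have "\<bar>ln (L0 (real_of_int j / 2 ^ n)) - ln (L0 (real_of_int i / 2 ^ n))\<bar> <= eps / 2"
   using m0[of m "real_of_int j / 2 ^ n" "real_of_int i / 2 ^ n"] site[OF i(1)] site[OF i(2)] by (simp add: m_def abs_minus_commute)
  moreover have "\<bar>rho k j - rho k i\<bar> <= modulus A c m"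
  proof (cases "i <= j")
   case True
   then show ?thesis using i c n by (intro rho_modulus[OF ok _ _ A]) auto
  next
   case False
   then have "\<bar>rho k i - rho k j\<bar> <= modulus A c m" using i c n by (intro rho_modulus[OF ok _ _ A]) auto
   then show ?thesis by (simp add: abs_minus_commute)
  qed
  ultimately show "\<bar>ln (L k j) - ln (L k i)\<bar> <= eps" using m1[of m] unfolding rho_def loc_0 m_def by (auto simp: abs_if split: if_splits)
 qed
qed

lemma sum_ratio_bound:
 fixes a b eps :: real
 assumes "a > 0" "b > 0" "\<bar>ln a - ln b\<bar> <= eps"
 shows "\<bar>a - b\<bar> <= eps * (a + b)"
proof -
 have one: "p - q <= eps * (p + q)" if p: "p > 0" "q > 0" "ln p - ln q <= eps" "eps >= 0" for p q :: real
 proof -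
  have "1 - q / p <= eps" using ln_le_minus_one[of "q / p"] that by (simp add: ln_div)
  then have "p * (1 - q / p) <= p * eps" using p by (intro mult_left_mono) auto
  then have "p - q <= p * eps" using p by (simp add: right_diff_distrib)
  moreover have "0 <= eps * q" using p by simp
  ultimately show ?thesis by (simp add: algebra_simps)
 qed
 show ?thesis using one[of a b] one[of b a] assms by (auto simp: abs_le_iff algebra_simps)
qed

context traj begin

lemma dclk_pos: "dclk n L0 x k > 0" using sh_pos[of k 1] sh_pos[of k "-1"] by (simp add: dclk_def)

lemma clk_Suc: "clk n L0 x (Suc k) = clk n L0 x k + dclk n L0 x k" by (simp add: clk_def)

lemma clk_0: "clk n L0 x 0 = 0" by (simp add: clk_def)

lemma clk_mono: "k <= l ==> clk n L0 x k <= clk n L0 x l"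
 unfolding clk_def using dclk_pos by (intro sum_mono2) (auto simp: less_imp_le)

lemma clk_nonneg: "clk n L0 x k >= 0" using clk_mono[of 0 k] by (simp add: clk_0)

text \<open>Both losses contain the same factor from the occupied site; their ratio is the ratio of
  the local times of the two neighbours.\<close>

lemma shrink_asym:
 assumes "\<bar>ln (L k (pos x k + 1)) - ln (L k (pos x k - 1))\<bar> <= eps" and s: "sgm = 1 \<or> sgm = -1"
 shows "\<bar>sh k sgm - dclk n L0 x k\<bar> <= eps * dclk n L0 x k"
proof -
 define d where "d = 1 / L k (pos x k) - 1 / L (Suc k) (pos x k)"
 have d: "d > 0"
  using L_pos[of k "pos x k"] h_pos[of k] by (simp add: d_def loc_Suc frac_less2)
 have ln: "ln (1 / (2 ^ n * a) * d) = ln d - ln (2 ^ n) - ln a" if "a > 0" for a :: real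
 proof -
  have "ln (1 / (2 ^ n * a) * d) = ln (1 / (2 ^ n * a)) + ln d" using that d by (intro ln_mult_pos) auto
  also have "ln (1 / (2 ^ n * a)) = - ln (2 ^ n * a)" using that by (subst ln_div) auto
  also have "ln (2 ^ n * a) = ln (2 ^ n) + ln a" using that by (intro ln_mult_pos) auto
  finally show ?thesis by simp
 qed
 have "ln (sh k 1) - ln (sh k (-1)) = ln (L k (pos x k - 1)) - ln (L k (pos x k + 1))"
  unfolding sh_eq d_def[symmetric] ln[OF L_pos] by simp
 then have "\<bar>sh k 1 - sh k (-1)\<bar> <= eps * (sh k 1 + sh k (-1))"
  using assms(1) by (intro sum_ratio_bound sh_pos) simp
 moreover have "\<bar>a - (a + b) / 2\<bar> = \<bar>a - b\<bar> / 2" "\<bar>b - (a + b) / 2\<bar> = \<bar>a - b\<bar> / 2" for a b :: real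
  by (auto simp: abs_if field_simps)
 ultimately show ?thesis using s unfolding dclk_def by auto
qed

lemma shrink_le_dclk: "sh k sgm <= 2 * dclk n L0 x k" if "sgm = 1 \<or> sgm = -1"
 using that sh_pos[of k 1] sh_pos[of k "-1"] by (auto simp: dclk_def)

lemma S_change_le: "\<bar>S k j - scl0 n L0 j\<bar> <= 2 * clk n L0 x k"
proof (induction k)
 case (Suc k)
 have "\<bar>dscl n L0 x j k\<bar> <= 2 * dclk n L0 x k"
  using shrink_le_dclk[of 1 k] shrink_le_dclk[of "-1" k] sh_pos[of k 1] sh_pos[of k "-1"] dclk_pos[of k] by (auto simp: dscl_def)
 then show ?case using Suc by (simp add: scl_Suc clk_Suc abs_le_iff)
qed (simp add: scl_def clk_0)

lemma rho_unvisited: "(!!i. i < k ==> pos x i ~= j) ==> rho k j = 0"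
 by (simp add: rho_def loc_def)

lemma pos_0: "pos x 0 = 0" by (simp add: pos_def)

text \<open>Tanaka formula on a window whose far end has not been reached: nothing is gained there,
  so the local time gained at the origin accounts for the losses suffered to the right of it, up to
  fluctuation.\<close>

lemma rho_0_ge_pos:
 assumes j: "0 < j" and b: "!!i. i < k ==> pos x i < j"
 shows "rho k 0 / 2 >= - fluct n L0 0 j x k + (\<Sum>i<k. if 0 < pos x i then sh i (-1) else 0)"
proof -
 have "(\<Sum>i<k. if 0 < pos x i & pos x i <= j then sh i (-1) else 0) = (\<Sum>i<k. if 0 < pos x i then sh i (-1) else 0)"
  using b by (intro sum.cong) force+
 moreover have "phi 0 j 0 = 0" by (simp add: phi_def pos_0)
 moreover have "rho k j = 0" by (rule rho_unvisited) (use b in force)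
 ultimately show ?thesis using rho_fluct[OF j, of k] phi_bounds[OF j, of k] by simp
qed

text \<open>The formula is not symmetric: it counts left losses, and the walk now starts at the
  right end, where \<open>phi\<close> is the full length. The identity \<open>gap\<close> for that
  length converts the left losses into right ones.\<close>

lemma rho_0_ge_neg:
 assumes j: "j < 0" and b: "!!i. i < k ==> j < pos x i"
 shows "rho k 0 / 2 >= fluct n L0 j 0 x k + (\<Sum>i<k. if pos x i < 0 then sh i 1 else 0)"
proof -
 have gap: "scl0 n L0 0 - scl0 n L0 j - (S l 0 - S l j) = (\<Sum>i<l. if pos x i < 0 then sh i 1 else 0)
   + (\<Sum>i<l. if j < pos x i & pos x i <= 0 then sh i (-1) else 0)" if "l <= k" for l
  using that
 proof (induction l)
  case (Suc l)
  have "j < pos x l" using b[of l] Suc by simp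
  then show ?case using Suc gap_Suc[OF j, of l] by simp
 qed (simp add: scl_def)
 have "phi j 0 0 = scl0 n L0 0 - scl0 n L0 j" using j by (simp add: phi_def pos_0 scl_def)
 moreover have "rho k j = 0" by (rule rho_unvisited) (use b in force)
 ultimately show ?thesis using rho_fluct[OF j, of k] phi_bounds[OF j, of k] gap[of k] by simp
qed

text \<open>By \<open>asym\<close> each loss is at least half of the clock step, and the clock spent
  at 0 itself is at most 1. Adding the two sides gives clk/2 <= rho + clk/4 + 16 w + 1/2 for rho at
  the origin; solving for the clock yields the constants 4 and 64 w + 2.\<close>

lemma rho_0_growth:
 assumes j: "0 < j" and b: "!!i. i < k ==> \<bar>pos x i\<bar> < j"
  and asym: "!!i. i < k ==> \<bar>ln (L i (pos x i + 1)) - ln (L i (pos x i - 1))\<bar> <= 1 / 2"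
  and f1: "fluct n L0 0 j x k <= occ n L0 0 j x k / 8 + 8 * w"
  and f2: "- fluct n L0 (-j) 0 x k <= occ n L0 (-j) 0 x k / 8 + 8 * w"
  and e: "scl0 n L0 1 - scl0 n L0 (-1) <= 2"
 shows "clk n L0 x k <= 4 * rho k 0 + (64 * w + 2)"
proof -
 let ?P = "\<Sum>i<k. if 0 < pos x i then sh i (-1) else 0" and ?Q = "\<Sum>i<k. if pos x i < 0 then sh i 1 else 0"
 let ?Z = "\<Sum>i<k. if 0 <= pos x i & pos x i <= 0 then dclk n L0 x i else 0"
 have occ: "occ n L0 j1 j2 x k <= clk n L0 x k" for j1 j2
  unfolding occ_def clk_def using dclk_pos by (intro sum_mono) (auto simp: less_imp_le)
 have "clk n L0 x k / 2 <= ?P + ?Q + ?Z / 2"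
  unfolding clk_def sum_divide_distrib sum.distrib[symmetric]
 proof (rule sum_mono)
  fix i assume i: "i \<in> {..<k}"
  have "\<bar>sh i 1 - dclk n L0 x i\<bar> <= 1 / 2 * dclk n L0 x i" "\<bar>sh i (-1) - dclk n L0 x i\<bar> <= 1 / 2 * dclk n L0 x i"
   using i by (intro shrink_asym asym; simp)+
  then have "dclk n L0 x i / 2 <= sh i 1" "dclk n L0 x i / 2 <= sh i (-1)" by linarith+
  then show "dclk n L0 x i / 2 <= (if 0 < pos x i then sh i (-1) else 0) + (if pos x i < 0 then sh i 1 else 0)
   + (if 0 <= pos x i & pos x i <= 0 then dclk n L0 x i else 0) / 2"
   by auto
 qed
 moreover have "?Z <= 1" using clk_sum[of 0 0 k] e by simp
 moreover have "rho k 0 / 2 >= - fluct n L0 0 j x k + ?P" by (rule rho_0_ge_pos[OF j]) (use b in force)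
 moreover have "rho k 0 / 2 >= fluct n L0 (-j) 0 x k + ?Q" by (rule rho_0_ge_neg) (use b j in force)+
 ultimately show ?thesis using f1 f2 occ[of 0 j] occ[of "-j" 0] by argo
qed

end

context vrjp begin

text \<open>Unlike in \<open>prob_fluct_ge\<close>, the window is large and its clock must not enter
  the constant. The supermartingale with parameter 1/8 is therefore compared with a line of slope
  1/8 in the clock, so the probability is independent of the window.\<close>

lemma prob_fluct_drift:
 assumes j: "j1 < j2" and c: "c > 0" "!!j. j1 - 1 <= j ==> j <= j2 + 1 ==> L0 (real_of_int j / 2 ^ n) >= c"
  and c1: "1 <= 2 ^ n * c\<^sup>2" and s: "s = 1 \<or> s = (-1::real)"
 shows "prob {om \<in> space M. \<exists>k. s * fluct n L0 j1 j2 (X om) k > occ n L0 j1 j2 (X om) k / 8 + 8 * w} <= exp (- w)"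
proof -
 let ?g = "%k x. exp ((s / 8) * fluct n L0 j1 j2 x k - (s / 8)\<^sup>2 * occ n L0 j1 j2 x k)"
 have sm: "supermart ?g" using s c1 by (intro supermart_fluct[OF j c]) auto
 note supermartD(1)[OF sm, measurable]
 have "prob {om \<in> space M. \<exists>k. s * fluct n L0 j1 j2 (X om) k > occ n L0 j1 j2 (X om) k / 8 + 8 * w} <= prob {om \<in> space M. \<exists>k. ?g k (X om) >= exp w}"
 proof (rule finite_measure_mono)
  have "exp w <= ?g k (X om)" if "s * fluct n L0 j1 j2 (X om) k > occ n L0 j1 j2 (X om) k / 8 + 8 * w" for om k
  proof -
   have "(s / 8)\<^sup>2 = 1 / 64" using s by (auto simp: power2_eq_square)
   then show ?thesis using that unfolding \<open>(s / 8)\<^sup>2 = 1 / 64\<close> exp_le_cancel_iff by (simp add: field_simps)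
  qed
  then show "{om \<in> space M. \<exists>k. s * fluct n L0 j1 j2 (X om) k > occ n L0 j1 j2 (X om) k / 8 + 8 * w} \<subseteq> {om \<in> space M. \<exists>k. ?g k (X om) >= exp w}" by blast
 qed measurable
 also have "... <= ?g 0 (%_. (1, 1)) / exp w" by (rule supermart_ville[OF sm]) simp
 also have "... = exp (- w)" by (simp add: fluct_def occ_def exp_minus inverse_eq_divide)
 finally show ?thesis .
qed

text \<open>The expectation of exp(-Z) is 1/2 for a standard exponential variable Z, so 2^k times
  the exponential of minus the sum of the normalised holding times is a martingale. It bounds the
  number of jumps by that sum.\<close>

lemma prob_many_jumps:
 assumes C: "C > 0"
 shows "prob {om \<in> space M. \<exists>k. 2 ^ k >= C * exp (\<Sum>j<k. trate n L0 (X om) j * snd (X om j))} <= 1 / C"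
proof -
 let ?g = "%k x. 2 ^ k * exp (- (\<Sum>j<k. trate n L0 x j * snd (x j)))"
 have sm: "supermart ?g"
  unfolding supermart_def
 proof (intro allI conjI impI)
  fix k
  have [measurable]: "(%x. trate n L0 x j) \<in> borel_measurable seqM" for j unfolding trate_def by measurable
  show "?g k \<in> borel_measurable seqM" by measurable
  have na: "nonanticipating (Suc i) (%x. trate n L0 x i * snd (x i))" for i
  proof (rule naI)
   fix x y :: "nat => int \<times> real" assume xy: "\<forall>l<Suc i. x l = y l"
   then have "\<forall>l<i. x l = y l" "x i = y i" by auto
   then show "trate n L0 x i * snd (x i) = trate n L0 y i * snd (y i)" using naD[OF nonanticipating_rate(2)] by metis
  qed
  show "nonanticipating k (?g k)"
  proof (rule naI)
   fix x y :: "nat => int \<times> real" assume xy: "\<forall>l<k. x l = y l"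
   show "?g k x = ?g k y" unfolding naD[OF nonanticipating_sum[OF na] xy] ..
  qed
  fix x :: "nat => int \<times> real" assume v: "\<forall>i<k. valid (x i)"
  show "0 <= ?g k x" by simp
  let ?r = "trate n L0 x k" and ?C = "2 ^ Suc k * exp (- (\<Sum>j<k. trate n L0 x j * snd (x j)))"
  have r: "?r > 0" using rate_pos(2)[of L0 k x n] L0_pos v by auto
  have "step n L0 k (%y. ennreal (?g (Suc k) y)) x
   = (\<integral>\<^sup>+ s. indicator {0<..} s * (ennreal (?r * exp (- ?r * s)) * ennreal (?C * exp (- ?r * s))) \<partial>lborel)"
  proof (rule step_eq_exponential)
   fix sgm :: int and s :: real assume "sgm \<in> {1, -1}" "s > 0"
   have "(\<Sum>j<k. trate n L0 (x(k := (sgm, s))) j * snd ((x(k := (sgm, s))) j)) = (\<Sum>j<k. trate n L0 x j * snd (x j))"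
    by (rule naD[OF nonanticipating_sum[OF na]]) auto
   moreover have "trate n L0 (x(k := (sgm, s))) k = ?r" by (rule naD[OF nonanticipating_rate(2)]) auto
   ultimately show "ennreal (?g (Suc k) (x(k := (sgm, s)))) = ennreal (?C * exp (- ?r * s))"
    by (simp add: exp_diff exp_minus field_simps exp_add)
  qed (use v L0_pos in auto)
  \<comment> \<open>Multiplying the density by exp(- r s) gives one half of the density with rate 2
    r; the half cancels against the additional factor 2.\<close>
  also have "... = (\<integral>\<^sup>+ s. ennreal (?C / 2) * (indicator {0<..} s * ennreal ((2 * ?r) * exp (- (2 * ?r) * s))) \<partial>lborel)"
  proof (rule nn_integral_cong)
   fix s :: real
   have "exp (- (2 * ?r) * s) = exp (- ?r * s) * exp (- ?r * s)" by (simp add: exp_add[symmetric])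
   then have "(?r * exp (- ?r * s)) * (?C * exp (- ?r * s)) = ?C / 2 * ((2 * ?r) * exp (- (2 * ?r) * s))" by (simp add: algebra_simps)
   then have "ennreal (?r * exp (- ?r * s)) * ennreal (?C * exp (- ?r * s)) = ennreal (?C / 2) * ennreal ((2 * ?r) * exp (- (2 * ?r) * s))"
    using r by (simp only: ennreal_mult''[symmetric] exp_ge_zero mult_nonneg_nonneg zero_le_power less_imp_le zero_le_numeral divide_nonneg_nonneg)
   then show "indicator {0<..} s * (ennreal (?r * exp (- ?r * s)) * ennreal (?C * exp (- ?r * s))) = ennreal (?C / 2) * (indicator {0<..} s * ennreal ((2 * ?r) * exp (- (2 * ?r) * s)))"
    by (simp add: indicator_def)
  qed
  also have "... = ennreal (?C / 2) * (\<integral>\<^sup>+ s. indicator {0<..} s * ennreal ((2 * ?r) * exp (- (2 * ?r) * s)) \<partial>lborel)"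
   by (rule nn_integral_cmult) measurable
  also have "(\<integral>\<^sup>+ s. indicator {0<..} s * ennreal ((2 * ?r) * exp (- (2 * ?r) * s)) \<partial>lborel) = 1"
   using nn_integral_exp_tail[of "2 * ?r" 0] r by simp
  finally show "step n L0 k (%y. ennreal (?g (Suc k) y)) x <= ennreal (?g k x)" by simp
 qed
 note supermartD(1)[OF sm, measurable]
 have "{om \<in> space M. \<exists>k. 2 ^ k >= C * exp (\<Sum>j<k. trate n L0 (X om) j * snd (X om j))} = {om \<in> space M. \<exists>k. ?g k (X om) >= C}"
  by (simp add: exp_minus field_simps)
 then show ?thesis using supermart_ville[OF sm C] by simp
qed

end

text \<open>The constants \<open>A r\<close> and \<open>C\<close> do not depend on the window size
  \<open>s\<close>. This is essential: the clock and the range of the walk up to a fixed time must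
  be bounded before \<open>s\<close> tends to infinity. Only the number \<open>km\<close> of jumps
  may depend on \<open>s\<close> and \<open>n\<close>.\<close>

definition good :: "nat => (real => real) => (nat => real) => real => nat => nat => (nat => int \<times> real) => bool" where
 "good n L0 A C s km x \<longleftrightarrow> (\<forall>r\<le>Suc s. modulus_ok n L0 (A r) r x)
  & (\<forall>k. alive n s km x k --> clk n L0 x k <= 4 * (ln (loc n L0 x k 0) - ln (loc n L0 x 0 0)) + C)
  & (\<forall>k. (\<forall>i\<le>k. \<bar>pos x i\<bar> <= int s * 2 ^ n) --> (\<Sum>i<k. snd (x i)) <= real s --> k < km)"

lemma measurable_good [measurable]: "Measurable.pred seqM (good n L0 A C s km)"
proof -
 have [measurable]: "Measurable.pred seqM (%x. \<bar>pos x i\<bar> <= D)" for i D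
  using measurable_compose[OF measurable_pos, of "%j. \<bar>j\<bar> <= D" "count_space UNIV" i] by simp
 have 1: "Measurable.pred seqM (%x. modulus_ok n L0 (A r) r x)" for r by measurable
 have 2: "Measurable.pred seqM (%x. clk n L0 x k <= 4 * (ln (loc n L0 x k 0) - ln (loc n L0 x 0 0)) + C)" for k
 proof -
  have l: "(%x. ln (loc n L0 x l 0)) \<in> borel_measurable seqM" for l by (rule borel_measurable_ln[OF measurable_loc'])
  show ?thesis by (intro borel_measurable_pred_less borel_measurable_le[unfolded pred_def[symmetric]] borel_measurable_add borel_measurable_times borel_measurable_diff l measurable_clk borel_measurable_const)
 qed
 have 3: "Measurable.pred seqM (%x. \<forall>i\<le>k. \<bar>pos x i\<bar> <= int s * 2 ^ n)" "Measurable.pred seqM (%x. (\<Sum>i<k. snd (x i)) <= real s)" for k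
  by measurable
 show ?thesis unfolding good_def[abs_def]
  by (intro pred_intros_logic(4,3) pred_intros_countable(1) pred_intros_conj1' 1 2 3 measurable_alive measurable_const pred_intros_imp') auto
qed

lemma site_le: "\<bar>l\<bar> <= int r * 2 ^ n ==> \<bar>real_of_int l / 2 ^ n\<bar> <= real r"
proof -
 assume "\<bar>l\<bar> <= int r * 2 ^ n"
 then have "real_of_int \<bar>l\<bar> <= real_of_int (int r * 2 ^ n)" by (simp only: of_int_le_iff)
 then show ?thesis by (simp add: abs_divide divide_le_eq)
qed

text \<open>In the window up to time \<open>s\<close> every local time involved is at most D + 2^n
  s, so the sum of the normalised holding times is bounded, and \<open>c\<close> converts it into a
  bound for the number of jumps.\<close>

lemma jump_count_bound:
 assumes v: "\<forall>i. valid (x i)" and L0p: "!!y. L0 y > 0" and D: "!!y. \<bar>y\<bar> <= real s + 1 ==> L0 y <= D"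
  and c: "!!k. 2 ^ k < C * exp (\<Sum>j<k. trate n L0 x j * snd (x j))" and C: "C > 0"
  and km: "C * exp (4 ^ n * (D + 2 ^ n * real s) * real s) <= 2 ^ km"
  and k: "\<forall>i\<le>k. \<bar>pos x i\<bar> <= int s * 2 ^ n" "(\<Sum>i<k. snd (x i)) <= real s"
 shows "k < km"
proof -
 interpret traj n L0 x by standard (use L0p v in auto)
 have h: "snd (x i) >= 0" for i using h_pos[of i] by simp
 have l: "L j (pos x j + sgm) <= D + 2 ^ n * real s" if "j < k" "sgm = 1 \<or> sgm = -1" for j and sgm :: int
 proof -
  have "\<bar>pos x j\<bar> <= int s * 2 ^ n" using k(1) that by simp
  moreover have "(1::int) <= 2 ^ n" by simp
  ultimately have "\<bar>pos x j + sgm\<bar> <= int s * 2 ^ n + 2 ^ n" using that(2) by linarith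
  also have "... = int (Suc s) * 2 ^ n" by (simp add: algebra_simps)
  finally have "\<bar>pos x j + sgm\<bar> <= int (Suc s) * 2 ^ n" .
  from D[of "real_of_int (pos x j + sgm) / 2 ^ n"] site_le[OF this]
  have "L0 (real_of_int (pos x j + sgm) / 2 ^ n) <= D" by simp
  moreover have "(\<Sum>i<j. if pos x i = pos x j + sgm then snd (x i) else 0) <= (\<Sum>i<k. snd (x i))"
  proof -
   have "(\<Sum>i<j. if pos x i = pos x j + sgm then snd (x i) else 0) <= (\<Sum>i<j. snd (x i))" using h by (intro sum_mono) auto
   also have "... <= (\<Sum>i<k. snd (x i))" using that(1) h by (intro sum_mono2) auto
   finally show ?thesis .
  qed
  ultimately show ?thesis unfolding loc_def using k(2) by (intro add_mono mult_left_mono) auto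
 qed
 have D0: "D + 2 ^ n * real s >= 0" using D[of 0] L0p[of 0] by (intro add_nonneg_nonneg) auto
 have "(\<Sum>j<k. trate n L0 x j * snd (x j)) <= (\<Sum>j<k. 4 ^ n * (D + 2 ^ n * real s) * snd (x j))"
 proof (intro sum_mono mult_right_mono h)
  fix j assume j: "j \<in> {..<k}"
  have "trate n L0 x j = 4 ^ n / 2 * (L j (pos x j + 1) + L j (pos x j + -1))" by (simp add: trate_def rate_def algebra_simps)
  also have "... <= 4 ^ n / 2 * ((D + 2 ^ n * real s) + (D + 2 ^ n * real s))" using j by (intro mult_left_mono add_mono l) auto
  also have "... = 4 ^ n * (D + 2 ^ n * real s)" by (simp add: algebra_simps)
  finally show "trate n L0 x j <= 4 ^ n * (D + 2 ^ n * real s)" .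
 qed
 also have "... = 4 ^ n * (D + 2 ^ n * real s) * (\<Sum>j<k. snd (x j))" by (simp add: sum_distrib_left)
 also have "... <= 4 ^ n * (D + 2 ^ n * real s) * real s" using D0 k(2) by (intro mult_left_mono) auto
 finally have "C * exp (\<Sum>j<k. trate n L0 x j * snd (x j)) <= C * exp (4 ^ n * (D + 2 ^ n * real s) * real s)" using C by simp
 then have "(2::real) ^ k < 2 ^ km" using c[of k] km by linarith
 then show ?thesis by simp
qed

text \<open>Four sources of failure, each of probability at most p/4: the moduli, the number of
  jumps, and the fluctuations to the right and to the left of the origin.\<close>

lemma prob_good:
 assumes L0: "continuous_on UNIV L0" "!!y. (L0::real => real) y > 0" and p: "p > 0"
 shows "\<exists>A C \<nu> km. (\<forall>r. A r >= 0) & (\<forall>s n. \<nu> s <= n --> (\<forall>(M::'a measure) dir H. vrjp n L0 M dir H -->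
  measure M {om \<in> space M. \<not> good n L0 A C s (km s n) (vrjp.X dir H om)} <= p))"
proof -
 \<comment> \<open>Probabilities summable in \<open>r\<close> allow \<open>A r\<close> to be chosen
   once for all radii, independently of \<open>s\<close>.\<close>
 have "\<exists>A>0. \<forall>n M dir H. vrjp n L0 (M::'a measure) dir H -->
  measure M {om \<in> space M. \<not> modulus_ok n L0 A r (vrjp.X dir H om)} <= p / 4 * (1 / 2) ^ Suc r" for r
  using p by (intro prob_modulus_ok L0) auto
 then obtain A where A: "!!r. A r > 0" and Ap: "!!r n M dir H. vrjp n L0 (M::'a measure) dir H ==>
  measure M {om \<in> space M. \<not> modulus_ok n L0 (A r) r (vrjp.X dir H om)} <= p / 4 * (1 / 2) ^ Suc r"
  by metis
 have "\<exists>c>0. \<forall>y. \<bar>y\<bar> <= real s + 2 --> L0 y >= c" for s :: nat by (rule L0_lower_bound[OF L0])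
 then obtain c where c: "!!s::nat. c s > 0" "!!s y. \<bar>y\<bar> <= real s + 2 ==> L0 y >= c s" by metis
 have "\<exists>D. \<forall>y. \<bar>y\<bar> <= real s + 1 --> L0 y <= D" for s :: nat
 proof -
  have "bounded (L0 ` {-(real s + 1)..real s + 1})"
   by (intro compact_imp_bounded compact_continuous_image continuous_on_subset[OF L0(1)]) auto
  then obtain D where "\<forall>y\<in>{-(real s + 1)..real s + 1}. norm (L0 y) <= D" unfolding bounded_iff by auto
  then show ?thesis by (intro exI[of _ D]) (auto simp: abs_le_iff)
 qed
 then obtain D where D: "!!(s::nat) y. \<bar>y\<bar> <= real s + 1 ==> L0 y <= D s" by metis
 have "\<exists>m. \<forall>n\<ge>m. \<forall>x. (\<forall>i. valid (x i)) --> modulus_ok n L0 (A (Suc s)) (Suc s) x -->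
  (\<forall>k i j. \<bar>i\<bar> <= int (Suc s) * 2 ^ n --> \<bar>j\<bar> <= int (Suc s) * 2 ^ n --> \<bar>i - j\<bar> <= 2 ^ (n - m)
    --> \<bar>ln (loc n L0 x k j) - ln (loc n L0 x k i)\<bar> <= 1 / 2)" for s
  using A[of "Suc s"] by (intro ln_loc_osc L0) auto
 then obtain m where m: "!!s n x k i j. m s <= n ==> \<forall>i. valid (x i) ==> modulus_ok n L0 (A (Suc s)) (Suc s) x ==>
  \<bar>i\<bar> <= int (Suc s) * 2 ^ n ==> \<bar>j\<bar> <= int (Suc s) * 2 ^ n ==> \<bar>i - j\<bar> <= 2 ^ (n - m s)
    ==> \<bar>ln (loc n L0 x k j) - ln (loc n L0 x k i)\<bar> <= 1 / 2" by metis
 have "\<exists>q. 1 / (c s)\<^sup>2 < 2 ^ q" for s by (rule real_arch_pow) simp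
 then obtain q where q: "!!s. 1 / (c s)\<^sup>2 < 2 ^ q s" by metis
 define C2 where "C2 = 4 / p"
 define w where "w = ln (4 / p)"
 have C2: "C2 > 0" "1 / C2 = p / 4" using p by (auto simp: C2_def)
 have w: "exp (- w) = p / 4" using p by (simp add: w_def exp_minus)
 have "\<exists>q. C2 * exp (4 ^ n * (D s + 2 ^ n * real s) * real s) < 2 ^ q" for s n by (rule real_arch_pow) simp
 then have "\<exists>km. \<forall>s n. C2 * exp (4 ^ n * (D s + 2 ^ n * real s) * real s) < 2 ^ km s n"
  by (intro choice allI)
 then obtain km where km: "!!s n. C2 * exp (4 ^ n * (D s + 2 ^ n * real s) * real s) < 2 ^ km s n" by blast
 \<comment> \<open>The part \<open>Suc (m s)\<close> makes the two neighbours of the walker, at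
   distance 2, comparable at resolution \<open>m s\<close>; the part \<open>q s\<close> gives 1 <=
   2^n c^2, which admits the parameter 1/8 and bounds the two edges at the origin.\<close>
 define \<nu> where "\<nu> s = Suc (m s) + q s + 1" for s
 show ?thesis
 proof (intro exI[of _ A] exI[of _ "64 * w + 2"] exI[of _ \<nu>] exI[of _ km] conjI allI impI)
  show "A r >= 0" for r using A[of r] by simp
 next
  fix s n and M :: "'a measure" and dir H assume n: "\<nu> s <= n" and v: "vrjp n L0 M dir H"
  interpret vrjp n L0 M dir H by (rule v)
  \<comment> \<open>The first site beyond the window: it has not been visited while the trajectory
    is alive.\<close>
  let ?j = "int s * 2 ^ n + 1"
  have n2: "(2::int) <= 2 ^ n" using n power_increasing[of 1 n "2::int"] by (simp add: \<nu>_def)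
  have cj: "L0 (real_of_int j / 2 ^ n) >= c s" if "\<bar>j\<bar> <= ?j + 1" for j
  proof (rule c(2))
   have "\<bar>j\<bar> <= int (Suc s) * 2 ^ n" using that n2 by (simp add: algebra_simps)
   then show "\<bar>real_of_int j / 2 ^ n\<bar> <= real s + 2" using site_le[of j "Suc s" n] by simp
  qed
  have c1: "1 <= 2 ^ n * (c s)\<^sup>2"
  proof -
   have "(2::real) ^ q s <= 2 ^ n" using n by (intro power_increasing) (auto simp: \<nu>_def)
   then have "1 / (c s)\<^sup>2 <= 2 ^ n" using q[of s] by linarith
   then show ?thesis using c(1)[of s] by (simp add: divide_le_eq)
  qed
  let ?B1 = "{om \<in> space M. \<exists>k. 1 * fluct n L0 0 ?j (X om) k > occ n L0 0 ?j (X om) k / 8 + 8 * w}"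
  let ?B2 = "{om \<in> space M. \<exists>k. -1 * fluct n L0 (-?j) 0 (X om) k > occ n L0 (-?j) 0 (X om) k / 8 + 8 * w}"
  let ?B3 = "{om \<in> space M. \<exists>k. 2 ^ k >= C2 * exp (\<Sum>j<k. trate n L0 (X om) j * snd (X om j))}"
  let ?B4 = "%r. {om \<in> space M. \<not> modulus_ok n L0 (A r) r (X om)}"
  have [measurable]: "(%x. trate n L0 x j) \<in> borel_measurable seqM" for j unfolding trate_def by measurable
  have [measurable]: "(%x. fluct n L0 j1 j2 x k) \<in> borel_measurable seqM" "(%x. occ n L0 j1 j2 x k) \<in> borel_measurable seqM" for j1 j2 k
   by measurable
  have s0: "int s * 2 ^ n >= 0" by simp
  have B1: "prob ?B1 <= p / 4" unfolding w[symmetric]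
  proof (rule prob_fluct_drift[OF _ c(1) _ c1])
   show "0 < ?j" using s0 by linarith
   show "c s <= L0 (real_of_int j / 2 ^ n)" if "0 - 1 <= j" "j <= ?j + 1" for j using that s0 by (intro cj) linarith
  qed simp
  have B2: "prob ?B2 <= p / 4" unfolding w[symmetric]
  proof (rule prob_fluct_drift[OF _ c(1) _ c1])
   show "- ?j < 0" using s0 by linarith
   show "c s <= L0 (real_of_int j / 2 ^ n)" if "- ?j - 1 <= j" "j <= 0 + 1" for j using that s0 by (intro cj) linarith
  qed simp
  have B3: "prob ?B3 <= p / 4" using prob_many_jumps[OF C2(1)] C2(2) by simp
  have B4: "prob (\<Union>r\<in>{..Suc s}. ?B4 r) <= p / 4"
  proof -
   have "prob (\<Union>r\<in>{..Suc s}. ?B4 r) <= (\<Sum>r\<in>{..Suc s}. prob (?B4 r))" by (intro measure_UNION_le) (auto, measurable)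
   also have "... <= (\<Sum>r\<in>{..Suc s}. p / 4 * (1 / 2) ^ Suc r)" by (intro sum_mono Ap[OF v])
   also have "... = p / 4 * (\<Sum>r\<in>{..Suc s}. (1 / 2) ^ Suc r)" by (simp only: sum_distrib_left)
   also have "(\<Sum>r\<in>{..Suc s}. (1 / 2) ^ Suc r) = 1 - (1 / 2 :: real) ^ (Suc (Suc s))" by (induction s) (auto simp: field_simps)
   also have "p / 4 * (1 - (1 / 2) ^ (Suc (Suc s))) <= p / 4 * 1" using p by (intro mult_left_mono) auto
   finally show ?thesis by simp
  qed
  have "prob {om \<in> space M. \<not> good n L0 A (64 * w + 2) s (km s n) (X om)} <= prob ((?B1 \<union> ?B2) \<union> (?B3 \<union> (\<Union>r\<in>{..Suc s}. ?B4 r)))"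
  proof (rule finite_measure_mono_AE)
   show "AE om in M. om \<in> {om \<in> space M. \<not> good n L0 A (64 * w + 2) s (km s n) (X om)} --> om \<in> (?B1 \<union> ?B2) \<union> (?B3 \<union> (\<Union>r\<in>{..Suc s}. ?B4 r))"
    using AE_valid
   proof eventually_elim
    case (elim om)
    interpret T: traj n L0 "X om" by standard (use L0_pos elim in auto)
    show ?case
    proof (intro impI; rule ccontr)
     assume ng: "om \<in> {om \<in> space M. \<not> good n L0 A (64 * w + 2) s (km s n) (X om)}"
      and "om \<notin> (?B1 \<union> ?B2) \<union> (?B3 \<union> (\<Union>r\<in>{..Suc s}. ?B4 r))"
     then have nb: "om \<in> space M" "om \<notin> ?B1" "om \<notin> ?B2" "om \<notin> ?B3" "!!r. r <= Suc s ==> om \<notin> ?B4 r" by blast+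
     have f1: "!!k. fluct n L0 0 ?j (X om) k <= occ n L0 0 ?j (X om) k / 8 + 8 * w"
      and f2: "!!k. - fluct n L0 (-?j) 0 (X om) k <= occ n L0 (-?j) 0 (X om) k / 8 + 8 * w"
      and f3: "!!k. 2 ^ k < C2 * exp (\<Sum>j<k. trate n L0 (X om) j * snd (X om j))"
      and f4: "!!r. r <= Suc s ==> modulus_ok n L0 (A r) r (X om)"
     subgoal for k using nb(1,2) by (simp add: not_less)
     subgoal for k using nb(1,3) by (simp add: not_less)
     subgoal for k using nb(1,4) by (simp add: not_le)
     subgoal for r using nb(1) nb(5)[of r] by simp
     done
     have g1: "k < km s n" if "\<forall>i\<le>k. \<bar>pos (X om) i\<bar> <= int s * 2 ^ n" "(\<Sum>i<k. snd (X om i)) <= real s" for k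
      by (rule jump_count_bound[OF elim L0_pos D f3 C2(1) less_imp_le[OF km] that])
     have g2: "clk n L0 (X om) k <= 4 * T.rho k 0 + (64 * w + 2)" if al: "alive n s (km s n) (X om) k" for k
     proof (rule T.rho_0_growth[OF _ _ _ f1 f2])
      show "0 < ?j" by (simp add: add_nonneg_pos)
      have b: "\<bar>pos (X om) i\<bar> <= int s * 2 ^ n" if "i < k" for i using al that by (simp add: alive_def)
      show "\<bar>pos (X om) i\<bar> < ?j" if "i < k" for i using b[OF that] by simp
      show "\<bar>ln (T.L i (pos (X om) i + 1)) - ln (T.L i (pos (X om) i - 1))\<bar> <= 1 / 2" if "i < k" for i
      proof (rule m[OF _ elim f4[OF order_refl]])
       show "m s <= n" using n by (simp add: \<nu>_def)
       show "\<bar>pos (X om) i - 1\<bar> <= int (Suc s) * 2 ^ n" "\<bar>pos (X om) i + 1\<bar> <= int (Suc s) * 2 ^ n"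
        using b[OF that] n2 by (auto simp: algebra_simps)
       have "(2::int) ^ 1 <= 2 ^ (n - m s)" using n by (intro power_increasing) (auto simp: \<nu>_def)
       then show "\<bar>pos (X om) i - 1 - (pos (X om) i + 1)\<bar> <= 2 ^ (n - m s)" by simp
      qed
      have "scl0 n L0 1 - scl0 n L0 (-1) <= real_of_int (1 - -1) / 2 ^ n / (c s)\<^sup>2"
       by (rule scl0_diff_le) (use c(1) in \<open>auto intro!: cj simp: abs_le_iff\<close>, (smt (verit) mult_nonneg_nonneg of_nat_0_le_iff zero_le_power)+)
      also have "... <= 2" using c1 c(1)[of s] by (simp add: field_simps)
      finally show "scl0 n L0 1 - scl0 n L0 (-1) <= 2" .
     qed
     have "good n L0 A (64 * w + 2) s (km s n) (X om)"
      unfolding good_def using f4 g1 g2 by (auto simp: T.rho_def)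
     then show False using ng by simp
    qed
   qed
  qed measurable
  also have "... <= (prob ?B1 + prob ?B2) + (prob ?B3 + prob (\<Union>r\<in>{..Suc s}. ?B4 r))"
   by (intro order_trans[OF measure_Un_le] add_mono measure_Un_le order_refl) measurable
  also have "... <= p" using B1 B2 B3 B4 by linarith
  finally show "measure M {om \<in> space M. \<not> good n L0 A (64 * w + 2) s (km s n) (X om)} <= p" .
 qed
qed

section \<open>Subsequence criteria\<close>

lemma frequently_subseq:
 assumes "\<not> (\<forall>\<^sub>F i in sequentially. P i)"
 shows "\<exists>r :: nat => nat. strict_mono r & (\<forall>i. \<not> P (r i))"
proof -
 have "infinite {i. \<not> P i}"
  using assms by (simp add: eventually_cofinite[symmetric] cofinite_eq_sequentially)
 from infinite_enumerate[OF this] show ?thesis by auto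
qed

lemma bounded_subseq:
 fixes a :: "nat => real"
 assumes "!!i. \<bar>a i\<bar> <= C"
 obtains r y where "strict_mono r" "(%i. a (r i)) \<longlonglongrightarrow> y" "\<bar>y\<bar> <= C"
proof -
 have "seq_compact {-C..C}" by (simp add: compact_imp_seq_compact)
 moreover have "\<forall>i. a i \<in> {-C..C}" using assms by (auto simp: abs_le_iff minus_le_iff)
 ultimately obtain y r where "y \<in> {-C..C}" "strict_mono r" "(a \<circ> r) \<longlonglongrightarrow> y" unfolding seq_compact_def by blast
 then show thesis using that[of r y] by (simp add: o_def abs_le_iff)
qed

text \<open>Compactness: it is enough to identify the limit of every convergent subsequence. In this
  way clock values and positions are found as the unique solution of an equation for the
  limit.\<close>

lemma bounded_tendstoI:
 fixes a :: "nat => real"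
 assumes "!!i. \<bar>a i\<bar> <= C" and lim: "!!r y. strict_mono r ==> (%i. a (r i)) \<longlonglongrightarrow> y ==> y = l"
 shows "a \<longlonglongrightarrow> l"
proof (rule tendstoI, rule ccontr)
 fix e :: real assume e: "e > 0" and "\<not> (\<forall>\<^sub>F i in sequentially. dist (a i) l < e)"
 from frequently_subseq[OF this(2)] obtain r :: "nat => nat" where r: "strict_mono r" "!!i. \<not> dist (a (r i)) l < e" by auto
 obtain r' y where r': "strict_mono r'" "(%i. a (r (r' i))) \<longlonglongrightarrow> y" by (rule bounded_subseq[of "%i. a (r i)" C]) (rule assms(1))
 have "strict_mono (%i. r (r' i))" using r(1) r'(1) by (simp add: strict_mono_def)
 from lim[OF this r'(2)] have "(%i. a (r (r' i))) \<longlonglongrightarrow> l" using r'(2) by simp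
 then have "\<forall>\<^sub>F i in sequentially. dist (a (r (r' i))) l < e" using e by (rule tendstoD)
 then show False using r(2) by (auto simp: eventually_sequentially)
qed

text \<open>If uniformity failed, there would be a sequence of bad points, and no subsequence of it
  could have vanishing differences. Uniform statements thus reduce to sequences of times and
  places.\<close>

lemma uniform_limit_subseqI:
 fixes f :: "nat => 'c => real"
 assumes "!!(r :: nat => nat) p. strict_mono r ==> (!!i. p i \<in> S) ==> \<exists>r'. strict_mono r' & (%i. f (r (r' i)) (p (r' i)) - l (p (r' i))) \<longlonglongrightarrow> 0"
 shows "uniform_limit S f l sequentially"
proof (rule uniform_limitI, rule ccontr)
 fix e :: real assume e: "e > 0" and "\<not> (\<forall>\<^sub>F i in sequentially. \<forall>x\<in>S. dist (f i x) (l x) < e)"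
 from frequently_subseq[OF this(2)] obtain r :: "nat => nat" where r: "strict_mono r" "!!i. \<not> (\<forall>x\<in>S. dist (f (r i) x) (l x) < e)" by auto
 then have "\<exists>p. p \<in> S & \<not> dist (f (r i) p) (l p) < e" for i by blast
 then obtain p where p: "!!i. p i \<in> S" "!!i. \<not> dist (f (r i) (p i)) (l (p i)) < e" by metis
 obtain r' where r': "(%i. f (r (r' i)) (p (r' i)) - l (p (r' i))) \<longlonglongrightarrow> 0" using assms[of r p] r(1) p(1) by auto
 from tendstoD[OF r' e] p(2) show False by (auto simp: eventually_sequentially dist_real_def)
qed

section \<open>The initial scale function and its discretisation\<close>

lemma has_real_derivative_S0:
 assumes L0c: "continuous_on UNIV L0" and L0p: "!!y. L0 y > 0"
 shows "(S0 L0 has_real_derivative 1 / (L0 y)\<^sup>2) (at y)"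
proof -
 define p where "p = min 0 y - 1"
 define q where "q = max 0 y + 1"
 have pq: "p < 0" "0 < q" "p < y" "y < q" by (auto simp: p_def q_def)
 have "continuous_on {p..q} (%r. 1 / (L0 r)\<^sup>2)"
  using L0p by (intro continuous_intros continuous_on_subset[OF L0c]) (auto simp: less_imp_neq[symmetric])
 from interval_integral_FTC2[OF _ _ this, of 0 y]
 have "(S0 L0 has_vector_derivative 1 / (L0 y)\<^sup>2) (at y within {p..q})" unfolding S0_def[abs_def] using pq by simp
 moreover have "at y within {p..q} = at y" by (rule at_within_interior) (use pq in simp)
 ultimately show ?thesis unfolding has_real_derivative_iff_has_vector_derivative by simp
qed

locale scale_fn =
 fixes L0 :: "real => real"
 assumes L0c: "continuous_on UNIV L0" and L0p: "!!y. L0 y > 0"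
  and S0_unbounded: "!!C. \<exists>r::nat. S0 L0 (real r) > C" "!!C. \<exists>r::nat. S0 L0 (- real r) < - C"
begin

lemma L0_isCont: "isCont L0 y" using L0c by (simp add: continuous_on_eq_continuous_at)

lemma S0_deriv: "(S0 L0 has_real_derivative 1 / (L0 y)\<^sup>2) (at y)"
 by (rule has_real_derivative_S0[OF L0c L0p])

lemma S0_cont: "isCont (S0 L0) y" by (rule DERIV_isCont[OF S0_deriv])

lemma S0_0: "S0 L0 0 = 0" by (simp add: S0_def)

lemma S0_less: "a < b ==> S0 L0 a < S0 L0 b"
proof -
 assume "a < b"
 have "1 / (L0 y)\<^sup>2 > 0" for y using L0p[of y] by simp
 then show ?thesis using DERIV_pos_imp_increasing[OF \<open>a < b\<close>] S0_deriv by blast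
qed

lemma S0_inj: "S0 L0 a = S0 L0 b ==> a = b" using S0_less[of a b] S0_less[of b a] by linarith

lemma S0_surj: "\<exists>a. S0 L0 a = y"
proof -
 obtain r q :: nat where r: "S0 L0 (real r) > y" and q: "S0 L0 (- real q) < y" using S0_unbounded(1)[of y] S0_unbounded(2)[of "-y"] by auto
 have "\<exists>a\<ge>- real q. a <= real r & S0 L0 a = y" using r q S0_cont by (intro IVT) auto
 then show ?thesis by blast
qed

lemma S0_inv: "S0 L0 (inv (S0 L0) y) = y" using S0_surj[of y] by (intro f_inv_into_f) auto

lemma inv_S0: "inv (S0 L0) (S0 L0 y) = y" using S0_inv S0_inj by blast

lemma inv_S0_cont: "isCont (inv (S0 L0)) y"
 using isCont_inverse_function[of 1 "inv (S0 L0) y" "inv (S0 L0)" "S0 L0"] inv_S0 S0_cont by (simp add: S0_inv)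

text \<open>By the mean value theorem the increment of \<open>S0\<close> is the mesh divided by the
  square of \<open>L0\<close> at an intermediate point, whereas an edge uses the product of the two
  end values. The error carries a factor 1/2^n, so that it can be summed over order 2^n
  edges.\<close>

lemma edge0_approx:
 assumes e: "eps > 0"
 shows "\<exists>N. \<forall>n\<ge>N. \<forall>j. - int r * 2 ^ n <= j --> j < int r * 2 ^ n -->
  \<bar>edge0 n L0 j - (S0 L0 (real_of_int (j + 1) / 2 ^ n) - S0 L0 (real_of_int j / 2 ^ n))\<bar> <= eps / 2 ^ n"
proof -
 obtain c where c: "c > 0" "!!y. \<bar>y\<bar> <= real r ==> L0 y >= c" using L0_lower_bound[OF L0c L0p, of "real r"] by auto
 have "continuous_on {-real r..real r} (%y. 1 / L0 y)"
  using L0p by (intro continuous_intros continuous_on_subset[OF L0c]) (auto simp: less_imp_neq[symmetric])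
 then obtain N where N: "!!m y z. m >= N ==> \<bar>y\<bar> <= real r ==> \<bar>z\<bar> <= real r ==> \<bar>y - z\<bar> <= 1 / 2 ^ m ==> \<bar>1 / L0 y - 1 / L0 z\<bar> <= eps * c / 2"
  using dyadic_uniform_continuity[of "real r" "%y. 1 / L0 y" "eps * c / 2"] mult_pos_pos[OF e c(1)] by (metis half_gt_zero)
 show ?thesis
 proof (intro exI[of _ N] allI impI)
  fix n and j :: int assume n: "N <= n" and j: "- int r * 2 ^ n <= j" "j < int r * 2 ^ n"
  define y1 where "y1 = real_of_int j / 2 ^ n"
  define y2 where "y2 = real_of_int (j + 1) / 2 ^ n"
  have y: "y2 - y1 = 1 / 2 ^ n" "y1 < y2" by (auto simp: y1_def y2_def diff_divide_distrib[symmetric] divide_strict_right_mono)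
  have yr: "\<bar>y1\<bar> <= real r" "\<bar>y2\<bar> <= real r"
   unfolding y1_def y2_def using j by (intro site_le; simp add: abs_le_iff; linarith)+
  obtain z where z: "y1 < z" "z < y2" "S0 L0 y2 - S0 L0 y1 = (y2 - y1) * (1 / (L0 z)\<^sup>2)"
   using MVT2[OF y(2), of "S0 L0" "%z. 1 / (L0 z)\<^sup>2"] S0_deriv by auto
  have zr: "\<bar>z\<bar> <= real r" "\<bar>y1 - z\<bar> <= 1 / 2 ^ n" "\<bar>y2 - z\<bar> <= 1 / 2 ^ n" using z yr y by linarith+
  have g: "\<bar>1 / L0 y1 - 1 / L0 z\<bar> <= eps * c / 2" "\<bar>1 / L0 y2 - 1 / L0 z\<bar> <= eps * c / 2"
   using N[OF n yr(1) zr(1,2)] N[OF n yr(2) zr(1,3)] by auto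
  have G: "\<bar>1 / L0 v\<bar> <= 1 / c" if "\<bar>v\<bar> <= real r" for v using c(2)[OF that] c(1) by (simp add: frac_le)
  have ed: "edge0 n L0 j - (S0 L0 y2 - S0 L0 y1) = 1 / 2 ^ n * (1 / L0 y1 * (1 / L0 y2 - 1 / L0 z) + 1 / L0 z * (1 / L0 y1 - 1 / L0 z))"
   unfolding z(3) y(1) edge0_def y1_def[symmetric] y2_def[symmetric] using L0p[of z] by (simp add: power2_eq_square algebra_simps)
  have "\<bar>1 / L0 y1 * (1 / L0 y2 - 1 / L0 z)\<bar> <= 1 / c * (eps * c / 2)"
   unfolding abs_mult using c(1) by (intro mult_mono g G yr) auto
  moreover have "\<bar>1 / L0 z * (1 / L0 y1 - 1 / L0 z)\<bar> <= 1 / c * (eps * c / 2)"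
   unfolding abs_mult using c(1) by (intro mult_mono g G zr) auto
  moreover have "1 / c * (eps * c / 2) = eps / 2" using c(1) by simp
  ultimately have "\<bar>1 / L0 y1 * (1 / L0 y2 - 1 / L0 z) + 1 / L0 z * (1 / L0 y1 - 1 / L0 z)\<bar> <= eps" by linarith
  then have "\<bar>1 / 2 ^ n\<bar> * \<bar>1 / L0 y1 * (1 / L0 y2 - 1 / L0 z) + 1 / L0 z * (1 / L0 y1 - 1 / L0 z)\<bar> <= \<bar>1 / 2 ^ n\<bar> * eps"
   by (intro mult_left_mono) auto
  then have "\<bar>edge0 n L0 j - (S0 L0 y2 - S0 L0 y1)\<bar> <= 1 / 2 ^ n * eps" unfolding ed abs_mult by simp
  then have "\<bar>edge0 n L0 j - (S0 L0 y2 - S0 L0 y1)\<bar> <= eps / 2 ^ n" by simp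
  then show "\<bar>edge0 n L0 j - (S0 L0 (real_of_int (j + 1) / 2 ^ n) - S0 L0 (real_of_int j / 2 ^ n))\<bar> <= eps / 2 ^ n"
   unfolding y1_def y2_def .
 qed
qed

lemma scl0_approx:
 assumes e: "eps > 0"
 shows "\<exists>N. \<forall>n\<ge>N. \<forall>j. \<bar>j\<bar> <= int r * 2 ^ n --> \<bar>scl0 n L0 j - S0 L0 (real_of_int j / 2 ^ n)\<bar> <= eps"
proof -
 obtain N where N: "!!n j. n >= N ==> - int r * 2 ^ n <= j ==> j < int r * 2 ^ n ==>
  \<bar>edge0 n L0 j - (S0 L0 (real_of_int (j + 1) / 2 ^ n) - S0 L0 (real_of_int j / 2 ^ n))\<bar> <= eps / (real r + 1) / 2 ^ n"
  using edge0_approx[of "eps / (real r + 1)" r] e by auto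
 show ?thesis
 proof (intro exI[of _ N] allI impI)
  fix n and j :: int assume n: "N <= n" and j: "\<bar>j\<bar> <= int r * 2 ^ n"
  define d where "d = eps / (real r + 1) / 2 ^ n"
  let ?D = "%j. scl0 n L0 j - S0 L0 (real_of_int j / 2 ^ n)" and ?e = d
  note N = N[OF n, folded d_def]
  have up: "\<bar>?D (int q)\<bar> <= real q * ?e" if "int q <= int r * 2 ^ n" for q
   using that
  proof (induction q)
   case (Suc q)
   have "\<bar>?D (int q)\<bar> <= real q * ?e" using Suc by simp
   moreover have "- int r * 2 ^ n <= int q" "int q < int r * 2 ^ n" using Suc.prems by (auto intro: order_trans[of _ 0])
   from N[OF this] have "\<bar>?D (int q + 1) - ?D (int q)\<bar> <= ?e" unfolding scl0_Suc by (simp add: algebra_simps)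
   moreover have 2: "int (Suc q) = int q + 1" "real (Suc q) * ?e = real q * ?e + ?e" by (simp_all add: algebra_simps)
   ultimately show ?case unfolding 2 by linarith
  qed (simp add: scl0_def S0_0)
  have dn: "\<bar>?D (- int q)\<bar> <= real q * ?e" if "int q <= int r * 2 ^ n" for q
   using that
  proof (induction q)
   case (Suc q)
   have 1: "\<bar>?D (- int q)\<bar> <= real q * ?e" using Suc by simp
   have "- int r * 2 ^ n <= - int (Suc q)" "- int (Suc q) < int r * 2 ^ n" using Suc.prems by auto
   from N[OF this] have "\<bar>?D (- int (Suc q) + 1) - ?D (- int (Suc q))\<bar> <= ?e" unfolding scl0_Suc by (simp add: algebra_simps)
   moreover have 2: "- int (Suc q) + 1 = - int q" "real (Suc q) * ?e = real q * ?e + ?e" by (simp_all add: algebra_simps)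
   ultimately show ?case using 1 unfolding 2 by linarith
  qed (simp add: scl0_def S0_0)
  have "\<bar>?D j\<bar> <= real (nat \<bar>j\<bar>) * ?e"
   using up[of "nat \<bar>j\<bar>"] dn[of "nat \<bar>j\<bar>"] j by (cases "j >= 0") auto
  also have "... <= (real r * 2 ^ n) * ?e"
  proof (rule mult_right_mono)
   have "real_of_int \<bar>j\<bar> <= real_of_int (int r * 2 ^ n)" using j by (simp only: of_int_le_iff)
   then show "real (nat \<bar>j\<bar>) <= real r * 2 ^ n" by simp
  qed (use e in \<open>simp add: d_def\<close>)
  also have "... = eps * (real r / (real r + 1))" by (simp add: d_def)
  also have "... <= eps * 1" using e by (intro mult_left_mono) auto
  finally show "\<bar>?D j\<bar> <= eps" by simp
 qed
qed

end

text \<open>If \<open>F\<close> stayed bounded, its limit would be the finite value of a divergent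
  integral. The sign \<open>s\<close> lets one argument serve both half-lines.\<close>

lemma S0_upper:
 fixes L0 :: "real => real"
 assumes L0c: "continuous_on UNIV L0" and L0p: "!!y. L0 y > 0"
  and F: "!!y. y >= 0 ==> (F has_real_derivative 1 / (L0 (s * y))\<^sup>2) (at y)" and F0: "F 0 = 0"
  and inf: "(\<integral>\<^sup>+ y \<in> {0..}. ennreal (1 / (L0 (s * y))\<^sup>2) \<partial>lborel) = \<infinity>"
 shows "\<exists>r::nat. F (real r) > C"
proof (rule ccontr)
 assume no: "\<nexists>r::nat. F (real r) > C"
 have mono: "F a <= F b" if "0 <= a" "a <= b" for a b
  using that F by (intro DERIV_nonneg_imp_nondecreasing[OF that(2)]) (meson order_trans zero_le_divide_1_iff zero_le_power2)
 have bd: "F a <= C" if "a >= 0" for a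
 proof -
  obtain r :: nat where "a <= real r" using real_arch_simple by blast
  then show ?thesis using mono[OF that, of "real r"] no by (meson not_less order_trans)
 qed
 define T where "T = (SUP a\<in>{0..}. F a)"
 have bdd: "bdd_above (F ` {0..})" using bd by (intro bdd_aboveI[of _ C]) auto
 have lim: "(F \<longlongrightarrow> T) at_top"
 proof (rule tendstoI)
  fix e :: real assume e: "e > 0"
  have "T - e < T" using e by simp
  then obtain a where a: "a >= 0" "T - e < F a" unfolding T_def using less_cSUP_iff[OF _ bdd] by auto
  have "dist (F y) T < e" if "y >= a" for y
  proof -
   have "F y <= T" unfolding T_def using that a by (intro cSUP_upper bdd) auto
   then show ?thesis using mono[OF a(1) that] a(2) by (simp add: dist_real_def)
  qed
  then show "\<forall>\<^sub>F y in at_top. dist (F y) T < e" unfolding eventually_at_top_linorder by blast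
 qed
 have [measurable]: "L0 \<in> borel_measurable borel" using L0c by (rule borel_measurable_continuous_onI)
 have "(\<integral>\<^sup>+ y. ennreal (1 / (L0 (s * y))\<^sup>2) * indicator {0..} y \<partial>lborel) = ennreal (T - F 0)"
  by (rule nn_integral_FTC_atLeast[OF _ F _ lim]) auto
 then show False using inf by simp
qed

lemma scale_fnI:
 fixes L0 :: "real => real"
 assumes L0c: "continuous_on UNIV L0" and L0p: "!!y. L0 y > 0"
  and p: "(\<integral>\<^sup>+ x \<in> {0..}. ennreal (1 / (L0 x) ^ 2) \<partial>lborel) = \<infinity>"
  and m: "(\<integral>\<^sup>+ x \<in> {..0}. ennreal (1 / (L0 x) ^ 2) \<partial>lborel) = \<infinity>"
 shows "scale_fn L0"
proof
 show "continuous_on UNIV L0" "!!y. L0 y > 0" by fact+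
 note D = has_real_derivative_S0[of L0, OF L0c L0p]
 show "\<exists>r::nat. S0 L0 (real r) > C" for C
  by (rule S0_upper[OF L0c L0p, where s=1]) (use D p in \<open>auto simp: S0_def[of _ 0]\<close>)
 have [measurable]: "L0 \<in> borel_measurable borel" using L0c by (rule borel_measurable_continuous_onI)
 have "(\<integral>\<^sup>+ y \<in> {0..}. ennreal (1 / (L0 (-1 * y))\<^sup>2) \<partial>lborel) = (\<integral>\<^sup>+ x \<in> {..0}. ennreal (1 / (L0 x) ^ 2) \<partial>lborel)"
  by (subst nn_integral_real_affine[where c="-1" and t=0 and f="%x. ennreal (1 / (L0 x) ^ 2) * indicator {..0} x"])
   (auto simp: indicator_def intro!: nn_integral_cong)
 then have i: "(\<integral>\<^sup>+ y \<in> {0..}. ennreal (1 / (L0 (-1 * y))\<^sup>2) \<partial>lborel) = \<infinity>" using m by simp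
 have neg: "\<exists>r::nat. - S0 L0 (- real r) > C" for C
 proof (rule S0_upper[OF L0c L0p _ _ i])
  fix y :: real
  have "((%y. S0 L0 (- y)) has_real_derivative (1 / (L0 (- y))\<^sup>2) * (-1)) (at y)"
   by (rule DERIV_chain2[OF D]) (auto intro!: derivative_eq_intros)
  from DERIV_minus[OF this] show "((%y. - S0 L0 (- y)) has_real_derivative 1 / (L0 (- 1 * y))\<^sup>2) (at y)" by simp
 qed (simp add: S0_def)
 show "\<exists>r::nat. S0 L0 (- real r) < - C" for C using neg[of C] by (simp add: less_minus_iff)
qed

section \<open>Continuity of the limiting clock, position and profiles\<close>

locale lrm_env = bbflow b \<Psi> \<Lambda> \<xi> + scale_fn L0 for b \<Psi> \<Lambda> \<xi> L0
begin

text \<open>Density of real time with respect to the clock. By \<open>lam_cube\<close> it is the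
  cube of the local time at the current position.\<close>

definition g :: "real => real" where
 "g v = (L0 (inv (S0 L0) (\<xi> v))) ^ 3 * (1 - 2 * \<Lambda> v (\<xi> v)) powr (-3/2)"

definition lam :: "real => real => real" where
 "lam u y = L0 y * (1 - 2 * \<Lambda> u (S0 L0 y)) powr (-1/2)"

definition Xu :: "real => real" where "Xu v = inv (S0 L0) (\<xi> v)"

abbreviation "clock \<equiv> lrm_clock L0 \<xi> \<Lambda>"

lemma Psi_lim:
 assumes "v \<longlonglongrightarrow> u" "!!i. v i >= 0"
 shows "(%i. \<Psi> (v i) y) \<longlonglongrightarrow> \<Psi> u y"
proof -
 have "u >= 0" using assms by (intro LIMSEQ_le_const[OF assms(1)]) auto
 then show ?thesis using assms by (intro continuous_on_tendsto_compose[OF Psi_cont_u]) auto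
qed

lemma b_lim: "v \<longlonglongrightarrow> u ==> (!!i. v i >= 0) ==> (%i. b (v i)) \<longlonglongrightarrow> b u"
 by (intro continuous_on_tendsto_compose[OF b_cont]) (auto intro: LIMSEQ_le_const)

text \<open>The flow is increasing in the label, so the label of the path is trapped between two
  labels as soon as the path lies strictly between their flow lines, and this is an open condition
  in time.\<close>

lemma xi_lim:
 assumes v: "v \<longlonglongrightarrow> u" "!!i. v i >= 0"
 shows "(%i. \<xi> (v i)) \<longlonglongrightarrow> \<xi> u"
proof (rule tendstoI)
 fix e :: real assume e: "e > 0"
 have u: "u >= 0" using v by (intro LIMSEQ_le_const[OF v(1)]) auto
 have d: "(%i. b (v i) - \<Psi> (v i) y) \<longlonglongrightarrow> b u - \<Psi> u y" for y by (intro tendsto_diff b_lim Psi_lim v)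
 have "b u - \<Psi> u (\<xi> u - e) > 0" "b u - \<Psi> u (\<xi> u + e) < 0"
  using less_xi_iff[OF u, of "\<xi> u - e"] xi_less_iff[OF u, of "\<xi> u + e"] e by auto
 then have "\<forall>\<^sub>F i in sequentially. b (v i) - \<Psi> (v i) (\<xi> u - e) > 0" "\<forall>\<^sub>F i in sequentially. b (v i) - \<Psi> (v i) (\<xi> u + e) < 0"
  using order_tendstoD(1)[OF d] order_tendstoD(2)[OF d] by blast+
 then show "\<forall>\<^sub>F i in sequentially. dist (\<xi> (v i)) (\<xi> u) < e"
 proof eventually_elim
  case (elim i)
  then have "\<xi> u - e < \<xi> (v i)" "\<xi> (v i) < \<xi> u + e" using less_xi_iff[OF v(2)] xi_less_iff[OF v(2)] by auto
  then show ?case by (simp add: dist_real_def abs_less_iff)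
 qed
qed

lemma Lam_lim:
 assumes "v \<longlonglongrightarrow> u" "!!i. v i >= 0" "y \<longlonglongrightarrow> z"
 shows "(%i. \<Lambda> (v i) (y i)) \<longlonglongrightarrow> \<Lambda> u z"
proof -
 have "u >= 0" using assms by (intro LIMSEQ_le_const[OF assms(1)]) auto
 then have "(%i. (%(u, y). \<Lambda> u y) (v i, y i)) \<longlonglongrightarrow> (%(u, y). \<Lambda> u y) (u, z)"
  using assms by (intro continuous_on_tendsto_compose[OF Lam_cont] tendsto_Pair) auto
 then show ?thesis by simp
qed

lemma g_lim:
 assumes v: "v \<longlonglongrightarrow> u" "!!i. v i >= 0"
 shows "(%i. g (v i)) \<longlonglongrightarrow> g u"
proof -
 have u: "u >= 0" using v by (intro LIMSEQ_le_const[OF v(1)]) auto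
 note x = xi_lim[OF v]
 have "1 - 2 * \<Lambda> u (\<xi> u) ~= 0" using Lam_less[OF u, of "\<xi> u"] by simp
 then show ?thesis unfolding g_def
  by (intro tendsto_intros isCont_tendsto_compose[OF L0_isCont] isCont_tendsto_compose[OF inv_S0_cont] x Lam_lim v) simp
qed

lemma g_cont: "continuous_on {0..} g"
 unfolding continuous_on_sequentially by (auto simp: o_def intro!: g_lim)

lemma g_pos: "v >= 0 ==> g v > 0"
 unfolding g_def using L0p Lam_less by (intro mult_pos_pos zero_less_power) (auto simp: less_imp_neq[symmetric])

lemma clock_eq: "clock u = integral {0..u} g"
proof -
 have "set_integrable lborel {0..u} g"
  by (rule borel_integrable_atLeastAtMost'[OF continuous_on_subset[OF g_cont]]) auto
 from set_borel_integral_eq_integral(2)[OF this] show ?thesis unfolding lrm_clock_def g_def[symmetric] by simp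
qed

lemma clock_mvt:
 assumes "0 <= u" "u <= v"
 shows "\<exists>z. u <= z & z <= v & clock v - clock u = (v - u) * g z"
proof (cases "u = v")
 case False
 then have uv: "u < v" using assms by simp
 have "((%w. integral {0..w} g) has_real_derivative g w) (at w within {0..v})" if "w \<in> {0..v}" for w
  by (rule integral_has_real_derivative[OF continuous_on_subset[OF g_cont]]) (use that in auto)
 then have d: "((%w. integral {0..w} g) has_real_derivative g w) (at w within {u..v})" if "u <= w" "w <= v" for w
  using that assms by (intro DERIV_subset[where s="{0..v}" and t="{u..v}"]) auto
 have "\<exists>z\<in>{u<..<v}. integral {0..v} g - integral {0..u} g = (%h. g z * h) (v - u)"
  by (rule mvt_simple[OF uv]) (use d in \<open>auto simp: has_field_derivative_def\<close>)
 then show ?thesis unfolding clock_eq by (metis greaterThanLessThan_iff less_imp_le mult.commute)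
qed (auto intro!: exI[of _ u])

lemma clock_less: "0 <= u ==> u < v ==> clock u < clock v"
proof -
 assume uv: "0 <= u" "u < v"
 obtain z where "u <= z" "clock v - clock u = (v - u) * g z" using clock_mvt[of u v] uv by auto
 moreover have "(v - u) * g z > 0" using uv \<open>u <= z\<close> g_pos[of z] by (intro mult_pos_pos) auto
 ultimately show ?thesis by linarith
qed

lemma clock_0: "clock 0 = 0" by (simp add: clock_eq)

lemma clock_inj: "inj_on clock {0..}"
 using clock_less by (intro linorder_inj_onI) force+

lemma clock_lim: "v \<longlonglongrightarrow> u ==> (!!i. v i >= 0) ==> (%i. clock (v i)) \<longlonglongrightarrow> clock u"
proof -
 assume v: "v \<longlonglongrightarrow> u" "!!i. v i >= 0"
 have u: "u >= 0" using v by (intro LIMSEQ_le_const[OF v(1)]) auto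
 obtain D where D: "!!i. v i <= D" using convergent_imp_bounded[OF v(1)] unfolding bounded_iff by (auto simp: abs_le_iff)
 have "continuous_on {0..max u D} (%w. integral {0..w} g)"
  by (intro indefinite_integral_continuous_1 integrable_continuous_interval continuous_on_subset[OF g_cont]) auto
 then show ?thesis unfolding clock_eq
  using v u D by (intro continuous_on_tendsto_compose[where f="%w. integral {0..w} g" and s="{0..max u D}"]) (auto simp: le_max_iff_disj)
qed

lemma lrm_time_clock: "u >= 0 ==> lrm_time L0 \<xi> \<Lambda> (clock u) = u"
 unfolding lrm_time_def using clock_inj by (intro the_inv_into_f_f) auto

lemma lam_lim:
 assumes v: "v \<longlonglongrightarrow> u" "!!i. v i >= 0" and y: "y \<longlonglongrightarrow> z"
 shows "(%i. lam (v i) (y i)) \<longlonglongrightarrow> lam u z"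
proof -
 have u: "u >= 0" using v by (intro LIMSEQ_le_const[OF v(1)]) auto
 have "1 - 2 * \<Lambda> u (S0 L0 z) ~= 0" using Lam_less[OF u, of "S0 L0 z"] by simp
 then show ?thesis unfolding lam_def
  by (intro tendsto_intros isCont_tendsto_compose[OF L0_isCont] isCont_tendsto_compose[OF S0_cont] Lam_lim v y) simp
qed

lemma Xu_lim: "v \<longlonglongrightarrow> u ==> (!!i. v i >= 0) ==> (%i. Xu (v i)) \<longlonglongrightarrow> Xu u"
 unfolding Xu_def by (intro isCont_tendsto_compose[OF inv_S0_cont] xi_lim)

lemma lam_pos: "u >= 0 ==> lam u y > 0"
 unfolding lam_def using L0p Lam_less by (intro mult_pos_pos) (auto simp: less_imp_neq[symmetric])

lemma lam_cube: "u >= 0 ==> lam u (Xu u) ^ 3 = g u"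
 unfolding lam_def g_def Xu_def S0_inv using Lam_less[of u "\<xi> u"] by (simp add: power_mult_distrib powr_power)

end

text \<open>If the local times on a stretch of \<open>N\<close> edges agree up to exp(eps), the
  length of the stretch is N / (2^n L^2) up to exp(2 eps). This reads the local time off from a
  macroscopic gap of the scale.\<close>

lemma (in traj) S_gap_ln:
 assumes o: "!!l. l <= N ==> \<bar>ln (L k (j + int l)) - ln (L k j)\<bar> <= eps" and N: "N >= 1"
 shows "\<bar>ln (S k (j + int N) - S k j) - ln (real N / 2 ^ n) + 2 * ln (L k j)\<bar> <= 2 * eps"
proof -
 define a where "a = 1 / (2 ^ n * (L k j * L k j))"
 have a: "a > 0" using L_pos[of k j] by (simp add: a_def)
 have lna: "ln (1 / (2 ^ n * (p * q))) = - ln (2 ^ n) - ln p - ln q" if "p > 0" "q > 0" for p q :: real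
  using that by (simp add: ln_div ln_mult_pos)
 have t: "a * exp (- 2 * eps) <= S k (j + int l + 1) - S k (j + int l) & S k (j + int l + 1) - S k (j + int l) <= a * exp (2 * eps)" if l: "l < N" for l
 proof -
  let ?t = "S k (j + int l + 1) - S k (j + int l)"
  have tp: "?t > 0" using S_step[of k "j + int l"] by simp
  have "ln ?t = - ln (2 ^ n) - ln (L k (j + int l)) - ln (L k (j + int l + 1))" unfolding S_diff by (rule lna[OF L_pos L_pos])
  moreover have "ln a = - ln (2 ^ n) - ln (L k j) - ln (L k j)" unfolding a_def by (rule lna[OF L_pos L_pos])
  moreover have "\<bar>ln (L k (j + int l)) - ln (L k j)\<bar> <= eps" "\<bar>ln (L k (j + int l + 1)) - ln (L k j)\<bar> <= eps"
   using o[of l] o[of "Suc l"] l by (auto simp: algebra_simps)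
  ultimately have "ln a + - 2 * eps <= ln ?t" "ln ?t <= ln a + 2 * eps" by linarith+
  then have "exp (ln a + - 2 * eps) <= exp (ln ?t)" "exp (ln ?t) <= exp (ln a + 2 * eps)" by simp_all
  then show ?thesis using tp a unfolding exp_add by simp
 qed
 have s: "real q * (a * exp (- 2 * eps)) <= S k (j + int q) - S k j & S k (j + int q) - S k j <= real q * (a * exp (2 * eps))" if "q <= N" for q
  using that
 proof (induction q)
  case (Suc q)
  have e: "j + int (Suc q) = j + int q + 1" by simp
  have "real (Suc q) * z = real q * z + z" for z :: real by (simp add: algebra_simps)
  then show ?case unfolding e using Suc t[of q] by simp
 qed simp
 have Np: "real N > 0" using N by simp
 have Sp: "S k (j + int N) - S k j > 0" using S_less[of j "j + int N" k] N by simp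
 have "ln (real N * (a * exp z)) = ln (real N / 2 ^ n) - 2 * ln (L k j) + z" for z
 proof -
  have "ln (real N * (a * exp z)) = ln (real N) + (ln a + z)" using Np a by (simp add: ln_mult_pos)
  moreover have "ln a = - ln (2 ^ n) - ln (L k j) - ln (L k j)" unfolding a_def by (rule lna[OF L_pos L_pos])
  ultimately show ?thesis using Np by (simp add: ln_div)
 qed
 moreover have "ln (real N * (a * exp (- 2 * eps))) <= ln (S k (j + int N) - S k j)" "ln (S k (j + int N) - S k j) <= ln (real N * (a * exp (2 * eps)))"
  using s[of N] Sp Np a by (subst ln_le_cancel_iff; simp)+
 ultimately show ?thesis by (simp add: abs_le_iff)
qed

section \<open>Deterministic passage to the limit along trajectories near a path\<close>

lemma jump_index:
 fixes h :: "nat => real"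
 assumes h: "!!i. h i > 0" and t: "0 <= t" "t < jtime h (Suc K)" and k: "k = (LEAST k. t < jtime h (Suc k))"
 shows "k <= K" "jtime h k <= t" "t < jtime h (Suc k)" "stop_time h t = t" "ereal t < expl_time h"
proof -
 show "k <= K" unfolding k using t(2) by (rule Least_le)
 show "t < jtime h (Suc k)" unfolding k using t(2) by (rule LeastI)
 show "jtime h k <= t"
 proof (cases k)
  case 0
  then show ?thesis using t by (simp add: jtime_def)
 next
  case (Suc l)
  then have "\<not> t < jtime h (Suc l)" unfolding k by (intro not_less_Least) simp
  then show ?thesis using Suc by simp
 qed
 have "ereal t < ereal (jtime h (Suc K))" using t by simp
 also have "... <= expl_time h" unfolding expl_time_def by (intro SUP_upper) auto
 finally show e: "ereal t < expl_time h" .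
 show "stop_time h t = t"
 proof (cases "expl_time h")
  case (real r)
  then show ?thesis using e by (simp add: stop_time_def)
 qed (use e in \<open>auto simp: stop_time_def\<close>)
qed

text \<open>Local times are nondecreasing, so the profile in the middle of a holding time is
  sandwiched between the profiles at the two jump indices. Partial holding times need no separate
  limit.\<close>

lemma vrjp_L_bounds:
 assumes v: "\<forall>i. valid (x i)" and L0p: "!!y. L0 y > 0" and k: "jtime (%i. snd (x i)) k <= t" "t < jtime (%i. snd (x i)) (Suc k)"
 shows "loc n L0 x k j <= vrjp_L n L0 (%i. fst (x i)) (%i. snd (x i)) t (real_of_int j / 2 ^ n)"
  "vrjp_L n L0 (%i. fst (x i)) (%i. snd (x i)) t (real_of_int j / 2 ^ n) <= loc n L0 x (Suc k) j"
proof -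
 let ?t = "jtime (%i. snd (x i))"
 have h: "snd (x i) > 0" for i using v by (simp add: valid_def)
 have mono: "?t l <= ?t l'" if "l <= l'" for l l' unfolding jtime_def using that h by (intro sum_mono2) (auto simp: less_imp_le)
 have jp: "jpos n (%i. fst (x i)) l = real_of_int j / 2 ^ n \<longleftrightarrow> pos x l = j" for l
  by (simp add: jpos_def pos_def divide_cancel_right flip: of_int_sum)
 let ?f = "%l. if jpos n (%i. fst (x i)) l = real_of_int j / 2 ^ n then max 0 (min (?t (Suc l)) t - ?t l) else 0"
 have z: "?f l = 0" if "l \<notin> {..k}" for l
  using mono[of "Suc k" l] k that by auto
 have full: "?f l = (if pos x l = j then snd (x l) else 0)" if "l < k" for l
  using mono[of "Suc l" k] k h[of l] that unfolding jp by (auto simp: jtime_def min_def max_def)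
 have last: "0 <= ?f k" "?f k <= (if pos x k = j then snd (x k) else 0)"
  using k h[of k] unfolding jp by (auto simp: jtime_def)
 have "suminf ?f = sum ?f {..k}" by (rule suminf_finite[OF _ z]) auto
 also have "... = sum ?f {..<k} + ?f k" by (simp add: lessThan_Suc_atMost[symmetric])
 also have "sum ?f {..<k} = (\<Sum>l<k. if pos x l = j then snd (x l) else 0)" by (intro sum.cong) (auto simp only: full lessThan_iff)
 finally have s: "suminf ?f = (\<Sum>l<k. if pos x l = j then snd (x l) else 0) + ?f k" .
 then show "loc n L0 x k j <= vrjp_L n L0 (%i. fst (x i)) (%i. snd (x i)) t (real_of_int j / 2 ^ n)"
  unfolding vrjp_L_def vrjp_loc_def loc_def s using last(1) by (intro add_left_mono mult_left_mono) auto
 show "vrjp_L n L0 (%i. fst (x i)) (%i. snd (x i)) t (real_of_int j / 2 ^ n) <= loc n L0 x (Suc k) j"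
  unfolding vrjp_L_def vrjp_loc_def loc_def s using last(2) by (intro add_left_mono mult_left_mono) auto
qed

text \<open>Up to jump index \<open>K i\<close> the walk stays within radius \<open>R\<close>, and
  the next jump happens after time \<open>T\<close>. The modulus is assumed on radius
  \<open>R + 2\<close>: one unit for neighbours and interpolation nodes, one more for the forward
  gaps that determine local times. The level \<open>n i\<close> only has to tend to infinity, which
  suits arbitrary subsequences.\<close>

locale lim_data = lrm_env b \<Psi> \<Lambda> \<xi> L0 for b \<Psi> \<Lambda> \<xi> L0 +
 fixes T U A :: real and R :: nat and n :: "nat => nat" and x :: "nat => nat => int \<times> real" and K :: "nat => nat" and tht :: "nat => real"
 assumes n_lim: "filterlim n at_top sequentially" and vx: "!!i. \<forall>k. valid (x i k)"
  and A0: "A >= 0" and ok: "!!i. modulus_ok (n i) L0 A (R + 2) (x i)"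
  and posR: "!!i k. k <= K i ==> \<bar>pos (x i) k\<bar> <= int R * 2 ^ n i"
  and uU: "!!i k. k <= Suc (K i) ==> clk (n i) L0 (x i) k <= U"
  and tht: "tht \<longlonglongrightarrow> 0" "!!i. tht i >= 0"
  and close: "!!i k v. k <= K i ==> clk (n i) L0 (x i) k <= v ==> v <= clk (n i) L0 (x i) (Suc k) ==> \<bar>mart (n i) L0 (x i) k - b v\<bar> <= tht i"
  and tK: "!!i. jtime (%k. snd (x i k)) (Suc (K i)) > T" and T: "0 <= T" "T <= real R"
begin

abbreviation "LL i \<equiv> loc (n i) L0 (x i)"
abbreviation "SS i \<equiv> scl (n i) L0 (x i)"
abbreviation "MM i \<equiv> mart (n i) L0 (x i)"
abbreviation "uu i \<equiv> clk (n i) L0 (x i)"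
abbreviation "dd i \<equiv> dclk (n i) L0 (x i)"
abbreviation "ss i \<equiv> shrink (n i) L0 (x i)"
abbreviation "site i j \<equiv> real_of_int j / 2 ^ n i"
abbreviation "tm i \<equiv> jtime (%k. snd (x i k))"

lemma tr: "traj L0 (x i)" by standard (use L0p vx in auto)

lemma U0: "U >= 0" using uU[of 0 0] traj.clk_0[OF tr, of "n 0" 0] by simp

lemma uu_nonneg: "uu i k >= 0" by (rule traj.clk_nonneg[OF tr])

lemma n_ge: "\<forall>\<^sub>F i in sequentially. m <= n i" using n_lim by (simp add: filterlim_at_top)

lemma osc:
 assumes "eps > 0"
 shows "\<exists>m. \<forall>m'\<ge>m. \<forall>i. m' <= n i --> (\<forall>k j j'. \<bar>j\<bar> <= int (R + 2) * 2 ^ n i --> \<bar>j'\<bar> <= int (R + 2) * 2 ^ n i --> \<bar>j - j'\<bar> <= 2 ^ (n i - m')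
    --> \<bar>ln (LL i k j') - ln (LL i k j)\<bar> <= eps)"
proof -
 obtain m where m: "!!n x k i j. n >= m ==> \<forall>i. valid (x i) ==> modulus_ok n L0 A (R + 2) x ==>
  \<bar>i\<bar> <= int (R + 2) * 2 ^ n ==> \<bar>j\<bar> <= int (R + 2) * 2 ^ n ==> \<bar>i - j\<bar> <= 2 ^ (n - m)
    ==> \<bar>ln (loc n L0 x k j) - ln (loc n L0 x k i)\<bar> <= eps"
  using ln_loc_osc[OF L0c L0p A0 assms, of "R + 2"] by blast
 show ?thesis
 proof (intro exI[of _ m] allI impI)
  fix m' i k and j j' :: int assume m': "m <= m'" "m' <= n i" and j: "\<bar>j\<bar> <= int (R + 2) * 2 ^ n i" "\<bar>j'\<bar> <= int (R + 2) * 2 ^ n i" "\<bar>j - j'\<bar> <= 2 ^ (n i - m')"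
  have "(2::int) ^ (n i - m') <= 2 ^ (n i - m)" using m' by (intro power_increasing) auto
  then have "\<bar>j - j'\<bar> <= 2 ^ (n i - m)" using j(3) by linarith
  then show "\<bar>ln (LL i k j') - ln (LL i k j)\<bar> <= eps" using m' j by (intro m[OF _ vx ok]) auto
 qed
qed

lemma asym_ev:
 assumes "kap > 0"
 shows "\<forall>\<^sub>F i in sequentially. \<forall>k\<le>K i. \<forall>sgm\<in>{1,-1}. \<bar>ss i k sgm - dd i k\<bar> <= kap * dd i k"
proof -
 obtain m where m: "!!i k j j'. m <= n i ==> \<bar>j\<bar> <= int (R + 2) * 2 ^ n i ==> \<bar>j'\<bar> <= int (R + 2) * 2 ^ n i ==> \<bar>j - j'\<bar> <= 2 ^ (n i - m)
    ==> \<bar>ln (LL i k j') - ln (LL i k j)\<bar> <= kap" using osc[OF assms] by blast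
 have "\<forall>\<^sub>F i in sequentially. m + 1 <= n i" by (rule n_ge)
 then show ?thesis
 proof eventually_elim
  case (elim i)
  show ?case
  proof (intro allI impI ballI traj.shrink_asym[OF tr])
   fix k sgm assume k: "k <= K i"
   have b: "\<bar>pos (x i) k\<bar> <= int R * 2 ^ n i" by (rule posR[OF k])
   have p: "(1::int) <= 2 ^ n i" by simp
   have "(2::int) ^ 1 <= 2 ^ (n i - m)" using elim by (intro power_increasing) auto
   moreover have "int (R + 2) * 2 ^ n i = int R * 2 ^ n i + 2 * 2 ^ n i" by (simp add: algebra_simps)
   ultimately show "\<bar>ln (LL i k (pos (x i) k + 1)) - ln (LL i k (pos (x i) k - 1))\<bar> <= kap"
    using b p elim by (intro m) (linarith | simp)+
  qed auto
 qed
qed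

lemma LL_lower: "\<exists>c>0. \<forall>i k j. \<bar>j\<bar> <= int (R + 2) * 2 ^ n i --> c <= LL i k j"
proof -
 obtain c where c: "c > 0" "!!y. \<bar>y\<bar> <= real (R + 2) ==> L0 y >= c" using L0_lower_bound[OF L0c L0p, of "real (R + 2)"] by auto
 have "c <= LL i k j" if "\<bar>j\<bar> <= int (R + 2) * 2 ^ n i" for i k j
  using c(2)[OF site_le[OF that]] traj.L_ge[OF tr, of j "n i" i k] by linarith
 then show ?thesis using c(1) by blast
qed

lemma nbr:
 assumes "k <= K i" "sgm = 0 \<or> sgm = 1 \<or> sgm = -1"
 shows "\<bar>pos (x i) k + sgm\<bar> <= int (R + 1) * 2 ^ n i"
proof -
 have "\<bar>pos (x i) k\<bar> <= int R * 2 ^ n i" "(1::int) <= 2 ^ n i" using posR assms by auto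
 moreover have "int (R + 1) * 2 ^ n i = int R * 2 ^ n i + 2 ^ n i" by (simp add: algebra_simps)
 ultimately show ?thesis using assms(2) by linarith
qed

lemma wider: "\<bar>j\<bar> <= int (R + 1) * 2 ^ n i ==> \<bar>j\<bar> <= int (R + 2) * 2 ^ n i"
proof -
 assume "\<bar>j\<bar> <= int (R + 1) * 2 ^ n i"
 also have "... <= int (R + 2) * 2 ^ n i" by (intro mult_right_mono) auto
 finally show ?thesis .
qed

lemma dd_small:
 assumes "eps > 0"
 shows "\<forall>\<^sub>F i in sequentially. \<forall>k\<le>K i. dd i k <= eps"
proof -
 obtain c where c: "c > 0" "!!i k j. \<bar>j\<bar> <= int (R + 2) * 2 ^ n i ==> c <= LL i k j" using LL_lower by auto
 obtain m where m: "1 / (eps * c\<^sup>2) < 2 ^ m" using real_arch_pow[of 2 "1 / (eps * c\<^sup>2)"] by auto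
 have "\<forall>\<^sub>F i in sequentially. m <= n i" by (rule n_ge)
 then show ?thesis
 proof eventually_elim
  case (elim i)
  have "(2::real) ^ m <= 2 ^ n i" using elim by (intro power_increasing) auto
  then have "1 / (eps * c\<^sup>2) <= 2 ^ n i" using m by linarith
  then have *: "1 / (2 ^ n i * c\<^sup>2) <= eps" using assms c(1) by (simp add: field_simps)
  have "ss i k sgm <= eps" if k: "k <= K i" and s: "sgm = 1 \<or> sgm = -1" for k sgm
  proof -
   interpret traj "n i" L0 "x i" by (rule tr)
   have l: "c <= LL i k (pos (x i) k)" "c <= LL i k (pos (x i) k + sgm)"
    using c(2)[OF wider[OF nbr[OF k, of 0]], of k] c(2)[OF wider[OF nbr[OF k, of sgm]], of k] s by auto
   have "ss i k sgm <= 1 / (2 ^ n i * LL i k (pos (x i) k + sgm)) * (1 / LL i k (pos (x i) k))"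
    unfolding sh_eq using L_pos[of k "pos (x i) k + sgm"] L_pos[of "Suc k" "pos (x i) k"] by (intro mult_left_mono) auto
   also have "... = 1 / (2 ^ n i * (LL i k (pos (x i) k) * LL i k (pos (x i) k + sgm)))" by simp
   also have "... <= 1 / (2 ^ n i * (c * c))" using l c(1) by (intro divide_left_mono mult_left_mono mult_mono mult_pos_pos) auto
   finally show ?thesis using * by (simp add: power2_eq_square)
  qed
  note sb = this
  show ?case
  proof (intro allI impI)
   fix k assume "k <= K i"
   then show "dd i k <= eps" using sb[of k 1] sb[of k "-1"] by (simp add: dclk_def)
  qed
 qed
qed

context
 fixes rh :: "nat => nat" assumes rh: "filterlim rh at_top sequentially"
begin

lemma evrh: "\<forall>\<^sub>F i in sequentially. P i ==> \<forall>\<^sub>F i in sequentially. P (rh i)"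
 by (rule eventually_compose_filterlim[OF _ rh])

lemma scl0_lim:
 assumes j: "!!i. \<bar>j i\<bar> <= int (R + 2) * 2 ^ n (rh i)" and y: "(%i. site (rh i) (j i)) \<longlonglongrightarrow> y"
 shows "(%i. scl0 (n (rh i)) L0 (j i)) \<longlonglongrightarrow> S0 L0 y"
proof -
 have "(%i. scl0 (n (rh i)) L0 (j i) - S0 L0 (site (rh i) (j i))) \<longlonglongrightarrow> 0"
 proof (rule tendstoI)
  fix e :: real assume e: "e > 0"
  obtain N where N: "!!n j. n >= N ==> \<bar>j\<bar> <= int (R + 2) * 2 ^ n ==> \<bar>scl0 n L0 j - S0 L0 (real_of_int j / 2 ^ n)\<bar> <= e / 2"
   using scl0_approx[of "e / 2" "R + 2"] e by auto
  from evrh[OF n_ge[of N]]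
  show "\<forall>\<^sub>F i in sequentially. dist (scl0 (n (rh i)) L0 (j i) - S0 L0 (site (rh i) (j i))) 0 < e"
  proof eventually_elim
   case (elim i)
   then show ?case using N[OF elim j] e by (simp add: dist_real_def)
  qed
 qed
 moreover have "(%i. S0 L0 (site (rh i) (j i))) \<longlonglongrightarrow> S0 L0 y" by (rule isCont_tendsto_compose[OF S0_cont y])
 ultimately have "(%i. (scl0 (n (rh i)) L0 (j i) - S0 L0 (site (rh i) (j i))) + S0 L0 (site (rh i) (j i))) \<longlonglongrightarrow> 0 + S0 L0 y" by (rule tendsto_add)
 then show ?thesis by simp
qed

text \<open>The images of a site satisfy the discrete equation with martingale close to the path and
  speeds close to one, so \<open>compare_up\<close> and \<open>compare_down\<close> keep them near
  the flow line started from the initial scale.\<close>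

lemma S_lim:
 assumes j: "!!i. \<bar>j i\<bar> <= int (R + 2) * 2 ^ n (rh i)" and y: "(%i. site (rh i) (j i)) \<longlonglongrightarrow> y"
  and k: "!!i. k i <= Suc (K (rh i))" and u: "(%i. uu (rh i) (k i)) \<longlonglongrightarrow> u"
 shows "(%i. SS (rh i) (k i) (j i)) \<longlonglongrightarrow> \<Psi> u (S0 L0 y)"
proof -
 have "(%i. SS (rh i) (k i) (j i) - \<Psi> (uu (rh i) (k i)) (S0 L0 y)) \<longlonglongrightarrow> 0"
 proof (rule tendstoI)
  fix e :: real assume e: "e > 0"
  \<comment> \<open>Error budget: one quarter of \<open>e\<close> each for the speeds, for three
    clock steps of size e/12, for the distance of martingale and path, and for the initial
    scale.\<close>
  define kap where "kap = e / (4 * (U + 1))"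
  have kap: "kap > 0" "kap * U <= e / 4" using e U0 by (auto simp: kap_def field_simps)
  have e1: "\<forall>\<^sub>F i in sequentially. \<forall>k\<le>K (rh i). \<forall>sgm\<in>{1,-1}. \<bar>ss (rh i) k sgm - dd (rh i) k\<bar> <= kap * dd (rh i) k" by (rule evrh[OF asym_ev[OF kap(1)]])
  have e2: "\<forall>\<^sub>F i in sequentially. \<forall>k\<le>K (rh i). dd (rh i) k <= e / 12" using e by (intro evrh[OF dd_small]) auto
  have e3: "\<forall>\<^sub>F i in sequentially. tht (rh i) < e / 4" using e by (intro evrh[OF order_tendstoD(2)[OF tht(1)]]) auto
  have e4: "\<forall>\<^sub>F i in sequentially. dist (scl0 (n (rh i)) L0 (j i)) (S0 L0 y) < e / 4" using e by (intro tendstoD[OF scl0_lim[OF j y]]) auto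
  from e1 e2 e3 e4 show "\<forall>\<^sub>F i in sequentially. dist (SS (rh i) (k i) (j i) - \<Psi> (uu (rh i) (k i)) (S0 L0 y)) 0 < e"
  proof eventually_elim
   case (elim i)
   let ?I = "rh i"
   interpret tj: traj "n ?I" L0 "x ?I" by (rule tr)
   have d0: "dd ?I l > 0" for l by (rule tj.dclk_pos)
   have duu: "uu ?I (Suc l) - uu ?I l = dd ?I l" for l by (simp add: tj.clk_Suc)
   have sb: "\<bar>ss ?I l 1 - dd ?I l\<bar> <= kap * dd ?I l" "\<bar>ss ?I l (-1) - dd ?I l\<bar> <= kap * dd ?I l" if "l < Suc (K ?I)" for l
    using elim(1) that by auto
   have km: "(1 + kap) * d = d + kap * d" "(1 - kap) * d = d - kap * d" for d by (simp_all add: algebra_simps)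
   have dS: "SS ?I (Suc l) (j i) - SS ?I l (j i) = dscl (n ?I) L0 (x ?I) (j i) l" for l by (simp add: scl_Suc)
   have du: "uu ?I l <= uu ?I (Suc l) & uu ?I (Suc l) <= uu ?I l + e / 12" if "l < Suc (K ?I)" for l
    using elim(2) that d0[of l] by (simp add: tj.clk_Suc)
   have cl: "\<bar>MM ?I l - b v\<bar> <= tht ?I" if "l < Suc (K ?I)" "uu ?I l <= v" "v <= uu ?I (Suc l)" for l v
    using close[of l ?I v] that by simp
   have kd: "0 <= kap * dd ?I l" for l using kap d0[of l] by simp
   have a: "\<bar>dscl (n ?I) L0 (x ?I) (j i) l\<bar> <= dd ?I l + kap * dd ?I l" if "l < Suc (K ?I)" for l
    using sb[OF that] d0[of l] kd[of l] tj.sh_pos[of l 1] tj.sh_pos[of l "-1"] by (auto simp: dscl_def)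
   have up: "SS ?I (Suc l) (j i) - SS ?I l (j i) <= (1 + kap) * (uu ?I (Suc l) - uu ?I l)"
    "SS ?I (Suc l) (j i) - SS ?I l (j i) >= - (1 + kap) * (uu ?I (Suc l) - uu ?I l)" if "l < Suc (K ?I)" for l
    using a[OF that] unfolding dS duu minus_mult_left[symmetric] km by linarith+
   \<comment> \<open>The scale is increasing and the martingale is the image of the walker, so an
     image above the martingale belongs to a site on the right of the walker.\<close>
   have dn1: "SS ?I (Suc l) (j i) - SS ?I l (j i) <= - (1 - kap) * (uu ?I (Suc l) - uu ?I l)"
    if "l < Suc (K ?I)" "SS ?I l (j i) > MM ?I l" for l
   proof -
    have "pos (x ?I) l < j i" using that(2) tj.S_le[of "j i" "pos (x ?I) l" l] tj.S_pos[of l] by (cases "pos (x ?I) l < j i") auto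
    then show ?thesis unfolding dS duu minus_mult_left[symmetric] km using sb[OF that(1)] by (simp add: dscl_def abs_le_iff)
   qed
   have dn2: "SS ?I (Suc l) (j i) - SS ?I l (j i) >= (1 - kap) * (uu ?I (Suc l) - uu ?I l)"
    if "l < Suc (K ?I)" "SS ?I l (j i) < MM ?I l" for l
   proof -
    have "pos (x ?I) l > j i" using that(2) tj.S_le[of "pos (x ?I) l" "j i" l] tj.S_pos[of l] by (cases "pos (x ?I) l > j i") auto
    then show ?thesis unfolding dS duu km using sb[OF that(1)] by (simp add: dscl_def abs_le_iff)
   qed
   have S0s: "SS ?I 0 (j i) = scl0 (n ?I) L0 (j i)" by (simp add: scl_def)
   have e12: "0 <= e / 12" using e by simp
   have c1: "SS ?I (k i) (j i) - \<Psi> (uu ?I (k i)) (S0 L0 y) <= max (SS ?I 0 (j i) - S0 L0 y) (tht ?I + 3 * (e / 12)) + kap * uu ?I (k i) & uu ?I (k i) >= 0"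
    by (rule compare_up[where s="%l. SS ?I l (j i)" and u="uu ?I" and m="MM ?I" and K="Suc (K ?I)"])
     (use du cl up dn1 k[of i] kap e12 tht(2)[of ?I] tj.clk_0 in auto)
   have c2: "\<Psi> (uu ?I (k i)) (S0 L0 y) - SS ?I (k i) (j i) <= max (S0 L0 y - SS ?I 0 (j i)) (tht ?I + 3 * (e / 12)) + kap * uu ?I (k i) & uu ?I (k i) >= 0"
    by (rule compare_down[where s="%l. SS ?I l (j i)" and u="uu ?I" and m="MM ?I" and K="Suc (K ?I)"])
     (use du cl up dn2 k[of i] kap e12 tht(2)[of ?I] tj.clk_0 in auto)
   have "kap * uu ?I (k i) <= kap * U" using kap uU[OF k] by (intro mult_left_mono) auto
   then show ?case using c1 c2 elim(3,4) kap(2) e unfolding S0s dist_real_def by (simp add: abs_less_iff max_def split: if_splits; linarith)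
  qed
 qed
 moreover have "(%i. \<Psi> (uu (rh i) (k i)) (S0 L0 y)) \<longlonglongrightarrow> \<Psi> u (S0 L0 y)" by (rule Psi_lim[OF u uu_nonneg])
 ultimately have "(%i. (SS (rh i) (k i) (j i) - \<Psi> (uu (rh i) (k i)) (S0 L0 y)) + \<Psi> (uu (rh i) (k i)) (S0 L0 y)) \<longlonglongrightarrow> 0 + \<Psi> u (S0 L0 y)" by (rule tendsto_add)
 then show ?thesis by simp
qed

lemma b_uu_lim:
 assumes k: "!!i. k i <= K (rh i)" and u: "(%i. uu (rh i) (k i)) \<longlonglongrightarrow> u"
 shows "(%i. MM (rh i) (k i)) \<longlonglongrightarrow> b u"
proof -
 have "\<bar>MM (rh i) (k i) - b (uu (rh i) (k i))\<bar> <= tht (rh i)" for i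
  using close[OF k order_refl, of i] traj.clk_mono[OF tr, of "k i" "Suc (k i)" "n (rh i)" "rh i"] by simp
 then have "(%i. MM (rh i) (k i) - b (uu (rh i) (k i))) \<longlonglongrightarrow> 0"
  by (intro Lim_null_comparison[OF _ filterlim_compose[OF tht(1) rh]]) auto
 from tendsto_add[OF this b_lim[OF u uu_nonneg]] show ?thesis by simp
qed

end

text \<open>The image of the walker tends to the flow line of any subsequential limit of its
  position and, being the martingale, also to the path. Exactly one label has its flow line on the
  path at clock \<open>u\<close>.\<close>

lemma pos_lim:
 assumes rh: "filterlim rh at_top sequentially" and k: "!!i. k i <= K (rh i)" and u: "(%i. uu (rh i) (k i)) \<longlonglongrightarrow> u"
 shows "(%i. site (rh i) (pos (x (rh i)) (k i))) \<longlonglongrightarrow> Xu u"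
proof (rule bounded_tendstoI)
 show "\<bar>site (rh i) (pos (x (rh i)) (k i))\<bar> <= real R" for i by (rule site_le[OF posR[OF k]])
next
 fix r :: "nat => nat" and y assume r: "strict_mono r" and y: "(%i. site (rh (r i)) (pos (x (rh (r i))) (k (r i)))) \<longlonglongrightarrow> y"
 have rl: "filterlim r at_top sequentially" by (rule filterlim_subseq[OF r])
 have rh': "filterlim (%i. rh (r i)) at_top sequentially" by (rule filterlim_compose[OF rh rl])
 have u': "(%i. uu (rh (r i)) (k (r i))) \<longlonglongrightarrow> u" using filterlim_compose[OF u rl] .
 have u0: "u >= 0" using uu_nonneg by (intro LIMSEQ_le_const[OF u]) auto
 have "(%i. SS (rh (r i)) (k (r i)) (pos (x (rh (r i))) (k (r i)))) \<longlonglongrightarrow> \<Psi> u (S0 L0 y)"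
  by (rule S_lim[OF rh' _ y _ u']) (use posR[OF k] k in \<open>auto intro!: wider order_trans[OF posR[OF k]] le_SucI simp: mult_right_mono\<close>)
 moreover have "(%i. SS (rh (r i)) (k (r i)) (pos (x (rh (r i))) (k (r i)))) \<longlonglongrightarrow> b u"
  unfolding traj.S_pos[OF tr] by (rule b_uu_lim[OF rh' k u'])
 ultimately have "\<Psi> u (S0 L0 y) = b u" by (rule LIMSEQ_unique)
 then have "\<xi> u = S0 L0 y" using xi_eq_iff[OF u0] by blast
 then show "y = Xu u" by (simp add: Xu_def inv_S0)
qed

lemma inv_pow_lim: "filterlim rh at_top sequentially ==> (%i. 1 / 2 ^ n (rh i)) \<longlonglongrightarrow> (0::real)"
proof -
 assume "filterlim rh at_top sequentially"
 then have "filterlim (%i. n (rh i)) at_top sequentially" by (rule filterlim_compose[OF n_lim])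
 moreover have "(%m. (1 / 2) ^ m) \<longlonglongrightarrow> (0::real)" by (intro LIMSEQ_power_zero) auto
 ultimately have "(%i. (1 / 2) ^ n (rh i)) \<longlonglongrightarrow> (0::real)" by (rule filterlim_compose[rotated])
 then show ?thesis by (simp add: power_one_over)
qed

text \<open>A scale gap over length \<open>h\<close> is about h / L^2, and in the limit it is about
  \<open>h\<close> times the space derivative \<open>G\<close> of the flow; hence ln L tends to - ln
  G / 2. The length 1/2^m is fixed first, small enough for the difference quotient and the modulus,
  and only then the mesh tends to 0.\<close>

lemma L_lim:
 assumes rh: "filterlim rh at_top sequentially" and j: "!!i. \<bar>j i\<bar> <= int (R + 1) * 2 ^ n (rh i)" and y: "(%i. site (rh i) (j i)) \<longlonglongrightarrow> y"
  and k: "!!i. k i <= Suc (K (rh i))" and u: "(%i. uu (rh i) (k i)) \<longlonglongrightarrow> u"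
 shows "(%i. LL (rh i) (k i) (j i)) \<longlonglongrightarrow> lam u y"
proof -
 have u0: "u >= 0" using uu_nonneg by (intro LIMSEQ_le_const[OF u]) auto
 define D where "D = 1 - 2 * \<Lambda> u (S0 L0 y)"
 define G where "G = D * (1 / (L0 y)\<^sup>2)"
 have D: "D > 0" unfolding D_def by (rule Lam_less[OF u0])
 have G: "G > 0" using D L0p[of y] by (simp add: G_def)
 have der: "((%y. \<Psi> u (S0 L0 y)) has_real_derivative G) (at y)"
  unfolding G_def D_def by (rule DERIV_chain2[OF Psi_deriv[OF u0] S0_deriv])
 define h :: "nat => real" where "h m = 1 / 2 ^ m" for m
 have h: "h m > 0" for m by (simp add: h_def)
 have "(%m. (1 / 2) ^ m) \<longlonglongrightarrow> (0::real)" by (intro LIMSEQ_power_zero) auto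
 then have "h \<longlonglongrightarrow> 0" by (simp add: h_def[abs_def] power_one_over)
 then have h0: "filterlim h (at 0) sequentially" using h by (intro filterlim_atI) (auto simp: less_imp_neq[symmetric])
 define q where "q m = (\<Psi> u (S0 L0 (y + h m)) - \<Psi> u (S0 L0 y)) / h m" for m
 have "q \<longlonglongrightarrow> G" unfolding q_def[abs_def] using filterlim_compose[OF DERIV_D[OF der] h0] .
 then have lnq: "(%m. ln (q m)) \<longlonglongrightarrow> ln G" using G by (intro tendsto_ln) auto
 have "(%i. ln (LL (rh i) (k i) (j i))) \<longlonglongrightarrow> - (ln G / 2)"
 proof (rule tendstoI)
  fix e :: real assume e: "e > 0"
  obtain m1 where m1: "!!m i k j j'. m >= m1 ==> m <= n i ==> \<bar>j\<bar> <= int (R + 2) * 2 ^ n i ==> \<bar>j'\<bar> <= int (R + 2) * 2 ^ n i ==> \<bar>j - j'\<bar> <= 2 ^ (n i - m)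
    ==> \<bar>ln (LL i k j') - ln (LL i k j)\<bar> <= e / 4" using osc[of "e / 4"] e by (metis zero_less_divide_iff zero_less_numeral)
  have "\<forall>\<^sub>F m in sequentially. dist (ln (q m)) (ln G) < e / 4 & m >= m1"
   using e by (intro eventually_conj tendstoD[OF lnq] eventually_ge_at_top) auto
  then obtain m where m: "\<bar>ln (q m) - ln G\<bar> < e / 4" "m >= m1" unfolding dist_real_def using eventually_happens'[OF sequentially_bot] by blast
  define D where "D = \<Psi> u (S0 L0 (y + h m)) - \<Psi> u (S0 L0 y)"
  have Dp: "D > 0" unfolding D_def using Psi_less[OF u0] S0_less h[of m] by simp
  have lq: "ln (q m) = ln D - ln (h m)" unfolding q_def D_def[symmetric] using Dp h[of m] by (simp add: ln_div)
  \<comment> \<open>Before the mesh is finer than 1/2^m the shifted site is replaced by the site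
    itself, which keeps it in the window for every index.\<close>
  define j' where "j' i = (if m <= n (rh i) then j i + 2 ^ (n (rh i) - m) else j i)" for i
  have nm: "\<forall>\<^sub>F i in sequentially. m <= n (rh i)" by (rule evrh[OF rh n_ge])
  have j'b: "\<bar>j' i\<bar> <= int (R + 2) * 2 ^ n (rh i)" for i
  proof -
   have "(2::int) ^ (n (rh i) - m) <= 2 ^ n (rh i)" by (intro power_increasing) auto
   moreover have "int (R + 2) * 2 ^ n (rh i) = int (R + 1) * 2 ^ n (rh i) + 2 ^ n (rh i)" by (simp add: algebra_simps)
   moreover have "0 <= (2::int) ^ (n (rh i) - m)" by simp
   moreover have "j' i = j i \<or> j' i = j i + 2 ^ (n (rh i) - m)" by (simp add: j'_def)
   ultimately show ?thesis using j[of i] by linarith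
  qed
  have pw: "2 ^ (a - m) / 2 ^ a = h m" if "m <= a" for a using that by (simp add: h_def power_diff)
  have "\<forall>\<^sub>F i in sequentially. site (rh i) (j i) + h m = site (rh i) (j' i)"
   using nm by eventually_elim (simp add: j'_def add_divide_distrib pw)
  moreover have "(%i. site (rh i) (j i) + h m) \<longlonglongrightarrow> y + h m" by (intro tendsto_add y tendsto_const)
  ultimately have y': "(%i. site (rh i) (j' i)) \<longlonglongrightarrow> y + h m" by (rule Lim_transform_eventually[rotated])
  have "(%i. SS (rh i) (k i) (j' i) - SS (rh i) (k i) (j i)) \<longlonglongrightarrow> D"
   unfolding D_def by (intro tendsto_diff S_lim[OF rh j'b y' k u] S_lim[OF rh wider[OF j] y k u])
  then have "(%i. ln (SS (rh i) (k i) (j' i) - SS (rh i) (k i) (j i))) \<longlonglongrightarrow> ln D" using Dp by (intro tendsto_ln) auto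
  then have "\<forall>\<^sub>F i in sequentially. dist (ln (SS (rh i) (k i) (j' i) - SS (rh i) (k i) (j i))) (ln D) < e / 4" using e by (intro tendstoD) auto
  with nm show "\<forall>\<^sub>F i in sequentially. dist (ln (LL (rh i) (k i) (j i))) (- (ln G / 2)) < e"
  proof eventually_elim
   case (elim i)
   let ?N = "(2::nat) ^ (n (rh i) - m)"
   have "\<bar>ln (SS (rh i) (k i) (j i + int ?N) - SS (rh i) (k i) (j i)) - ln (real ?N / 2 ^ n (rh i)) + 2 * ln (LL (rh i) (k i) (j i))\<bar> <= 2 * (e / 4)"
   proof (rule traj.S_gap_ln[OF tr])
    fix l assume l: "l <= ?N"
    then have l': "int l <= 2 ^ (n (rh i) - m)" by (metis of_nat_le_iff of_nat_numeral of_nat_power)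
    have jj: "j' i = j i + 2 ^ (n (rh i) - m)" using elim by (simp add: j'_def)
    show "\<bar>ln (LL (rh i) (k i) (j i + int l)) - ln (LL (rh i) (k i) (j i))\<bar> <= e / 4"
     using l' j'b[of i] wider[OF j[of i]] unfolding jj by (intro m1[OF m(2) elim(1)]) linarith+
   qed simp
   moreover have "j i + int ?N = j' i" using elim by (simp add: j'_def)
   moreover have "ln (real ?N / 2 ^ n (rh i)) = ln (h m)" using pw[OF elim(1)] by simp
   ultimately have "\<bar>ln (SS (rh i) (k i) (j' i) - SS (rh i) (k i) (j i)) - ln (h m) + 2 * ln (LL (rh i) (k i) (j i))\<bar> <= 2 * (e / 4)" by simp
   then show ?case using elim(2) m(1) e unfolding lq dist_real_def by argo
  qed
 qed
 then have "(%i. exp (ln (LL (rh i) (k i) (j i)))) \<longlonglongrightarrow> exp (- (ln G / 2))" by (intro tendsto_exp)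
 moreover have "exp (ln (LL (rh i) (k i) (j i))) = LL (rh i) (k i) (j i)" for i using traj.L_pos[OF tr] by simp
 moreover have "exp (- (ln G / 2)) = lam u y"
 proof -
  have "ln G = ln D - 2 * ln (L0 y)" unfolding G_def using D L0p[of y] by (simp add: ln_mult_pos ln_div ln_realpow)
  then have "exp (- (ln G / 2)) = exp (ln (L0 y)) * exp (- 1 / 2 * ln D)" by (simp add: exp_add[symmetric] algebra_simps diff_divide_distrib)
  then show ?thesis unfolding lam_def D_def[symmetric] using D L0p[of y] by (simp add: powr_def)
 qed
 ultimately show ?thesis by simp
qed

lemma uu_Suc_lim:
 assumes rh: "filterlim rh at_top sequentially" and k: "!!i. k i <= K (rh i)" and u: "(%i. uu (rh i) (k i)) \<longlonglongrightarrow> u"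
 shows "(%i. uu (rh i) (Suc (k i))) \<longlonglongrightarrow> u"
proof -
 have "(%i. dd (rh i) (k i)) \<longlonglongrightarrow> 0"
 proof (rule tendstoI)
  fix e :: real assume e: "e > 0"
  from evrh[OF rh dd_small[of "e / 2"]] e have "\<forall>\<^sub>F i in sequentially. \<forall>k\<le>K (rh i). dd (rh i) k <= e / 2" by simp
  then show "\<forall>\<^sub>F i in sequentially. dist (dd (rh i) (k i)) 0 < e"
  proof eventually_elim
   case (elim i)
   then have "dd (rh i) (k i) <= e / 2" using k[of i] by blast
   then show ?case using e traj.dclk_pos[OF tr, of "n (rh i)" "rh i" "k i"] by simp
  qed
 qed
 from tendsto_add[OF u this] show ?thesis by (simp add: traj.clk_Suc[OF tr])
qed

text \<open>Holding time divided by clock step is exactly the product of the local times at the site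
  before and after, times the harmonic mean of the local times of the neighbours. All of them tend
  to the same value, so the ratio tends to its cube.\<close>

lemma ratio_lim:
 assumes rh: "filterlim rh at_top sequentially" and k: "!!i. k i <= K (rh i)" and u: "(%i. uu (rh i) (k i)) \<longlonglongrightarrow> u"
 shows "(%i. snd (x (rh i) (k i)) / dd (rh i) (k i)) \<longlonglongrightarrow> g u"
proof -
 have u0: "u >= 0" using uu_nonneg by (intro LIMSEQ_le_const[OF u]) auto
 let ?p = "%i. pos (x (rh i)) (k i)"
 have P: "(%i. site (rh i) (?p i)) \<longlonglongrightarrow> Xu u" by (rule pos_lim[OF rh k u])
 have s: "(%i. site (rh i) (?p i + sgm)) \<longlonglongrightarrow> Xu u" for sgm :: int
 proof -
  have "(%i. site (rh i) (?p i) + of_int sgm * (1 / 2 ^ n (rh i))) \<longlonglongrightarrow> Xu u + of_int sgm * 0"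
   by (intro tendsto_intros P inv_pow_lim rh)
  then show ?thesis by (simp add: add_divide_distrib)
 qed
 have kS: "k i <= Suc (K (rh i))" "Suc (k i) <= Suc (K (rh i))" for i using k[of i] by auto
 have A: "(%i. LL (rh i) (k i) (?p i + sgm)) \<longlonglongrightarrow> lam u (Xu u)" if "sgm = 0 \<or> sgm = 1 \<or> sgm = -1" for sgm
  by (rule L_lim[OF rh nbr[OF k that] s kS(1) u])
 have B: "(%i. LL (rh i) (Suc (k i)) (?p i + 0)) \<longlonglongrightarrow> lam u (Xu u)"
  by (rule L_lim[OF rh nbr[OF k] s kS(2) uu_Suc_lim[OF rh k u]]) simp
 have lp: "lam u (Xu u) > 0" by (rule lam_pos[OF u0])
 have "(%i. LL (rh i) (k i) (?p i + 0) * LL (rh i) (Suc (k i)) (?p i + 0) * (2 / (1 / LL (rh i) (k i) (?p i + 1) + 1 / LL (rh i) (k i) (?p i + -1))))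
  \<longlonglongrightarrow> lam u (Xu u) * lam u (Xu u) * (2 / (1 / lam u (Xu u) + 1 / lam u (Xu u)))"
  using lp by (intro tendsto_mult tendsto_divide tendsto_add tendsto_const A B) auto
 moreover have "lam u (Xu u) * lam u (Xu u) * (2 / (1 / lam u (Xu u) + 1 / lam u (Xu u))) = g u"
  unfolding lam_cube[OF u0, symmetric] using lp by (simp add: power3_eq_cube)
 moreover have "LL (rh i) (k i) (?p i + 0) * LL (rh i) (Suc (k i)) (?p i + 0) * (2 / (1 / LL (rh i) (k i) (?p i + 1) + 1 / LL (rh i) (k i) (?p i + -1)))
  = snd (x (rh i) (k i)) / dd (rh i) (k i)" for i
 proof -
  interpret tj: traj "n (rh i)" L0 "x (rh i)" by (rule tr)
  define l where "l = LL (rh i) (k i) (?p i)"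
  define l' where "l' = LL (rh i) (Suc (k i)) (?p i)"
  define c where "c = 1 / LL (rh i) (k i) (?p i + 1) + 1 / LL (rh i) (k i) (?p i + -1)"
  have l: "l > 0" "l' > 0" "c > 0" using tj.L_pos by (auto simp: l_def l'_def c_def intro!: add_pos_pos)
  have hp: "snd (x (rh i) (k i)) > 0" by (rule tj.h_pos)
  have ll: "l' = l + 2 ^ n (rh i) * snd (x (rh i) (k i))" by (simp add: l'_def l_def loc_Suc)
  have "1 / l - 1 / l' = 2 ^ n (rh i) * snd (x (rh i) (k i)) / (l * l')" using l by (simp add: ll field_simps)
  moreover have "1 / (p * q1) * z + 1 / (p * q2) * z = (1 / q1 + 1 / q2) / p * z" for p q1 q2 z :: real
   by (simp add: add_divide_distrib distrib_left mult.commute)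
  then have "dd (rh i) (k i) = c / 2 ^ n (rh i) / 2 * (1 / l - 1 / l')"
   unfolding dclk_def tj.sh_eq l_def[symmetric] l'_def[symmetric] c_def by simp
  ultimately have "dd (rh i) (k i) = c / 2 * snd (x (rh i) (k i)) / (l * l')" by simp
  then have "snd (x (rh i) (k i)) / dd (rh i) (k i) = l * l' * (2 / c)" using l hp by simp
  then show ?thesis unfolding add_0_right l_def[symmetric] l'_def[symmetric] c_def[symmetric] by simp
 qed
 ultimately show ?thesis by simp
qed

text \<open>Uniformity in \<open>k\<close> is obtained by contradiction: bad indices have bounded
  clock values, and along a convergent subsequence \<open>ratio_lim\<close> and the mean value form
  of the limiting clock give the same density.\<close>

lemma time_step:
 assumes e: "eps > 0"
 shows "\<forall>\<^sub>F i in sequentially. \<forall>k\<le>K i. \<bar>snd (x i k) - (clock (uu i (Suc k)) - clock (uu i k))\<bar> <= eps * dd i k"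
proof (rule ccontr)
 assume "\<not> ?thesis"
 from frequently_subseq[OF this] obtain r :: "nat => nat" where r: "strict_mono r"
  and "!!i. \<exists>k\<le>K (r i). \<not> \<bar>snd (x (r i) k) - (clock (uu (r i) (Suc k)) - clock (uu (r i) k))\<bar> <= eps * dd (r i) k" by auto
 then obtain k where k: "!!i. k i <= K (r i)" "!!i. \<not> \<bar>snd (x (r i) (k i)) - (clock (uu (r i) (Suc (k i))) - clock (uu (r i) (k i)))\<bar> <= eps * dd (r i) (k i)" by metis
 have "\<bar>uu (r i) (k i)\<bar> <= U" for i using uu_nonneg[of "r i" "k i"] uU[of "k i" "r i"] k(1)[of i] by simp
 then obtain r' u where r': "strict_mono r'" and u: "(%i. uu (r (r' i)) (k (r' i))) \<longlonglongrightarrow> u" by (rule bounded_subseq)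
 have rh: "filterlim (%i. r (r' i)) at_top sequentially" by (rule filterlim_compose[OF filterlim_subseq[OF r] filterlim_subseq[OF r']])
 have "\<exists>z. uu (r (r' i)) (k (r' i)) <= z & z <= uu (r (r' i)) (Suc (k (r' i))) &
  clock (uu (r (r' i)) (Suc (k (r' i)))) - clock (uu (r (r' i)) (k (r' i))) = (uu (r (r' i)) (Suc (k (r' i))) - uu (r (r' i)) (k (r' i))) * g z" for i
  by (rule clock_mvt[OF uu_nonneg traj.clk_mono[OF tr]]) simp
 then obtain z where z: "!!i. uu (r (r' i)) (k (r' i)) <= z i" "!!i. z i <= uu (r (r' i)) (Suc (k (r' i)))"
  "!!i. clock (uu (r (r' i)) (Suc (k (r' i)))) - clock (uu (r (r' i)) (k (r' i))) = (uu (r (r' i)) (Suc (k (r' i))) - uu (r (r' i)) (k (r' i))) * g (z i)" by metis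
 have zl: "z \<longlonglongrightarrow> u"
  by (rule tendsto_sandwich[OF _ _ u uu_Suc_lim[OF rh k(1) u]]) (use z in auto)
 have "z i >= 0" for i using z(1)[of i] uu_nonneg order_trans by blast
 then have "(%i. g (z i)) \<longlonglongrightarrow> g u" by (rule g_lim[OF zl])
 from tendsto_diff[OF ratio_lim[OF rh k(1) u] this]
 have "(%i. snd (x (r (r' i)) (k (r' i))) / dd (r (r' i)) (k (r' i)) - g (z i)) \<longlonglongrightarrow> 0" by simp
 from tendstoD[OF this e] obtain i where i: "\<bar>snd (x (r (r' i)) (k (r' i))) / dd (r (r' i)) (k (r' i)) - g (z i)\<bar> < eps"
  by (auto simp: eventually_sequentially)
 define d where "d = dd (r (r' i)) (k (r' i))"
 have d: "d > 0" unfolding d_def by (rule traj.dclk_pos[OF tr])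
 have "snd (x (r (r' i)) (k (r' i))) - d * g (z i) = d * (snd (x (r (r' i)) (k (r' i))) / d - g (z i))" using d by (simp add: right_diff_distrib)
 then have "\<bar>snd (x (r (r' i)) (k (r' i))) - d * g (z i)\<bar> <= d * eps" using i d unfolding d_def[symmetric] by (simp add: abs_mult less_imp_le)
 moreover have "clock (uu (r (r' i)) (Suc (k (r' i)))) - clock (uu (r (r' i)) (k (r' i))) = d * g (z i)"
  unfolding z(3) d_def by (simp add: traj.clk_Suc[OF tr])
 ultimately show False using k(2)[of "r' i"] by (simp add: d_def mult.commute)
qed

text \<open>The errors of \<open>time_step\<close> are proportional to clock steps, so they add up
  to at most a small multiple of \<open>U\<close>, however many jumps there are.\<close>

lemma time_approx:
 assumes e: "eps > 0"
 shows "\<forall>\<^sub>F i in sequentially. \<forall>k\<le>Suc (K i). \<bar>tm i k - clock (uu i k)\<bar> <= eps"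
proof -
 define \<delta> where "\<delta> = eps / (U + 1)"
 have \<delta>: "\<delta> > 0" "\<delta> * U <= eps" using e U0 by (auto simp: \<delta>_def field_simps)
 from time_step[OF \<delta>(1)] show ?thesis
 proof eventually_elim
  case (elim i)
  have "k <= Suc (K i) ==> \<bar>tm i k - clock (uu i k)\<bar> <= \<delta> * uu i k" for k
  proof (induction k)
   case (Suc k)
   have "\<bar>snd (x i k) - (clock (uu i (Suc k)) - clock (uu i k))\<bar> <= \<delta> * dd i k" using elim Suc by simp
   moreover have "\<delta> * uu i (Suc k) = \<delta> * uu i k + \<delta> * dd i k" by (simp add: traj.clk_Suc[OF tr] distrib_left)
   moreover have "tm i (Suc k) = tm i k + snd (x i k)" by (simp add: jtime_def)
   moreover have "\<bar>tm i k - clock (uu i k)\<bar> <= \<delta> * uu i k" using Suc by simp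
   ultimately show ?case by linarith
  qed (simp add: jtime_def clk_def clock_0)
  moreover have "\<delta> * uu i k <= eps" if "k <= Suc (K i)" for k
   using \<delta> uU[OF that] mult_left_mono[of "uu i k" U \<delta>] by linarith
  ultimately show ?case by (meson order_trans)
 qed
qed

lemma clock_limit_time:
 assumes rh: "filterlim rh at_top sequentially" and k: "!!i. k i <= K (rh i)" and t: "!!i. tm (rh i) (k i) <= t i" "!!i. t i < tm (rh i) (Suc (k i))"
  and tl: "t \<longlonglongrightarrow> t0" and u: "(%i. uu (rh i) (k i)) \<longlonglongrightarrow> u"
 shows "clock u = t0"
proof -
 have e: "(%i. tm (rh i) (l i) - clock (uu (rh i) (l i))) \<longlonglongrightarrow> 0" if l: "!!i. l i <= Suc (K (rh i))" for l
 proof (rule tendstoI)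
  fix e :: real assume e: "e > 0"
  from evrh[OF rh time_approx[of "e / 2"]] e have "\<forall>\<^sub>F i in sequentially. \<forall>k\<le>Suc (K (rh i)). \<bar>tm (rh i) k - clock (uu (rh i) k)\<bar> <= e / 2" by simp
  then show "\<forall>\<^sub>F i in sequentially. dist (tm (rh i) (l i) - clock (uu (rh i) (l i))) 0 < e"
  proof eventually_elim
   case (elim i)
   then have "\<bar>tm (rh i) (l i) - clock (uu (rh i) (l i))\<bar> <= e / 2" using l by blast
   then show ?case using e by simp
  qed
 qed
 have 1: "(%i. tm (rh i) (k i)) \<longlonglongrightarrow> clock u"
  using tendsto_add[OF e[of k] clock_lim[OF u uu_nonneg]] k by (simp add: le_SucI)
 have 2: "(%i. tm (rh i) (Suc (k i))) \<longlonglongrightarrow> clock u"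
  using tendsto_add[OF e[of "%i. Suc (k i)"] clock_lim[OF uu_Suc_lim[OF rh k u] uu_nonneg]] k by simp
 have "t \<longlonglongrightarrow> clock u" by (rule tendsto_sandwich[OF _ _ 1 2]) (use t in \<open>auto simp: less_imp_le\<close>)
 then show ?thesis using tl LIMSEQ_unique by blast
qed

text \<open>The clock at a convergent sequence of times can only accumulate at a point where the
  limiting clock takes the limiting time, and that point is unique by injectivity.\<close>

lemma uu_limit_time:
 assumes rh: "filterlim rh at_top sequentially" and k: "!!i. k i <= K (rh i)" and t: "!!i. tm (rh i) (k i) <= t i" "!!i. t i < tm (rh i) (Suc (k i))"
  and tl: "t \<longlonglongrightarrow> t0"
 shows "\<exists>u\<ge>0. clock u = t0 & (%i. uu (rh i) (k i)) \<longlonglongrightarrow> u"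
proof -
 have bd: "\<bar>uu (rh i) (k i)\<bar> <= U" for i using uu_nonneg[of "rh i" "k i"] uU[of "k i" "rh i"] k[of i] by simp
 have sub: "v >= 0 & clock v = t0" if r: "strict_mono r" and v: "(%i. uu (rh (r i)) (k (r i))) \<longlonglongrightarrow> v" for r v
 proof
  show "v >= 0" using uu_nonneg by (intro LIMSEQ_le_const[OF v]) auto
  have rl: "filterlim r at_top sequentially" by (rule filterlim_subseq[OF r])
  show "clock v = t0"
   by (rule clock_limit_time[OF filterlim_compose[OF rh rl] k t filterlim_compose[OF tl rl] v])
 qed
 obtain r u where r: "strict_mono r" "(%i. uu (rh (r i)) (k (r i))) \<longlonglongrightarrow> u" using bd by (rule bounded_subseq)
 have u: "u >= 0" "clock u = t0" using sub[OF r] by auto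
 have "(%i. uu (rh i) (k i)) \<longlonglongrightarrow> u"
 proof (rule bounded_tendstoI[OF bd])
  fix r' v assume "strict_mono r'" "(%i. uu (rh (r' i)) (k (r' i))) \<longlonglongrightarrow> v"
  from sub[OF this] u show "v = u" using inj_onD[OF clock_inj, of v u] by auto
 qed
 then show ?thesis using u by blast
qed

definition ix :: "nat => real => nat" where "ix i t = (LEAST k. t < tm i (Suc k))"

lemma ix:
 assumes "0 <= t" "t <= T"
 shows "ix i t <= K i" "tm i (ix i t) <= t" "t < tm i (Suc (ix i t))" "stop_time (%k. snd (x i k)) t = t" "ereal t < expl_time (%k. snd (x i k))"
 using jump_index[of "%k. snd (x i k)" t "K i" "ix i t"] assms tK[of i] vx[of i] by (auto simp: ix_def valid_def)

text \<open>That the limiting clock reaches time \<open>T\<close> is inferred from the walks: their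
  clocks at time \<open>t\<close> stay bounded and accumulate at a preimage of
  \<open>t\<close>.\<close>

lemma clock_surj: "0 <= t ==> t <= T ==> \<exists>u\<ge>0. clock u = t"
 using uu_limit_time[of "%i. i" "%i. ix i t" "%_. t" t] ix[of t] by (auto simp: filterlim_ident)

lemma time_inverse_lim:
 assumes t: "!!i. 0 <= t i" "!!i. t i <= T" and tl: "t \<longlonglongrightarrow> clock u" and u: "u >= 0"
 shows "(%i. lrm_time L0 \<xi> \<Lambda> (t i)) \<longlonglongrightarrow> u" "!!i. lrm_time L0 \<xi> \<Lambda> (t i) >= 0"
proof -
 have "\<forall>i. \<exists>v\<ge>0. clock v = t i" using clock_surj t by blast
 then obtain v where v: "!!i. v i >= 0" "!!i. clock (v i) = t i" by metis
 obtain V where V: "V >= 0" "clock V = T" using clock_surj[of T] T by auto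
 have vV: "v i <= V" for i using clock_less[OF V(1), of "v i"] v(2)[of i] t(2)[of i] V(2) by (cases "v i <= V") auto
 have eq: "lrm_time L0 \<xi> \<Lambda> (t i) = v i" for i using lrm_time_clock[OF v(1)] v(2) by metis
 have "v \<longlonglongrightarrow> u"
 proof (rule bounded_tendstoI[of _ V])
  show "\<bar>v i\<bar> <= V" for i using v(1)[of i] vV[of i] by simp
  fix r :: "nat => nat" and w assume r: "strict_mono r" and w: "(%i. v (r i)) \<longlonglongrightarrow> w"
  have "(%i. clock (v (r i))) \<longlonglongrightarrow> clock w" by (rule clock_lim[OF w v(1)])
  moreover have "(%i. clock (v (r i))) \<longlonglongrightarrow> clock u" unfolding v(2) by (rule filterlim_compose[OF tl filterlim_subseq[OF r]])
  ultimately have "clock w = clock u" by (rule LIMSEQ_unique)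
  moreover have "w >= 0" using v(1) by (intro LIMSEQ_le_const[OF w]) auto
  ultimately show "w = u" using inj_onD[OF clock_inj, of w u] u by auto
 qed
 then show "(%i. lrm_time L0 \<xi> \<Lambda> (t i)) \<longlonglongrightarrow> u" "!!i. lrm_time L0 \<xi> \<Lambda> (t i) >= 0" unfolding eq using v(1) by auto
qed

abbreviation "Y i \<equiv> vrjp_stopped (n i) L0 (%k. fst (x i k)) (%k. snd (x i k))"

lemma path_eq: "0 <= t ==> t <= T ==> fst (Y i) t = site i (pos (x i) (ix i t))"
 using ix[of t i] by (simp add: vrjp_stopped_def vrjp_path_def jpos_def pos_def ix_def)

lemma times_subseq:
 fixes r :: "nat => nat" and t :: "nat => real"
 assumes r: "strict_mono r" and t: "!!i. t i \<in> {0..T}"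
 obtains r' :: "nat => nat" and u where "strict_mono r'" "u >= 0" "(%i. t (r' i)) \<longlonglongrightarrow> clock u" "(%i. uu (r (r' i)) (ix (r (r' i)) (t (r' i)))) \<longlonglongrightarrow> u"
  "filterlim (%i. r (r' i)) at_top sequentially"
proof -
 obtain r' t0 where r': "strict_mono r'" "(%i. t (r' i)) \<longlonglongrightarrow> t0" by (rule bounded_subseq[of t T]) (use t in auto)
 have rh: "filterlim (%i. r (r' i)) at_top sequentially" by (rule filterlim_compose[OF filterlim_subseq[OF r] filterlim_subseq[OF r'(1)]])
 have t': "0 <= t i" "t i <= T" for i using t[of i] by auto
 from uu_limit_time[OF rh ix(1,2,3)[OF t'] r'(2)] obtain u where "u >= 0" "clock u = t0" "(%i. uu (r (r' i)) (ix (r (r' i)) (t (r' i)))) \<longlonglongrightarrow> u" by auto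
 then show thesis using that[of r' u] r' rh by auto
qed

lemma uniform_path: "uniform_limit {0..T} (%i. fst (Y i)) (fst (lrm L0 \<xi> \<Lambda>)) sequentially"
proof (rule uniform_limit_subseqI)
 fix r :: "nat => nat" and t :: "nat => real" assume r: "strict_mono r" and t: "!!i. t i \<in> {0..T}"
 obtain r' u where r': "strict_mono r'" "u >= 0" "(%i. t (r' i)) \<longlonglongrightarrow> clock u" "(%i. uu (r (r' i)) (ix (r (r' i)) (t (r' i)))) \<longlonglongrightarrow> u"
  "filterlim (%i. r (r' i)) at_top sequentially" by (rule times_subseq[OF r t])
 have t': "0 <= t i" "t i <= T" for i using t[of i] by auto
 have "(%i. fst (Y (r (r' i))) (t (r' i))) \<longlonglongrightarrow> Xu u"
  unfolding path_eq[OF t'] by (rule pos_lim[OF r'(5) ix(1)[OF t'] r'(4)])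
 moreover have "(%i. fst (lrm L0 \<xi> \<Lambda>) (t (r' i))) \<longlonglongrightarrow> Xu u"
  unfolding lrm_def fst_conv Xu_def[symmetric] by (rule Xu_lim[OF time_inverse_lim[OF t' r'(3,2)]])
 ultimately have "(%i. fst (Y (r (r' i))) (t (r' i)) - fst (lrm L0 \<xi> \<Lambda>) (t (r' i))) \<longlonglongrightarrow> Xu u - Xu u" by (rule tendsto_diff)
 then show "\<exists>r'. strict_mono r' & (%i. fst (Y (r (r' i))) (t (r' i)) - fst (lrm L0 \<xi> \<Lambda>) (t (r' i))) \<longlonglongrightarrow> 0" using r'(1) by auto
qed

text \<open>Along a subsequence times and places converge, and both interpolation nodes tend to the
  same place. A convex combination of two values with the same limit has that limit, whatever the
  weights do.\<close>

lemma uniform_profile: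
 "uniform_limit ({0..T} \<times> {-T..T}) (%i p. snd (Y i) (fst p) (snd p)) (%p. snd (lrm L0 \<xi> \<Lambda>) (fst p) (snd p)) sequentially"
proof (rule uniform_limit_subseqI)
 fix r :: "nat => nat" and p :: "nat => real \<times> real" assume r: "strict_mono r" and p: "!!i. p i \<in> {0..T} \<times> {-T..T}"
 define t where "t i = fst (p i)" for i
 define y where "y i = snd (p i)" for i
 have t: "t i \<in> {0..T}" and y: "\<bar>y i\<bar> <= T" for i using p[of i] by (auto simp: t_def y_def mem_Times_iff abs_le_iff)
 obtain r1 u where r1: "strict_mono r1" "u >= 0" "(%i. t (r1 i)) \<longlonglongrightarrow> clock u" "(%i. uu (r (r1 i)) (ix (r (r1 i)) (t (r1 i)))) \<longlonglongrightarrow> u"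
  "filterlim (%i. r (r1 i)) at_top sequentially" by (rule times_subseq[OF r t])
 obtain r2 z where r2: "strict_mono r2" "(%i. y (r1 (r2 i))) \<longlonglongrightarrow> z" by (rule bounded_subseq[of "%i. y (r1 i)" T]) (rule y)
 define q where "q i = r1 (r2 i)" for i
 have r2l: "filterlim r2 at_top sequentially" by (rule filterlim_subseq[OF r2(1)])
 have q: "strict_mono q" using r1(1) r2(1) by (simp add: q_def strict_mono_def)
 define k where "k i = ix (r (q i)) (t (q i))" for i
 have rh: "filterlim (%i. r (q i)) at_top sequentially" unfolding q_def by (rule filterlim_compose[OF r1(5) r2l])
 have uq: "(%i. uu (r (q i)) (k i)) \<longlonglongrightarrow> u" unfolding q_def k_def by (rule filterlim_compose[OF r1(4) r2l])
 have tq: "(%i. t (q i)) \<longlonglongrightarrow> clock u" unfolding q_def by (rule filterlim_compose[OF r1(3) r2l])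
 have yq: "(%i. y (q i)) \<longlonglongrightarrow> z" unfolding q_def by (rule r2(2))
 have t': "0 <= t i" "t i <= T" for i using t[of i] by auto
 have kK: "k i <= K (r (q i))" for i unfolding k_def by (rule ix(1)[OF t'])
 define j where "j i = \<lfloor>2 ^ n (r (q i)) * y (q i)\<rfloor>" for i
 define th where "th i = 2 ^ n (r (q i)) * y (q i) - real_of_int (j i)" for i
 have th: "0 <= th i" "th i <= 1" for i unfolding th_def j_def by linarith+
 have jb: "\<bar>j i + sgm\<bar> <= int (R + 1) * 2 ^ n (r (q i))" if s: "sgm = 0 \<or> sgm = 1" for i and sgm :: int
 proof -
  have "\<bar>2 ^ n (r (q i)) * y (q i)\<bar> <= 2 ^ n (r (q i)) * real R" unfolding abs_mult using y[of "q i"] T by (intro mult_mono) auto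
  then have "- (2 ^ n (r (q i)) * real R) <= 2 ^ n (r (q i)) * y (q i)" "2 ^ n (r (q i)) * y (q i) <= 2 ^ n (r (q i)) * real R" by linarith+
  moreover have "2 ^ n (r (q i)) * real R = real_of_int (int R * 2 ^ n (r (q i)))" by simp
  ultimately have a: "real_of_int (- (int R * 2 ^ n (r (q i)))) <= 2 ^ n (r (q i)) * y (q i)" "2 ^ n (r (q i)) * y (q i) < real_of_int (int R * 2 ^ n (r (q i))) + 1"
   unfolding of_int_minus by linarith+
  have "- (int R * 2 ^ n (r (q i))) <= j i" "j i <= int R * 2 ^ n (r (q i))"
   unfolding j_def le_floor_iff floor_le_iff by (rule a)+
  moreover have "int (R + 1) * 2 ^ n (r (q i)) = int R * 2 ^ n (r (q i)) + 2 ^ n (r (q i))" "(1::int) <= 2 ^ n (r (q i))" by (simp_all add: algebra_simps)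
  ultimately show ?thesis using s by linarith
 qed
 have sl: "(%i. site (r (q i)) (j i + sgm)) \<longlonglongrightarrow> z" for sgm :: int
 proof -
  have "(%i. site (r (q i)) (j i + sgm) - y (q i)) \<longlonglongrightarrow> 0"
  proof (rule Lim_null_comparison)
   have "norm (site (r (q i)) (j i + sgm) - y (q i)) <= (\<bar>of_int sgm\<bar> + 1) * (1 / 2 ^ n (r (q i)))" for i
   proof -
    have "site (r (q i)) (j i + sgm) - y (q i) = (of_int sgm - th i) / 2 ^ n (r (q i))" by (simp add: th_def field_simps)
    then show ?thesis using th[of i] by (simp add: abs_divide divide_right_mono)
   qed
   then show "\<forall>\<^sub>F i in sequentially. norm (site (r (q i)) (j i + sgm) - y (q i)) <= (\<bar>of_int sgm\<bar> + 1) * (1 / 2 ^ n (r (q i)))" by simp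
   show "(%i. (\<bar>of_int sgm\<bar> + 1) * (1 / 2 ^ n (r (q i)))) \<longlonglongrightarrow> (0::real)" by (rule tendsto_mult_right_zero[OF inv_pow_lim[OF rh]])
  qed
  from tendsto_add[OF this yq] show ?thesis by simp
 qed
 define f where "f i sgm = vrjp_L (n (r (q i))) L0 (%k. fst (x (r (q i)) k)) (%k. snd (x (r (q i)) k)) (t (q i)) (site (r (q i)) (j i + sgm))" for i and sgm :: int
 have fl: "(%i. f i sgm) \<longlonglongrightarrow> lam u z" if s: "sgm = 0 \<or> sgm = 1" for sgm
 proof (rule tendsto_sandwich)
  show "(%i. LL (r (q i)) (k i) (j i + sgm)) \<longlonglongrightarrow> lam u z"
   by (rule L_lim[OF rh jb[OF s] sl le_SucI[OF kK] uq])
  show "(%i. LL (r (q i)) (Suc (k i)) (j i + sgm)) \<longlonglongrightarrow> lam u z"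
   by (rule L_lim[OF rh jb[OF s] sl Suc_le_mono[THEN iffD2, OF kK] uu_Suc_lim[OF rh kK uq]])
  have "LL (r (q i)) (k i) (j i + sgm) <= f i sgm & f i sgm <= LL (r (q i)) (Suc (k i)) (j i + sgm)" for i
   unfolding f_def k_def
   using vrjp_L_bounds[where ?L0.0=L0 and x="x (r (q i))" and k="ix (r (q i)) (t (q i))" and t="t (q i)" and n="n (r (q i))" and j="j i + sgm"] vx L0p ix(2,3)[OF t'] by auto
  then show "\<forall>\<^sub>F i in sequentially. LL (r (q i)) (k i) (j i + sgm) <= f i sgm" "\<forall>\<^sub>F i in sequentially. f i sgm <= LL (r (q i)) (Suc (k i)) (j i + sgm)" by auto
 qed
 have val: "snd (Y (r (q i))) (t (q i)) (y (q i)) = (1 - th i) * f i 0 + th i * f i 1" for i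
  using ix(4)[OF t'] by (simp add: vrjp_stopped_def lin_interp_def Let_def f_def th_def j_def)
 have "(%i. snd (Y (r (q i))) (t (q i)) (y (q i)) - lam u z) \<longlonglongrightarrow> 0"
 proof (rule Lim_null_comparison)
  have "norm (snd (Y (r (q i))) (t (q i)) (y (q i)) - lam u z) <= \<bar>f i 0 - lam u z\<bar> + \<bar>f i 1 - lam u z\<bar>" for i
  proof -
   have "snd (Y (r (q i))) (t (q i)) (y (q i)) - lam u z = (1 - th i) * (f i 0 - lam u z) + th i * (f i 1 - lam u z)" unfolding val by (simp add: algebra_simps)
   moreover have "\<bar>(1 - th i) * (f i 0 - lam u z)\<bar> <= 1 * \<bar>f i 0 - lam u z\<bar>" unfolding abs_mult using th[of i] by (intro mult_right_mono) auto
   moreover have "\<bar>th i * (f i 1 - lam u z)\<bar> <= 1 * \<bar>f i 1 - lam u z\<bar>" unfolding abs_mult using th[of i] by (intro mult_right_mono) auto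
   ultimately show ?thesis by simp
  qed
  then show "\<forall>\<^sub>F i in sequentially. norm (snd (Y (r (q i))) (t (q i)) (y (q i)) - lam u z) <= \<bar>f i 0 - lam u z\<bar> + \<bar>f i 1 - lam u z\<bar>" by simp
  have "(%i. \<bar>f i 0 - lam u z\<bar> + \<bar>f i 1 - lam u z\<bar>) \<longlonglongrightarrow> \<bar>lam u z - lam u z\<bar> + \<bar>lam u z - lam u z\<bar>"
   by (intro tendsto_intros fl) auto
  then show "(%i. \<bar>f i 0 - lam u z\<bar> + \<bar>f i 1 - lam u z\<bar>) \<longlonglongrightarrow> 0" by simp
 qed
 moreover have "(%i. snd (lrm L0 \<xi> \<Lambda>) (t (q i)) (y (q i)) - lam u z) \<longlonglongrightarrow> 0"
 proof -
  have "(%i. lam (lrm_time L0 \<xi> \<Lambda> (t (q i))) (y (q i))) \<longlonglongrightarrow> lam u z"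
   by (rule lam_lim[OF time_inverse_lim[OF t' tq r1(2)] yq])
  then have "(%i. snd (lrm L0 \<xi> \<Lambda>) (t (q i)) (y (q i))) \<longlonglongrightarrow> lam u z" unfolding lrm_def snd_conv lam_def .
  then show ?thesis by (simp add: LIM_zero)
 qed
 ultimately have "(%i. (snd (Y (r (q i))) (t (q i)) (y (q i)) - lam u z) - (snd (lrm L0 \<xi> \<Lambda>) (t (q i)) (y (q i)) - lam u z)) \<longlonglongrightarrow> 0 - 0" by (rule tendsto_diff)
 then have "(%i. snd (Y (r (q i))) (fst (p (q i))) (snd (p (q i))) - snd (lrm L0 \<xi> \<Lambda>) (fst (p (q i))) (snd (p (q i)))) \<longlonglongrightarrow> 0" by (simp add: t_def y_def)
 then show "\<exists>r'. strict_mono r' & (%i. snd (Y (r (r' i))) (fst (p (r' i))) (snd (p (r' i))) - snd (lrm L0 \<xi> \<Lambda>) (fst (p (r' i))) (snd (p (r' i)))) \<longlonglongrightarrow> 0"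
  using q by blast
qed

end

section \<open>Bounds for good trajectories up to a fixed time\<close>

lemma (in traj) occupation_le_time:
 assumes "finite J"
 shows "(\<Sum>j\<in>J. (L k j - L0 (real_of_int j / 2 ^ n)) / 2 ^ n) <= jtime (%i. snd (x i)) k"
proof -
 have "(\<Sum>j\<in>J. (L k j - L0 (real_of_int j / 2 ^ n)) / 2 ^ n) = (\<Sum>j\<in>J. \<Sum>i<k. if pos x i = j then snd (x i) else 0)"
  by (simp add: loc_def)
 also have "... = (\<Sum>i<k. \<Sum>j\<in>J. if pos x i = j then snd (x i) else 0)" by (rule sum.swap)
 also have "... <= (\<Sum>i<k. snd (x i))" using h_pos assms by (intro sum_mono) (auto simp: sum.delta less_imp_le)
 finally show ?thesis by (simp add: jtime_def)
qed

text \<open>If the local time at the origin has grown by a large factor, then by the modulus all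
  sites of [0, 1) have grown by a comparable factor; their total occupation time is at most
  \<open>t\<close>. With the exponential growth of the local time in the clock this bounds the clock
  by the time.\<close>

lemma (in traj) rho_0_le_time:
 assumes ok: "modulus_ok n L0 A 1 x" and A: "A >= 0" and c: "c > 0" "!!y. \<bar>y\<bar> <= 1 ==> L0 y >= c"
  and t: "jtime (%i. snd (x i)) k <= t"
 shows "rho k 0 <= modulus A c 0 + ln (1 + t / c)"
proof -
 let ?a = "modulus A c 0"
 have "0 <= jtime (%i. snd (x i)) k" unfolding jtime_def using h_pos by (intro sum_nonneg) (auto simp: less_imp_le)
 then have t0: "t >= 0" using t by linarith
 show ?thesis
 proof (cases "rho k 0 <= ?a")
  case True
  moreover have "0 <= ln (1 + t / c)" using t0 c by (intro ln_ge_zero) auto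
  ultimately show ?thesis by linarith
 next
  case False
  \<comment> \<open>The relative gain that the modulus guarantees at every site of [0, 1).\<close>
  define E where "E = exp (rho k 0 - ?a) - 1"
  have E: "E >= 0" using False by (simp add: E_def)
  have "(\<Sum>j\<in>{0..<(2::int) ^ n}. c * E / 2 ^ n) <= (\<Sum>j\<in>{0..<(2::int) ^ n}. (L k j - L0 (real_of_int j / 2 ^ n)) / 2 ^ n)"
  proof (intro sum_mono divide_right_mono)
   fix j :: int assume j: "j \<in> {0..<2 ^ n}"
   then have "\<bar>j\<bar> <= int 1 * 2 ^ n" by simp
   from site_le[OF this] have l: "L0 (real_of_int j / 2 ^ n) >= c" by (intro c(2)) simp
   have "\<bar>rho k j - rho k 0\<bar> <= ?a" using c j by (intro rho_modulus[OF ok _ _ A]) auto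
   then have "exp (rho k 0 - ?a) <= exp (rho k j)" by simp
   also have "exp (rho k j) = L k j / L0 (real_of_int j / 2 ^ n)"
    unfolding rho_def exp_diff using L_pos[of k j] L_pos[of 0 j] by (simp add: loc_0)
   finally have "L0 (real_of_int j / 2 ^ n) * exp (rho k 0 - ?a) <= L k j" using L0p[of "real_of_int j / 2 ^ n"] by (simp add: field_simps)
   then have "L0 (real_of_int j / 2 ^ n) * E <= L k j - L0 (real_of_int j / 2 ^ n)" by (simp add: E_def algebra_simps)
   then show "c * E <= L k j - L0 (real_of_int j / 2 ^ n)" using mult_right_mono[OF l E] by linarith
  qed auto
  also have "... <= t" using occupation_le_time[of "{0..<(2::int) ^ n}" k] t by simp
  finally have "c * E <= t" by simp
  then have "exp (rho k 0 - ?a) <= 1 + t / c" using c(1) by (simp add: E_def field_simps)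
  then have "rho k 0 - ?a <= ln (1 + t / c)" using t0 c(1) by (subst ln_ge_iff) (auto intro: add_pos_nonneg)
  then show ?thesis by simp
 qed
qed

lemma uniform_limit_offset:
 fixes f :: "nat => 'c => real"
 shows "uniform_limit S (%i. f (i + I)) l sequentially ==> uniform_limit S f l sequentially"
 unfolding uniform_limit_iff by (auto simp: eventually_sequentially_seg[of "%i. \<forall>x\<in>S. dist (f i x) (l x) < _" I])

context lrm_env begin

text \<open>Bounds that do not involve the window are derived in turn: time bounds the clock, the
  clock bounds the path and thereby the martingale, the martingale bounds the position. For large
  \<open>i\<close> the walk therefore stays strictly inside its window until time \<open>T\<close>
  has passed.\<close>

lemma deterministic_limit_upto:
 fixes s n km :: "nat => nat" and x :: "nat => nat => int \<times> real" and A :: "nat => real" and T :: nat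
 assumes s: "filterlim s at_top sequentially" and sn: "filterlim n at_top sequentially" and v: "!!i. \<forall>k. valid (x i k)"
  and A: "!!r. A r >= 0" and good: "!!i. good (n i) L0 A C (s i) (km i) (x i)"
  and tht: "tht \<longlonglongrightarrow> 0" "!!i. tht i >= 0"
  and close: "!!i k v. alive (n i) (s i) (km i) (x i) k ==> clk (n i) L0 (x i) k < real (s i) ==> clk (n i) L0 (x i) k <= v
   ==> v <= clk (n i) L0 (x i) (Suc k) ==> \<bar>mart (n i) L0 (x i) k - b v\<bar> <= tht i"
 shows "\<exists>I R U K. lim_data b \<Psi> \<Lambda> \<xi> L0 (real T) U (A (R + 2)) R (%i. n (i + I)) (%i. x (i + I)) (%i. K (i + I)) (%i. tht (i + I))"
proof -
 let ?tm = "%i. jtime (%k. snd (x i k))"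
 have tr: "traj L0 (x i)" for i by standard (use L0p v in auto)
 obtain c where c: "c > 0" "!!y. \<bar>y\<bar> <= 1 ==> L0 y >= c" using L0_lower_bound[OF L0c L0p, of 1] by auto
 \<comment> \<open>Combines \<open>rho_0_le_time\<close> at time T + 1 with the clock bound in
   \<open>good\<close>.\<close>
 define U where "U = max 0 (4 * (modulus (A 1) c 0 + ln (1 + (real T + 1) / c)) + C)"
 have U0: "U >= 0" by (simp add: U_def)
 have B1: "clk (n i) L0 (x i) k <= U" if "alive (n i) (s i) (km i) (x i) k" "?tm i k <= real T + 1" for i k
 proof -
  have "modulus_ok (n i) L0 (A 1) 1 (x i)" using good[of i] by (simp add: good_def)
  from traj.rho_0_le_time[OF tr this A c that(2)]
  have "traj.rho (n i) L0 (x i) k 0 <= modulus (A 1) c 0 + ln (1 + (real T + 1) / c)" .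
  moreover have "clk (n i) L0 (x i) k <= 4 * traj.rho (n i) L0 (x i) k 0 + C" using good[of i] that(1) unfolding good_def traj.rho_def[OF tr] by blast
  ultimately have "clk (n i) L0 (x i) k <= 4 * (modulus (A 1) c 0 + ln (1 + (real T + 1) / c)) + C" by argo
  then show ?thesis unfolding U_def by (rule max.coboundedI2)
 qed
 have "bounded (b ` {0..U})" by (intro compact_imp_bounded compact_continuous_image continuous_on_subset[OF b_cont]) auto
 then obtain Bm where "\<forall>y\<in>b ` {0..U}. norm y <= Bm" unfolding bounded_iff ..
 then have Bm: "!!w. 0 <= w ==> w <= U ==> \<bar>b w\<bar> <= Bm" for w by simp
 \<comment> \<open>The martingale is at most Bm + 1, images of sites move by at most 2 U, and the
   discrete scale differs from \<open>S0\<close> by at most 1; so the images of the sites at plus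
   and minus \<open>R\<close> remain beyond the martingale.\<close>
 define D where "D = Bm + 2 + 2 * U"
 obtain r1 :: nat where r1: "S0 L0 (real r1) > D" using S0_unbounded(1)[of D] by (rule exE)
 obtain r2 :: nat where r2: "S0 L0 (- real r2) < - D" using S0_unbounded(2)[of D] by (rule exE)
 have S0_le: "S0 L0 p <= S0 L0 q" if "p <= q" for p q
  using S0_less[of p q] that by (cases "p = q") (simp_all add: less_imp_le)
 define R where "R = max T (max r1 r2)"
 have R: "S0 L0 (real R) > D" "S0 L0 (- real R) < - D" "T <= R"
 proof -
  have "S0 L0 (real r1) <= S0 L0 (real R)" by (rule S0_le) (simp add: R_def)
  then show "S0 L0 (real R) > D" using r1 by (rule less_le_trans[rotated])
  have "S0 L0 (- real R) <= S0 L0 (- real r2)" by (rule S0_le) (simp add: R_def)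
  then show "S0 L0 (- real R) < - D" using r2 by (rule le_less_trans)
 qed (simp add: R_def)
 \<comment> \<open>The bound \<open>U\<close> covers only indices with \<open>okk\<close>, but index
   \<open>Suc (K i)\<close> is needed too; there the clock is bounded by the total length of the
   scale, with 2 for the discretisation at both ends.\<close>
 define U' where "U' = (S0 L0 (real (R + 1)) - S0 L0 (- real (R + 1)) + 2) / 2"
 obtain N where N: "!!n j. n >= N ==> \<bar>j\<bar> <= int (R + 1) * 2 ^ n ==> \<bar>scl0 n L0 j - S0 L0 (real_of_int j / 2 ^ n)\<bar> <= 1"
  using scl0_approx[of 1 "R + 1"] by auto
 define s0 where "s0 = R + 2 + T + nat \<lceil>U\<rceil>"
 have "\<forall>\<^sub>F i in sequentially. N <= n i" "\<forall>\<^sub>F i in sequentially. Suc s0 <= s i" "\<forall>\<^sub>F i in sequentially. tht i < 1"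
  using sn s order_tendstoD(2)[OF tht(1), of 1] by (auto simp: filterlim_at_top)
 then have "\<forall>\<^sub>F i in sequentially. N <= n i & Suc s0 <= s i & tht i < 1" by eventually_elim simp
 then obtain I where I: "!!i. i >= I ==> N <= n i & Suc s0 <= s i & tht i < 1" unfolding eventually_sequentially by auto
 have Us: "U < real (s i)" if "i >= I" for i
 proof -
  have "U <= real (nat \<lceil>U\<rceil>)" by linarith
  then show ?thesis using I[OF that] unfolding s0_def by linarith
 qed
 define okk where "okk i k \<longleftrightarrow> alive (n i) (s i) (km i) (x i) k & ?tm i k <= real T + 1" for i k
 have cl: "\<bar>mart (n i) L0 (x i) k - b w\<bar> <= tht i" if "i >= I" "okk i k" "clk (n i) L0 (x i) k <= w" "w <= clk (n i) L0 (x i) (Suc k)" for i k w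
  using B1[of i k] Us[OF that(1)] that(2-4) unfolding okk_def by (intro close) auto
 have B2: "\<bar>pos (x i) k\<bar> <= int R * 2 ^ n i" if i: "i >= I" and ok: "okk i k" for i k
 proof -
  interpret traj "n i" L0 "x i" by (rule tr)
  have u: "clk (n i) L0 (x i) k <= U" "0 <= clk (n i) L0 (x i) k" using B1 ok clk_nonneg by (auto simp: okk_def)
  have "\<bar>Mt k - b (clk (n i) L0 (x i) k)\<bar> <= tht i" by (rule cl[OF i ok order_refl]) (simp add: clk_mono)
  then have M: "\<bar>Mt k\<bar> <= Bm + 1" using Bm[OF u(2,1)] I[OF i] by linarith
  have RR: "\<bar>int R * 2 ^ n i\<bar> <= int (R + 1) * 2 ^ n i" "\<bar>- (int R * 2 ^ n i)\<bar> <= int (R + 1) * 2 ^ n i" by (auto simp: algebra_simps)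
  have site: "real_of_int (int R * 2 ^ n i) / 2 ^ n i = real R" "real_of_int (- (int R * 2 ^ n i)) / 2 ^ n i = - real R" by auto
  have n: "N <= n i" using I[OF i] by simp
  have p: "S k (int R * 2 ^ n i) > Bm + 1" using N[OF n RR(1)] S_change_le[of k "int R * 2 ^ n i"] u R(1) unfolding site D_def by linarith
  have m: "S k (- (int R * 2 ^ n i)) < - (Bm + 1)" using N[OF n RR(2)] S_change_le[of k "- (int R * 2 ^ n i)"] u R(2) unfolding site D_def by linarith
  have "\<not> pos (x i) k > int R * 2 ^ n i" using S_less[of "int R * 2 ^ n i" "pos (x i) k" k] p M S_pos[of k] by force
  moreover have "\<not> pos (x i) k < - (int R * 2 ^ n i)" using S_less[of "pos (x i) k" "- (int R * 2 ^ n i)" k] m M S_pos[of k] by force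
  ultimately show ?thesis by (simp add: abs_le_iff)
 qed
 have g3: "k < km i" if "\<forall>l\<le>k. \<bar>pos (x i) l\<bar> <= int (s i) * 2 ^ n i" "?tm i k <= real (s i)" for i k
  using good[of i] that unfolding good_def jtime_def by blast
 have down: "okk i l" if "okk i k" "l <= k" for i k l
 proof -
  interpret traj "n i" L0 "x i" by (rule tr)
  have "?tm i l <= ?tm i k" unfolding jtime_def using that(2) h_pos by (intro sum_mono2) (auto simp: less_imp_le)
  then show ?thesis using that unfolding okk_def alive_def jtime_def by auto
 qed
 \<comment> \<open>The set is finite because an alive index is below \<open>km i\<close>.\<close>
 define K where "K i = Max {k. okk i k}" for i
 have fin: "finite {k. okk i k}" for i by (rule finite_subset[of _ "{..<km i}"]) (auto simp: okk_def alive_def)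
 have ok0: "okk i 0" if "i >= I" for i
  using g3[of 0 i] by (simp add: okk_def alive_def jtime_def pos_def)
 have okK: "okk i k" if "i >= I" "k <= K i" for i k
 proof -
  have "K i \<in> {k. okk i k}" unfolding K_def using ok0[OF that(1)] fin by (intro Max_in) auto
  then show ?thesis using down that(2) by blast
 qed
 have tK: "?tm i (Suc (K i)) > real T" if i: "i >= I" for i
 proof (rule ccontr)
  interpret traj "n i" L0 "x i" by (rule tr)
  assume "\<not> ?tm i (Suc (K i)) > real T"
  then have t: "?tm i (Suc (K i)) <= real T" by simp
  have sR: "int R * 2 ^ n i + 1 <= int (s i) * 2 ^ n i"
  proof -
   have "int R + 1 <= int (s i)" using I[OF i] by (simp add: s0_def)
   then have "(int R + 1) * 2 ^ n i <= int (s i) * 2 ^ n i" by (intro mult_right_mono) auto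
   moreover have "(int R + 1) * 2 ^ n i = int R * 2 ^ n i + 2 ^ n i" "(1::int) <= 2 ^ n i" by (simp_all add: algebra_simps)
   ultimately show ?thesis by linarith
  qed
  have "\<bar>pos (x i) l\<bar> <= int (s i) * 2 ^ n i" if "l <= Suc (K i)" for l
  proof (cases "l <= K i")
   case True
   then show ?thesis using B2[OF i okK[OF i True]] sR by linarith
  next
   case False
   then have "l = Suc (K i)" using that by simp
   then show ?thesis using B2[OF i okK[OF i order_refl]] sR dir_cases[of "K i"] by (auto simp: pos_Suc)
  qed
  moreover have ts: "real T + 1 <= real (s i)" using I[OF i] by (simp add: s0_def)
  \<comment> \<open>The next index would satisfy all conditions as well, including the jump count by
    \<open>g3\<close>, against maximality. So time \<open>T\<close> is passed after finitely many
    jumps, which excludes explosion before it.\<close>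
  ultimately have "okk i (Suc (K i))" using g3[of "Suc (K i)" i] t unfolding okk_def alive_def jtime_def by force
  then have "Suc (K i) <= K i" unfolding K_def using fin by (intro Max_ge) auto
  then show False by simp
 qed
 have uU: "clk (n i) L0 (x i) k <= U'" if i: "i >= I" and k: "k <= Suc (K i)" for i k
 proof -
  interpret traj "n i" L0 "x i" by (rule tr)
  define j where "j = int (R + 1) * 2 ^ n i"
  have j1: "j >= int R * 2 ^ n i + 1" using one_le_power[of "2::int" "n i"] by (simp add: j_def algebra_simps)
  have j0: "j >= 1" using j1 by (smt (verit) mult_nonneg_nonneg of_nat_0_le_iff zero_le_power)
  have "clk (n i) L0 (x i) k = (\<Sum>l<k. if - j + 1 <= pos (x i) l & pos (x i) l <= j - 1 then dclk (n i) L0 (x i) l else 0)"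
   unfolding clk_def
  proof (intro sum.cong refl)
   fix l assume "l \<in> {..<k}"
   then have "l <= K i" using k by simp
   from B2[OF i okK[OF i this]] j1 have "- j + 1 <= pos (x i) l & pos (x i) l <= j - 1" by linarith
   then show "dclk (n i) L0 (x i) l = (if - j + 1 <= pos (x i) l & pos (x i) l <= j - 1 then dclk (n i) L0 (x i) l else 0)" by simp
  qed
  also have "... <= (scl0 (n i) L0 (j - 1 + 1) - scl0 (n i) L0 (- j + 1 - 1)) / 2" using j0 by (intro clk_sum) simp
  also have "... <= U'"
  proof -
   have st: "real_of_int j / 2 ^ n i = real (R + 1)" "real_of_int (- j) / 2 ^ n i = - real (R + 1)" by (auto simp: j_def)
   have n: "N <= n i" using I[OF i] by simp
   have "\<bar>j\<bar> <= int (R + 1) * 2 ^ n i" "\<bar>- j\<bar> <= int (R + 1) * 2 ^ n i" using j0 by (auto simp: j_def)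
   from N[OF n this(1)] N[OF n this(2)] show ?thesis unfolding st U'_def by (simp add: abs_le_iff)
  qed
  finally show ?thesis .
 qed
 have shift: "filterlim (%i. i + I) at_top sequentially" by (rule filterlim_add_const_nat_at_top)
 have "lim_data b \<Psi> \<Lambda> \<xi> L0 (real T) U' (A (R + 2)) R (%i. n (i + I)) (%i. x (i + I)) (%i. K (i + I)) (%i. tht (i + I))"
 proof
  show "filterlim (%i. n (i + I)) at_top sequentially" by (rule filterlim_compose[OF sn shift])
  show "\<forall>k. valid (x (i + I) k)" for i by (rule v)
  show "0 <= A (R + 2)" by (rule A)
  show "modulus_ok (n (i + I)) L0 (A (R + 2)) (R + 2) (x (i + I))" for i
   using good[of "i + I"] I[of "i + I"] unfolding good_def s0_def by auto
  show "\<bar>pos (x (i + I)) k\<bar> <= int R * 2 ^ n (i + I)" if "k <= K (i + I)" for i k by (rule B2[OF _ okK[OF _ that]]) auto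
  show "clk (n (i + I)) L0 (x (i + I)) k <= U'" if "k <= Suc (K (i + I))" for i k by (rule uU[OF _ that]) auto
  show "(%i. tht (i + I)) \<longlonglongrightarrow> 0" by (rule LIMSEQ_ignore_initial_segment[OF tht(1)])
  show "0 <= tht (i + I)" for i by (rule tht(2))
  show "\<bar>mart (n (i + I)) L0 (x (i + I)) k - b w\<bar> <= tht (i + I)" if "k <= K (i + I)" "clk (n (i + I)) L0 (x (i + I)) k <= w" "w <= clk (n (i + I)) L0 (x (i + I)) (Suc k)" for i k w
   by (rule cl[OF _ okK[OF _ that(1)] that(2,3)]) auto
  show "real T < ?tm (i + I) (Suc (K (i + I)))" for i by (rule tK) simp
  show "0 <= real T" "real T <= real R" using R(3) by auto
 qed
 then show ?thesis by blast
qed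

lemma deterministic_limit:
 fixes s n km :: "nat => nat" and x :: "nat => nat => int \<times> real" and A :: "nat => real"
 assumes s: "filterlim s at_top sequentially" and sn: "filterlim n at_top sequentially" and v: "!!i. \<forall>k. valid (x i k)"
  and A: "!!r. A r >= 0" and good: "!!i. good (n i) L0 A C (s i) (km i) (x i)"
  and tht: "tht \<longlonglongrightarrow> 0" "!!i. tht i >= 0"
  and close: "!!i k v. alive (n i) (s i) (km i) (x i) k ==> clk (n i) L0 (x i) k < real (s i) ==> clk (n i) L0 (x i) k <= v
   ==> v <= clk (n i) L0 (x i) (Suc k) ==> \<bar>mart (n i) L0 (x i) k - b v\<bar> <= tht i"
 shows "lu_conv (%i. vrjp_stopped (n i) L0 (%k. fst (x i k)) (%k. snd (x i k))) (lrm L0 \<xi> \<Lambda>)"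
  and "\<forall>\<^sub>F i in sequentially. ereal T < expl_time (%k. snd (x i k))"
proof -
 have *: "\<exists>I R U K. lim_data b \<Psi> \<Lambda> \<xi> L0 (real T) U (A (R + 2)) R (%i. n (i + I)) (%i. x (i + I)) (%i. K (i + I)) (%i. tht (i + I))" for T :: nat
  by (rule deterministic_limit_upto[where s=s and n=n and km=km and x=x and A=A and C=C and tht=tht])
   (assumption | rule s sn v A good tht | rule close)+
 show "lu_conv (%i. vrjp_stopped (n i) L0 (%k. fst (x i k)) (%k. snd (x i k))) (lrm L0 \<xi> \<Lambda>)"
  unfolding lu_conv_def
 proof (intro allI impI conjI)
  fix T :: real
  obtain T' :: nat where T': "T <= real T'" using real_arch_simple by blast
  from *[of T'] obtain I R U K where "lim_data b \<Psi> \<Lambda> \<xi> L0 (real T') U (A (R + 2)) R (%i. n (i + I)) (%i. x (i + I)) (%i. K (i + I)) (%i. tht (i + I))" by (elim exE) (erule that)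
  then interpret lim_data b \<Psi> \<Lambda> \<xi> L0 "real T'" U "A (R + 2)" R "%i. n (i + I)" "%i. x (i + I)" "%i. K (i + I)" "%i. tht (i + I)" .
  show "uniform_limit {0..T} (%i. fst (vrjp_stopped (n i) L0 (%k. fst (x i k)) (%k. snd (x i k)))) (fst (lrm L0 \<xi> \<Lambda>)) sequentially"
   by (rule uniform_limit_offset[where I=I], rule uniform_limit_on_subset[OF uniform_path]) (use T' in auto)
  show "uniform_limit ({0..T} \<times> {-T..T}) (%i p. snd (vrjp_stopped (n i) L0 (%k. fst (x i k)) (%k. snd (x i k))) (fst p) (snd p))
   (%p. snd (lrm L0 \<xi> \<Lambda>) (fst p) (snd p)) sequentially"
   by (rule uniform_limit_offset[where I=I], rule uniform_limit_on_subset[OF uniform_profile]) (use T' in auto)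
 qed
 obtain T' :: nat where T': "T <= real T'" using real_arch_simple by blast
 from *[of T'] obtain I R U K where "lim_data b \<Psi> \<Lambda> \<xi> L0 (real T') U (A (R + 2)) R (%i. n (i + I)) (%i. x (i + I)) (%i. K (i + I)) (%i. tht (i + I))" by (elim exE) (erule that)
 then interpret lim_data b \<Psi> \<Lambda> \<xi> L0 "real T'" U "A (R + 2)" R "%i. n (i + I)" "%i. x (i + I)" "%i. K (i + I)" "%i. tht (i + I)" .
 have "ereal T < expl_time (%k. snd (x (i + I) k))" for i
 proof -
  have "ereal T <= ereal (real T')" using T' by simp
  also have "... < expl_time (%k. snd (x (i + I) k))" by (rule ix(5)) auto
  finally show ?thesis .
 qed
 then have "\<forall>\<^sub>F i in sequentially. ereal T < expl_time (%k. snd (x (i + I) k))" by simp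
 then show "\<forall>\<^sub>F i in sequentially. ereal T < expl_time (%k. snd (x i k))"
  using eventually_sequentially_seg[of "%i. ereal T < expl_time (%k. snd (x i k))" I] by simp
qed

end

section \<open>From single trajectories to expectations\<close>

lemma prob_tendsto_one:
 assumes N: "prob_space N" and E[measurable]: "!!q::nat. E q \<in> sets N" and ev: "AE om in N. \<forall>\<^sub>F q in sequentially. om \<in> E q"
 shows "(%q. measure N (E q)) \<longlonglongrightarrow> 1"
proof -
 interpret prob_space N by fact
 have "(%q. \<integral>om. indicat_real (E q) om \<partial>N) \<longlonglongrightarrow> (\<integral>om. 1 \<partial>N)"
 proof (rule integral_dominated_convergence[where w="%_. 1"])
  show "AE om in N. (%q. indicat_real (E q) om) \<longlonglongrightarrow> 1"
   using ev
  proof eventually_elim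
   case (elim om)
   then have "\<forall>\<^sub>F q in sequentially. indicat_real (E q) om = 1" by eventually_elim simp
   then show ?case by (rule tendsto_eventually)
  qed
 qed (auto simp: indicator_def)
 moreover have "(\<integral>om. indicat_real (E q) om \<partial>N) = measure N (E q)" for q
  using sets.sets_into_space[OF E] by (simp add: Int_absorb2)
 ultimately show ?thesis by (simp add: prob_space)
qed

lemma integral_ge_off_bad:
 fixes f g :: "'c => real"
 assumes M: "prob_space M" and [measurable]: "f \<in> borel_measurable M" "g \<in> borel_measurable M" and Bad[measurable]: "Bad \<in> sets M"
  and f: "!!om. \<bar>f om\<bar> <= C" and g: "!!om. \<bar>g om\<bar> <= C" and ae: "AE om in M. om \<notin> Bad --> g om - \<eta> <= f om" and \<eta>: "\<eta> >= 0"
 shows "(\<integral>om. g om \<partial>M) - \<eta> - 2 * C * measure M Bad <= (\<integral>om. f om \<partial>M)"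
proof -
 interpret prob_space M by fact
 have fi: "integrable M f" and gi: "integrable M g" by (rule integrable_const_bound[where B=C]; use f g in auto)+
 have bi: "integrable M (indicat_real Bad)" by (rule integrable_const_bound[where B=1]) (auto simp: indicator_def)
 have "(\<integral>om. g om - \<eta> - 2 * C * indicat_real Bad om \<partial>M) <= (\<integral>om. f om \<partial>M)"
 proof (rule integral_mono_AE)
  show "integrable M (%om. g om - \<eta> - 2 * C * indicat_real Bad om)"
   by (intro Bochner_Integration.integrable_diff integrable_mult_right gi bi integrable_const)
  show "AE om in M. g om - \<eta> - 2 * C * indicat_real Bad om <= f om"
   using ae
  proof eventually_elim
   case (elim om)
   show ?case
   proof (cases "om \<in> Bad")
    case True
    then show ?thesis using f[of om] g[of om] \<eta> by (simp add: abs_le_iff)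
   next
    case False
    then show ?thesis using elim by simp
   qed
  qed
 qed (rule fi)
 also have "(\<integral>om. g om - \<eta> - 2 * C * indicat_real Bad om \<partial>M) = (\<integral>om. g om \<partial>M) - \<eta> - 2 * C * measure M Bad"
  using gi bi sets.sets_into_space[OF Bad] by (simp add: prob_space Int_absorb2)
 finally show ?thesis .
qed

text \<open>The original martingale and clock appear here, not their continuations; both agree as
  long as the trajectory is alive.\<close>

definition closeto :: "nat => (real => real) => nat => nat => (real => real) => real => (nat => int \<times> real) => bool" where
 "closeto n L0 s km b \<delta> x \<longleftrightarrow> (\<forall>k v. alive n s km x k --> clk n L0 x k < real s --> clk n L0 x k <= v --> v <= clk n L0 x (Suc k)
   --> \<bar>mart n L0 x k - b v\<bar> <= \<delta>)"

context wenv begin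

lemma alive_prefix:
 assumes v: "\<forall>i. valid (x i)" and "al x k" "i <= k"
 shows "al x i"
proof -
 have "(\<Sum>i<i. snd (x i)) <= (\<Sum>i<k. snd (x i))" using v assms(3) by (intro sum_mono2) (auto simp: valid_def less_imp_le)
 then show ?thesis using assms(2,3) by (auto simp: alive_def)
qed

lemma alive_eq:
 assumes v: "\<forall>i. valid (x i)" and a: "al x k"
 shows "Wp x k = mart n L0 x k" "up x k = clk n L0 x k" "up x (Suc k) = clk n L0 x (Suc k)"
proof -
 have "al x i" if "i <= k" for i by (rule alive_prefix[OF v a that])
 then show "Wp x k = mart n L0 x k" "up x k = clk n L0 x k" "up x (Suc k) = clk n L0 x (Suc k)"
  unfolding Wk_def mart_def uk_def clk_def by (auto simp: dW_def du_def intro!: sum.cong)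
qed

lemma Wg_0: "\<forall>i. valid (x i) ==> Wg x 0 = 0"
proof -
 assume v: "\<forall>i. valid (x i)"
 have "cross x 0 <= 0" unfolding cross_le_iff[OF v] up_0[OF v] by simp
 then show ?thesis by (simp add: Wg_def Wk_def)
qed

text \<open>The error has three parts: oscillation of the martingale within its clock block,
  distance to \<open>b\<close> at the grid point, and oscillation of \<open>b\<close>. The last is
  needed over two blocks, since the clock step at the end of a block may reach into the next
  one.\<close>

lemma closeto_grid:
 assumes v: "\<forall>i. valid (x i)" and osc: "osc_ok hh m z x" and hh: "hh > 0" "real m * hh = real s" "e <= hh"
  and g: "!!j. j < m ==> \<bar>Wg x (real j * hh) - b (real j * hh)\<bar> <= \<delta>0"
  and bm: "!!j t. j < m ==> real j * hh <= t ==> t <= real (j + 2) * hh ==> \<bar>b t - b (real j * hh)\<bar> <= \<delta>1"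
 shows "closeto n L0 s km b (z + \<delta>0 + \<delta>1) x"
 unfolding closeto_def
proof (intro allI impI)
 fix k t assume a: "al x k" and us: "clk n L0 x k < real s" and t: "clk n L0 x k <= t" "t <= clk n L0 x (Suc k)"
 note eq = alive_eq[OF v a]
 have u0: "up x k >= 0" using up_mono[OF v, of 0 k] up_0[OF v] by simp
 define j where "j = nat \<lfloor>up x k / hh\<rfloor>"
 have "real j <= up x k / hh" "up x k / hh < real j + 1" using u0 hh(1) unfolding j_def by (simp_all add: of_nat_nat)
 then have j: "real j * hh <= up x k" "up x k < real (Suc j) * hh" using hh(1) by (simp_all add: field_simps)
 have "real j * hh < real m * hh" using j(1) us hh(2) eq(2) by linarith
 then have jm: "j < m" using hh(1) by simp
 have c1: "cross x (real j * hh) <= k" unfolding cross_le_iff[OF v] by (rule j(1))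
 have "\<not> cross x (real (Suc j) * hh) <= k" unfolding cross_le_iff[OF v] using j(2) by simp
 then have c2: "k <= cross x (real (Suc j) * hh)" by simp
 have 1: "\<bar>Wp x k - Wg x (real j * hh)\<bar> <= z" by (rule osc_okD[OF osc v jm less_imp_le[OF hh(1)] c1 c2])
 have "up x (Suc k) <= up x k + e" using du_bounds(2)[of k x] v up_Suc[OF v, of k] by simp
 then have "t <= real (Suc j) * hh + hh" using t(2) j(2) hh(3) eq(3) by linarith
 also have "... = real (j + 2) * hh" by (simp add: algebra_simps)
 finally have 2: "\<bar>b t - b (real j * hh)\<bar> <= \<delta>1" using t(1) j(1) eq(2) by (intro bm[OF jm]) linarith+
 show "\<bar>mart n L0 x k - b t\<bar> <= z + \<delta>0 + \<delta>1" using 1 2 g[OF jm] unfolding eq(1) by linarith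
qed

end

text \<open>Rational times make the event a countable intersection, hence measurable. The tolerance
  1/(4 s) is one of the three error parts that must add up to at most 1/s.\<close>

definition bm_mod :: "'b measure => ('b => real => real) => nat => nat => 'b set" where
 "bm_mod N B s m = {om \<in> space N. \<forall>j<m. \<forall>q::rat. real j * (real s / real m) <= of_rat q --> of_rat q <= real (j + 2) * (real s / real m)
   --> \<bar>B om (of_rat q) - B om (real j * (real s / real m))\<bar> <= 1 / (4 * real s)}"

lemma sets_bm_mod [measurable]:
 assumes B: "std_brownian_motion N B" shows "bm_mod N B s m \<in> sets N"
proof -
 have [measurable]: "(%om. B om t) \<in> borel_measurable N" for t using B by (simp add: std_brownian_motion_def)
 show ?thesis unfolding bm_mod_def by measurable
qed

lemma bm_mod_real:
 assumes w: "om \<in> bm_mod N B s m" and c: "continuous_on {0..} (B om)" and s: "s >= 1" and m: "m >= 1" and j: "j < m"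
  and t: "real j * (real s / real m) <= t" "t <= real (j + 2) * (real s / real m)"
 shows "\<bar>B om t - B om (real j * (real s / real m))\<bar> <= 1 / (4 * real s)"
proof (rule ccontr)
 define p where "p = real j * (real s / real m)"
 define q where "q = real (j + 2) * (real s / real m)"
 have hh: "real s / real m > 0" using s m by simp
 have pq: "0 <= p" "p < q"
  unfolding p_def q_def by (simp, intro mult_strict_right_mono[OF _ hh], simp)
 assume "\<not> ?thesis"
 then have gt: "\<bar>B om t - B om p\<bar> - 1 / (4 * real s) > 0" by (simp add: p_def)
 have pt: "p <= t" "t <= q" using t unfolding p_def q_def by auto
 then have "t \<in> {0..}" using pq by simp
 then obtain d where d: "d > 0" "!!r. r \<in> {0..} ==> dist r t < d ==> dist (B om r) (B om t) < \<bar>B om t - B om p\<bar> - 1 / (4 * real s)"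
  using c gt unfolding continuous_on_iff by blast
 have "max p (t - d) < min q (t + d)" using pt pq d(1) by auto
 then obtain r where r: "max p (t - d) < of_rat r" "of_rat r < min q (t + d)" using of_rat_dense by blast
 have "dist (B om (of_rat r)) (B om t) < \<bar>B om t - B om p\<bar> - 1 / (4 * real s)"
 proof (rule d(2))
  have "p < of_rat r" "t - d < of_rat r" "of_rat r < t + d" using r by auto
  then show "of_rat r \<in> {0::real..}" "dist (of_rat r) t < d" using pq unfolding dist_real_def atLeast_iff by linarith+
 qed
 moreover have "\<bar>B om (of_rat r) - B om p\<bar> <= 1 / (4 * real s)"
  using w j r unfolding bm_mod_def p_def q_def by auto
 ultimately show False unfolding dist_real_def by linarith
qed

lemma bm_mod_eventually:
 assumes c: "continuous_on {0..} (B om)" and s: "s >= 1" and w: "om \<in> space N"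
 shows "\<forall>\<^sub>F m in sequentially. om \<in> bm_mod N B s m"
proof -
 have "uniformly_continuous_on {0..2 * real s} (B om)"
  by (intro compact_uniformly_continuous continuous_on_subset[OF c]) auto
 then obtain d where d: "d > 0" "!!r t. r \<in> {0..2 * real s} ==> t \<in> {0..2 * real s} ==> dist t r < d ==> dist (B om t) (B om r) < 1 / (4 * real s)"
  using uniformly_continuous_onE[of "{0..2 * real s}" "B om" "1 / (4 * real s)"] s by auto
 obtain M :: nat where M: "2 * real s / d < real M" using reals_Archimedean2 by blast
 show ?thesis unfolding eventually_sequentially
 proof (intro exI[of _ "Suc M"] allI impI)
  fix m assume m: "Suc M <= m"
  have hm: "2 * (real s / real m) < d"
  proof -
   have "2 * real s / d < real m" using M m by linarith
   then show ?thesis using d(1) m by (simp add: field_simps)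
  qed
  have h0: "real s / real m >= 0" by simp
  have "\<bar>B om t - B om (real j * (real s / real m))\<bar> <= 1 / (4 * real s)"
   if j: "j < m" and t: "real j * (real s / real m) <= t" "t <= real (j + 2) * (real s / real m)" for j t
  proof -
   have e: "real (j + 2) * (real s / real m) = real j * (real s / real m) + 2 * (real s / real m)" by (simp add: algebra_simps)
   have "real (j + 2) * (real s / real m) <= real (m + 1) * (real s / real m)" using j h0 by (intro mult_right_mono) auto
   also have "... = real s + real s / real m" using m by (simp add: field_simps)
   also have "real s / real m <= real s" using m mult_left_mono[of 1 "real m" "real s"] by (simp add: divide_le_eq)
   finally have "t <= 2 * real s" using t by linarith
   moreover have "0 <= real j * (real s / real m)" by simp
   ultimately have r: "real j * (real s / real m) \<in> {0..2 * real s}" "t \<in> {0..2 * real s}" using t(1) unfolding atLeastAtMost_iff by linarith+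
   have "dist t (real j * (real s / real m)) < d" using t hm e unfolding dist_real_def by linarith
   from d(2)[OF r this] have "dist (B om t) (B om (real j * (real s / real m))) < 1 / (4 * real s)" .
   then show ?thesis by (simp add: dist_real_def)
  qed
  then show "om \<in> bm_mod N B s m" unfolding bm_mod_def using w by auto
 qed
qed

text \<open>One mesh has to serve both sides: the Brownian path oscillates little over two cells,
  and the union bound for the oscillation of the time-changed martingale is small. The latter is m
  exponentials with exponent of order - m / s^3, so it vanishes as \<open>m\<close> grows.\<close>

lemma grid_exists:
 assumes B: "std_brownian_motion N B" and s: "s >= 1" and p: "p > 0"
 shows "\<exists>m\<ge>1. measure N (bm_mod N B s m) >= 1 - p & 2 * real m * exp (- (real m / (128 * real s ^ 3))) <= p"
proof -
 have N: "prob_space N" using B by (simp add: std_brownian_motion_def)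
 have "AE om in N. continuous_on {0..} (B om)" using B by (auto simp: std_brownian_motion_def)
 then have "AE om in N. \<forall>\<^sub>F m in sequentially. om \<in> bm_mod N B s m"
  using AE_space by eventually_elim (rule bm_mod_eventually[OF _ s])
 from prob_tendsto_one[OF N sets_bm_mod[OF B] this]
 have 1: "\<forall>\<^sub>F m in sequentially. measure N (bm_mod N B s m) > 1 - p" using p by (intro order_tendstoD) auto
 define a where "a = 1 / (128 * real s ^ 3)"
 have a: "a > 0" using s by (simp add: a_def)
 have "((%z::real. z ^ 1 / exp z) \<longlongrightarrow> 0) at_top" by (rule tendsto_power_div_exp_0)
 moreover have "filterlim (%m. a * real m) at_top sequentially"
  by (rule filterlim_tendsto_pos_mult_at_top[OF tendsto_const a filterlim_real_sequentially])
 ultimately have "(%m. (a * real m) ^ 1 / exp (a * real m)) \<longlonglongrightarrow> 0" by (rule filterlim_compose)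
 then have "(%m. 2 / a * ((a * real m) ^ 1 / exp (a * real m))) \<longlonglongrightarrow> 2 / a * 0" by (intro tendsto_mult tendsto_const)
 then have "(%m. 2 * real m * exp (- (real m / (128 * real s ^ 3)))) \<longlonglongrightarrow> 0" using a by (simp add: a_def exp_minus field_simps)
 then have 2: "\<forall>\<^sub>F m in sequentially. 2 * real m * exp (- (real m / (128 * real s ^ 3))) < p" using p by (intro order_tendstoD) auto
 from 1 2 eventually_ge_at_top[of 1] have "\<forall>\<^sub>F m in sequentially. m >= 1 & measure N (bm_mod N B s m) >= 1 - p & 2 * real m * exp (- (real m / (128 * real s ^ 3))) <= p"
  by eventually_elim auto
 from eventually_happens'[OF sequentially_bot this] show ?thesis by blast
qed

text \<open>A supremum of functions that are Lipschitz in \<open>w\<close> with a common constant is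
  Lipschitz, whatever the dependence on the path is. It dominates \<zeta> at paths of distance 0,
  while a steep slope \<open>c\<close> lets only nearby paths compete. The entry - C keeps the
  supremum meaningful when \<open>G\<close> is empty.\<close>

lemma sup_regularization:
 fixes d :: "'w => 'o => real" and \<zeta> :: "'o => real" and G :: "'o set"
 assumes z: "!!om. \<bar>\<zeta> om\<bar> <= C" and d: "!!w om. d w om >= 0" and c: "c >= 0" and D: "!!w w' om. \<bar>d w om - d w' om\<bar> <= D w w'"
 defines "Gm \<equiv> %w. Sup (insert (- C) ((%om. \<zeta> om - c * d w om) ` G))"
 shows "\<bar>Gm w\<bar> <= C" "\<bar>Gm w - Gm w'\<bar> <= c * D w w'" "!!om. om \<in> G ==> \<zeta> om - c * d w om <= Gm w"
  "(!!om. om \<in> G ==> \<zeta> om - c * d w om <= y) ==> - C <= y ==> Gm w <= y"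
proof -
 have le: "\<zeta> om - c * d w om <= C" for w om using z[of om] mult_nonneg_nonneg[OF c d, of w om] by linarith
 have C: "C >= 0" using z[of undefined] by linarith
 have bdd: "bdd_above (insert (- C) ((%om. \<zeta> om - c * d w om) ` G))" for w
  using le C by (intro bdd_aboveI[of _ C]) (auto intro: order_trans[of _ 0])
 have up: "\<zeta> om - c * d w om <= Gm w" if "om \<in> G" for w om unfolding Gm_def using that by (intro cSup_upper bdd) auto
 have lo: "- C <= Gm w" for w unfolding Gm_def by (intro cSup_upper bdd) auto
 have least: "Gm w <= y" if "!!om. om \<in> G ==> \<zeta> om - c * d w om <= y" "- C <= y" for w y
  unfolding Gm_def using that by (intro cSup_least) auto
 show "\<bar>Gm w\<bar> <= C" using least[of w C] le C lo[of w] by (simp add: abs_le_iff)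
 have D0: "0 <= D w w'" for w w' using D[of w undefined w'] by linarith
 have one: "Gm w <= Gm w' + c * E" if E: "!!om. \<bar>d w om - d w' om\<bar> <= E" for w w' E
 proof (rule least)
  have E0: "E >= 0" using E[of undefined] by linarith
  then show "- C <= Gm w' + c * E" using lo[of w'] c by (simp add: add_increasing2)
  fix om assume w: "om \<in> G"
  have "c * d w' om <= c * (d w om + E)" using E[of om] c by (intro mult_left_mono) linarith+
  then show "\<zeta> om - c * d w om <= Gm w' + c * E" using up[OF w, of w'] by (simp add: distrib_left)
 qed
 have "\<bar>d w' om - d w om\<bar> <= D w w'" for om using D[of w om w'] by (simp add: abs_minus_commute)
 then show "\<bar>Gm w - Gm w'\<bar> <= c * D w w'" using one[of w w' "D w w'"] one[of w' w "D w w'"] D by (simp add: abs_le_iff)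
 show "\<zeta> om - c * d w om <= Gm w" if "om \<in> G" for om by (rule up[OF that])
 show "Gm w <= y" if "!!om. om \<in> G ==> \<zeta> om - c * d w om <= y" "- C <= y" by (rule least[OF that])
qed

lemma increments_converge:
 fixes M :: "nat => 'a measure" and N :: "'b measure" and km :: "nat => nat" and Gm :: "(nat => real) => real"
 assumes law: "!!n. vrjp n L0 (M n) (dir n) (H n)" and c: "c > 0"
  and we: "!!n. n0 <= n ==> wenv n L0 (M n) (dir n) (H n) s c (1 / (2 ^ n * c\<^sup>2))"
  and B: "std_brownian_motion N B" and hh: "hh > 0"
  and lip: "!!w w'. \<bar>Gm w - Gm w'\<bar> <= K * (\<Sum>i<m. \<bar>w i - w' i\<bar>)" and bd: "!!w. \<bar>Gm w\<bar> <= C"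
 defines "W \<equiv> %n om. wenv.Wg n L0 s (km n) (1 / (2 ^ n * c\<^sup>2)) (vrjp.X (dir n) (H n) om)"
 defines "V \<equiv> %n om i. if n0 <= n then W n om (real (Suc i) * hh) - W n om (real i * hh) else 0"
 defines "Z \<equiv> %om i. B om (real (Suc i) * hh) - B om (real i * hh)"
 shows "(%n. \<integral>om. Gm (V n om) \<partial>M n) \<longlonglongrightarrow> (\<integral>om. Gm (Z om) \<partial>N)"
  "(%om. Gm (V n om)) \<in> borel_measurable (M n)" "(%om. Gm (Z om)) \<in> borel_measurable N"
proof -
 have P: "prob_space (M n)" for n using vrjp.law[OF law] by (simp add: vrjp_law_def)
 have Q: "prob_space N" using B by (simp add: std_brownian_motion_def)
 have Bm[measurable]: "(%om. B om t) \<in> borel_measurable N" for t using B by (simp add: std_brownian_motion_def)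
 have Wm: "(%om. W n om t) \<in> borel_measurable (M n)" if "n0 <= n" for n t
  unfolding W_def by (rule measurable_compose[OF vrjp.measurable_X[OF law] wenv.measurable_Wg[OF we[OF that]]])
 have Vm: "(%om. V n om i) \<in> borel_measurable (M n)" for n i
  unfolding V_def using Wm[of n] by (cases "n0 <= n") (auto intro!: borel_measurable_diff)
 have Zm: "(%om. Z om i) \<in> borel_measurable N" for i unfolding Z_def by measurable
 define e where "e n = 1 / (2 ^ n * c\<^sup>2)" for n
 have "(%n. 1 / c\<^sup>2 * (1 / 2) ^ n) \<longlonglongrightarrow> 1 / c\<^sup>2 * 0" by (intro tendsto_mult tendsto_const LIMSEQ_power_zero) auto
 then have e0: "e \<longlonglongrightarrow> 0" by (simp add: e_def[abs_def] power_one_over mult.commute)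
 have char: "(%n. \<integral>om. cos ((\<Sum>i<m. tht i * V n om i) + alp) \<partial>M n) \<longlonglongrightarrow> (\<integral>om. cos ((\<Sum>i<m. tht i * Z om i) + alp) \<partial>N)" for tht alp
 proof -
  define b where "b = (\<Sum>j<m. \<bar>tht j\<bar>)"
  define t where "t = exp (- ((\<Sum>j<m. (tht j)\<^sup>2) * hh / 2))"
  define E where "E = exp (b\<^sup>2 * (real m * hh + 1) / 2)"
  define k where "k = 3 * E * b ^ 3 * (real m * hh + 1) + E * (\<Sum>j<m. (tht j)\<^sup>2)"
  have tgt: "(\<integral>om. cos ((\<Sum>i<m. tht i * Z om i) + alp) \<partial>N) = t * cos alp" unfolding Z_def t_def by (rule brownian_cos[OF B hh])
  have "(%n. b * e n) \<longlonglongrightarrow> b * 0" by (intro tendsto_mult tendsto_const e0)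
  then have "\<forall>\<^sub>F n in sequentially. b * e n < 1" by (intro order_tendstoD) auto
  with eventually_ge_at_top[of n0]
  have ev: "\<forall>\<^sub>F n in sequentially. norm ((\<integral>om. cos ((\<Sum>i<m. tht i * V n om i) + alp) \<partial>M n) - t * cos alp) <= k * e n"
  proof eventually_elim
   case (elim n)
   let ?S = "%om. \<Sum>i<m. tht i * (W n om (real (Suc i) * hh) - W n om (real i * hh))"
   have cb: "(\<integral>om. cos (?S om + \<beta>) \<partial>M n) <= t * cos \<beta> + k * e n" for \<beta>
    unfolding W_def t_def k_def E_def b_def e_def
    by (rule wenv.char_bound[OF we[OF elim(1)] less_imp_le[OF hh]]) (use elim(2) in \<open>simp add: b_def e_def\<close>)
   have VS: "(\<Sum>i<m. tht i * V n om i) = ?S om" for om using elim(1) by (simp add: V_def)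
   \<comment> \<open>The bound \<open>cb\<close> is one-sided; the shifted phase turns it into a
     lower bound.\<close>
   have "cos (?S om + (alp + pi)) = - cos (?S om + alp)" for om by (simp only: add.assoc[symmetric] cos_periodic_pi)
   then have "(\<integral>om. cos (?S om + (alp + pi)) \<partial>M n) = - (\<integral>om. cos (?S om + alp) \<partial>M n)" by simp
   then show ?case using cb[of alp] cb[of "alp + pi"] unfolding VS by (simp add: abs_le_iff)
  qed
  have "(%n. k * e n) \<longlonglongrightarrow> k * 0" by (intro tendsto_mult tendsto_const e0)
  then have "(%n. k * e n) \<longlonglongrightarrow> 0" by simp
  from Lim_null_comparison[OF ev this] show ?thesis unfolding tgt by (rule LIM_zero_cancel)
 qed
 have tight: "\<exists>R>0. (\<forall>\<^sub>F n in sequentially. measure (M n) {om \<in> space (M n). \<not> (\<forall>i<m. \<bar>V n om i\<bar> <= R)} <= eps)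
    & measure N {om \<in> space N. \<not> (\<forall>i<m. \<bar>Z om i\<bar> <= R)} <= eps" if ep: "eps > 0" for eps
 proof -
  interpret N: prob_space N by (rule Q)
  note [measurable] = Zm
  have "(%q. measure N {om \<in> space N. \<forall>i<m. \<bar>Z om i\<bar> <= real q}) \<longlonglongrightarrow> 1"
  proof (rule prob_tendsto_one[OF Q])
   show "{om \<in> space N. \<forall>i<m. \<bar>Z om i\<bar> <= real q} \<in> sets N" for q by measurable
   have "\<forall>\<^sub>F q in sequentially. \<forall>i<m. \<bar>Z om i\<bar> <= real q" for om
   proof -
    obtain q0 :: nat where q0: "(\<Sum>i<m. \<bar>Z om i\<bar>) <= real q0" using real_arch_simple by blast
    have "\<bar>Z om i\<bar> <= real q" if "q >= q0" "i < m" for q i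
    proof -
     have "\<bar>Z om i\<bar> <= (\<Sum>i<m. \<bar>Z om i\<bar>)" using that(2) by (intro member_le_sum) auto
     then show ?thesis using q0 that(1) by linarith
    qed
    then show ?thesis unfolding eventually_sequentially by blast
   qed
   then show "AE om in N. \<forall>\<^sub>F q in sequentially. om \<in> {om \<in> space N. \<forall>i<m. \<bar>Z om i\<bar> <= real q}" by (intro AE_I2) auto
  qed
  then have "\<forall>\<^sub>F q in sequentially. measure N {om \<in> space N. \<forall>i<m. \<bar>Z om i\<bar> <= real q} > 1 - eps" using ep by (intro order_tendstoD) auto
  then obtain q where q: "measure N {om \<in> space N. \<forall>i<m. \<bar>Z om i\<bar> <= real q} > 1 - eps" using eventually_happens'[OF sequentially_bot] by blast
  \<comment> \<open>The logarithmic term makes the oscillation bound with parameter 1, that is 2 m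
    exp(- R + hh + 1) at worst, at most \<open>eps\<close>.\<close>
  define R where "R = max (max 1 (real q)) (hh + 1 + ln ((2 * real m + 1) / eps))"
  have R: "R > 0" "R >= real q" "R >= hh + 1 + ln ((2 * real m + 1) / eps)" by (auto simp: R_def)
  have "measure N {om \<in> space N. \<not> (\<forall>i<m. \<bar>Z om i\<bar> <= R)} <= measure N (space N - {om \<in> space N. \<forall>i<m. \<bar>Z om i\<bar> <= real q})"
   using R(2) by (intro N.finite_measure_mono) force+
  also have "... = 1 - measure N {om \<in> space N. \<forall>i<m. \<bar>Z om i\<bar> <= real q}" by (rule N.prob_compl) measurable
  finally have z: "measure N {om \<in> space N. \<not> (\<forall>i<m. \<bar>Z om i\<bar> <= R)} <= eps" using q by linarith
  have "measure (M n) {om \<in> space (M n). \<not> (\<forall>i<m. \<bar>V n om i\<bar> <= R)} <= eps" if n: "n0 <= n" for n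
  proof -
   interpret w: wenv n L0 "M n" "dir n" "H n" s "km n" c "1 / (2 ^ n * c\<^sup>2)" by (rule we[OF n])
   have "measure (M n) {om \<in> space (M n). \<not> (\<forall>i<m. \<bar>V n om i\<bar> <= R)} <= w.prob {om \<in> space (M n). \<not> w.osc_ok hh m R (w.X om)}"
   proof (rule w.finite_measure_mono_AE)
    show "AE om in M n. om \<in> {om \<in> space (M n). \<not> (\<forall>i<m. \<bar>V n om i\<bar> <= R)} --> om \<in> {om \<in> space (M n). \<not> w.osc_ok hh m R (w.X om)}"
     using w.AE_valid
    proof eventually_elim
     case (elim om)
     have "\<bar>V n om i\<bar> <= R" if "w.osc_ok hh m R (w.X om)" "i < m" for i
     proof -
      have "real i * hh <= real (Suc i) * hh" using hh by (intro mult_right_mono) auto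
      then show ?thesis
       using w.osc_okD[OF that(1) elim that(2) less_imp_le[OF hh] w.cross_mono[OF elim] order_refl] n
       unfolding V_def W_def w.Wg_def by simp
     qed
     then show ?case by blast
    qed
   qed measurable
   also have "... <= 2 * real m * exp (- 1 * R + 1\<^sup>2 * (hh + 1 / (2 ^ n * c\<^sup>2)))"
    by (rule w.prob_osc_ok) (use w.e_le hh in auto)
   also have "... <= 2 * real m * exp (- ln ((2 * real m + 1) / eps))" using R(3) w.e_le by (intro mult_left_mono) auto
   also have "exp (- ln ((2 * real m + 1) / eps)) = eps / (2 * real m + 1)" using ep by (simp add: exp_minus)
   also have "2 * real m * (eps / (2 * real m + 1)) <= eps" using ep by (simp add: field_simps)
   finally show ?thesis .
  qed
  then have "\<forall>\<^sub>F n in sequentially. measure (M n) {om \<in> space (M n). \<not> (\<forall>i<m. \<bar>V n om i\<bar> <= R)} <= eps" unfolding eventually_sequentially by blast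
  then show ?thesis using R(1) z by blast
 qed
 show "(%n. \<integral>om. Gm (V n om) \<partial>M n) \<longlonglongrightarrow> (\<integral>om. Gm (Z om) \<partial>N)"
  by (rule fdd_convergence(1)[where P=M and Q=N and V=V and Z=Z and m=m and Gm=Gm, OF P Q Vm Zm char tight lip bd])
 show "(%om. Gm (V n om)) \<in> borel_measurable (M n)"
  by (rule fdd_convergence(2)[where P=M and Q=N and V=V and Z=Z and m=m and Gm=Gm, OF P Q Vm Zm char tight lip bd])
 show "(%om. Gm (Z om)) \<in> borel_measurable N"
  by (rule fdd_convergence(3)[where P=M and Q=N and V=V and Z=Z and m=m and Gm=Gm, OF P Q Vm Zm char tight lip bd])
qed

definition approx_seq where
 "approx_seq L0 A D s n km x b \<longleftrightarrow> filterlim s at_top sequentially & filterlim n at_top sequentially & (\<forall>i k. valid (x i k))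
  & (\<forall>i. good (n i) L0 A D (s i) (km i) (x i)) & (\<forall>i. closeto (n i) L0 (s i) (km i) b (1 / real (s i)) (x i))"

text \<open>Hypothesis \<open>lim\<close> is purely deterministic: near a Brownian path, good
  trajectories make \<phi> asymptotically at least \<zeta>. For a fixed scale \<open>s\<close> the
  walk is compared with the regularised function \<open>Gm\<close> of its increments: \<phi> is at
  least \<open>Gm\<close> up to eps/4 at the walk, \<open>Gm\<close> converges in expectation, and
  \<open>Gm\<close> is at least \<zeta> at the Brownian motion, each off a small event. No path of
  the walk is ever paired with a Brownian path on a common space.\<close>

lemma eventually_expectation_ge:
 fixes M :: "nat => 'a measure" and N :: "'b measure" and \<phi> :: "nat => (nat => int \<times> real) => real" and \<zeta> :: "'b => real"
 assumes L0c: "continuous_on UNIV L0" and L0p: "!!y. L0 y > 0"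
  and law: "!!n. vrjp n L0 (M n) (dir n) (H n)" and B: "std_brownian_motion N B"
  and \<phi>m: "!!n. (%om. \<phi> n (vrjp.X (dir n) (H n) om)) \<in> borel_measurable (M n)" and \<zeta>m: "\<zeta> \<in> borel_measurable N"
  and C: "C > 0" and \<phi>: "!!n x. \<bar>\<phi> n x\<bar> <= C" and \<zeta>: "!!om. \<bar>\<zeta> om\<bar> <= C"
  and lim: "!!A D. (!!r. A r >= 0) ==> AE om in N. \<forall>s n km x. approx_seq L0 A D s n km x (B om) -->
   (\<forall>eps>0. \<forall>\<^sub>F i in sequentially. \<zeta> om - eps <= \<phi> (n i) (x i))"
  and eps: "eps > 0"
 shows "\<forall>\<^sub>F n in sequentially. (\<integral>om. \<zeta> om \<partial>N) - eps <= (\<integral>om. \<phi> n (vrjp.X (dir n) (H n) om) \<partial>M n)"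
proof -
 have Q: "prob_space N" using B by (simp add: std_brownian_motion_def)
 interpret N: prob_space N by (rule Q)
 have P: "prob_space (M n)" for n using vrjp.law[OF law] by (simp add: vrjp_law_def)
 \<comment> \<open>Four losses of eps/4: the bad event for the Brownian motion, the bad event for
   the walk, the convergence of expectations, and the tolerance in \<open>As\<close>. Each bad event
   has mass at most 2 p and costs 2 C per unit of mass.\<close>
 define p where "p = eps / (16 * C)"
 have p: "p > 0" "2 * C * (2 * p) = eps / 4" using eps C by (auto simp: p_def)
 from prob_good[OF L0c L0p p(1)] obtain A D \<nu> km where AD: "(\<forall>r. A r >= 0) & (\<forall>s n. \<nu> s <= n --> (\<forall>(M::'a measure) dir H. vrjp n L0 M dir H -->
   measure M {om \<in> space M. \<not> good n L0 A D s (km s n) (vrjp.X dir H om)} <= p))"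
  by (elim exE) (erule that)
 have A: "!!r. A r >= 0" using AD by simp
 have pg: "measure (M n) {om \<in> space (M n). \<not> good n L0 A D s (km s n) (vrjp.X (dir n) (H n) om)} <= p" if "\<nu> s <= n" for s n
  using AD that law[of n] by blast
 have "\<exists>c>0. \<forall>y. \<bar>y\<bar> <= real s + 1 --> L0 y >= c" for s :: nat by (rule L0_lower_bound[OF L0c L0p])
 then obtain c where c: "!!s::nat. c s > 0" "!!s y. \<bar>y\<bar> <= real s + 1 ==> L0 y >= c s" by metis
 have "\<exists>q. 1 / (c s)\<^sup>2 < 2 ^ q" for s by (rule real_arch_pow) simp
 then obtain q where q: "!!s. 1 / (c s)\<^sup>2 < 2 ^ q s" by metis
 define \<nu>' where "\<nu>' s = \<nu> s + q s + s" for s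
 have we: "wenv n L0 (M n) (dir n) (H n) s (c s) (1 / (2 ^ n * (c s)\<^sup>2))" if "\<nu>' s <= n" for s n
 proof (rule wenv.intro[OF law wenv_axioms.intro[OF c(1) c(2) refl]])
  have "(2::real) ^ q s <= 2 ^ n" using that by (intro power_increasing) (auto simp: \<nu>'_def)
  then have "1 / (c s)\<^sup>2 <= 2 ^ n" using q[of s] by linarith
  then show "1 / (2 ^ n * (c s)\<^sup>2) <= 1" using c(1)[of s] by (simp add: field_simps)
 qed
 \<comment> \<open>Uniform form of \<open>lim\<close> at one finite scale. A path outside
   \<open>As s\<close> for infinitely many \<open>s\<close> would supply counterexamples that form
   an approximating sequence, contrary to \<open>lim\<close>.\<close>
 define As where "As s = {om. \<forall>n\<ge>\<nu>' s. \<forall>x. (\<forall>k. valid (x k)) --> good n L0 A D s (km s n) x -->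
   closeto n L0 s (km s n) (B om) (1 / real s) x --> \<zeta> om - eps / 4 <= \<phi> n x}" for s
 have AsE: "AE om in N. \<forall>\<^sub>F s in sequentially. om \<in> As s"
  using lim[where A=A and D=D, OF A]
 proof eventually_elim
  case (elim om)
  show ?case
  proof (rule ccontr)
   assume "\<not> (\<forall>\<^sub>F s in sequentially. om \<in> As s)"
   from frequently_subseq[OF this] obtain r :: "nat => nat" where r: "strict_mono r" and nA: "!!i. om \<notin> As (r i)" by blast
   have "\<exists>n x. \<nu>' (r i) <= n & (\<forall>k. valid (x k)) & good n L0 A D (r i) (km (r i) n) x &
     closeto n L0 (r i) (km (r i) n) (B om) (1 / real (r i)) x & \<not> \<zeta> om - eps / 4 <= \<phi> n x" for i
    using nA[of i] unfolding As_def by blast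
   then have "\<forall>i. \<exists>f. \<nu>' (r i) <= fst f & (\<forall>k. valid (snd f k)) & good (fst f) L0 A D (r i) (km (r i) (fst f)) (snd f) &
     closeto (fst f) L0 (r i) (km (r i) (fst f)) (B om) (1 / real (r i)) (snd f) & \<not> \<zeta> om - eps / 4 <= \<phi> (fst f) (snd f)" by simp
   from choice[OF this] obtain f where f: "\<forall>i. \<nu>' (r i) <= fst (f i) & (\<forall>k. valid (snd (f i) k)) & good (fst (f i)) L0 A D (r i) (km (r i) (fst (f i))) (snd (f i)) &
     closeto (fst (f i)) L0 (r i) (km (r i) (fst (f i))) (B om) (1 / real (r i)) (snd (f i)) & \<not> \<zeta> om - eps / 4 <= \<phi> (fst (f i)) (snd (f i))" by (rule exE)
   define n where "n i = fst (f i)" for i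
   define x where "x i = snd (f i)" for i
   have nx: "!!i. \<nu>' (r i) <= n i" "!!i k. valid (x i k)" "!!i. good (n i) L0 A D (r i) (km (r i) (n i)) (x i)"
    "!!i. closeto (n i) L0 (r i) (km (r i) (n i)) (B om) (1 / real (r i)) (x i)" "!!i. \<not> \<zeta> om - eps / 4 <= \<phi> (n i) (x i)"
    using f by (simp_all add: n_def x_def)
   have rl: "filterlim r at_top sequentially" by (rule filterlim_subseq[OF r])
   have "r i <= n i" for i using nx(1)[of i] by (simp add: \<nu>'_def)
   then have nl: "filterlim n at_top sequentially" by (intro filterlim_at_top_mono[OF rl] always_eventually allI)
   have "approx_seq L0 A D r n (%i. km (r i) (n i)) x (B om)"
    unfolding approx_seq_def by (intro conjI allI rl nl nx(2,3,4))
   from elim[THEN spec, THEN spec, THEN spec, THEN spec, THEN mp, OF this]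
   have "\<forall>\<^sub>F i in sequentially. \<zeta> om - eps / 4 <= \<phi> (n i) (x i)" using eps by simp
   from eventually_happens'[OF sequentially_bot this] show False using nx(5) by blast
  qed
 qed
 have "\<exists>m. m >= 1 & (s >= 1 --> measure N (bm_mod N B s m) >= 1 - p & 2 * real m * exp (- (real m / (128 * real s ^ 3))) <= p)" for s
  using grid_exists[OF B _ p(1), of s] by (cases "s >= 1") auto
 then have "\<forall>s. \<exists>m. m >= 1 & (s >= 1 --> measure N (bm_mod N B s m) >= 1 - p & 2 * real m * exp (- (real m / (128 * real s ^ 3))) <= p)" by blast
 from choice[OF this] obtain m where mm: "\<forall>s. m s >= 1 & (s >= 1 --> measure N (bm_mod N B s (m s)) >= 1 - p & 2 * real (m s) * exp (- (real (m s) / (128 * real s ^ 3))) <= p)" by (rule exE)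
 then have m: "!!s. m s >= 1" "!!s. s >= 1 ==> measure N (bm_mod N B s (m s)) >= 1 - p"
  "!!s. s >= 1 ==> 2 * real (m s) * exp (- (real (m s) / (128 * real s ^ 3))) <= p" by simp_all
 define hh where "hh s = real s / real (m s)" for s
 define G where "G s = As s \<inter> bm_mod N B s (m s) \<inter> {om. B om 0 = 0 & continuous_on {0..} (B om)}" for s
 define d where "d s w om = (\<Sum>j\<le>m s. \<bar>(\<Sum>i<j. w i) - B om (real j * hh s)\<bar>)" for s w om
 \<comment> \<open>A path at grid distance more than 1/(4 s) is then penalised by at least 2 C,
   which exceeds any possible gain.\<close>
 define K where "K s = 8 * real s * C" for s
 define Gm where "Gm s w = Sup (insert (- C) ((%om. \<zeta> om - K s * d s w om) ` G s))" for s w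
 define Z where "Z s om i = B om (real (Suc i) * hh s) - B om (real i * hh s)" for s om i
 have d0: "d s w om >= 0" for s w om unfolding d_def by (rule sum_nonneg) simp
 have K0: "K s >= 0" for s using C by (simp add: K_def)
 have dD: "\<bar>d s w om - d s w' om\<bar> <= real (Suc (m s)) * (\<Sum>i<m s. \<bar>w i - w' i\<bar>)" for s w w' om
 proof -
  have "\<bar>d s w om - d s w' om\<bar> <= (\<Sum>j\<le>m s. \<bar>\<bar>(\<Sum>i<j. w i) - B om (real j * hh s)\<bar> - \<bar>(\<Sum>i<j. w' i) - B om (real j * hh s)\<bar>\<bar>)"
   unfolding d_def sum_subtractf[symmetric] by (rule sum_abs)
  also have "... <= (\<Sum>j\<le>m s. \<Sum>i<m s. \<bar>w i - w' i\<bar>)"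
  proof (rule sum_mono)
   fix j assume j: "j \<in> {..m s}"
   have "\<bar>\<bar>(\<Sum>i<j. w i) - B om (real j * hh s)\<bar> - \<bar>(\<Sum>i<j. w' i) - B om (real j * hh s)\<bar>\<bar> <= \<bar>(\<Sum>i<j. w i) - (\<Sum>i<j. w' i)\<bar>" by linarith
   also have "... <= (\<Sum>i<j. \<bar>w i - w' i\<bar>)" unfolding sum_subtractf[symmetric] by (rule sum_abs)
   also have "... <= (\<Sum>i<m s. \<bar>w i - w' i\<bar>)" using j by (intro sum_mono2) auto
   finally show "\<bar>\<bar>(\<Sum>i<j. w i) - B om (real j * hh s)\<bar> - \<bar>(\<Sum>i<j. w' i) - B om (real j * hh s)\<bar>\<bar> <= (\<Sum>i<m s. \<bar>w i - w' i\<bar>)" .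
  qed
  finally show ?thesis by simp
 qed
 note reg = sup_regularization[where d="d s" and \<zeta>=\<zeta> and C=C and c="K s" and D="%w w'. real (Suc (m s)) * (\<Sum>i<m s. \<bar>w i - w' i\<bar>)" and G="G s" for s,
   OF \<zeta> d0 K0 dD, folded Gm_def]
 have lip: "\<bar>Gm s w - Gm s w'\<bar> <= (K s * real (Suc (m s))) * (\<Sum>i<m s. \<bar>w i - w' i\<bar>)" for s w w'
  using reg(2)[of s w w'] by (simp only: mult.assoc)
 have hh0: "hh s > 0" if "s >= 1" for s using that m(1)[of s] by (simp add: hh_def)
 have conv: "(%n. \<integral>om. Gm s (%i. if \<nu>' s <= n then wenv.Wg n L0 s (km s n) (1 / (2 ^ n * (c s)\<^sup>2)) (vrjp.X (dir n) (H n) om) (real (Suc i) * hh s)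
    - wenv.Wg n L0 s (km s n) (1 / (2 ^ n * (c s)\<^sup>2)) (vrjp.X (dir n) (H n) om) (real i * hh s) else 0) \<partial>M n)
   \<longlonglongrightarrow> (\<integral>om. Gm s (Z s om) \<partial>N)"
  "(%om. Gm s (%i. if \<nu>' s <= n then wenv.Wg n L0 s (km s n) (1 / (2 ^ n * (c s)\<^sup>2)) (vrjp.X (dir n) (H n) om) (real (Suc i) * hh s)
    - wenv.Wg n L0 s (km s n) (1 / (2 ^ n * (c s)\<^sup>2)) (vrjp.X (dir n) (H n) om) (real i * hh s) else 0)) \<in> borel_measurable (M n)"
  "(%om. Gm s (Z s om)) \<in> borel_measurable N" if s: "s >= 1" for s n
  unfolding Z_def
  by (rule increments_converge(1)[where ?L0.0=L0 and M=M and dir=dir and H=H and N=N and km="km s" and s=s and m="m s" and ?n0.0="\<nu>' s" and c="c s" and hh="hh s" and B=B and Gm="Gm s"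
   and K="K s * real (Suc (m s))" and C=C, OF law c(1) we B hh0[OF s] lip reg(1)], assumption,
    rule increments_converge(2)[where ?L0.0=L0 and M=M and dir=dir and H=H and N=N and km="km s" and s=s and m="m s" and ?n0.0="\<nu>' s" and c="c s" and hh="hh s" and B=B and Gm="Gm s"
   and K="K s * real (Suc (m s))" and C=C, OF law c(1) we B hh0[OF s] lip reg(1)], assumption,
    rule increments_converge(3)[where ?L0.0=L0 and M=M and dir=dir and H=H and N=N and s=s and m="m s" and ?n0.0="\<nu>' s" and c="c s" and hh="hh s" and B=B and Gm="Gm s"
   and K="K s * real (Suc (m s))" and C=C, OF law c(1) we B hh0[OF s] lip reg(1)], assumption)
 note [measurable] = \<zeta>m
 \<comment> \<open>Measurability of \<open>As s\<close> is not at hand. The event is therefore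
   expressed through \<open>Gm\<close>, which is Lipschitz in the increments.\<close>
 define E where "E s = (if s >= 1 then {om \<in> space N. \<zeta> om <= Gm s (Z s om)} else space N)" for s
 have Em[measurable]: "E s \<in> sets N" for s
 proof (cases "s >= 1")
  case True
  note [measurable] = conv(3)[OF True]
  show ?thesis unfolding E_def using True by simp
 qed (simp add: E_def)
 note [measurable] = sets_bm_mod[OF B]
 have "AE om in N. B om 0 = 0 & continuous_on {0..} (B om)" using B by (simp add: std_brownian_motion_def)
 with AsE AE_space have "AE om in N. \<forall>\<^sub>F s in sequentially. om \<in> E s \<union> (space N - bm_mod N B s (m s))"
 proof eventually_elim
  case (elim om)
  have "om \<in> E s \<union> (space N - bm_mod N B s (m s))" if "om \<in> As s" for s
  proof (cases "om \<in> bm_mod N B s (m s)")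
   case True
   then have "om \<in> G s" using that elim by (simp add: G_def)
   moreover have "d s (Z s om) om = 0"
   proof -
    have "(\<Sum>i<j. Z s om i) = B om (real j * hh s)" for j
     unfolding Z_def using sum_lessThan_telescope[of "%i. B om (real i * hh s)" j] elim by simp
    then show ?thesis by (simp add: d_def)
   qed
   ultimately show ?thesis using reg(3)[of om s "Z s om"] elim by (simp add: E_def)
  qed (use elim in simp)
  with elim(1) show ?case by (rule eventually_mono)
 qed
 from prob_tendsto_one[OF Q _ this] have "(%s. N.prob (E s \<union> (space N - bm_mod N B s (m s)))) \<longlonglongrightarrow> 1" by measurable
 then have "\<forall>\<^sub>F s in sequentially. N.prob (E s \<union> (space N - bm_mod N B s (m s))) > 1 - p" using p(1) by (intro order_tendstoD) auto
 with eventually_ge_at_top[of 1] have "\<forall>\<^sub>F s in sequentially. s >= 1 & N.prob (E s \<union> (space N - bm_mod N B s (m s))) > 1 - p" by eventually_elim simp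
 from eventually_happens'[OF sequentially_bot this] obtain s :: nat
  where s: "s >= 1" and sE: "N.prob (E s \<union> (space N - bm_mod N B s (m s))) > 1 - p" by blast
 have "N.prob (E s \<union> (space N - bm_mod N B s (m s))) <= N.prob (E s) + N.prob (space N - bm_mod N B s (m s))" by (rule measure_Un_le) measurable
 also have "N.prob (space N - bm_mod N B s (m s)) = 1 - N.prob (bm_mod N B s (m s))" by (rule N.prob_compl) measurable
 finally have "N.prob (E s) >= 1 - 2 * p" using sE m(2)[OF s] by linarith
 moreover have "N.prob (space N - E s) = 1 - N.prob (E s)" by (rule N.prob_compl) measurable
 ultimately have Ep: "N.prob (space N - E s) <= 2 * p" by linarith
 have iN: "(\<integral>om. \<zeta> om \<partial>N) - eps / 4 <= (\<integral>om. Gm s (Z s om) \<partial>N)"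
 proof -
  have "(\<integral>om. \<zeta> om \<partial>N) - 0 - 2 * C * N.prob (space N - E s) <= (\<integral>om. Gm s (Z s om) \<partial>N)"
  proof (rule integral_ge_off_bad[OF Q conv(3)[OF s] \<zeta>m sets.compl_sets[OF Em] reg(1) \<zeta>])
   show "AE om in N. om \<notin> space N - E s --> \<zeta> om - 0 <= Gm s (Z s om)"
    using AE_space by eventually_elim (use s in \<open>simp add: E_def\<close>)
  qed simp
  moreover have "2 * C * N.prob (space N - E s) <= 2 * C * (2 * p)" using Ep C by (intro mult_left_mono) auto
  ultimately show ?thesis using p(2) by linarith
 qed
 have "(%n. 1 / (c s)\<^sup>2 * (1 / 2) ^ n) \<longlonglongrightarrow> 1 / (c s)\<^sup>2 * 0" by (intro tendsto_mult tendsto_const LIMSEQ_power_zero) auto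
 then have e0: "(%n. 1 / (2 ^ n * (c s)\<^sup>2)) \<longlonglongrightarrow> 0" by (simp add: power_one_over mult.commute)
 define z where "z = 1 / (4 * real s)"
 \<comment> \<open>This minimises - l z + 2 hh l^2, with value - z^2 / (8 hh), which is the exponent
   - m / (128 s^3) provided by \<open>grid_exists\<close>.\<close>
 define l where "l = z / (4 * hh s)"
 have z: "z > 0" and l: "l > 0" using s hh0[OF s] by (auto simp: z_def l_def)
 have ev1: "\<forall>\<^sub>F n in sequentially. 1 / (2 ^ n * (c s)\<^sup>2) < min (hh s) (1 / l)" using hh0[OF s] l by (intro order_tendstoD(2)[OF e0]) auto
 have ev2: "\<forall>\<^sub>F n in sequentially. dist (\<integral>om. Gm s (%i. if \<nu>' s <= n then wenv.Wg n L0 s (km s n) (1 / (2 ^ n * (c s)\<^sup>2)) (vrjp.X (dir n) (H n) om) (real (Suc i) * hh s)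
    - wenv.Wg n L0 s (km s n) (1 / (2 ^ n * (c s)\<^sup>2)) (vrjp.X (dir n) (H n) om) (real i * hh s) else 0) \<partial>M n) (\<integral>om. Gm s (Z s om) \<partial>N) < eps / 4"
  using eps by (intro tendstoD[OF conv(1)[OF s]]) auto
 from ev1 ev2 eventually_ge_at_top[of "\<nu>' s"] show ?thesis
 proof eventually_elim
  case (elim n)
  define e where "e = 1 / (2 ^ n * (c s)\<^sup>2)"
  interpret w: wenv n L0 "M n" "dir n" "H n" s "km s n" "c s" e unfolding e_def by (rule we[OF elim(3)])
  have e: "e <= hh s" "l * e <= 1" using elim(1) l by (auto simp: e_def[symmetric] field_simps)
  define V where "V om i = (if \<nu>' s <= n then w.Wg (w.X om) (real (Suc i) * hh s) - w.Wg (w.X om) (real i * hh s) else 0)" for om i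
  have Vm: "(%om. Gm s (V om)) \<in> borel_measurable (M n)" using conv(2)[OF s, of n] unfolding V_def e_def .
  have iV: "(\<integral>om. \<zeta> om \<partial>N) - eps / 2 <= (\<integral>om. Gm s (V om) \<partial>M n)"
   using elim(2) iN unfolding V_def e_def dist_real_def by linarith
  define B1 where "B1 = {om \<in> space (M n). \<not> good n L0 A D s (km s n) (w.X om)}"
  define B2 where "B2 = {om \<in> space (M n). \<not> w.osc_ok (hh s) (m s) z (w.X om)}"
  have [measurable]: "B1 \<in> sets (M n)" "B2 \<in> sets (M n)" unfolding B1_def B2_def by measurable
  have "w.prob B1 <= p" unfolding B1_def by (rule pg) (use elim(3) in \<open>simp add: \<nu>'_def\<close>)
  moreover have "w.prob B2 <= p"
  proof -
   have "w.prob B2 <= 2 * real (m s) * exp (- l * z + l\<^sup>2 * (hh s + e))"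
    unfolding B2_def by (rule w.prob_osc_ok) (use l e hh0[OF s] in auto)
   also have "... <= 2 * real (m s) * exp (- l * z + l\<^sup>2 * (2 * hh s))"
   proof -
    have "l\<^sup>2 * (hh s + e) <= l\<^sup>2 * (2 * hh s)" using e(1) by (intro mult_left_mono) auto
    then show ?thesis by (intro mult_left_mono) auto
   qed
   also have "- l * z + l\<^sup>2 * (2 * hh s) = - (z\<^sup>2 / (8 * hh s))"
    using hh0[OF s] by (simp add: l_def power2_eq_square field_simps)
   also have "z\<^sup>2 / (8 * hh s) = real (m s) / (128 * real s ^ 3)"
    using s m(1)[of s] by (simp add: z_def hh_def power2_eq_square power3_eq_cube)
   finally show ?thesis using m(3)[OF s] by linarith
  qed
  ultimately have Bp: "w.prob (B1 \<union> B2) <= 2 * p" using measure_Un_le[of B1 "M n" B2] by simp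
  have "(\<integral>om. Gm s (V om) \<partial>M n) - eps / 4 - 2 * C * w.prob (B1 \<union> B2) <= (\<integral>om. \<phi> n (w.X om) \<partial>M n)"
  proof (rule integral_ge_off_bad[OF P \<phi>m Vm _ \<phi> reg(1)])
   show "AE om in M n. om \<notin> B1 \<union> B2 --> Gm s (V om) - eps / 4 <= \<phi> n (w.X om)"
    using w.AE_valid AE_space
   proof eventually_elim
    case (elim om)
    show ?case
    proof
     assume "om \<notin> B1 \<union> B2"
     then have gd: "good n L0 A D s (km s n) (w.X om)" and oo: "w.osc_ok (hh s) (m s) z (w.X om)" using elim(2) by (auto simp: B1_def B2_def)
     have tel: "(\<Sum>i<j. V om i) = w.Wg (w.X om) (real j * hh s)" for j
      using sum_lessThan_telescope[of "%i. w.Wg (w.X om) (real i * hh s)" j] w.Wg_0[OF elim(1)] \<open>\<nu>' s <= n\<close> by (simp add: V_def)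
     have "Gm s (V om) <= \<phi> n (w.X om) + eps / 4"
     proof (rule reg(4))
      show "- C <= \<phi> n (w.X om) + eps / 4" using \<phi>[of n "w.X om"] eps by linarith
      fix om' assume w': "om' \<in> G s"
      show "\<zeta> om' - K s * d s (V om) om' <= \<phi> n (w.X om) + eps / 4"
      proof (cases "d s (V om) om' <= 1 / (4 * real s)")
       case False
       then have "K s * (1 / (4 * real s)) <= K s * d s (V om) om'" using K0 by (intro mult_left_mono) auto
       moreover have "K s * (1 / (4 * real s)) = 2 * C" using s by (simp add: K_def)
       ultimately show ?thesis using \<zeta>[of om'] \<phi>[of n "w.X om"] eps by linarith
      next
       case True
       have "closeto n L0 s (km s n) (B om') (z + 1 / (4 * real s) + 1 / (4 * real s)) (w.X om)"
       proof (rule w.closeto_grid[OF elim(1) oo hh0[OF s] _ e(1)])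
        show "real (m s) * hh s = real s" using m(1)[of s] by (simp add: hh_def)
        fix j assume j: "j < m s"
        have "\<bar>(\<Sum>i<j. V om i) - B om' (real j * hh s)\<bar> <= d s (V om) om'"
         unfolding d_def using j by (intro member_le_sum[where f="%j. \<bar>(\<Sum>i<j. V om i) - B om' (real j * hh s)\<bar>"]) auto
        then show "\<bar>w.Wg (w.X om) (real j * hh s) - B om' (real j * hh s)\<bar> <= 1 / (4 * real s)" using True unfolding tel by linarith
        fix t assume "real j * hh s <= t" "t <= real (j + 2) * hh s"
        then show "\<bar>B om' t - B om' (real j * hh s)\<bar> <= 1 / (4 * real s)"
         unfolding hh_def using w' j by (intro bm_mod_real[OF _ _ s m(1)]) (auto simp: G_def)
       qed
       moreover have "z + 1 / (4 * real s) + 1 / (4 * real s) <= 1 / real s" using s by (simp add: z_def field_simps)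
       ultimately have "closeto n L0 s (km s n) (B om') (1 / real s) (w.X om)" unfolding closeto_def by (meson order_trans)
       then have "\<zeta> om' - eps / 4 <= \<phi> n (w.X om)" using w' gd elim(1) \<open>\<nu>' s <= n\<close> unfolding G_def As_def by blast
       moreover have "0 <= K s * d s (V om) om'" using K0 d0 by simp
       ultimately show ?thesis by linarith
      qed
     qed
     then show "Gm s (V om) - eps / 4 <= \<phi> n (w.X om)" by linarith
    qed
   qed
  qed (use eps in auto)
  moreover have "2 * C * w.prob (B1 \<union> B2) <= 2 * C * (2 * p)" using Bp C by (intro mult_left_mono) auto
  ultimately show ?case using iV p(2) by linarith
 qed
qed

text \<open>Both claims are instances of \<open>eventually_expectation_ge\<close>: non-explosion
  with \<phi> the indicator of survival and \<zeta> = 1, convergence in law with a test functional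
  and with its negative.\<close>

theorem mainTheorem1:
  fixes L0 :: "real \<Rightarrow> real"
    and M :: "nat \<Rightarrow> 'a measure"
    and dir :: "nat \<Rightarrow> nat \<Rightarrow> 'a \<Rightarrow> int"
    and H :: "nat \<Rightarrow> nat \<Rightarrow> 'a \<Rightarrow> real"
    and N :: "'b measure"
    and B :: "'b \<Rightarrow> real \<Rightarrow> real"
    and \<Psi> \<Lambda> :: "'b \<Rightarrow> real \<Rightarrow> real \<Rightarrow> real"
  assumes "continuous_on UNIV L0"
    and "\<forall>x. L0 x > 0"
    and "(\<integral>\<^sup>+ x \<in> {0..}. ennreal (1 / (L0 x) ^ 2) \<partial>lborel) = \<infinity>"
    and "(\<integral>\<^sup>+ x \<in> {..0}. ennreal (1 / (L0 x) ^ 2) \<partial>lborel) = \<infinity>"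
    and "\<forall>n. vrjp_law n L0 (M n) (dir n) (H n)"
    and "std_brownian_motion N B"
    and "bass_burdzy_flow N B \<Psi>"
    and "occupation_densities N (reduced_proc \<Psi> B) \<Lambda>"
  shows "(\<forall>K :: real. (\<lambda>n. measure (M n) {\<omega> \<in> space (M n). expl_time (\<lambda>i. H n i \<omega>) \<le> ereal K})
            \<longlonglongrightarrow> 0)
       \<and> conv_in_law M (\<lambda>n \<omega>. vrjp_stopped n L0 (\<lambda>i. dir n i \<omega>) (\<lambda>i. H n i \<omega>))
           N (\<lambda>\<omega>. lrm L0 (reduced_proc \<Psi> B \<omega>) (\<Lambda> \<omega>))"
proof -
 have L0p: "!!y. L0 y > 0" using assms(2) by simp
 have sc: "scale_fn L0" by (rule scale_fnI[OF assms(1) L0p assms(3,4)])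
 have law: "!!n. vrjp n L0 (M n) (dir n) (H n)" by (rule vrjp.intro) (use assms(5) L0p in auto)
 have P: "prob_space (M n)" for n using assms(5) by (simp add: vrjp_law_def)
 have X: "fst (vrjp.X (dir n) (H n) om k) = dir n k om" "snd (vrjp.X (dir n) (H n) om k) = H n k om" for n om k
  using vrjp.X_def[OF law, of n om k] by simp_all
 \<comment> \<open>The exceptional set depends on the starting point, so the equation is collected
   over a countable dense set only.\<close>
 have q: "AE om in N. \<forall>q\<in>\<rat>. bb_solution (B om) q (%u. \<Psi> om u q)"
  using assms(7) by (simp add: AE_ball_countable[OF countable_rat] bass_burdzy_flow_def)
 have "AE om in N. B om 0 = 0 & continuous_on {0..} (B om)" using assms(6) by (simp add: std_brownian_motion_def)
 moreover have "AE om in N. continuous_on ({0..} \<times> UNIV) (%(u, y). \<Psi> om u y) & (\<forall>u\<ge>0. incr_C1_diffeo (\<Psi> om u))"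
  using assms(7) by (simp add: bass_burdzy_flow_def)
 moreover note q
 moreover have "AE om in N. continuous_on ({0..} \<times> UNIV) (%(u, y). \<Lambda> om u y)
    & (\<forall>u\<ge>0. \<forall>f :: real => real. f \<in> borel_measurable borel --> bounded (range f) -->
      set_lebesgue_integral lborel {0..u} (%v. f (reduced_proc \<Psi> B om v)) = (\<integral>y. f y * \<Lambda> om u y \<partial>lborel))"
  using assms(8) by (simp add: occupation_densities_def)
 ultimately have flow: "AE om in N. lrm_env (B om) (\<Psi> om) (\<Lambda> om) (reduced_proc \<Psi> B om) L0"
 proof eventually_elim
  case (elim om)
  have "bbflow (B om) (\<Psi> om) (\<Lambda> om) (reduced_proc \<Psi> B om)"
   by (rule bbflow.intro) (use elim in \<open>auto simp: reduced_proc_def\<close>)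
  then show ?case using sc by (rule lrm_env.intro)
 qed
 have det: "AE om in N. \<forall>s n km x. approx_seq L0 A D s n km x (B om) -->
   lu_conv (%i. vrjp_stopped (n i) L0 (%k. fst (x i k)) (%k. snd (x i k))) (lrm L0 (reduced_proc \<Psi> B om) (\<Lambda> om))
   & (\<forall>T. \<forall>\<^sub>F i in sequentially. ereal T < expl_time (%k. snd (x i k)))" if A: "!!r. A r >= 0" for A D
  using flow
 proof eventually_elim
  case (elim om)
  interpret lrm_env "B om" "\<Psi> om" "\<Lambda> om" "reduced_proc \<Psi> B om" L0 by (rule elim)
  show ?case
  proof (intro allI impI)
   fix s n km x assume a: "approx_seq L0 A D s n km x (B om)"
   have s: "filterlim s at_top sequentially" and n: "filterlim n at_top sequentially" and v: "!!i. \<forall>k. valid (x i k)"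
    and g: "!!i. good (n i) L0 A D (s i) (km i) (x i)" using a by (auto simp: approx_seq_def)
   have th: "(%i. 1 / real (s i)) \<longlonglongrightarrow> 0" by (rule filterlim_compose[OF lim_1_over_n s])
   have cl: "\<bar>mart (n i) L0 (x i) k - B om t\<bar> <= 1 / real (s i)" if "alive (n i) (s i) (km i) (x i) k" "clk (n i) L0 (x i) k < real (s i)"
    "clk (n i) L0 (x i) k <= t" "t <= clk (n i) L0 (x i) (Suc k)" for i k t
    using a that unfolding approx_seq_def closeto_def by blast
   show "lu_conv (%i. vrjp_stopped (n i) L0 (%k. fst (x i k)) (%k. snd (x i k))) (lrm L0 (reduced_proc \<Psi> B om) (\<Lambda> om))
    & (\<forall>T. \<forall>\<^sub>F i in sequentially. ereal T < expl_time (%k. snd (x i k)))"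
   proof (intro conjI allI)
    show "lu_conv (%i. vrjp_stopped (n i) L0 (%k. fst (x i k)) (%k. snd (x i k))) (lrm L0 (reduced_proc \<Psi> B om) (\<Lambda> om))"
     by (rule deterministic_limit(1)[where s=s and n=n and km=km and x=x and A=A and C=D and tht="%i. 1 / real (s i)"])
      (assumption | rule s n v A g th cl | simp)+
    show "\<forall>\<^sub>F i in sequentially. ereal T < expl_time (%k. snd (x i k))" for T
     by (rule deterministic_limit(2)[where s=s and n=n and km=km and x=x and A=A and C=D and tht="%i. 1 / real (s i)"])
      (assumption | rule s n v A g th cl | simp)+
   qed
  qed
 qed
 have part1: "(%n. measure (M n) {om \<in> space (M n). expl_time (%i. H n i om) <= ereal K}) \<longlonglongrightarrow> 0" for K :: real
 proof -
  \<comment> \<open>The expectation of this indicator is one minus the probability of explosion by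
    time \<open>K\<close>, so the lower bound forces that probability to 0.\<close>
  define \<phi> :: "nat => (nat => int \<times> real) => real" where "\<phi> n x = (if ereal K < expl_time (%k. snd (x k)) then 1 else 0)" for n x
  have em: "(%om. expl_time (%i. H n i om)) \<in> borel_measurable (M n)" for n
  proof -
   have [measurable]: "H n i \<in> borel_measurable (M n)" for i using assms(5) by (simp add: vrjp_law_def)
   show ?thesis unfolding expl_time_def jtime_def by measurable
  qed
  note [measurable] = em
  have \<phi>X: "\<phi> n (vrjp.X (dir n) (H n) om) = (if ereal K < expl_time (%i. H n i om) then 1 else 0)" for n om by (simp add: \<phi>_def X)
  have int: "(\<integral>om. \<phi> n (vrjp.X (dir n) (H n) om) \<partial>M n) = 1 - measure (M n) {om \<in> space (M n). expl_time (%i. H n i om) <= ereal K}" for n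
  proof -
   interpret prob_space "M n" by (rule P)
   let ?E = "{om \<in> space (M n). expl_time (%i. H n i om) <= ereal K}"
   have "(\<integral>om. \<phi> n (vrjp.X (dir n) (H n) om) \<partial>M n) = (\<integral>om. 1 - indicat_real ?E om \<partial>M n)"
    unfolding \<phi>X by (intro Bochner_Integration.integral_cong refl) (auto simp: indicator_def)
   also have "... = 1 - (\<integral>om. indicat_real ?E om \<partial>M n)"
    by (subst Bochner_Integration.integral_diff) (auto simp: prob_space intro!: integrable_const_bound[where B=1])
   finally show ?thesis by (simp add: Int_def conj_commute)
  qed
  have N1: "(\<integral>om. 1 \<partial>N) = (1::real)"
  proof -
   interpret prob_space N using assms(6) by (simp add: std_brownian_motion_def)
   show ?thesis by (simp add: prob_space)
  qed
  show ?thesis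
  proof (rule tendstoI)
   fix eps :: real assume eps: "eps > 0"
   have "\<forall>\<^sub>F n in sequentially. (\<integral>om. 1 \<partial>N) - eps / 2 <= (\<integral>om. \<phi> n (vrjp.X (dir n) (H n) om) \<partial>M n)"
   proof (rule eventually_expectation_ge[where C=1 and \<phi>=\<phi> and \<zeta>="%_. 1" and M=M and dir=dir and H=H and N=N and B=B and ?L0.0=L0, OF assms(1) L0p law assms(6)])
    show "(%om. \<phi> n (vrjp.X (dir n) (H n) om)) \<in> borel_measurable (M n)" for n unfolding \<phi>X by measurable
    show "AE om in N. \<forall>s n km x. approx_seq L0 A D s n km x (B om) --> (\<forall>eps>0. \<forall>\<^sub>F i in sequentially. 1 - eps <= \<phi> (n i) (x i))"
     if A: "!!r. A r >= 0" for A D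
     using det[where A=A and D=D, OF A]
    proof eventually_elim
     case (elim om)
     show ?case
     proof (intro allI impI)
      fix s n km x and e :: real assume a: "approx_seq L0 A D s n km x (B om)" and e: "e > 0"
      have "\<forall>\<^sub>F i in sequentially. ereal K < expl_time (%k. snd (x i k))" using elim a by blast
      then show "\<forall>\<^sub>F i in sequentially. 1 - e <= \<phi> (n i) (x i)" by eventually_elim (use e in \<open>simp add: \<phi>_def\<close>)
     qed
    qed
   qed (use eps in \<open>auto simp: \<phi>_def\<close>)
   then show "\<forall>\<^sub>F n in sequentially. dist (measure (M n) {om \<in> space (M n). expl_time (%i. H n i om) <= ereal K}) 0 < eps"
   proof eventually_elim
    case (elim n)
    have "measure (M n) {om \<in> space (M n). expl_time (%i. H n i om) <= ereal K} <= eps / 2" using elim unfolding int N1 by linarith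
    then show ?case using eps by (simp add: dist_real_def)
   qed
  qed
 qed
 have lower: "\<forall>\<^sub>F n in sequentially. (\<integral>om. F (lrm L0 (reduced_proc \<Psi> B om) (\<Lambda> om)) \<partial>N) - eps
   <= (\<integral>om. F (vrjp_stopped n L0 (%i. dir n i om) (%i. H n i om)) \<partial>M n)"
  if F: "test_functional F" "\<forall>n. (%om. F (vrjp_stopped n L0 (%i. dir n i om) (%i. H n i om))) \<in> borel_measurable (M n)"
   "(%om. F (lrm L0 (reduced_proc \<Psi> B om) (\<Lambda> om))) \<in> borel_measurable N" and eps: "eps > 0" for F and eps :: real
 proof -
  have "bounded (range F)" using F(1) by (simp add: test_functional_def)
  then obtain C0 where C0: "\<forall>y\<in>range F. norm y <= C0" unfolding bounded_iff by (rule exE)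
  define C where "C = max 1 C0"
  have C: "C > 0" "!!y. \<bar>F y\<bar> <= C" using C0 by (auto simp: C_def intro: max.coboundedI2)
  define \<phi> where "\<phi> n x = F (vrjp_stopped n L0 (%k. fst (x k)) (%k. snd (x k)))" for n and x :: "nat => int \<times> real"
  have \<phi>X: "\<phi> n (vrjp.X (dir n) (H n) om) = F (vrjp_stopped n L0 (%i. dir n i om) (%i. H n i om))" for n om by (simp add: \<phi>_def X)
  have "\<forall>\<^sub>F n in sequentially. (\<integral>om. F (lrm L0 (reduced_proc \<Psi> B om) (\<Lambda> om)) \<partial>N) - eps <= (\<integral>om. \<phi> n (vrjp.X (dir n) (H n) om) \<partial>M n)"
  proof (rule eventually_expectation_ge[where C=C and \<phi>=\<phi> and \<zeta>="%om. F (lrm L0 (reduced_proc \<Psi> B om) (\<Lambda> om))" and M=M and dir=dir and H=H and N=N and B=B and ?L0.0=L0,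
    OF assms(1) L0p law assms(6) _ F(3) C(1) _ _ _ eps])
   show "(%om. \<phi> n (vrjp.X (dir n) (H n) om)) \<in> borel_measurable (M n)" for n unfolding \<phi>X using F(2) by blast
   show "\<bar>\<phi> n x\<bar> <= C" "\<bar>F (lrm L0 (reduced_proc \<Psi> B om) (\<Lambda> om))\<bar> <= C" for n x om unfolding \<phi>_def by (rule C(2))+
   show "AE om in N. \<forall>s n km x. approx_seq L0 A D s n km x (B om) --> (\<forall>eps>0. \<forall>\<^sub>F i in sequentially. F (lrm L0 (reduced_proc \<Psi> B om) (\<Lambda> om)) - eps <= \<phi> (n i) (x i))"
    if A: "!!r. A r >= 0" for A D
    using det[where A=A and D=D, OF A]
   proof eventually_elim
    case (elim om)
    show ?case
    proof (intro allI impI)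
     fix s n km x and e :: real assume a: "approx_seq L0 A D s n km x (B om)" and e: "e > 0"
     have "lu_conv (%i. vrjp_stopped (n i) L0 (%k. fst (x i k)) (%k. snd (x i k))) (lrm L0 (reduced_proc \<Psi> B om) (\<Lambda> om))" using elim a by blast
     then have "(%i. \<phi> (n i) (x i)) \<longlonglongrightarrow> F (lrm L0 (reduced_proc \<Psi> B om) (\<Lambda> om))" unfolding \<phi>_def using F(1) unfolding test_functional_def by blast
     from tendstoD[OF this e] show "\<forall>\<^sub>F i in sequentially. F (lrm L0 (reduced_proc \<Psi> B om) (\<Lambda> om)) - e <= \<phi> (n i) (x i)"
      by eventually_elim (auto simp: dist_real_def abs_less_iff)
    qed
   qed
  qed
  then show ?thesis unfolding \<phi>X .
 qed
 have "conv_in_law M (%n om. vrjp_stopped n L0 (%i. dir n i om) (%i. H n i om)) N (%om. lrm L0 (reduced_proc \<Psi> B om) (\<Lambda> om))"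
  unfolding conv_in_law_def
 proof (intro allI impI)
  fix F assume F: "test_functional F" "\<forall>n. (%om. F (vrjp_stopped n L0 (%i. dir n i om) (%i. H n i om))) \<in> borel_measurable (M n)"
   "(%om. F (lrm L0 (reduced_proc \<Psi> B om) (\<Lambda> om))) \<in> borel_measurable N"
  \<comment> \<open>The negative is again a test functional, which turns the one-sided estimate into
    convergence.\<close>
  have nF: "test_functional (%y. - F y)"
  proof -
   have "range (%y. - F y) = uminus ` range F" by auto
   then show ?thesis using F(1) unfolding test_functional_def by (auto intro: tendsto_minus bounded_uminus)
  qed
  show "(%n. \<integral>om. F (vrjp_stopped n L0 (%i. dir n i om) (%i. H n i om)) \<partial>M n) \<longlonglongrightarrow> (\<integral>om. F (lrm L0 (reduced_proc \<Psi> B om) (\<Lambda> om)) \<partial>N)"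
  proof (rule tendstoI)
   fix eps :: real assume "eps > 0"
   then have e2: "eps / 2 > 0" by simp
   have "\<forall>\<^sub>F n in sequentially. (\<integral>om. - F (lrm L0 (reduced_proc \<Psi> B om) (\<Lambda> om)) \<partial>N) - eps / 2
     <= (\<integral>om. - F (vrjp_stopped n L0 (%i. dir n i om) (%i. H n i om)) \<partial>M n)"
    by (rule lower[OF nF _ _ e2]) (use F(2,3) in auto)
   with lower[OF F e2] show "\<forall>\<^sub>F n in sequentially. dist (\<integral>om. F (vrjp_stopped n L0 (%i. dir n i om) (%i. H n i om)) \<partial>M n)
     (\<integral>om. F (lrm L0 (reduced_proc \<Psi> B om) (\<Lambda> om)) \<partial>N) < eps"
    by eventually_elim (use \<open>eps > 0\<close> in \<open>simp add: dist_real_def abs_less_iff\<close>)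
  qed
 qed
 then show ?thesis using part1 by blast
qed

end
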